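(* There exist an absolute margin $d_*>1$ and constants $C_0,C,c>0$ such that the following holds. Let $\mu\ge0$, let $\Gamma\in L^\infty(J_{d_*};\mathbb C^{2\times2})$ with $\|\Gamma\|_{L^\infty(J_{d_*})}\le\mu$, and let $w$ be a weak finite-energy solution on $J_{d_*}$ of \[ w_{tt}+w_t-A_0w=C^*\Gamma(t)Cw . \] Then, for every integer $N$ with $N+1\ge C_0(1+\mu^2)$, one has \[ \|w(0)\|_{\mathcal H}^2\le\exp\bigl(C(N+1)\bigr)\,\|Cw\|_{L^2(J_{d_*})}^2+Ce^{-cN}\mathcal M_{d_*}(w)^2 . \] (Here the scalar constant $C$ in the final estimate is not to be confused with the trace operator $C$ in $Cw$ and $C^*$.)
   Context: Let $\omega(\varphi)=(\sin\varphi)^{1/2}$, $\mathcal H=L^2((0,\pi),\omega\,d\varphi)$, $\mathfrak a_0[f,g]=4\int_0^\pi\omega f'\,\overline{g'}\,d\varphi$ with form domain $\mathcal V=\{f\in\mathcal H:f\in H^1_{\mathrm{loc}}(0,\pi),\int_0^\pi\omega|f'|^2d\varphi<\infty\}$, $\|f\|_{\mathcal V}^2=\mathfrak a_0[f,f]+\|f\|_{\mathcal H}^2$, and $\mathcal V^*$ the (anti)dual with pivot $\mathcal H$. $A_0$ is the operator of the form $\mathfrak a_0$ (also viewed as a bounded map $\mathcal V\to\mathcal V^*$), $A_0f=-4\omega^{-1}(\omega f')'$. Elements of $\mathcal V$ have endpoint values depending continuously on $f\in\mathcal V$; the trace operator is $C:\mathcal V\to\mathbb C^2$, $Cf=(f(0),f(\pi))^{\mathsf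 T}$, with dual $C^*:\mathbb C^2\to\mathcal V^*$. For $d>1$ put $J_d=(-d,1+d)$ and $\mathcal M_d(w)=\sup_{t\in J_d}\|w(t)\|_{\mathcal H}$; $\|Cw\|_{L^2(J_d)}$ is the $L^2(J_d;\mathbb C^2)$ norm. Weak finite-energy solution on a bounded interval $J$ of $w_{tt}+w_t-A_0w=C^*\Gamma(t)Cw$: $w\in L^2(J;\mathcal V)\cap H^1(J;\mathcal H)$, $w_{tt}\in L^2(J;\mathcal V^* )$, and for every $\psi\in C_c^\infty(J;\mathcal V)$, $\int_J\bigl(\langle w_{tt},\psi\rangle_{\mathcal V^*,\mathcal V}+(w_t,\psi)_{\mathcal H}-\mathfrak a_0[w,\psi]-(\Gamma Cw,C\psi)_{\mathbb C^2}\bigr)dt=0$. Such $w$ belongs to $C(\overline J;\mathcal H)$. *)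

theory Defs
  imports "HOL-Probability.Probability"
begin

section \<open>Test functions, strong measurability\<close>

text \<open>\<open>C\<^sub>c\<^sup>\<infinity>(S; E)\<close>: \<open>D\<close> is the sequence of the successive derivatives.\<close>

definition Cc_smooth :: "real set \<Rightarrow> (real \<Rightarrow> 'a::real_normed_vector) set" where
  "Cc_smooth S = {\<psi>. (\<exists>D::nat \<Rightarrow> real \<Rightarrow> 'a. D 0 = \<psi> \<and>
       (\<forall>k t. (D k has_vector_derivative D (Suc k) t) (at t))) \<and>
     (\<exists>K. compact K \<and> K \<subseteq> S \<and> (\<forall>t. t \<notin> K \<longrightarrow> \<psi> t = 0))}"

text \<open>Bochner's notion of measurability. It is spelled out because the library's Bochner integral
  asks for a second countable type, which the type of bounded linear maps used for the antidual
  below is not.\<close>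

definition strongly_measurable :: "'a measure \<Rightarrow> ('a \<Rightarrow> 'b::real_normed_vector) \<Rightarrow> bool" where
  "strongly_measurable M f \<longleftrightarrow>
     (\<exists>s. (\<forall>n::nat. simple_function M (s n)) \<and> (AE x in M. (\<lambda>n. s n x) \<longlonglongrightarrow> f x))"

text \<open>\<open>L\<^sup>2(J; E)\<close>, as a space of representatives.\<close>

definition L2 :: "real set \<Rightarrow> (real \<Rightarrow> 'b::real_normed_vector) set" where
  "L2 J = {f. strongly_measurable (lebesgue_on J) f \<and>
              integrable (lebesgue_on J) (\<lambda>t. (norm (f t))\<^sup>2)}"

definition L2_norm :: "real set \<Rightarrow> (real \<Rightarrow> 'b::real_normed_vector) \<Rightarrow> real" where
  "L2_norm J f = sqrt (LINT t|lebesgue_on J. (norm (f t))\<^sup>2)"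


section \<open>The weighted space \<open>\<H> = L\<^sup>2((0,\<pi>), \<omega> d\<phi>)\<close>\<close>

definition omega :: "real \<Rightarrow> real" where
  "omega \<phi> = sqrt (sin \<phi>)"

definition omega_measure :: "real measure" where
  "omega_measure = density (lebesgue_on {0<..<pi}) (\<lambda>\<phi>. ennreal (omega \<phi>))"

definition square_integrable :: "(real \<Rightarrow> complex) \<Rightarrow> bool" where
  "square_integrable f \<longleftrightarrow> f \<in> borel_measurable omega_measure \<and>
     integrable omega_measure (\<lambda>\<phi>. (norm (f \<phi>))\<^sup>2)"

lemma omega_pos: "x \<in> {0<..<pi} \<Longrightarrow> omega x > 0"
  by (simp add: omega_def sin_gt_zero)

lemma omega_measurable [measurable]: "omega \<in> borel_measurable (lebesgue_on {0<..<pi})"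
proof -
  have "omega \<in> borel_measurable borel"
    unfolding omega_def by measurable
  then show ?thesis
    by (auto intro!: measurable_restrict_space1 measurable_completion)
qed

lemma sets_omega_measure [simp, measurable_cong]:
  "sets omega_measure = sets (lebesgue_on {0<..<pi})"
  by (simp add: omega_measure_def)

lemma space_omega_measure [simp]: "space omega_measure = {0<..<pi}"
  by (simp add: omega_measure_def)

lemma AE_omega_measure:
  "(AE x in omega_measure. P x) \<longleftrightarrow> (AE x in lebesgue_on {0<..<pi}. P x)"
proof -
  have "(AE x in omega_measure. P x) \<longleftrightarrow> (AE x in lebesgue_on {0<..<pi}. 0 < omega x \<longrightarrow> P x)"
    unfolding omega_measure_def by (subst AE_density) auto
  also have "\<dots> \<longleftrightarrow> (AE x in lebesgue_on {0<..<pi}. P x)"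
    by (rule AE_cong) (auto simp: omega_pos)
  finally show ?thesis .
qed

lemma borel_measurable_cnj [measurable (raw)]:
  "f \<in> borel_measurable M \<Longrightarrow> (\<lambda>x. cnj (f x)) \<in> borel_measurable M"
  by (rule borel_measurable_continuous_on[where f=cnj]) (intro continuous_intros)

lemma square_integrable_0: "square_integrable (\<lambda>_. 0)"
  by (simp add: square_integrable_def)

lemma square_integrable_scale:
  assumes "square_integrable f" shows "square_integrable (\<lambda>x. c * f x)"
  using assms by (auto simp: square_integrable_def norm_mult power_mult_distrib)

lemma square_integrable_add:
  assumes "square_integrable f" "square_integrable g"
  shows "square_integrable (\<lambda>x. f x + g x)"
proof -
  have [measurable]: "f \<in> borel_measurable omega_measure" "g \<in> borel_measurable omega_measure"
    using assms by (auto simp: square_integrable_def)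
  have b: "(norm (a + b))\<^sup>2 \<le> 2 * (norm a)\<^sup>2 + 2 * (norm b)\<^sup>2" for a b :: complex
  proof -
    have "(norm (a + b))\<^sup>2 \<le> (norm a + norm b)\<^sup>2"
      by (intro power_mono norm_triangle_ineq) auto
    also have "\<dots> \<le> 2 * (norm a)\<^sup>2 + 2 * (norm b)\<^sup>2"
      using sum_squares_bound[of "norm a" "norm b"] by (simp add: power2_sum)
    finally show ?thesis .
  qed
  have "integrable omega_measure (\<lambda>x. (norm (f x + g x))\<^sup>2)"
    by (rule Bochner_Integration.integrable_bound
        [where f="\<lambda>x. 2 * (norm (f x))\<^sup>2 + 2 * (norm (g x))\<^sup>2"])
       (use assms b in \<open>auto simp: square_integrable_def\<close>)
  then show ?thesis by (simp add: square_integrable_def)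
qed

lemma square_integrable_mult:
  assumes "square_integrable f" "square_integrable g"
  shows "integrable omega_measure (\<lambda>x. f x * cnj (g x))"
proof -
  have [measurable]: "f \<in> borel_measurable omega_measure" "g \<in> borel_measurable omega_measure"
    using assms by (auto simp: square_integrable_def)
  have b: "norm (a * cnj b) \<le> (norm a)\<^sup>2 + (norm b)\<^sup>2" for a b :: complex
  proof -
    have "2 * norm a * norm b \<le> (norm a)\<^sup>2 + (norm b)\<^sup>2"
      by (rule sum_squares_bound)
    moreover have "0 \<le> norm a * norm b" by simp
    ultimately show ?thesis unfolding norm_mult complex_mod_cnj by linarith
  qed
  show ?thesis
    by (rule Bochner_Integration.integrable_bound
        [where f="\<lambda>x. (norm (f x))\<^sup>2 + (norm (g x))\<^sup>2"])
       (use assms b in \<open>auto simp: square_integrable_def\<close>)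
qed

definition hrel :: "(real \<Rightarrow> complex) \<Rightarrow> (real \<Rightarrow> complex) \<Rightarrow> bool" where
  "hrel f g \<longleftrightarrow> square_integrable f \<and> square_integrable g \<and> (AE \<phi> in omega_measure. f \<phi> = g \<phi>)"

quotient_type hsp = "real \<Rightarrow> complex" / partial: hrel
proof (rule part_equivpI)
  show "\<exists>x. hrel x x"
    using square_integrable_0 by (auto simp: hrel_def)
  show "symp hrel"
    by (rule sympI) (auto simp: hrel_def elim: eventually_mono)
  show "transp hrel"
    by (rule transpI) (auto simp: hrel_def elim: eventually_elim2)
qed

lift_definition hinner :: "hsp \<Rightarrow> hsp \<Rightarrow> complex" is
  "\<lambda>f g. LINT \<phi>|omega_measure. f \<phi> * cnj (g \<phi>)"
  by (rule integral_cong_AE) (auto simp: hrel_def square_integrable_def)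

lift_definition hscaleC :: "complex \<Rightarrow> hsp \<Rightarrow> hsp" is "\<lambda>z f \<phi>. z * f \<phi>"
  by (auto simp: hrel_def square_integrable_scale)

instantiation hsp :: real_inner
begin

lift_definition zero_hsp :: hsp is "\<lambda>_. 0"
  by (simp add: hrel_def square_integrable_0)

lift_definition plus_hsp :: "hsp \<Rightarrow> hsp \<Rightarrow> hsp" is "\<lambda>f g \<phi>. f \<phi> + g \<phi>"
  by (auto simp: hrel_def square_integrable_add)

definition uminus_hsp :: "hsp \<Rightarrow> hsp" where "uminus_hsp f = hscaleC (-1) f"

definition minus_hsp :: "hsp \<Rightarrow> hsp \<Rightarrow> hsp" where "minus_hsp f g = f + (- g)"

definition scaleR_hsp :: "real \<Rightarrow> hsp \<Rightarrow> hsp" where "scaleR_hsp r f = hscaleC (of_real r) f"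

definition inner_hsp :: "hsp \<Rightarrow> hsp \<Rightarrow> real" where "inner_hsp f g = Re (hinner f g)"

definition norm_hsp :: "hsp \<Rightarrow> real" where "norm_hsp f = sqrt (inner f f)"

definition sgn_hsp :: "hsp \<Rightarrow> hsp" where "sgn_hsp f = inverse (norm f) *\<^sub>R f"

definition dist_hsp :: "hsp \<Rightarrow> hsp \<Rightarrow> real" where "dist_hsp f g = norm (f - g)"

definition uniformity_hsp :: "(hsp \<times> hsp) filter" where
  "uniformity_hsp = (INF e\<in>{0 <..}. principal {(x, y). dist x y < e})"

definition open_hsp :: "hsp set \<Rightarrow> bool" where
  "open_hsp U \<longleftrightarrow> (\<forall>x\<in>U. eventually (\<lambda>(x', y). x' = x \<longrightarrow> y \<in> U) uniformity)"

instance
proof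
  fix f g h :: hsp and r s :: real
  show "f + g + h = f + (g + h)"
    by transfer (auto simp: hrel_def square_integrable_add add.assoc)
  show "f + g = g + f"
    by transfer (auto simp: hrel_def square_integrable_add add.commute)
  show "0 + f = f"
    by transfer (auto simp: hrel_def)
  show "- f + f = 0"
    unfolding uminus_hsp_def by transfer (auto simp: hrel_def square_integrable_0)
  show "f - g = f + (- g)" by (rule minus_hsp_def)
  show "r *\<^sub>R (f + g) = r *\<^sub>R f + r *\<^sub>R g"
    unfolding scaleR_hsp_def
    by transfer (auto simp: hrel_def square_integrable_add square_integrable_scale distrib_left)
  show "(r + s) *\<^sub>R f = r *\<^sub>R f + s *\<^sub>R f"
    unfolding scaleR_hsp_def
    by transfer (auto simp: hrel_def square_integrable_add square_integrable_scale distrib_right)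
  show "r *\<^sub>R s *\<^sub>R f = (r * s) *\<^sub>R f"
    unfolding scaleR_hsp_def
    by transfer (auto simp: hrel_def square_integrable_scale mult.assoc)
  show "1 *\<^sub>R f = f"
    unfolding scaleR_hsp_def by transfer (auto simp: hrel_def)
  show "dist f g = norm (f - g)" by (rule dist_hsp_def)
  show "sgn f = inverse (norm f) *\<^sub>R f" by (rule sgn_hsp_def)
  show "uniformity = (INF e\<in>{0 <..}. principal {(x, y :: hsp). dist x y < e})"
    by (rule uniformity_hsp_def)
  show "open U \<longleftrightarrow> (\<forall>x\<in>U. eventually (\<lambda>(x', y). x' = x \<longrightarrow> y \<in> U) uniformity)" for U :: "hsp set"
    by (rule open_hsp_def)
  show "inner f g = inner g f"
  proof -
    have "hinner f g = cnj (hinner g f)"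
      unfolding hinner.rep_eq
      by (subst Bochner_Integration.integral_cnj [symmetric]) (simp add: mult.commute)
    then show ?thesis by (simp add: inner_hsp_def)
  qed
  show "inner (f + g) h = inner f h + inner g h"
    unfolding inner_hsp_def
    by transfer (auto simp: hrel_def distrib_right square_integrable_mult)
  show "inner (r *\<^sub>R f) g = r * inner f g"
  proof -
    have "hinner (r *\<^sub>R f) g = of_real r * hinner f g"
      unfolding scaleR_hsp_def
      by transfer (auto simp: hrel_def mult.assoc simp flip: integral_mult_right_zero)
    then show ?thesis by (simp add: inner_hsp_def)
  qed
  have *: "inner f f = (LINT \<phi>|omega_measure. (norm (rep_hsp f \<phi>))\<^sup>2)" for f
  proof -
    have "hinner f f = (LINT \<phi>|omega_measure. complex_of_real ((norm (rep_hsp f \<phi>))\<^sup>2))"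
      by (simp only: hinner.rep_eq complex_norm_square)
    then show ?thesis
      unfolding inner_hsp_def by (simp only: integral_complex_of_real Re_complex_of_real)
  qed
  have sq: "square_integrable (rep_hsp f)" for f
    using Quotient_rep_reflp[OF Quotient_hsp, of f] by (simp add: hrel_def)
  show "0 \<le> inner f f"
    unfolding * by (intro integral_nonneg_AE) auto
  show "inner f f = 0 \<longleftrightarrow> f = 0"
  proof
    assume "inner f f = 0"
    then have "AE \<phi> in omega_measure. (norm (rep_hsp f \<phi>))\<^sup>2 = 0"
      unfolding * using sq[of f]
      by (subst (asm) integral_nonneg_eq_0_iff_AE) (auto simp: square_integrable_def)
    then have "hrel (rep_hsp f) (\<lambda>_. 0)"
      using sq[of f] by (auto simp: hrel_def square_integrable_0)
    then have "abs_hsp (rep_hsp f) = abs_hsp (\<lambda>_. 0)"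
      by (rule Quotient_rel_abs[OF Quotient_hsp])
    then show "f = 0"
      by (simp add: zero_hsp_def Quotient_abs_rep[OF Quotient_hsp])
  next
    assume "f = 0"
    then show "inner f f = 0"
      unfolding inner_hsp_def by (simp, transfer) auto
  qed
  show "norm f = sqrt (inner f f)" by (rule norm_hsp_def)
qed

end

lemma hrel_rep: "hrel (rep_hsp f) (rep_hsp f)"
  by (rule Quotient_rep_reflp[OF Quotient_hsp])

lemma square_integrable_rep: "square_integrable (rep_hsp f)"
  using hrel_rep by (simp add: hrel_def)

lemma AE_rep_abs:
  assumes "square_integrable f"
  shows "AE x in lebesgue_on {0<..<pi}. rep_hsp (abs_hsp f) x = f x"
proof -
  have "hrel (rep_hsp (abs_hsp f)) f"
    using assms by (intro Quotient_rep_abs[OF Quotient_hsp]) (simp add: hrel_def)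
  then show ?thesis by (simp add: hrel_def AE_omega_measure)
qed

lemma AE_rep_plus:
  "AE x in lebesgue_on {0<..<pi}. rep_hsp (f + g) x = rep_hsp f x + rep_hsp g x"
proof -
  have "f + g = abs_hsp (\<lambda>x. rep_hsp f x + rep_hsp g x)"
    by (simp add: plus_hsp_def)
  then show ?thesis
    by (simp add: AE_rep_abs square_integrable_add square_integrable_rep)
qed

lemma AE_rep_scaleC:
  "AE x in lebesgue_on {0<..<pi}. rep_hsp (hscaleC z f) x = z * rep_hsp f x"
proof -
  have "hscaleC z f = abs_hsp (\<lambda>x. z * rep_hsp f x)"
    by (simp add: hscaleC_def)
  then show ?thesis
    by (simp add: AE_rep_abs square_integrable_scale square_integrable_rep)
qed

lemma AE_rep_0: "AE x in lebesgue_on {0<..<pi}. rep_hsp 0 x = 0"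
  unfolding zero_hsp_def by (rule AE_rep_abs) (rule square_integrable_0)


section \<open>The form domain \<open>\<V>\<close>\<close>

text \<open>\<open>weak_deriv f g\<close>: \<open>g\<close> is the distributional derivative of \<open>f\<close> on \<open>(0,\<pi>)\<close>. As \<open>\<omega>\<close> is bounded below
  on compact subsets of \<open>(0,\<pi>)\<close>, elements of \<open>\<H>\<close> are locally square integrable there for Lebesgue
  measure; hence a class \<open>f\<close> in \<open>\<H>\<close> lies in \<open>\<V>\<close> iff it has a weak derivative in \<open>\<H>\<close>.\<close>

definition weak_deriv :: "hsp \<Rightarrow> hsp \<Rightarrow> bool" where
  "weak_deriv f g \<longleftrightarrow> (\<forall>\<eta>::real \<Rightarrow> real. \<eta> \<in> Cc_smooth {0<..<pi} \<longrightarrow>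
     (LINT \<phi>|lebesgue_on {0<..<pi}. rep_hsp f \<phi> * of_real (deriv \<eta> \<phi>)) =
     - (LINT \<phi>|lebesgue_on {0<..<pi}. rep_hsp g \<phi> * of_real (\<eta> \<phi>)))"

definition test_pair :: "hsp \<Rightarrow> (real \<Rightarrow> real) \<Rightarrow> complex" where
  "test_pair f \<eta> = (LINT \<phi>|lebesgue_on {0<..<pi}. rep_hsp f \<phi> * of_real (\<eta> \<phi>))"

lemma weak_deriv_test_pair:
  "weak_deriv f g \<longleftrightarrow>
     (\<forall>\<eta>::real \<Rightarrow> real. \<eta> \<in> Cc_smooth {0<..<pi} \<longrightarrow> test_pair f (deriv \<eta>) = - test_pair g \<eta>)"
  by (simp add: weak_deriv_def test_pair_def)

lemma continuous_measurable_lebesgue_on: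
  fixes \<eta> :: "real \<Rightarrow> real"
  assumes "continuous_on UNIV \<eta>"
  shows "\<eta> \<in> borel_measurable (lebesgue_on S)"
  using borel_measurable_continuous_onI[OF assms]
  by (auto intro!: measurable_restrict_space1 measurable_completion)

lemma test_integrable:
  fixes \<eta> :: "real \<Rightarrow> real"
  assumes cont: "continuous_on UNIV \<eta>"
    and K: "compact K" "K \<subseteq> {0<..<pi}" "\<forall>t. t \<notin> K \<longrightarrow> \<eta> t = 0"
  shows "integrable (lebesgue_on {0<..<pi}) (\<lambda>\<phi>. rep_hsp f \<phi> * of_real (\<eta> \<phi>))"
proof -
  have "continuous_on K (\<lambda>x. \<bar>\<eta> x\<bar> / omega x)"
  proof (intro continuous_intros)
    show "continuous_on K \<eta>" using cont continuous_on_subset by blast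
    show "continuous_on K omega" unfolding omega_def by (intro continuous_intros)
    show "\<forall>x\<in>K. omega x \<noteq> 0"
    proof
      fix x assume "x \<in> K"
      then have "x \<in> {0<..<pi}" using K(2) by blast
      from omega_pos[OF this] show "omega x \<noteq> 0" by simp
    qed
  qed
  then have "bounded ((\<lambda>x. \<bar>\<eta> x\<bar> / omega x) ` K)"
    using K(1) compact_continuous_image compact_imp_bounded by blast
  then obtain B where B: "\<And>x. x \<in> K \<Longrightarrow> \<bar>\<bar>\<eta> x\<bar> / omega x\<bar> \<le> B"
    by (auto simp: bounded_iff)
  define B' where "B' = max B 0"
  have bd: "\<bar>\<eta> x\<bar> \<le> B' * omega x" if x: "x \<in> {0<..<pi}" for x
  proof (cases "x \<in> K")
    case True
    then have "\<bar>\<eta> x\<bar> / omega x \<le> B'" using B[OF True] unfolding B'_def by linarith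
    then show ?thesis using omega_pos[OF x] by (simp add: divide_simps)
  next
    case False
    then show ?thesis using K(3)[rule_format, OF False] omega_pos[OF x] by (simp add: B'_def)
  qed
  have "borel_measurable omega_measure = (borel_measurable (lebesgue_on {0<..<pi}) :: (real \<Rightarrow> complex) set)"
    by (rule measurable_cong_sets) (rule sets_omega_measure refl)+
  then have [measurable]: "rep_hsp f \<in> borel_measurable (lebesgue_on {0<..<pi})"
    using square_integrable_rep[of f] unfolding square_integrable_def by blast
  have [measurable]: "\<eta> \<in> borel_measurable (lebesgue_on {0<..<pi})"
    using cont by (rule continuous_measurable_lebesgue_on)
  have "integrable (lebesgue_on {0<..<pi}) (\<lambda>x. omega x *\<^sub>R (norm (rep_hsp f x))\<^sup>2)"
    using square_integrable_rep[of f] unfolding square_integrable_def omega_measure_def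
    by (subst (asm) integrable_density) (auto simp: less_imp_le intro!: AE_I2 omega_pos less_imp_le)
  moreover have "integrable (lebesgue_on {0<..<pi}) omega"
  proof (rule Bochner_Integration.integrable_bound[where f="\<lambda>_. 1::real"])
    interpret finite_measure "lebesgue_on {0<..<pi}"
      by (rule finite_measure_lebesgue_on) simp
    show "integrable (lebesgue_on {0<..<pi}) (\<lambda>_. 1::real)" by simp
    show "AE x in lebesgue_on {0<..<pi}. norm (omega x) \<le> norm (1::real)"
      by (intro AE_I2) (simp add: omega_def sin_ge_zero)
  qed measurable
  ultimately have int: "integrable (lebesgue_on {0<..<pi})
      (\<lambda>x. B' * (omega x + omega x *\<^sub>R (norm (rep_hsp f x))\<^sup>2))"
    by auto
  show ?thesis
  proof (rule Bochner_Integration.integrable_bound[OF int])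
    show "AE x in lebesgue_on {0<..<pi}. norm (rep_hsp f x * of_real (\<eta> x))
        \<le> norm (B' * (omega x + omega x *\<^sub>R (norm (rep_hsp f x))\<^sup>2))"
    proof (rule AE_I2)
      fix x assume "x \<in> space (lebesgue_on {0<..<pi})"
      then have x: "x \<in> {0<..<pi}" by simp
      define a where "a = norm (rep_hsp f x)"
      have "a \<le> 1 + a\<^sup>2"
      proof -
        have "0 \<le> a" by (simp add: a_def)
        then show ?thesis using sum_squares_bound[of a 1] by simp
      qed
      have "norm (rep_hsp f x * of_real (\<eta> x)) = a * \<bar>\<eta> x\<bar>"
        by (simp add: norm_mult a_def)
      also have "\<dots> \<le> (1 + a\<^sup>2) * (B' * omega x)"
        using \<open>a \<le> 1 + a\<^sup>2\<close> bd[OF x] by (intro mult_mono) auto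
      also have "\<dots> = B' * (omega x + omega x *\<^sub>R a\<^sup>2)"
        by (simp add: algebra_simps)
      also have "\<dots> \<le> norm \<dots>" by simp
      finally show "norm (rep_hsp f x * of_real (\<eta> x))
        \<le> norm (B' * (omega x + omega x *\<^sub>R (norm (rep_hsp f x))\<^sup>2))"
        by (simp add: a_def)
    qed
  qed measurable
qed

lemma Cc_smooth_test:
  fixes \<eta> :: "real \<Rightarrow> real"
  assumes "\<eta> \<in> Cc_smooth S"
  shows "\<exists>K. compact K \<and> K \<subseteq> S \<and> continuous_on UNIV \<eta> \<and> continuous_on UNIV (deriv \<eta>) \<and>
           (\<forall>t. t \<notin> K \<longrightarrow> \<eta> t = 0 \<and> deriv \<eta> t = 0)"
proof -
  from assms obtain D K where D: "D 0 = \<eta>"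
      "\<And>k t. (D k has_vector_derivative D (Suc k) t) (at t)"
    and K: "compact K" "K \<subseteq> S" "\<And>t. t \<notin> K \<Longrightarrow> \<eta> t = 0"
    unfolding Cc_smooth_def by blast
  have cont: "continuous_on UNIV (D k)" for k
    using D(2) by (meson continuous_at_imp_continuous_on has_vector_derivative_continuous)
  have der: "deriv \<eta> = D 1"
    using D(2)[of 0] by (auto simp: D(1) has_real_derivative_iff_has_vector_derivative
        intro!: ext DERIV_imp_deriv)
  have "deriv \<eta> t = 0" if "t \<notin> K" for t
  proof (rule DERIV_imp_deriv)
    have "(\<eta> has_real_derivative 0) (at t) \<longleftrightarrow> ((\<lambda>_. 0) has_real_derivative 0) (at t)"
    proof (rule DERIV_cong_ev)
      have "open (- K)" using K(1) by (simp add: compact_imp_closed open_Compl)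
      then have "\<forall>\<^sub>F x in nhds t. x \<in> - K"
        using that by (intro eventually_nhds_in_open) auto
      then show "\<forall>\<^sub>F x in nhds t. \<eta> x = 0"
        by (rule eventually_mono) (use K(3) in auto)
    qed auto
    then show "(\<eta> has_real_derivative 0) (at t)" by simp
  qed
  moreover have "continuous_on UNIV \<eta>" "continuous_on UNIV (deriv \<eta>)"
    using cont[of 0] cont[of 1] der D(1) by simp_all
  ultimately show ?thesis using K by blast
qed

lemma test_pair_0: "test_pair 0 \<eta> = 0"
proof -
  have "AE x in lebesgue_on {0<..<pi}. rep_hsp 0 x * of_real (\<eta> x) = 0"
    using AE_rep_0 by (rule eventually_mono) simp
  then show ?thesis
    unfolding test_pair_def by (rule integral_eq_zero_AE)
qed

lemma test_pair_plus:
  fixes \<eta> :: "real \<Rightarrow> real"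
  assumes "continuous_on UNIV \<eta>" "compact K" "K \<subseteq> {0<..<pi}" "\<forall>t. t \<notin> K \<longrightarrow> \<eta> t = 0"
  shows "test_pair (f + g) \<eta> = test_pair f \<eta> + test_pair g \<eta>"
proof -
  note int = test_integrable[OF assms]
  have "test_pair (f + g) \<eta> = (LINT \<phi>|lebesgue_on {0<..<pi}.
      rep_hsp f \<phi> * of_real (\<eta> \<phi>) + rep_hsp g \<phi> * of_real (\<eta> \<phi>))"
    unfolding test_pair_def
  proof (rule integral_cong_AE)
    show "AE x in lebesgue_on {0<..<pi}. rep_hsp (f + g) x * of_real (\<eta> x) =
        rep_hsp f x * of_real (\<eta> x) + rep_hsp g x * of_real (\<eta> x)"
      using AE_rep_plus[of f g] by (rule eventually_mono) (simp add: distrib_right)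
    show "(\<lambda>x. rep_hsp f x * of_real (\<eta> x) + rep_hsp g x * of_real (\<eta> x))
        \<in> borel_measurable (lebesgue_on {0<..<pi})"
      by (intro borel_measurable_add borel_measurable_integrable[OF int])
  qed (rule borel_measurable_integrable[OF int])
  also have "\<dots> = test_pair f \<eta> + test_pair g \<eta>"
    unfolding test_pair_def by (rule Bochner_Integration.integral_add[OF int int])
  finally show ?thesis .
qed

lemma test_pair_scaleC:
  fixes \<eta> :: "real \<Rightarrow> real"
  assumes "continuous_on UNIV \<eta>" "compact K" "K \<subseteq> {0<..<pi}" "\<forall>t. t \<notin> K \<longrightarrow> \<eta> t = 0"
  shows "test_pair (hscaleC z f) \<eta> = z * test_pair f \<eta>"
proof -
  note int = test_integrable[OF assms]
  have "test_pair (hscaleC z f) \<eta> =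
      (LINT \<phi>|lebesgue_on {0<..<pi}. z * (rep_hsp f \<phi> * of_real (\<eta> \<phi>)))"
    unfolding test_pair_def
  proof (rule integral_cong_AE)
    show "AE x in lebesgue_on {0<..<pi}. rep_hsp (hscaleC z f) x * of_real (\<eta> x) =
        z * (rep_hsp f x * of_real (\<eta> x))"
      using AE_rep_scaleC[of z f] by (rule eventually_mono) (simp add: mult.assoc)
    show "(\<lambda>x. z * (rep_hsp f x * of_real (\<eta> x))) \<in> borel_measurable (lebesgue_on {0<..<pi})"
      using int by (intro borel_measurable_integrable integrable_mult_right)
  qed (rule borel_measurable_integrable[OF int])
  also have "\<dots> = z * test_pair f \<eta>"
    unfolding test_pair_def by simp
  finally show ?thesis .
qed

lemma weak_deriv_0: "weak_deriv 0 0"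
  by (simp add: weak_deriv_test_pair test_pair_0)

lemma weak_deriv_add:
  assumes "weak_deriv f f'" "weak_deriv g g'" shows "weak_deriv (f + g) (f' + g')"
  unfolding weak_deriv_test_pair
proof (intro allI impI)
  fix \<eta> :: "real \<Rightarrow> real" assume \<eta>: "\<eta> \<in> Cc_smooth {0<..<pi}"
  from Cc_smooth_test[OF \<eta>] obtain K where
    K: "compact K" "K \<subseteq> {0<..<pi}" "continuous_on UNIV \<eta>" "continuous_on UNIV (deriv \<eta>)"
       "\<forall>t. t \<notin> K \<longrightarrow> \<eta> t = 0" "\<forall>t. t \<notin> K \<longrightarrow> deriv \<eta> t = 0" by blast
  show "test_pair (f + g) (deriv \<eta>) = - test_pair (f' + g') \<eta>"
  proof -
    have "test_pair f (deriv \<eta>) = - test_pair f' \<eta>" "test_pair g (deriv \<eta>) = - test_pair g' \<eta>"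
      using assms \<eta> unfolding weak_deriv_test_pair by blast+
    then show ?thesis
      unfolding test_pair_plus[OF K(3,1,2,5)] test_pair_plus[OF K(4,1,2,6)] by simp
  qed
qed

lemma weak_deriv_scaleC:
  assumes "weak_deriv f f'" shows "weak_deriv (hscaleC z f) (hscaleC z f')"
  unfolding weak_deriv_test_pair
proof (intro allI impI)
  fix \<eta> :: "real \<Rightarrow> real" assume \<eta>: "\<eta> \<in> Cc_smooth {0<..<pi}"
  from Cc_smooth_test[OF \<eta>] obtain K where
    K: "compact K" "K \<subseteq> {0<..<pi}" "continuous_on UNIV \<eta>" "continuous_on UNIV (deriv \<eta>)"
       "\<forall>t. t \<notin> K \<longrightarrow> \<eta> t = 0" "\<forall>t. t \<notin> K \<longrightarrow> deriv \<eta> t = 0" by blast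
  show "test_pair (hscaleC z f) (deriv \<eta>) = - test_pair (hscaleC z f') \<eta>"
  proof -
    have "test_pair f (deriv \<eta>) = - test_pair f' \<eta>"
      using assms \<eta> unfolding weak_deriv_test_pair by blast
    then show ?thesis
      unfolding test_pair_scaleC[OF K(3,1,2,5)] test_pair_scaleC[OF K(4,1,2,6)] by simp
  qed
qed

text \<open>An element \<open>f\<close> of \<open>\<V>\<close> is represented by the pair \<open>(f, f')\<close>. Since \<open>f'\<close> is determined by \<open>f\<close>, this
  is the same space as \<open>{f \<in> \<H>. \<exists>g \<in> \<H>. weak_deriv f g}\<close>; the pairs give the vector space
  operations directly.\<close>

typedef vsp = "{(f, g). weak_deriv f g}"
  using weak_deriv_0 by blast

definition vincl :: "vsp \<Rightarrow> hsp" where "vincl f = fst (Rep_vsp f)"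

definition vderiv :: "vsp \<Rightarrow> hsp" where "vderiv f = snd (Rep_vsp f)"

definition vscaleC :: "complex \<Rightarrow> vsp \<Rightarrow> vsp" where
  "vscaleC z f = Abs_vsp (hscaleC z (vincl f), hscaleC z (vderiv f))"

lemma weak_deriv_vderiv: "weak_deriv (vincl f) (vderiv f)"
  using Rep_vsp[of f] by (auto simp: vincl_def vderiv_def)

lemma vsp_eq_iff: "f = g \<longleftrightarrow> vincl f = vincl g \<and> vderiv f = vderiv g"
  by (simp add: vincl_def vderiv_def prod_eq_iff flip: Rep_vsp_inject)

lemma Abs_vsp_simps:
  assumes "weak_deriv f f'"
  shows "vincl (Abs_vsp (f, f')) = f" "vderiv (Abs_vsp (f, f')) = f'"
  using assms by (simp_all add: vincl_def vderiv_def Abs_vsp_inverse)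

definition a0 :: "vsp \<Rightarrow> vsp \<Rightarrow> complex" where
  "a0 f g = 4 * hinner (vderiv f) (vderiv g)"

text \<open>The inner product is chosen such that
  \<open>(norm f)\<^sup>2 = a0 f f + (norm (vincl f))\<^sup>2\<close>.\<close>

instantiation vsp :: real_inner
begin

definition zero_vsp :: vsp where "zero_vsp = Abs_vsp (0, 0)"

definition plus_vsp :: "vsp \<Rightarrow> vsp \<Rightarrow> vsp" where
  "plus_vsp f g = Abs_vsp (vincl f + vincl g, vderiv f + vderiv g)"

definition uminus_vsp :: "vsp \<Rightarrow> vsp" where "uminus_vsp f = vscaleC (-1) f"

definition minus_vsp :: "vsp \<Rightarrow> vsp \<Rightarrow> vsp" where "minus_vsp f g = f + (- g)"

definition scaleR_vsp :: "real \<Rightarrow> vsp \<Rightarrow> vsp" where "scaleR_vsp r f = vscaleC (of_real r) f"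

definition inner_vsp :: "vsp \<Rightarrow> vsp \<Rightarrow> real" where
  "inner_vsp f g = Re (a0 f g + hinner (vincl f) (vincl g))"

definition norm_vsp :: "vsp \<Rightarrow> real" where "norm_vsp f = sqrt (inner f f)"

definition sgn_vsp :: "vsp \<Rightarrow> vsp" where "sgn_vsp f = inverse (norm f) *\<^sub>R f"

definition dist_vsp :: "vsp \<Rightarrow> vsp \<Rightarrow> real" where "dist_vsp f g = norm (f - g)"

definition uniformity_vsp :: "(vsp \<times> vsp) filter" where
  "uniformity_vsp = (INF e\<in>{0 <..}. principal {(x, y). dist x y < e})"

definition open_vsp :: "vsp set \<Rightarrow> bool" where
  "open_vsp U \<longleftrightarrow> (\<forall>x\<in>U. eventually (\<lambda>(x', y). x' = x \<longrightarrow> y \<in> U) uniformity)"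

instance
proof
  fix f g h :: vsp and r s :: real
  have neg: "weak_deriv (- x) (- y)" and scale: "weak_deriv (r *\<^sub>R x) (r *\<^sub>R y)"
    if "weak_deriv x y" for x y r
    using weak_deriv_scaleC[OF that] by (simp_all add: uminus_hsp_def scaleR_hsp_def)
  note ext = vsp_eq_iff
  have simps: "vincl (f + g) = vincl f + vincl g" "vderiv (f + g) = vderiv f + vderiv g"
    "vincl (r *\<^sub>R f) = r *\<^sub>R vincl f" "vderiv (r *\<^sub>R f) = r *\<^sub>R vderiv f"
    "vincl (- f) = - vincl f" "vderiv (- f) = - vderiv f" "vincl 0 = 0" "vderiv 0 = 0" for f g r
    unfolding scaleR_vsp_def uminus_vsp_def plus_vsp_def zero_vsp_def vscaleC_def
    unfolding uminus_hsp_def [symmetric] scaleR_hsp_def [symmetric]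
    by (simp_all add: Abs_vsp_simps weak_deriv_add neg scale weak_deriv_0 weak_deriv_vderiv)
  have inner: "inner f g = 4 * inner (vderiv f) (vderiv g) + inner (vincl f) (vincl g)" for f g
    by (simp add: inner_vsp_def inner_hsp_def a0_def)
  show "f + g + h = f + (g + h)" "f + g = g + f" "0 + f = f" "- f + f = 0"
    "r *\<^sub>R (f + g) = r *\<^sub>R f + r *\<^sub>R g" "(r + s) *\<^sub>R f = r *\<^sub>R f + s *\<^sub>R f"
    "r *\<^sub>R s *\<^sub>R f = (r * s) *\<^sub>R f" "1 *\<^sub>R f = f"
    by (simp_all add: ext simps algebra_simps)
  show "f - g = f + (- g)" by (rule minus_vsp_def)
  show "dist f g = norm (f - g)" by (rule dist_vsp_def)
  show "sgn f = inverse (norm f) *\<^sub>R f" by (rule sgn_vsp_def)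
  show "uniformity = (INF e\<in>{0 <..}. principal {(x, y :: vsp). dist x y < e})"
    by (rule uniformity_vsp_def)
  show "open U \<longleftrightarrow> (\<forall>x\<in>U. eventually (\<lambda>(x', y). x' = x \<longrightarrow> y \<in> U) uniformity)" for U :: "vsp set"
    by (rule open_vsp_def)
  show "inner f g = inner g f"
    by (simp add: inner inner_commute)
  show "inner (f + g) h = inner f h + inner g h"
    by (simp add: inner simps inner_add_left)
  show "inner (r *\<^sub>R f) g = r * inner f g"
    by (simp add: inner simps algebra_simps)
  show "0 \<le> inner f f" by (simp add: inner)
  have "0 \<le> inner (vderiv f) (vderiv f)" "0 \<le> inner (vincl f) (vincl f)" by simp_all
  then have "inner f f = 0 \<longleftrightarrow> inner (vderiv f) (vderiv f) = 0 \<and> inner (vincl f) (vincl f) = 0"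
    unfolding inner by linarith
  then show "inner f f = 0 \<longleftrightarrow> f = 0"
    by (auto simp: ext simps)
  show "norm f = sqrt (inner f f)" by (rule norm_vsp_def)
qed

end

text \<open>The antidual of \<open>\<V>\<close>, with the operator norm: the bounded real-linear maps that are
  antilinear over \<open>\<complex>\<close>.\<close>

definition vdual :: "(vsp \<Rightarrow>\<^sub>L complex) set" where
  "vdual = {l. \<forall>z v. blinfun_apply l (vscaleC z v) = cnj z * blinfun_apply l v}"

text \<open>The continuous representative on \<open>[0,\<pi>]\<close> of an element of \<open>\<V>\<close>, and its endpoint values. It
  exists and is unique on \<open>[0,\<pi>]\<close>, because \<open>1 / \<omega>\<close> is integrable there.\<close>

definition vrepr :: "vsp \<Rightarrow> real \<Rightarrow> complex" where
  "vrepr f = (SOME h. continuous_on {0..pi} h \<and>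
                 (AE \<phi> in omega_measure. rep_hsp (vincl f) \<phi> = h \<phi>))"

definition trace_op :: "vsp \<Rightarrow> complex^2" where
  "trace_op f = vector [vrepr f 0, vrepr f pi]"

definition cinner2 :: "complex^2 \<Rightarrow> complex^2 \<Rightarrow> complex" where
  "cinner2 x y = (\<Sum>i\<in>UNIV. x $ i * cnj (y $ i))"


section \<open>Weak finite-energy solutions\<close>

text \<open>\<open>h_weak_deriv J w w1\<close>: the function \<open>w1\<close> in \<open>L\<^sup>2(J; \<H>)\<close> is the distributional time derivative of
  \<open>w\<close>. The identity \<open>\<integral> \<eta>' w = - \<integral> \<eta> w1\<close> between elements of \<open>\<H>\<close> is written by pairing it with
  every \<open>h \<in> \<H>\<close>, which turns the Bochner integrals into scalar ones.\<close>

definition h_weak_deriv :: "real set \<Rightarrow> (real \<Rightarrow> hsp) \<Rightarrow> (real \<Rightarrow> hsp) \<Rightarrow> bool" where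
  "h_weak_deriv J w w1 \<longleftrightarrow> (\<forall>\<eta>::real \<Rightarrow> real. \<eta> \<in> Cc_smooth J \<longrightarrow> (\<forall>h.
     (LINT t|lebesgue_on J. of_real (deriv \<eta> t) * hinner (w t) h) =
     - (LINT t|lebesgue_on J. of_real (\<eta> t) * hinner (w1 t) h)))"

text \<open>Likewise for a derivative with values in \<open>\<V>\<^sup>*\<close> of a function with values in \<open>\<H> \<subseteq> \<V>\<^sup>*\<close>, where
  \<open>h \<in> \<H>\<close> is the functional \<open>v \<mapsto> (h, v)\<close>.\<close>

definition vdual_weak_deriv ::
    "real set \<Rightarrow> (real \<Rightarrow> hsp) \<Rightarrow> (real \<Rightarrow> vsp \<Rightarrow>\<^sub>L complex) \<Rightarrow> bool" where
  "vdual_weak_deriv J w1 w2 \<longleftrightarrow> (\<forall>\<eta>::real \<Rightarrow> real. \<eta> \<in> Cc_smooth J \<longrightarrow> (\<forall>v.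
     (LINT t|lebesgue_on J. of_real (deriv \<eta> t) * hinner (w1 t) (vincl v)) =
     - (LINT t|lebesgue_on J. of_real (\<eta> t) * blinfun_apply (w2 t) v)))"

definition weak_solution ::
    "real set \<Rightarrow> (real \<Rightarrow> complex^2^2) \<Rightarrow> (real \<Rightarrow> vsp) \<Rightarrow> bool" where
  "weak_solution J \<Gamma> w \<longleftrightarrow> w \<in> L2 J \<and>
     (\<exists>w1 w2. w1 \<in> L2 J \<and> h_weak_deriv J (\<lambda>t. vincl (w t)) w1 \<and>
        w2 \<in> L2 J \<and> (AE t in lebesgue_on J. w2 t \<in> vdual) \<and> vdual_weak_deriv J w1 w2 \<and>
        (\<forall>\<psi>::real \<Rightarrow> vsp. \<psi> \<in> Cc_smooth J \<longrightarrow>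
          (LINT t|lebesgue_on J.
             blinfun_apply (w2 t) (\<psi> t) + hinner (w1 t) (vincl (\<psi> t)) - a0 (w t) (\<psi> t)
             - cinner2 (\<Gamma> t *v trace_op (w t)) (trace_op (\<psi> t))) = 0))"

text \<open>A solution is determined up to null sets of times; point values and suprema over time refer
  to the representative in \<open>C(closure J; \<H>)\<close>.\<close>

definition h_crep :: "real set \<Rightarrow> (real \<Rightarrow> vsp) \<Rightarrow> real \<Rightarrow> hsp" where
  "h_crep J w = (SOME u. continuous_on (closure J) u \<and>
                   (AE t in lebesgue_on J. vincl (w t) = u t))"

definition J_int :: "real \<Rightarrow> real set" where
  "J_int d = {-d<..<1 + d}"

definition M_sup :: "real \<Rightarrow> (real \<Rightarrow> vsp) \<Rightarrow> real" where
  "M_sup d w = (SUP t\<in>J_int d. norm (h_crep (J_int d) w t))"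

text \<open>The norm of \<open>\<Gamma>\<close> in \<open>L\<^sup>\<infinity>(J; \<complex>\<^bsup>2\<times>2\<^esup>)\<close>, for the operator norm on matrices.\<close>

definition Linf_norm :: "real set \<Rightarrow> (real \<Rightarrow> complex^2^2) \<Rightarrow> ereal" where
  "Linf_norm J \<Gamma> = esssup (lebesgue_on J) (\<lambda>t. ereal (onorm ((*v) (\<Gamma> t))))"

end

theory Submission
  imports Defs
begin

text \<open>The estimate is proved by separation of variables. The operator \<open>A\<^sub>0\<close> is diagonalised by the
  Gegenbayer polynomials of parameter \<open>1/4\<close> in \<open>cos \<phi>\<close>, with the eigenvalues \<open>2 n (2 n + 1)\<close>
  (\<open>gegenbayer_op_gegen\<close>, \<open>a0_eig_v\<close>). Tested with a normalised eigenfunction \<open>e\<^sub>n\<close>, the equation becomes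
  \<open>u'' + u' - 2 n (2 n + 1) u = f\<close> for the coefficient \<open>u\<close> of \<open>w\<close>, where
  \<open>f = (\<Gamma> C w, C e\<^sub>n)\<close> is bounded by \<open>\<mu> \<bar>C w\<bar> \<bar>C e\<^sub>n\<bar>\<close>. The characteristic roots are the integers \<open>2 n\<close> and
  \<open>- (2 n + 1)\<close>, so \<open>u\<close> is a multiple of \<open>exp (2 n t)\<close> plus a multiple of \<open>exp (- (2 n + 1) t)\<close>, with
  amplitudes that vary only through \<open>f\<close> (\<open>mode_formula\<close>).

  The high modes, \<open>n > N\<close>, are small in the middle of the interval: the growing component is
  controlled by the bound \<open>M\<close> of the solution near the right end, the decaying one by that near the left
  end (\<open>growing_component_bound\<close>, \<open>decaying_component_bound\<close>). On \<open>[0, 1]\<close> this leaves a term of size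
  \<open>exp (- 2 n d) M\<close> and the response to \<open>f\<close>. The responses are summed over \<open>n\<close> without knowing the
  size of the traces \<open>C e\<^sub>n\<close>: boundedness of \<open>C\<close> on the form domain means that the series of
  \<open>\<bar>C e\<^sub>n\<bar>\<^sup>2 / (1 + 2 n (2 n + 1))\<close> converges (\<open>trace_square_sum\<close>), and the resolvent of the
  scalar equation gains this denominator in \<open>L\<^sup>1\<close>, up to a constant (\<open>mode_bounds\<close>).

  The low modes, \<open>n \<le> N\<close>, are observed through the value at \<open>\<phi> = 0\<close>, where no eigenfunction vanishes.
  Apart from the responses to \<open>f\<close> their trace is a sum of exponentials with \<open>2 N + 2\<close> distinct integer
  frequencies. Products of the operators \<open>E - exp (s h)\<close>, where \<open>E\<close> is the shift by \<open>h\<close>, isolate one coefficient of such a sum, at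
  a cost that is exponential in \<open>N\<close> and does not depend on \<open>d\<close> (\<open>exp_sum_coeff_bound\<close>). As the high modes
  get smaller with growing \<open>d\<close>, a fixed \<open>d\<close> makes their contribution to the trace negligible even after
  multiplication with that cost (\<open>solution_estimate\<close>). The relation between \<open>N\<close> and \<open>\<mu>\<close> serves to bound \<open>\<mu>\<close>
  by \<open>exp (N + 1)\<close>.

  Below this argument lie three facts about the spaces. The lemma of du Bois-Reymond turns weak derivatives,
  in \<open>\<phi>\<close> and in \<open>t\<close>, into indefinite integrals (\<open>weak_derivative_imp_indefinite_integral\<close>). The trace is
  small relative to the derivative (\<open>trace_bound\<close>), so the eigenfunction expansion may be
  evaluated at the endpoint (\<open>trace_partial_v_tendsto\<close>). By Parseval and completeness the solution has
  a continuous representative (\<open>continuous_representative\<close>), for which the formula for the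
  coefficients holds at every time.\<close>

section \<open>Test functions on the line\<close>

text \<open>The first half of membership in \<open>Cc_smooth\<close>, kept apart from the support so that smooth functions
  without compact support can serve as factors.\<close>

definition derivative_sequence :: "(nat \<Rightarrow> real \<Rightarrow> 'a::real_normed_vector) \<Rightarrow> bool" where
  "derivative_sequence D \<longleftrightarrow> (\<forall>k t. (D k has_vector_derivative D (Suc k) t) (at t))"

lemma Cc_smoothI:
  assumes "derivative_sequence D" "D 0 = \<psi>" "compact K" "K \<subseteq> S" "\<And>t. t \<notin> K \<Longrightarrow> \<psi> t = 0"
  shows "\<psi> \<in> Cc_smooth S"
  using assms unfolding Cc_smooth_def derivative_sequence_def by blast

lemma Cc_smoothE:
  assumes "\<psi> \<in> Cc_smooth S"
  obtains D K where "derivative_sequence D" "D 0 = \<psi>" "compact K" "K \<subseteq> S" "\<And>t. t \<notin> K \<Longrightarrow> \<psi> t = 0"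
  using assms unfolding Cc_smooth_def derivative_sequence_def by blast

lemma derivative_sequence_shift:
  "derivative_sequence D \<Longrightarrow> derivative_sequence (\<lambda>k. D (Suc k))"
  by (simp add: derivative_sequence_def)

text \<open>By Leibniz the derivatives of a product are sums of products of derivatives. Binomial
  coefficients are avoided: on the doubly indexed family of the products of an \<open>i\<close>-th and a
  \<open>j\<close>-th derivative, differentiation in \<open>t\<close> is the operator \<open>T\<close> that adds the two shifts.\<close>

lemma derivative_sequence_mult:
  fixes F G :: "nat \<Rightarrow> real \<Rightarrow> real"
  assumes "derivative_sequence F" "derivative_sequence G"
  shows "\<exists>D. D 0 = (\<lambda>t. F 0 t * G 0 t) \<and> derivative_sequence D"
proof -
  define T :: "(nat \<Rightarrow> nat \<Rightarrow> real \<Rightarrow> real) \<Rightarrow> nat \<Rightarrow> nat \<Rightarrow> real \<Rightarrow> real"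
    where "T A = (\<lambda>i j t. A (Suc i) j t + A i (Suc j) t)" for A
  define A0 where "A0 = (\<lambda>i j t. F i t * G j t)"
  have F: "(F i has_real_derivative F (Suc i) t) (at t)"
    and G: "(G i has_real_derivative G (Suc i) t) (at t)" for i t
    using assms by (auto simp: derivative_sequence_def has_real_derivative_iff_has_vector_derivative)
  have inv: "\<forall>i j t. ((T ^^ m) A0 i j has_real_derivative T ((T ^^ m) A0) i j t) (at t)" for m
  proof (induction m)
    case 0
    have "((\<lambda>t. F i t * G j t) has_real_derivative F (Suc i) t * G j t + F i t * G (Suc j) t) (at t)" for i j t
      by (auto intro!: derivative_eq_intros F G)
    then show ?case by (simp add: A0_def T_def)
  next
    case (Suc m)
    have "((\<lambda>t. (T ^^ m) A0 (Suc i) j t + (T ^^ m) A0 i (Suc j) t) has_real_derivative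
        T ((T ^^ m) A0) (Suc i) j t + T ((T ^^ m) A0) i (Suc j) t) (at t)" for i j t
      by (intro DERIV_add) (use Suc in blast)+
    then show ?case by (simp add: T_def[of "T _"]) (simp add: T_def)
  qed
  have "derivative_sequence (\<lambda>m. (T ^^ m) A0 0 0)"
    using inv by (auto simp: derivative_sequence_def has_real_derivative_iff_has_vector_derivative)
  then show ?thesis by (intro exI[of _ "\<lambda>m. (T ^^ m) A0 0 0"]) (simp add: A0_def)
qed

lemma Cc_smooth_mult:
  fixes \<eta> :: "real \<Rightarrow> real"
  assumes "\<eta> \<in> Cc_smooth S" "derivative_sequence G"
  shows "(\<lambda>t. G 0 t * \<eta> t) \<in> Cc_smooth S"
proof -
  obtain D K where D: "derivative_sequence D" "D 0 = \<eta>" "compact K" "K \<subseteq> S" "\<And>t. t \<notin> K \<Longrightarrow> \<eta> t = 0"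
    using assms(1) by (rule Cc_smoothE) blast
  obtain P where P: "P 0 = (\<lambda>t. G 0 t * D 0 t)" "derivative_sequence P"
    using derivative_sequence_mult[OF assms(2) D(1)] by blast
  show ?thesis
    by (rule Cc_smoothI[OF P(2) _ D(3,4)]) (use P(1) D in auto)
qed

lemma derivative_sequence_exp: "derivative_sequence (\<lambda>i t. k ^ i * exp (k * t :: real))"
  by (auto simp: derivative_sequence_def simp flip: has_real_derivative_iff_has_vector_derivative
      intro!: derivative_eq_intros)

lemma Cc_smooth_exp_mult:
  fixes \<eta> :: "real \<Rightarrow> real"
  assumes "\<eta> \<in> Cc_smooth S"
  shows "(\<lambda>t. exp (k * t) * \<eta> t) \<in> Cc_smooth S"
  using Cc_smooth_mult[OF assms derivative_sequence_exp[of k]] by simp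

lemma Cc_smooth_DERIV:
  fixes \<eta> :: "real \<Rightarrow> real"
  assumes "\<eta> \<in> Cc_smooth S"
  shows "(\<eta> has_real_derivative deriv \<eta> t) (at t)"
  using assms unfolding Cc_smooth_def
  by (auto simp: DERIV_deriv_iff_real_differentiable simp flip: has_real_derivative_iff_has_vector_derivative)
     (metis real_differentiable_def)

lemma Cc_smooth_deriv:
  fixes \<eta> :: "real \<Rightarrow> real"
  assumes "\<eta> \<in> Cc_smooth S"
  shows "deriv \<eta> \<in> Cc_smooth S"
proof -
  obtain D where D: "derivative_sequence D" "D 0 = \<eta>"
    using assms by (rule Cc_smoothE) blast
  have "deriv \<eta> = D 1"
    using D by (auto simp: derivative_sequence_def simp flip: has_real_derivative_iff_has_vector_derivative
        intro!: ext DERIV_imp_deriv)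
  moreover obtain K where "compact K" "K \<subseteq> S" "\<forall>t. t \<notin> K \<longrightarrow> deriv \<eta> t = 0"
    using Cc_smooth_test[OF assms] by blast
  ultimately show ?thesis
    by (intro Cc_smoothI[OF derivative_sequence_shift[OF D(1)]]) auto
qed

lemma Cc_smooth_scaleR:
  fixes \<eta> :: "real \<Rightarrow> real" and v :: "'a::real_normed_vector"
  assumes "\<eta> \<in> Cc_smooth S"
  shows "(\<lambda>t. \<eta> t *\<^sub>R v) \<in> Cc_smooth S"
proof -
  obtain D K where D: "derivative_sequence D" "D 0 = \<eta>" and
    K: "compact K" "K \<subseteq> S" "\<And>t. t \<notin> K \<Longrightarrow> \<eta> t = 0"
    using assms by (rule Cc_smoothE) blast
  have "derivative_sequence (\<lambda>k t. D k t *\<^sub>R v)"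
    using D(1) by (auto simp: derivative_sequence_def simp flip: has_real_derivative_iff_has_vector_derivative
        intro!: derivative_eq_intros)
  then show ?thesis
    by (rule Cc_smoothI[OF _ _ K(1,2)]) (use D K in auto)
qed

lemma Cc_smooth_continuous:
  fixes \<eta> :: "real \<Rightarrow> real"
  assumes "\<eta> \<in> Cc_smooth S"
  shows "continuous_on A \<eta>"
  using Cc_smooth_DERIV[OF assms] by (meson DERIV_continuous continuous_at_imp_continuous_on)

lemma poly_times_exp_tendsto_0:
  fixes q :: "real poly"
  assumes "\<epsilon> > 0"
  shows "((\<lambda>y. poly q y * exp (- \<epsilon> * y)) \<longlongrightarrow> 0) at_top"
proof -
  have mono: "((\<lambda>y. y ^ i * exp (- \<epsilon> * y)) \<longlongrightarrow> 0) at_top" for i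
  proof -
    have "((\<lambda>y. (\<epsilon> * y) ^ i / exp (\<epsilon> * y)) \<longlongrightarrow> 0) at_top"
      by (rule filterlim_compose[OF tendsto_power_div_exp_0])
         (use assms in \<open>simp add: filterlim_tendsto_pos_mult_at_top[OF tendsto_const _ filterlim_ident]\<close>)
    then have "((\<lambda>y. (1 / \<epsilon> ^ i) * ((\<epsilon> * y) ^ i / exp (\<epsilon> * y))) \<longlongrightarrow> (1 / \<epsilon> ^ i) * 0) at_top"
      by (intro tendsto_mult tendsto_const)
    moreover have "(1 / \<epsilon> ^ i) * ((\<epsilon> * y) ^ i / exp (\<epsilon> * y)) = y ^ i * exp (- \<epsilon> * y)" for y
      using assms by (simp add: power_mult_distrib exp_minus field_simps)
    ultimately show ?thesis by simp
  qed
  have "((\<lambda>y. \<Sum>i\<le>degree q. coeff q i * (y ^ i * exp (- \<epsilon> * y))) \<longlongrightarrow> (\<Sum>i\<le>degree q. coeff q i * 0)) at_top"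
    by (intro tendsto_sum tendsto_mult tendsto_const mono)
  then show ?thesis
    by (simp add: poly_altdef sum_distrib_right mult.assoc)
qed

text \<open>The derivatives of \<open>exp (- \<epsilon> / x)\<close> are polynomials in \<open>1 / x\<close> times \<open>exp (- \<epsilon> / x)\<close>, and
  the exponential beats every polynomial as \<open>x\<close> tends to \<open>0\<close> from the right.\<close>

fun bump_poly :: "real \<Rightarrow> nat \<Rightarrow> real poly" where
  "bump_poly \<epsilon> 0 = 1"
| "bump_poly \<epsilon> (Suc k) = [:0, 0, 1:] * (smult \<epsilon> (bump_poly \<epsilon> k) - pderiv (bump_poly \<epsilon> k))"

definition flat_exp :: "real \<Rightarrow> nat \<Rightarrow> real \<Rightarrow> real" where
  "flat_exp \<epsilon> k x = (if x > 0 then poly (bump_poly \<epsilon> k) (1 / x) * exp (- \<epsilon> * (1 / x)) else 0)"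

lemma flat_exp_derivative_sequence:
  assumes \<epsilon>: "\<epsilon> > 0"
  shows "derivative_sequence (flat_exp \<epsilon>)"
  unfolding derivative_sequence_def
proof (intro allI)
  fix k :: nat and t :: real
  let ?p = "bump_poly \<epsilon> k"
  let ?f = "\<lambda>x. poly ?p (1 / x) * exp (- \<epsilon> * (1 / x))"
  consider "t > 0" | "t < 0" | "t = 0" by linarith
  then have "(flat_exp \<epsilon> k has_real_derivative flat_exp \<epsilon> (Suc k) t) (at t)"
  proof cases
    case 1
    have "(?f has_real_derivative flat_exp \<epsilon> (Suc k) t) (at t)"
      using 1 by (auto intro!: derivative_eq_intros
          simp: flat_exp_def power2_eq_square divide_simps algebra_simps)
    moreover have "eventually (\<lambda>x. flat_exp \<epsilon> k x = ?f x) (nhds t)"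
      using eventually_nhds_in_open[of "{0<..}" t] 1
      by (auto elim!: eventually_mono simp: flat_exp_def)
    ultimately show ?thesis using DERIV_cong_ev[of t t "flat_exp \<epsilon> k" ?f] by blast
  next
    case 2
    have "eventually (\<lambda>x. flat_exp \<epsilon> k x = 0) (nhds t)"
      using eventually_nhds_in_open[of "{..<0}" t] 2
      by (auto elim!: eventually_mono simp: flat_exp_def)
    then have "(flat_exp \<epsilon> k has_real_derivative 0) (at t) \<longleftrightarrow> ((\<lambda>_. 0) has_real_derivative 0) (at t)"
      by (intro DERIV_cong_ev) auto
    then show ?thesis using 2 by (simp add: flat_exp_def)
  next
    case 3
    have "((\<lambda>x. flat_exp \<epsilon> k x / x) \<longlongrightarrow> 0) (at 0)"
    proof (rule filterlim_split_at_real)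
      have "((\<lambda>_::real. 0::real) \<longlongrightarrow> 0) (at_left 0)" by simp
      moreover have "eventually (\<lambda>x. 0 = flat_exp \<epsilon> k x / x) (at_left (0::real))"
        by (auto simp: eventually_at_filter flat_exp_def)
      ultimately show "((\<lambda>x. flat_exp \<epsilon> k x / x) \<longlongrightarrow> 0) (at_left 0)"
        by (rule Lim_transform_eventually)
      have "((\<lambda>y. poly (pCons 0 ?p) y * exp (- \<epsilon> * y)) \<longlongrightarrow> 0) at_top"
        by (rule poly_times_exp_tendsto_0[OF \<epsilon>])
      then have "((\<lambda>x. poly (pCons 0 ?p) (inverse x) * exp (- \<epsilon> * inverse x)) \<longlongrightarrow> 0) (at_right 0)"
        by (rule filterlim_compose[OF _ filterlim_inverse_at_top_right])
      moreover have "eventually (\<lambda>x. poly (pCons 0 ?p) (inverse x) * exp (- \<epsilon> * inverse x)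
          = flat_exp \<epsilon> k x / x) (at_right (0::real))"
        by (auto simp: eventually_at_filter flat_exp_def divide_inverse)
      ultimately show "((\<lambda>x. flat_exp \<epsilon> k x / x) \<longlongrightarrow> 0) (at_right 0)"
        by (rule Lim_transform_eventually)
    qed
    then have "(flat_exp \<epsilon> k has_real_derivative 0) (at 0)"
      unfolding has_field_derivative_iff by (simp add: flat_exp_def)
    then show ?thesis using 3 by (simp add: flat_exp_def)
  qed
  then show "(flat_exp \<epsilon> k has_vector_derivative flat_exp \<epsilon> (Suc k) t) (at t)"
    by (simp add: has_real_derivative_iff_has_vector_derivative)
qed

lemma derivative_sequence_affine:
  fixes D :: "nat \<Rightarrow> real \<Rightarrow> real"
  assumes "derivative_sequence D"
  shows "derivative_sequence (\<lambda>k t. r ^ k * D k (r * t + c))"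
  using assms unfolding derivative_sequence_def has_real_derivative_iff_has_vector_derivative[symmetric]
proof (intro allI)
  fix k t
  assume D: "\<forall>k t. (D k has_real_derivative D (Suc k) t) (at t)"
  have "((\<lambda>t. D k (r * t + c)) has_real_derivative D (Suc k) (r * t + c) * r) (at t)"
    by (rule DERIV_chain'[where f = "\<lambda>t. r * t + c" and g = "D k"]) (use D in \<open>auto intro!: derivative_eq_intros\<close>)
  then show "((\<lambda>t. r ^ k * D k (r * t + c)) has_real_derivative r ^ Suc k * D (Suc k) (r * t + c)) (at t)"
    by (auto intro!: derivative_eq_intros)
qed

text \<open>A product of two flat exponentials is supported in \<open>[c, d]\<close>; the factor \<open>1 / (k + 1)\<close> in the exponents
  makes it tend to \<open>1\<close> inside.\<close>

definition bump :: "real \<Rightarrow> real \<Rightarrow> nat \<Rightarrow> real \<Rightarrow> real" where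
  "bump c d k x = flat_exp (1 / Suc k) 0 (x - c) * flat_exp (1 / Suc k) 0 (d - x)"

lemma bump_eq:
  "bump c d k x = (if c < x \<and> x < d then exp (- (1 / (x - c) + 1 / (d - x)) * inverse (Suc k)) else 0)"
  by (auto simp: bump_def flat_exp_def exp_add[symmetric] divide_simps)

lemma bump_bounds: "0 \<le> bump c d k x" "bump c d k x \<le> 1"
proof -
  show "0 \<le> bump c d k x" by (simp add: bump_eq)
  have "- (1 / (x - c) + 1 / (d - x)) * inverse (Suc k) \<le> 0" if "c < x" "x < d"
  proof (rule mult_nonpos_nonneg)
    have "0 \<le> 1 / (x - c)" "0 \<le> 1 / (d - x)" using that by auto
    then show "- (1 / (x - c) + 1 / (d - x)) \<le> 0" by linarith
  qed simp
  then show "bump c d k x \<le> 1" by (auto simp: bump_eq)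
qed

lemma bump_tendsto_indicator: "(\<lambda>k. bump c d k x) \<longlonglongrightarrow> indicator {c<..<d} x"
proof (cases "c < x \<and> x < d")
  case True
  have "(\<lambda>k. exp (- (1 / (x - c) + 1 / (d - x)) * inverse (Suc k))) \<longlonglongrightarrow> exp (- (1 / (x - c) + 1 / (d - x)) * 0)"
    by (intro tendsto_intros LIMSEQ_inverse_real_of_nat)
  then show ?thesis using True by (simp add: bump_eq)
qed (auto simp: bump_eq)

lemma bump_Cc_smooth:
  assumes "{c..d} \<subseteq> S"
  shows "bump c d k \<in> Cc_smooth S"
proof -
  have f: "derivative_sequence (flat_exp (1 / Suc k))" by (rule flat_exp_derivative_sequence) simp
  obtain D where D: "D 0 = (\<lambda>t. 1 ^ 0 * flat_exp (1 / Suc k) 0 (1 * t + (-c)) *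
      ((-1) ^ 0 * flat_exp (1 / Suc k) 0 ((-1) * t + d)))" "derivative_sequence D"
    using derivative_sequence_mult[OF derivative_sequence_affine[OF f, of 1 "-c"]
        derivative_sequence_affine[OF f, of "-1" d]] by blast
  show ?thesis
  proof (rule Cc_smoothI[OF D(2) _ compact_Icc assms])
    show "D 0 = bump c d k"
      unfolding D(1) by (simp add: bump_def fun_eq_iff)
    show "bump c d k t = 0" if "t \<notin> {c..d}" for t
      using that unfolding bump_eq by auto
  qed
qed


text \<open>The primitive that vanishes to the left of the support also vanishes to its right, because the mean
  is zero.\<close>

lemma Cc_smooth_primitive:
  fixes \<zeta> :: "real \<Rightarrow> real"
  assumes \<zeta>: "\<zeta> \<in> Cc_smooth {a<..<b}" and ab: "a < b" and 0: "integral {a..b} \<zeta> = 0"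
  shows "\<exists>\<eta>. \<eta> \<in> Cc_smooth {a<..<b} \<and> deriv \<eta> = \<zeta>"
proof -
  obtain D K where D: "derivative_sequence D" "D 0 = \<zeta>" and
    K: "compact K" "K \<subseteq> {a<..<b}" "\<And>t. t \<notin> K \<Longrightarrow> \<zeta> t = 0"
    using \<zeta> by (rule Cc_smoothE) blast
  have cont: "continuous_on A \<zeta>" for A using Cc_smooth_continuous[OF \<zeta>] .
  obtain l u where lu: "a < l" "u < b" "K \<subseteq> {l..u}"
  proof (cases "K = {}")
    case True then show ?thesis using that[of "(a+b)/2" "(a+b)/2"] ab by simp
  next
    case False
    then obtain l u where lu: "l \<in> K" "u \<in> K" "\<And>x. x \<in> K \<Longrightarrow> l \<le> x" "\<And>x. x \<in> K \<Longrightarrow> x \<le> u"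
      using K(1) by (metis compact_attains_inf compact_attains_sup)
    have "a < l" "u < b" using K(2) lu(1,2) by auto
    moreover have "K \<subseteq> {l..u}" using lu(3,4) by auto
    ultimately show ?thesis by (rule that)
  qed
  define \<eta> where "\<eta> x = integral {a..x} \<zeta>" for x
  have z: "\<zeta> x = 0" if "x < l \<or> u < x" for x using K(3) lu(3) that by force
  have \<eta>0: "\<eta> x = 0" if "x < l" for x
  proof -
    have "integral {a..x} \<zeta> = integral {a..x} (\<lambda>_. 0)"
      by (rule integral_cong) (use that z in auto)
    then show ?thesis by (simp add: \<eta>_def)
  qed
  have \<eta>1: "\<eta> x = 0" if "u < x" "l \<le> x" for x
  proof -
    define y where "y = max x b"
    have ax: "a \<le> x" using lu that by simp
    have int: "\<zeta> integrable_on S" if "S = {p..q}" for S p q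
      using that cont by (auto intro: integrable_continuous_interval)
    have "integral {a..x} \<zeta> + integral {x..y} \<zeta> = integral {a..y} \<zeta>"
      by (rule Henstock_Kurzweil_Integration.integral_combine) (use ax int in \<open>auto simp: y_def\<close>)
    moreover have "integral {x..y} \<zeta> = integral {x..y} (\<lambda>_. 0)"
      by (rule integral_cong) (use that z in auto)
    moreover have "integral {a..b} \<zeta> + integral {b..y} \<zeta> = integral {a..y} \<zeta>"
      by (rule Henstock_Kurzweil_Integration.integral_combine) (use ab int in \<open>auto simp: y_def\<close>)
    moreover have "integral {b..y} \<zeta> = integral {b..y} (\<lambda>_. 0)"
      by (rule integral_cong) (use lu z in auto)
    ultimately show ?thesis using 0 by (simp add: \<eta>_def)
  qed
  have der: "(\<eta> has_vector_derivative \<zeta> x) (at x)" for x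
  proof (cases "x < l")
    case True
    have "eventually (\<lambda>y. \<eta> y = 0) (nhds x)"
      using eventually_nhds_in_open[of "{..<l}" x] True by (auto elim!: eventually_mono simp: \<eta>0)
    then have "(\<eta> has_real_derivative 0) (at x) \<longleftrightarrow> ((\<lambda>_. 0) has_real_derivative 0) (at x)"
      by (intro DERIV_cong_ev) auto
    then show ?thesis using True by (simp add: z has_real_derivative_iff_has_vector_derivative[symmetric])
  next
    case False
    have "((\<lambda>u. integral {a..u} \<zeta>) has_vector_derivative \<zeta> x) (at x within {a..x+1})"
      by (rule integral_has_vector_derivative) (use cont False lu in auto)
    moreover have "at x within {a..x+1} = at x"
      by (rule at_within_interior) (use False lu in \<open>auto simp: interior_atLeastAtMost_real\<close>)
    ultimately show ?thesis by (simp add: \<eta>_def[abs_def])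
  qed
  define E where "E k = (case k of 0 \<Rightarrow> \<eta> | Suc j \<Rightarrow> D j)" for k
  have "derivative_sequence E"
    using der D by (auto simp: derivative_sequence_def E_def split: nat.splits)
  then have "\<eta> \<in> Cc_smooth {a<..<b}"
  proof (rule Cc_smoothI)
    show "compact {l..u}" "{l..u} \<subseteq> {a<..<b}" using lu by auto
    show "\<eta> t = 0" if "t \<notin> {l..u}" for t using \<eta>0[of t] \<eta>1[of t] that by (cases "t < l") auto
  qed (simp add: E_def)
  moreover have "deriv \<eta> = \<zeta>"
    using der by (auto intro!: ext DERIV_imp_deriv simp: has_real_derivative_iff_has_vector_derivative)
  ultimately show ?thesis by blast
qed

section \<open>Weak derivatives on an interval\<close>

lemma integrable_lebesgue_on_open_interval:
  fixes g :: "real \<Rightarrow> complex"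
  assumes "integrable (lebesgue_on {a<..<b}) g"
  shows "g absolutely_integrable_on {a..b}" "integral\<^sup>L (lebesgue_on {a<..<b}) g = integral {a..b} g"
    "g integrable_on {a..b}"
proof -
  have 1: "g absolutely_integrable_on {a<..<b}"
    using assms by (simp add: set_integrable_def integrable_restrict_space)
  show 2: "g absolutely_integrable_on {a..b}"
    using 1 by (simp add: absolutely_integrable_on_def integrable_on_open_interval_real)
  then show "g integrable_on {a..b}" by (rule set_lebesgue_integral_eq_integral)
  show "integral\<^sup>L (lebesgue_on {a<..<b}) g = integral {a..b} g"
    using lebesgue_integral_eq_integral[OF assms] by (simp add: integral_open_interval_real)
qed

lemma integrable_on_subinterval_real':
  fixes g :: "real \<Rightarrow> 'a::banach"
  shows "g integrable_on {a..b} \<Longrightarrow> a \<le> c \<Longrightarrow> d \<le> b \<Longrightarrow> g integrable_on {c..d}"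
  by (rule integrable_subinterval_real) auto

lemma lebesgue_on_integral_split:
  fixes h :: "real \<Rightarrow> complex"
  assumes h: "integrable (lebesgue_on {a<..<b}) h" and x: "a < x" "x < b"
  shows "(LINT s|lebesgue_on {a<..<b}. (if s < x then h s else 0)) = integral {a..x} h"
    "(LINT s|lebesgue_on {a<..<b}. (if x < s then h s else 0)) = integral {x..b} h"
proof -
  have i: "integrable (lebesgue_on {a<..<b}) (\<lambda>s. (if s \<in> A then h s else 0))" if "A \<in> sets lebesgue" for A
  proof -
    have "integrable (lebesgue_on {a<..<b}) (\<lambda>s. indicator (A \<inter> {a<..<b}) s *\<^sub>R h s)"
      by (rule integrable_mult_indicator[OF _ h])
         (use that in \<open>auto simp: sets_restrict_space_iff\<close>)
    then show ?thesis
      by (rule iffD1[OF Bochner_Integration.integrable_cong[OF refl], rotated]) auto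
  qed
  have "(LINT s|lebesgue_on {a<..<b}. (if s \<in> {..<x} then h s else 0)) = integral {a<..<b} (\<lambda>s. (if s \<in> {..<x} then h s else 0))"
    by (rule lebesgue_integral_eq_integral[OF i]) auto
  also have "\<dots> = integral ({..<x} \<inter> {a<..<b}) h" by (rule integral_restrict_Int)
  also have "{..<x} \<inter> {a<..<b} = {a<..<x}" using x by auto
  finally show "(LINT s|lebesgue_on {a<..<b}. (if s < x then h s else 0)) = integral {a..x} h"
    by (simp add: integral_open_interval_real)
  have "(LINT s|lebesgue_on {a<..<b}. (if s \<in> {x<..} then h s else 0)) = integral {a<..<b} (\<lambda>s. (if s \<in> {x<..} then h s else 0))"
    by (rule lebesgue_integral_eq_integral[OF i]) auto
  also have "\<dots> = integral ({x<..} \<inter> {a<..<b}) h" by (rule integral_restrict_Int)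
  also have "{x<..} \<inter> {a<..<b} = {x<..<b}" using x by auto
  finally show "(LINT s|lebesgue_on {a<..<b}. (if x < s then h s else 0)) = integral {x..b} h"
    by (simp add: integral_open_interval_real)
qed

lemma continuous_measurable_lebesgue_on_interval:
  fixes f :: "real \<Rightarrow> 'b::euclidean_space"
  assumes "continuous_on {a..b} f"
  shows "f \<in> borel_measurable (lebesgue_on {a<..<b})"
  by (rule continuous_imp_measurable_on_sets_lebesgue)
     (auto intro: continuous_on_subset[OF assms])

lemma continuous_on_interval_bounded:
  fixes f :: "real \<Rightarrow> 'a::real_normed_vector"
  assumes "continuous_on {a..b} f"
  obtains B where "\<And>x. x \<in> {a..b} \<Longrightarrow> norm (f x) \<le> B"
proof -
  have "bounded (f ` {a..b})"
    by (intro compact_imp_bounded compact_continuous_image assms compact_Icc)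
  then show ?thesis using that unfolding bounded_iff by (meson imageI)
qed

lemma continuous_times_integrable:
  fixes k :: "real \<Rightarrow> complex"
  assumes g: "integrable (lebesgue_on {a<..<b}) g" and k: "continuous_on {a..b} k"
  shows "integrable (lebesgue_on {a<..<b}) (\<lambda>x. g x * k x)"
proof -
  obtain B where B: "\<And>x. x \<in> {a..b} \<Longrightarrow> norm (k x) \<le> B"
    using continuous_on_interval_bounded[OF k] by blast
  have [measurable]: "g \<in> borel_measurable (lebesgue_on {a<..<b})" using g by simp
  have [measurable]: "k \<in> borel_measurable (lebesgue_on {a<..<b})"
    by (rule continuous_measurable_lebesgue_on_interval[OF k])
  show ?thesis
  proof (rule Bochner_Integration.integrable_bound[where f = "\<lambda>x. of_real B * g x"])
    show "AE x in lebesgue_on {a<..<b}. norm (g x * k x) \<le> norm (of_real B * g x)"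
    proof (rule AE_I2)
      fix x assume "x \<in> space (lebesgue_on {a<..<b})"
      then have "norm (k x) \<le> B" by (intro B) auto
      then have "norm (k x) \<le> \<bar>B\<bar>" by simp
      then have "norm (g x) * norm (k x) \<le> norm (g x) * \<bar>B\<bar>" by (rule mult_left_mono) simp
      then show "norm (g x * k x) \<le> norm (of_real B * g x)" by (simp add: norm_mult mult.commute)
    qed
  qed (use g in simp_all)
qed

lemma indefinite_integral_continuous:
  fixes g :: "real \<Rightarrow> complex"
  assumes "integrable (lebesgue_on {a<..<b}) g"
  shows "continuous_on {a..b} (\<lambda>x. integral {a..x} g)"
  by (rule indefinite_integral_continuous_1) (rule integrable_lebesgue_on_open_interval[OF assms])

text \<open>Integration by parts of an absolutely continuous function against a \<open>C\<^sup>1\<close> function: both sides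
  are the double integral of \<open>g s * k' x\<close> over the triangle \<open>s < x\<close>.\<close>

lemma integral_by_parts_indefinite:
  fixes g k k' :: "real \<Rightarrow> complex"
  assumes g: "integrable (lebesgue_on {a<..<b}) g"
    and kc: "continuous_on {a..b} k"
    and k: "\<And>x. x \<in> {a<..<b} \<Longrightarrow> (k has_vector_derivative k' x) (at x)"
    and k': "continuous_on {a..b} k'"
  shows "(LINT x|lebesgue_on {a<..<b}. integral {a..x} g * k' x) =
         (LINT s|lebesgue_on {a<..<b}. g s * (k b - k s))"
proof -
  let ?M = "lebesgue_on {a<..<b}"
  interpret M: finite_measure ?M by (rule finite_measure_lebesgue_on) simp
  interpret pair_sigma_finite ?M ?M by standard
  have [measurable]: "g \<in> borel_measurable ?M" using g by simp
  have [measurable]: "k' \<in> borel_measurable ?M" by (rule continuous_measurable_lebesgue_on_interval[OF k'])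
  have [measurable]: "(\<lambda>x::real. x) \<in> borel_measurable ?M"
    by (rule continuous_measurable_lebesgue_on_interval) (rule continuous_on_id)
  obtain B where B: "\<And>x. x \<in> {a..b} \<Longrightarrow> norm (k' x) \<le> B"
    using continuous_on_interval_bounded[OF k'] by blast
  have k'_int: "integrable ?M k'"
    by (rule M.integrable_const_bound[of _ B]) (auto intro!: AE_I2 B)
  have "integrable (?M \<Otimes>\<^sub>M ?M) (\<lambda>(x, s). g s)"
    by (rule Fubini_integrable) (use g in auto)
  then have int: "integrable (?M \<Otimes>\<^sub>M ?M) (\<lambda>(x, s). (if s < x then g s * k' x else 0))"
  proof (rule Bochner_Integration.integrable_bound[OF integrable_mult_left[of "of_real B"]])
    show "AE z in ?M \<Otimes>\<^sub>M ?M. norm (case z of (x, s) \<Rightarrow> if s < x then g s * k' x else 0)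
        \<le> norm ((case z of (x, s) \<Rightarrow> g s) * complex_of_real B)"
    proof (rule AE_I2)
      fix z assume "z \<in> space (?M \<Otimes>\<^sub>M ?M)"
      then have "norm (k' (fst z)) \<le> B" by (intro B) (auto simp: space_pair_measure)
      then have "norm (k' (fst z)) \<le> \<bar>B\<bar>" by simp
      then have "norm (g (snd z)) * norm (k' (fst z)) \<le> norm (g (snd z)) * \<bar>B\<bar>" by (rule mult_left_mono) simp
      then show "norm (case z of (x, s) \<Rightarrow> if s < x then g s * k' x else 0)
        \<le> norm ((case z of (x, s) \<Rightarrow> g s) * complex_of_real B)" by (auto simp: norm_mult split: prod.splits)
    qed
  qed measurable
  have "(LINT x|?M. integral {a..x} g * k' x) = (LINT x|?M. LINT s|?M. (if s < x then g s * k' x else 0))"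
  proof (rule Bochner_Integration.integral_cong[OF refl])
    fix x assume "x \<in> space ?M"
    then have x: "a < x" "x < b" by auto
    have "(LINT s|?M. (if s < x then g s * k' x else 0)) = (LINT s|?M. (if s < x then g s else 0) * k' x)"
      by (intro Bochner_Integration.integral_cong) auto
    then show "integral {a..x} g * k' x = (LINT s|?M. (if s < x then g s * k' x else 0))"
      using lebesgue_on_integral_split(1)[OF g x] by simp
  qed
  also have "\<dots> = (LINT s|?M. LINT x|?M. (if s < x then g s * k' x else 0))"
    using Fubini_integral[OF int] by simp
  also have "\<dots> = (LINT s|?M. g s * (k b - k s))"
  proof (rule Bochner_Integration.integral_cong[OF refl])
    fix s assume "s \<in> space ?M"
    then have s: "a < s" "s < b" by auto
    have "(LINT x|?M. (if s < x then g s * k' x else 0)) = (LINT x|?M. g s * (if s < x then k' x else 0))"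
      by (intro Bochner_Integration.integral_cong) auto
    also have "\<dots> = g s * integral {s..b} k'"
      using lebesgue_on_integral_split(2)[OF k'_int s] by simp
    also have "(k' has_integral (k b - k s)) {s..b}"
      by (rule fundamental_theorem_of_calculus_interior)
         (use s in \<open>auto intro!: k continuous_on_subset[OF kc]\<close>)
    then have "integral {s..b} k' = k b - k s" by (rule integral_unique)
    finally show "(LINT x|?M. (if s < x then g s * k' x else 0)) = g s * (k b - k s)" .
  qed
  finally show ?thesis .
qed

text \<open>Almost everywhere, a locally integrable function is the limit of its means over small intervals.\<close>

lemma AE_zero_if_interval_integrals_zero:
  fixes y :: "real \<Rightarrow> complex"
  assumes y: "integrable (lebesgue_on {a<..<b}) y"
    and 0: "\<And>c d. a < c \<Longrightarrow> c < d \<Longrightarrow> d < b \<Longrightarrow> integral {c..d} y = 0"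
  shows "AE x in lebesgue_on {a<..<b}. y x = 0"
proof -
  define f where "f x = (if x \<in> {a<..<b} then y x else 0)" for x
  have "f absolutely_integrable_on UNIV"
  proof -
    have "f = (\<lambda>x. indicator {a<..<b} x *\<^sub>R y x)" by (auto simp: f_def fun_eq_iff)
    then show ?thesis using y by (simp add: set_integrable_def integrable_restrict_space)
  qed
  then have "f integrable_on cbox c d" for c d
    using integrable_on_subcbox set_lebesgue_integral_eq_integral(1) by blast
  then obtain N where N: "negligible N"
    "\<And>x e. \<lbrakk>x \<notin> N; 0 < e\<rbrakk> \<Longrightarrow> \<exists>d>0. \<forall>h. 0 < h \<and> h < d \<longrightarrow>
        norm (integral (cbox x (x + h *\<^sub>R One)) f /\<^sub>R h ^ DIM(real) - f x) < e"
    using integrable_ccontinuous_explicit[of f] by metis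
  have "y x = 0" if x: "x \<in> {a<..<b}" "x \<notin> N" for x
  proof -
    have "norm (y x) < e" if e: "e > 0" for e
    proof -
      obtain d where d: "d > 0" "\<And>h. 0 < h \<and> h < d \<Longrightarrow> norm (integral {x..x+h} f /\<^sub>R h - f x) < e"
        using N(2)[OF x(2) e] by auto
      define h where "h = min (d/2) ((b - x)/2)"
      have h: "0 < h" "h < d" "x + h < b" using d(1) x by (auto simp: h_def min_def field_simps)
      have "integral {x..x+h} f = integral {x..x+h} y"
        by (rule integral_cong) (use x h in \<open>auto simp: f_def\<close>)
      also have "\<dots> = 0" by (rule 0) (use x h in auto)
      finally show ?thesis using d(2)[of h] h x by (simp add: f_def)
    qed
    then show ?thesis by (metis less_irrefl zero_less_norm_iff)
  qed
  then have "AE x in lebesgue. x \<in> {a<..<b} \<longrightarrow> y x = 0"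
    using N(1) by (intro AE_I'[of N]) (auto simp: negligible_iff_null_sets)
  then show ?thesis by (simp add: AE_restrict_space_iff)
qed

text \<open>Every test function of mean zero is the derivative of a test function. Hence the pairing of \<open>y\<close> with a test
  function depends on its mean only, as for a constant \<open>c\<close>; smooth bumps tend to the indicators of
  intervals, so \<open>y - c\<close> has integral zero over all intervals.\<close>

lemma weakly_constant_imp_AE_constant:
  fixes y :: "real \<Rightarrow> complex"
  assumes ab: "a < b" and y: "integrable (lebesgue_on {a<..<b}) y"
    and w: "\<And>\<eta>::real \<Rightarrow> real. \<eta> \<in> Cc_smooth {a<..<b} \<Longrightarrow> (LINT x|lebesgue_on {a<..<b}. y x * of_real (deriv \<eta> x)) = 0"
  shows "\<exists>c. AE x in lebesgue_on {a<..<b}. y x = c"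
proof -
  let ?M = "lebesgue_on {a<..<b}"
  interpret M: finite_measure ?M by (rule finite_measure_lebesgue_on) simp
  have [measurable]: "y \<in> borel_measurable ?M" using y by simp
  have cont: "continuous_on A \<zeta>" if "\<zeta> \<in> Cc_smooth S" for \<zeta> :: "real \<Rightarrow> real" and A S
    using Cc_smooth_continuous[OF that] .
  have iy: "integrable ?M (\<lambda>x. y x * of_real (\<zeta> x))" if "\<zeta> \<in> Cc_smooth {a<..<b}" for \<zeta> :: "real \<Rightarrow> real"
    by (rule continuous_times_integrable[OF y]) (intro continuous_intros cont[OF that])
  define p q where "p = a + (b - a) / 3" and "q = b - (b - a) / 3"
  have pq: "a < p" "p < q" "q < b" using ab by (auto simp: p_def q_def field_simps)
  define \<zeta>0 where "\<zeta>0 = bump p q 0"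
  have \<zeta>0: "\<zeta>0 \<in> Cc_smooth {a<..<b}" unfolding \<zeta>0_def by (rule bump_Cc_smooth) (use pq in auto)
  define m where "m \<zeta> = integral {a..b} \<zeta>" for \<zeta> :: "real \<Rightarrow> real"
  have integ: "\<zeta> integrable_on {a..b}" if "\<zeta> \<in> Cc_smooth {a<..<b}" for \<zeta> :: "real \<Rightarrow> real"
    by (rule integrable_continuous_interval[OF cont[OF that]])
  have "m \<zeta>0 \<noteq> 0"
  proof
    assume "m \<zeta>0 = 0"
    then have "\<zeta>0 ((p + q) / 2) = 0"
      unfolding m_def using integral_eq_0_iff[OF cont[OF \<zeta>0] ab] bump_bounds(1) pq
      by (auto simp: \<zeta>0_def)
    then show False using pq by (auto simp: \<zeta>0_def bump_eq)
  qed
  define c where "c = (LINT x|?M. y x * of_real (\<zeta>0 x)) / of_real (m \<zeta>0)"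
  have key: "(LINT x|?M. y x * of_real (\<zeta> x)) = c * of_real (m \<zeta>)"
    if \<zeta>: "\<zeta> \<in> Cc_smooth {a<..<b}" for \<zeta> :: "real \<Rightarrow> real"
  proof -
    define r where "r = m \<zeta> / m \<zeta>0"
    obtain D K where D: "derivative_sequence D" "D 0 = \<zeta>" and
      K: "compact K" "K \<subseteq> {a<..<b}" "\<And>t. t \<notin> K \<Longrightarrow> \<zeta> t = 0"
      using \<zeta> by (rule Cc_smoothE) blast
    obtain D' K' where D': "derivative_sequence D'" "D' 0 = \<zeta>0" and
      K': "compact K'" "K' \<subseteq> {a<..<b}" "\<And>t. t \<notin> K' \<Longrightarrow> \<zeta>0 t = 0"
      using \<zeta>0 by (rule Cc_smoothE) blast
    have "derivative_sequence (\<lambda>k t. D k t - r * D' k t)"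
      using D(1) D'(1) by (auto simp: derivative_sequence_def simp flip: has_real_derivative_iff_has_vector_derivative
          intro!: derivative_eq_intros)
    then have \<xi>: "(\<lambda>t. \<zeta> t - r * \<zeta>0 t) \<in> Cc_smooth {a<..<b}"
      by (rule Cc_smoothI[where K = "K \<union> K'"]) (use D D' K K' in auto)
    have "integral {a..b} (\<lambda>t. \<zeta> t - r * \<zeta>0 t) = m \<zeta> - r * m \<zeta>0"
      unfolding m_def using integ[OF \<zeta>] integ[OF \<zeta>0]
      by (subst Henstock_Kurzweil_Integration.integral_diff) (auto intro: integrable_on_mult_right)
    then have "integral {a..b} (\<lambda>t. \<zeta> t - r * \<zeta>0 t) = 0" using \<open>m \<zeta>0 \<noteq> 0\<close> by (simp add: r_def)
    from Cc_smooth_primitive[OF \<xi> ab this]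
    obtain \<eta> where "\<eta> \<in> Cc_smooth {a<..<b}" "deriv \<eta> = (\<lambda>t. \<zeta> t - r * \<zeta>0 t)" by blast
    then have "(LINT x|?M. y x * of_real (\<zeta> x - r * \<zeta>0 x)) = 0" using w[of \<eta>] by simp
    moreover have "(LINT x|?M. y x * of_real (\<zeta> x - r * \<zeta>0 x)) =
        (LINT x|?M. y x * of_real (\<zeta> x)) - of_real r * (LINT x|?M. y x * of_real (\<zeta>0 x))"
      using iy[OF \<zeta>] iy[OF \<zeta>0]
      by (subst integral_mult_right_zero[symmetric], subst Bochner_Integration.integral_diff[symmetric])
         (auto intro!: Bochner_Integration.integral_cong simp: algebra_simps)
    ultimately show ?thesis using \<open>m \<zeta>0 \<noteq> 0\<close> by (simp add: c_def r_def field_simps)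
  qed
  have yc: "integrable ?M (\<lambda>x. y x - c)" using y by auto
  have z: "integral {l..u} (\<lambda>x. y x - c) = 0" if lu: "a < l" "l < u" "u < b" for l u
  proof -
    have B: "bump l u k \<in> Cc_smooth {a<..<b}" for k by (rule bump_Cc_smooth) (use lu in auto)
    have int_bump: "integrable ?M (\<lambda>x. of_real (bump l u k x) :: complex)" for k
      by (rule M.integrable_const_bound[of _ 1])
         (auto intro!: AE_I2 continuous_measurable_lebesgue_on_interval continuous_intros cont[OF B]
           simp: bump_bounds)
    have bz: "(LINT x|?M. (y x - c) * of_real (bump l u k x)) = 0" for k
    proof -
      have "(LINT x|?M. of_real (bump l u k x) :: complex) = of_real (m (bump l u k))"
      proof -
        have r: "integrable ?M (bump l u k)"
          using integrable_Re[OF int_bump[of k]] by simp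
        have "(LINT x|?M. of_real (bump l u k x) :: complex) = of_real (LINT x|?M. bump l u k x)" by simp
        also have "(LINT x|?M. bump l u k x) = integral {a<..<b} (bump l u k)"
          by (rule lebesgue_integral_eq_integral[OF r]) auto
        finally show ?thesis by (simp add: m_def integral_open_interval_real)
      qed
      moreover have "(LINT x|?M. (y x - c) * of_real (bump l u k x)) =
        (LINT x|?M. y x * of_real (bump l u k x)) - c * (LINT x|?M. of_real (bump l u k x))"
        using iy[OF B] int_bump
        by (subst integral_mult_right_zero[symmetric], subst Bochner_Integration.integral_diff[symmetric])
           (auto intro!: Bochner_Integration.integral_cong simp: algebra_simps)
      ultimately show ?thesis using key[OF B] by simp
    qed
    have "(\<lambda>k. LINT x|?M. (y x - c) * of_real (bump l u k x)) \<longlonglongrightarrow>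
        (LINT x|?M. (y x - c) * of_real (indicator {l<..<u} x))"
    proof (rule integral_dominated_convergence[where w = "\<lambda>x. norm (y x - c)"])
      show "(\<lambda>x. (y x - c) * complex_of_real (bump l u i x)) \<in> borel_measurable ?M" for i
        by (rule borel_measurable_integrable[OF continuous_times_integrable[OF yc]])
           (intro continuous_intros cont[OF B])
      show "AE x in ?M. (\<lambda>i. (y x - c) * complex_of_real (bump l u i x)) \<longlonglongrightarrow> (y x - c) * complex_of_real (indicator {l<..<u} x)"
        by (intro AE_I2 tendsto_intros bump_tendsto_indicator)
      show "AE x in ?M. norm ((y x - c) * complex_of_real (bump l u i x)) \<le> norm (y x - c)" for i
        by (intro AE_I2) (auto simp: norm_mult bump_bounds intro: mult_left_le)
      have [measurable]: "(indicator {l<..<u} :: real \<Rightarrow> real) \<in> borel_measurable ?M"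
        by (intro measurable_restrict_space1 measurable_completion) simp
      show "(\<lambda>x. (y x - c) * complex_of_real (indicator {l<..<u} x)) \<in> borel_measurable ?M"
        by measurable
    qed (use yc in auto)
    then have "(LINT x|?M. (y x - c) * of_real (indicator {l<..<u} x)) = 0"
      unfolding bz by (rule LIMSEQ_unique[OF _ tendsto_const])
    moreover have "(LINT x|?M. (y x - c) * of_real (indicator {l<..<u} x)) = integral {l..u} (\<lambda>x. y x - c)"
    proof -
      have "integrable ?M (\<lambda>x. indicator {l<..<u} x *\<^sub>R (y x - c))"
        by (rule integrable_mult_indicator[OF _ yc]) (use lu in \<open>auto simp: sets_restrict_space_iff\<close>)
      then have "(LINT x|?M. indicator {l<..<u} x *\<^sub>R (y x - c)) = integral {a<..<b} (\<lambda>x. indicator {l<..<u} x *\<^sub>R (y x - c))"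
        by (rule lebesgue_integral_eq_integral) auto
      also have "\<dots> = integral {a<..<b} (\<lambda>x. (if x \<in> {l<..<u} then y x - c else 0))"
        by (rule integral_cong) auto
      also have "\<dots> = integral ({l<..<u} \<inter> {a<..<b}) (\<lambda>x. y x - c)" by (rule integral_restrict_Int)
      also have "{l<..<u} \<inter> {a<..<b} = {l<..<u}" using lu by auto
      finally show ?thesis by (simp add: integral_open_interval_real scaleR_conv_of_real mult.commute)
    qed
    ultimately show ?thesis by simp
  qed
  have "AE x in ?M. y x - c = 0"
    by (rule AE_zero_if_interval_integrals_zero[OF yc z])
  then show ?thesis by (auto intro!: exI[of _ c])
qed

text \<open>The lemma of du Bois-Reymond: subtract the indefinite integral of the weak derivative.\<close>

lemma weak_derivative_imp_indefinite_integral: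
  fixes u g :: "real \<Rightarrow> complex"
  assumes ab: "a < b" and u: "integrable (lebesgue_on {a<..<b}) u" and g: "integrable (lebesgue_on {a<..<b}) g"
    and w: "\<And>\<eta>::real \<Rightarrow> real. \<eta> \<in> Cc_smooth {a<..<b} \<Longrightarrow>
      (LINT x|lebesgue_on {a<..<b}. u x * of_real (deriv \<eta> x)) = - (LINT x|lebesgue_on {a<..<b}. g x * of_real (\<eta> x))"
  shows "\<exists>c. AE x in lebesgue_on {a<..<b}. u x = c + integral {a..x} g"
proof -
  let ?M = "lebesgue_on {a<..<b}"
  interpret M: finite_measure ?M by (rule finite_measure_lebesgue_on) simp
  define G where "G x = integral {a..x} g" for x
  have Gc: "continuous_on {a..b} G" unfolding G_def by (rule indefinite_integral_continuous[OF g])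
  have one: "integrable ?M (\<lambda>_. 1::complex)" by simp
  have G: "integrable ?M G" using continuous_times_integrable[OF one Gc] by simp
  have "\<exists>c. AE x in ?M. u x - G x = c"
  proof (rule weakly_constant_imp_AE_constant[OF ab])
    show "integrable ?M (\<lambda>x. u x - G x)" using u G by simp
    fix \<eta> :: "real \<Rightarrow> real" assume \<eta>: "\<eta> \<in> Cc_smooth {a<..<b}"
    have c\<eta>: "continuous_on {a..b} (\<lambda>x. complex_of_real (deriv \<eta> x))"
      by (intro continuous_intros Cc_smooth_continuous[OF Cc_smooth_deriv[OF \<eta>]])
    have b: "\<eta> b = 0" using \<eta> unfolding Cc_smooth_def by auto
    have "((\<lambda>x. complex_of_real (\<eta> x)) has_vector_derivative of_real (deriv \<eta> x)) (at x)" for x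
      using Cc_smooth_DERIV[OF \<eta>, of x]
      by (intro has_vector_derivative_of_real) (simp flip: has_real_derivative_iff_has_vector_derivative)
    moreover have "continuous_on {a..b} (\<lambda>x. complex_of_real (\<eta> x))"
      by (intro continuous_intros Cc_smooth_continuous[OF \<eta>])
    ultimately
    have "(LINT x|?M. G x * of_real (deriv \<eta> x)) = - (LINT x|?M. g x * of_real (\<eta> x))"
      using integral_by_parts_indefinite[OF g, of "\<lambda>x. of_real (\<eta> x)" "\<lambda>x. of_real (deriv \<eta> x)"] c\<eta>
      by (simp add: G_def b)
    moreover have "(LINT x|?M. (u x - G x) * of_real (deriv \<eta> x)) =
        (LINT x|?M. u x * of_real (deriv \<eta> x)) - (LINT x|?M. G x * of_real (deriv \<eta> x))"
      using continuous_times_integrable[OF u c\<eta>] continuous_times_integrable[OF G c\<eta>]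
      by (subst Bochner_Integration.integral_diff[symmetric])
         (auto intro!: Bochner_Integration.integral_cong simp: algebra_simps)
    ultimately show "(LINT x|?M. (u x - G x) * of_real (deriv \<eta> x)) = 0" using w[OF \<eta>] by simp
  qed
  then obtain c where "AE x in ?M. u x - G x = c" by blast
  then show ?thesis by (intro exI[of _ c]) (auto simp: G_def algebra_simps)
qed

section \<open>The Hilbert space\<close>

lemma abs_hsp_rep_hsp [simp]: "abs_hsp (rep_hsp f) = f"
  by (rule Quotient_abs_rep[OF Quotient_hsp])

lemma hrel_refl: "square_integrable f \<Longrightarrow> hrel f f"
  by (simp add: hrel_def)

lemma abs_hsp_add: "square_integrable f \<Longrightarrow> square_integrable g \<Longrightarrow> abs_hsp f + abs_hsp g = abs_hsp (\<lambda>x. f x + g x)"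
  by (rule plus_hsp.abs_eq) (simp_all add: hrel_refl)

lemma abs_hsp_scaleC: "square_integrable f \<Longrightarrow> hscaleC z (abs_hsp f) = abs_hsp (\<lambda>x. z * f x)"
  by (rule hscaleC.abs_eq) (simp_all add: hrel_refl)

lemma abs_hsp_diff: "square_integrable f \<Longrightarrow> square_integrable g \<Longrightarrow> abs_hsp f - abs_hsp g = abs_hsp (\<lambda>x. f x - g x)"
  unfolding minus_hsp_def uminus_hsp_def
  using abs_hsp_add[of f "\<lambda>x. (-1) * g x"] abs_hsp_scaleC[of g "-1"] square_integrable_scale[of g "-1"] by simp

lemma square_integrable_diff: "square_integrable f \<Longrightarrow> square_integrable g \<Longrightarrow> square_integrable (\<lambda>x. f x - g x)"
  using square_integrable_add[of f "\<lambda>x. (-1) * g x"] square_integrable_scale[of g "-1"] by simp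

lemma hinner_abs: "square_integrable f \<Longrightarrow> square_integrable g \<Longrightarrow>
    hinner (abs_hsp f) (abs_hsp g) = (LINT x|omega_measure. f x * cnj (g x))"
  by (rule hinner.abs_eq) (simp_all add: hrel_refl)

lemma hinner_add_left: "hinner (f + g) h = hinner f h + hinner g h"
  by transfer (auto simp: hrel_def distrib_right square_integrable_mult)

lemma hinner_scaleC_left: "hinner (hscaleC z f) h = z * hinner f h"
  by transfer (auto simp: hrel_def mult.assoc simp flip: integral_mult_right_zero)

lemma hinner_commute: "hinner f g = cnj (hinner g f)"
  unfolding hinner.rep_eq
  by (subst Bochner_Integration.integral_cnj [symmetric]) (simp add: mult.commute)

lemma hinner_add_right: "hinner f (g + h) = hinner f g + hinner f h"
  using hinner_add_left[of g h f] by (metis complex_cnj_add hinner_commute)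

lemma hinner_scaleC_right: "hinner f (hscaleC z g) = cnj z * hinner f g"
  using hinner_scaleC_left[of z g f] by (metis complex_cnj_mult hinner_commute)

lemma hinner_scaleR_left: "hinner (r *\<^sub>R f) g = of_real r * hinner f g"
  by (simp add: scaleR_hsp_def hinner_scaleC_left)

lemma hinner_scaleR_right: "hinner f (r *\<^sub>R g) = of_real r * hinner f g"
  by (simp add: scaleR_hsp_def hinner_scaleC_right)

lemma hinner_zero [simp]: "hinner 0 f = 0" "hinner f 0 = 0"
  using hinner_scaleR_left[of 0 0 f] hinner_scaleR_right[of f 0 0] by simp_all

lemma hinner_minus_left: "hinner (- f) g = - hinner f g"
  using hinner_scaleR_left[of "-1" f g] by simp

lemma hinner_minus_right: "hinner f (- g) = - hinner f g"
  using hinner_scaleR_right[of f "-1" g] by simp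

lemma hinner_diff_left: "hinner (f - g) h = hinner f h - hinner g h"
  using hinner_add_left[of f "- g" h] by (simp add: hinner_minus_left)

lemma hinner_diff_right: "hinner f (g - h) = hinner f g - hinner f h"
  using hinner_add_right[of f g "- h"] by (simp add: hinner_minus_right)

lemma hinner_sum_left: "hinner (\<Sum>i\<in>A. f i) h = (\<Sum>i\<in>A. hinner (f i) h)"
  by (induction A rule: infinite_finite_induct) (simp_all add: hinner_add_left)

lemma hinner_sum_right: "hinner h (\<Sum>i\<in>A. f i) = (\<Sum>i\<in>A. hinner h (f i))"
  by (induction A rule: infinite_finite_induct) (simp_all add: hinner_add_right)

lemma hinner_self: "hinner f f = of_real ((norm f)\<^sup>2)"
proof (rule complex_eqI)
  have "Re (hinner f f) = inner f f" by (simp add: inner_hsp_def)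
  then show "Re (hinner f f) = Re (of_real ((norm f)\<^sup>2))" by (simp add: power2_norm_eq_inner)
  have "hinner f f = cnj (hinner f f)" by (rule hinner_commute)
  then have "Im (hinner f f) = - Im (hinner f f)" by (metis cnj.sel(2))
  then show "Im (hinner f f) = Im (of_real ((norm f)\<^sup>2))" by simp
qed

lemma norm_hscaleC: "norm (hscaleC z f) = norm z * norm f"
proof -
  have "complex_of_real ((norm (hscaleC z f))\<^sup>2) = of_real ((norm z * norm f)\<^sup>2)"
    unfolding hinner_self[symmetric] hinner_scaleC_left hinner_scaleC_right mult.assoc[symmetric]
    by (simp only: hinner_self complex_norm_square power_mult_distrib of_real_mult mult_ac)
  then have "(norm (hscaleC z f))\<^sup>2 = (norm z * norm f)\<^sup>2" using of_real_eq_iff by blast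
  then show ?thesis by simp
qed

lemma norm_hinner_le: "norm (hinner f g) \<le> norm f * norm g"
proof (cases "hinner f g = 0")
  case False
  let ?z = "hinner f g"
  have "(norm ?z)\<^sup>2 = inner f (hscaleC ?z g)"
    unfolding inner_hsp_def hinner_scaleC_right mult.commute[of "cnj _"]
    by (simp flip: complex_norm_square)
  also have "\<dots> \<le> norm f * norm (hscaleC ?z g)" by (rule norm_cauchy_schwarz)
  also have "\<dots> = norm ?z * (norm f * norm g)" by (simp add: norm_hscaleC)
  finally show ?thesis using False by (simp add: power2_eq_square)
qed simp

lemma bounded_linear_hinner: "bounded_linear (\<lambda>f. hinner f g)"
  by (rule bounded_linear_intro[where K = "norm g"])
     (auto simp: hinner_add_left hinner_scaleR_left scaleR_conv_of_real norm_hinner_le)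

lemma norm_abs_hsp:
  assumes "square_integrable f"
  shows "(norm (abs_hsp f))\<^sup>2 = (LINT x|omega_measure. (norm (f x))\<^sup>2)"
proof -
  have "complex_of_real ((norm (abs_hsp f))\<^sup>2) = (LINT x|omega_measure. complex_of_real ((norm (f x))\<^sup>2))"
    unfolding hinner_self[symmetric] hinner_abs[OF assms assms] by (simp only: complex_norm_square)
  also have "\<dots> = of_real (LINT x|omega_measure. (norm (f x))\<^sup>2)" by (rule integral_complex_of_real)
  finally show ?thesis using of_real_eq_iff by blast
qed

lemma borel_measurable_omega_eq: "borel_measurable omega_measure = borel_measurable (lebesgue_on {0<..<pi})"
  by (rule measurable_cong_sets) (rule sets_omega_measure refl)+

lemma omega_bounds: "x \<in> {0<..<pi} \<Longrightarrow> 0 < omega x" "x \<in> {0<..<pi} \<Longrightarrow> omega x \<le> 1"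
  by (auto simp: omega_pos) (simp add: omega_def)

lemma integral_omega:
  fixes f :: "real \<Rightarrow> 'a::{banach, second_countable_topology}"
  assumes "f \<in> borel_measurable (lebesgue_on {0<..<pi})"
  shows "integral\<^sup>L omega_measure f = (LINT x|lebesgue_on {0<..<pi}. omega x *\<^sub>R f x)"
  unfolding omega_measure_def
  by (rule integral_density[OF assms]) (auto intro!: AE_I2 less_imp_le omega_pos)

lemma integrable_omega:
  fixes f :: "real \<Rightarrow> 'a::{banach, second_countable_topology}"
  assumes "f \<in> borel_measurable (lebesgue_on {0<..<pi})"
  shows "integrable omega_measure f \<longleftrightarrow> integrable (lebesgue_on {0<..<pi}) (\<lambda>x. omega x *\<^sub>R f x)"
  unfolding omega_measure_def
  by (rule integrable_density[OF assms]) (auto intro!: AE_I2 less_imp_le omega_pos)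

lemma emeasure_omega_le: "emeasure omega_measure {0<..<pi} \<le> ennreal pi"
proof -
  have "emeasure omega_measure (space omega_measure) = (\<integral>\<^sup>+x. ennreal (omega x) \<partial>lebesgue_on {0<..<pi})"
    unfolding omega_measure_def
    by (subst emeasure_density) (auto intro!: nn_integral_cong simp: sets_restrict_space)
  also have "\<dots> \<le> (\<integral>\<^sup>+x. 1 \<partial>lebesgue_on {0<..<pi})"
    by (intro nn_integral_mono) (auto simp: omega_bounds)
  also have "\<dots> = ennreal pi"
    by (simp add: emeasure_restrict_space)
  finally show ?thesis by simp
qed

interpretation omega: finite_measure omega_measure
proof
  have "emeasure omega_measure {0<..<pi} \<noteq> \<infinity>"
  proof
    assume "emeasure omega_measure {0<..<pi} = \<infinity>"
    then show False using emeasure_omega_le by (simp add: top_unique)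
  qed
  then show "emeasure omega_measure (space omega_measure) \<noteq> \<infinity>" by simp
qed

lemma measure_omega_le: "measure omega_measure {0<..<pi} \<le> pi"
  using emeasure_omega_le by (simp add: omega.emeasure_eq_measure)

lemma norm_integral_le_hsp:
  assumes "square_integrable f"
  shows "(\<integral>\<^sup>+x. ennreal (norm (f x)) \<partial>omega_measure) \<le> ennreal (sqrt pi * norm (abs_hsp f))"
proof -
  have [measurable]: "f \<in> borel_measurable omega_measure" using assms by (simp add: square_integrable_def)
  have "(\<integral>\<^sup>+x. ennreal (norm (f x)) \<partial>omega_measure)\<^sup>2 =
      (\<integral>\<^sup>+x. ennreal (norm (f x)) * 1 \<partial>omega_measure)\<^sup>2" by simp
  also have "\<dots> \<le> (\<integral>\<^sup>+x. ennreal (norm (f x)) ^ 2 \<partial>omega_measure) * (\<integral>\<^sup>+x. 1 ^ 2 \<partial>omega_measure)"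
    by (rule Cauchy_Schwarz_nn_integral) auto
  also have "(\<integral>\<^sup>+x. ennreal (norm (f x)) ^ 2 \<partial>omega_measure) = ennreal ((norm (abs_hsp f))\<^sup>2)"
    using assms by (simp add: norm_abs_hsp ennreal_power nn_integral_eq_integral square_integrable_def)
  also have "(\<integral>\<^sup>+x. 1 ^ 2 \<partial>omega_measure) \<le> ennreal pi"
    using measure_omega_le by (simp add: omega.emeasure_eq_measure)
  finally have "(\<integral>\<^sup>+x. ennreal (norm (f x)) \<partial>omega_measure)\<^sup>2 \<le> ennreal ((norm (abs_hsp f))\<^sup>2) * ennreal pi"
    by (simp add: mult_left_mono)
  also have "\<dots> = (ennreal (sqrt pi * norm (abs_hsp f)))\<^sup>2"
    by (simp add: ennreal_power ennreal_mult[symmetric] power_mult_distrib mult.commute)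
  finally have *: "(\<integral>\<^sup>+x. ennreal (norm (f x)) \<partial>omega_measure)\<^sup>2 \<le> (ennreal (sqrt pi * norm (abs_hsp f)))\<^sup>2" .
  show ?thesis
  proof (cases "\<integral>\<^sup>+x. ennreal (norm (f x)) \<partial>omega_measure" rule: ennreal_cases)
    case (real r)
    then have "r\<^sup>2 \<le> (sqrt pi * norm (abs_hsp f))\<^sup>2" using * by (simp add: ennreal_power)
    then have "r \<le> sqrt pi * norm (abs_hsp f)" by (rule power2_le_imp_le) simp
    then show ?thesis using real by (simp add: ennreal_leI)
  next
    case top
    then show ?thesis using * by (simp add: ennreal_power top_unique)
  qed
qed

lemma norm_rep_diff:
  "(\<integral>\<^sup>+x. ennreal ((norm (rep_hsp f x - rep_hsp g x))\<^sup>2) \<partial>omega_measure) = ennreal ((norm (f - g))\<^sup>2)"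
proof -
  have s: "square_integrable (\<lambda>x. rep_hsp f x - rep_hsp g x)"
    by (intro square_integrable_diff square_integrable_rep)
  have "f - g = abs_hsp (\<lambda>x. rep_hsp f x - rep_hsp g x)"
    using abs_hsp_diff[of "rep_hsp f" "rep_hsp g"] by (simp add: square_integrable_rep)
  then show ?thesis using s
    by (simp add: norm_abs_hsp nn_integral_eq_integral square_integrable_def)
qed

lemma hsp_fatou:
  fixes X :: "nat \<Rightarrow> hsp"
  assumes lim: "AE x in omega_measure. (\<lambda>m. rep_hsp (X m) x) \<longlonglongrightarrow> g x"
    and [measurable]: "g \<in> borel_measurable omega_measure"
    and bound: "\<And>m. m \<ge> K \<Longrightarrow> norm (X m - f) \<le> e" and e: "e \<ge> 0"
  shows "square_integrable g" "norm (abs_hsp g - f) \<le> e"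
proof -
  have [measurable]: "rep_hsp h \<in> borel_measurable omega_measure" for h
    using square_integrable_rep[of h] by (simp add: square_integrable_def)
  have "(\<integral>\<^sup>+x. ennreal ((norm (g x - rep_hsp f x))\<^sup>2) \<partial>omega_measure) =
      (\<integral>\<^sup>+x. liminf (\<lambda>m. ennreal ((norm (rep_hsp (X m) x - rep_hsp f x))\<^sup>2)) \<partial>omega_measure)"
  proof (rule nn_integral_cong_AE)
    show "AE x in omega_measure. ennreal ((norm (g x - rep_hsp f x))\<^sup>2) =
        liminf (\<lambda>m. ennreal ((norm (rep_hsp (X m) x - rep_hsp f x))\<^sup>2))"
      using lim
    proof (rule eventually_mono)
      fix x assume "(\<lambda>m. rep_hsp (X m) x) \<longlonglongrightarrow> g x"
      then have "(\<lambda>m. ennreal ((norm (rep_hsp (X m) x - rep_hsp f x))\<^sup>2)) \<longlonglongrightarrow> ennreal ((norm (g x - rep_hsp f x))\<^sup>2)"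
        by (intro tendsto_intros)
      then show "ennreal ((norm (g x - rep_hsp f x))\<^sup>2) = liminf (\<lambda>m. ennreal ((norm (rep_hsp (X m) x - rep_hsp f x))\<^sup>2))"
        using lim_imp_Liminf[OF sequentially_bot] by metis
    qed
  qed
  also have "\<dots> \<le> liminf (\<lambda>m. \<integral>\<^sup>+x. ennreal ((norm (rep_hsp (X m) x - rep_hsp f x))\<^sup>2) \<partial>omega_measure)"
    by (rule nn_integral_liminf) measurable
  also have "\<dots> = liminf (\<lambda>m. ennreal ((norm (X m - f))\<^sup>2))" by (simp add: norm_rep_diff)
  also have "\<dots> \<le> limsup (\<lambda>m. ennreal ((norm (X m - f))\<^sup>2))"
    by (rule Liminf_le_Limsup) simp
  also have "\<dots> \<le> ennreal (e\<^sup>2)"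
  proof (rule Limsup_bounded)
    show "\<forall>\<^sub>F m in sequentially. ennreal ((norm (X m - f))\<^sup>2) \<le> ennreal (e\<^sup>2)"
      using eventually_ge_at_top[of K] by eventually_elim (intro ennreal_leI power_mono bound norm_ge_zero)
  qed
  finally have le: "(\<integral>\<^sup>+x. ennreal ((norm (g x - rep_hsp f x))\<^sup>2) \<partial>omega_measure) \<le> ennreal (e\<^sup>2)" .
  have d: "square_integrable (\<lambda>x. g x - rep_hsp f x)"
    unfolding square_integrable_def
  proof
    show "integrable omega_measure (\<lambda>x. (norm (g x - rep_hsp f x))\<^sup>2)"
      by (rule integrableI_nonneg) (use le in \<open>auto simp: less_top[symmetric] top_unique\<close>)
  qed measurable
  from square_integrable_add[OF this square_integrable_rep[of f]] show sg: "square_integrable g" by simp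
  have "abs_hsp g - f = abs_hsp (\<lambda>x. g x - rep_hsp f x)"
    using abs_hsp_diff[OF sg square_integrable_rep[of f]] by simp
  then have "ennreal ((norm (abs_hsp g - f))\<^sup>2) \<le> ennreal (e\<^sup>2)"
    using le d by (simp add: norm_abs_hsp nn_integral_eq_integral square_integrable_def)
  then have "(norm (abs_hsp g - f))\<^sup>2 \<le> e\<^sup>2" by simp
  then show "norm (abs_hsp g - f) \<le> e" using e by (rule power2_le_imp_le)
qed

text \<open>The Riesz--Fischer theorem. A rapidly Cauchy subsequence converges almost everywhere, because
  its increments are summable in \<open>L\<^sup>1\<close>; by Fatou's lemma the pointwise limit is the limit in
  the norm.\<close>

instance hsp :: complete_space
proof
  fix X :: "nat \<Rightarrow> hsp" assume X: "Cauchy X"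
  have "\<exists>K. \<forall>m\<ge>K. \<forall>n\<ge>K. norm (X m - X n) < (1/2) ^ k" for k :: nat
    using CauchyD[OF X, of "(1/2)^k"] by auto
  then obtain K where K: "\<And>k m n. m \<ge> K k \<Longrightarrow> n \<ge> K k \<Longrightarrow> norm (X m - X n) < (1/2) ^ k" by metis
  define r where "r k = (\<Sum>j\<le>k. K j) + k" for k
  have rK: "r j \<ge> K k" if "j \<ge> k" for j k
    unfolding r_def using that by (meson atMost_iff finite_atMost member_le_sum trans_le_add1 zero_le)
  define f where "f k = rep_hsp (X (r k))" for k
  have [measurable]: "f k \<in> borel_measurable omega_measure" for k
    unfolding f_def using square_integrable_rep by (simp add: square_integrable_def)
  have inc: "(\<integral>\<^sup>+x. ennreal (norm (f (Suc k) x - f k x)) \<partial>omega_measure) \<le> ennreal (sqrt pi * (1/2) ^ k)" for k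
  proof -
    have "abs_hsp (\<lambda>x. f (Suc k) x - f k x) = X (r (Suc k)) - X (r k)"
      unfolding f_def using abs_hsp_diff[OF square_integrable_rep square_integrable_rep] by simp
    then have "(\<integral>\<^sup>+x. ennreal (norm (f (Suc k) x - f k x)) \<partial>omega_measure) \<le>
        ennreal (sqrt pi * norm (X (r (Suc k)) - X (r k)))"
      using norm_integral_le_hsp[of "\<lambda>x. f (Suc k) x - f k x"]
      by (simp add: f_def square_integrable_diff square_integrable_rep)
    also have "\<dots> \<le> ennreal (sqrt pi * (1/2) ^ k)"
      using K[OF rK[of k "Suc k"] rK[of k k]] by (intro ennreal_leI mult_left_mono) auto
    finally show ?thesis .
  qed
  have "(\<integral>\<^sup>+x. (\<Sum>k. ennreal (norm (f (Suc k) x - f k x))) \<partial>omega_measure) =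
      (\<Sum>k. \<integral>\<^sup>+x. ennreal (norm (f (Suc k) x - f k x)) \<partial>omega_measure)"
    by (rule nn_integral_suminf) measurable
  also have "\<dots> \<le> (\<Sum>k. ennreal (sqrt pi * (1/2) ^ k))"
    by (intro suminf_le inc) auto
  also have "\<dots> = ennreal (\<Sum>k. sqrt pi * (1/2) ^ k)"
    by (rule suminf_ennreal2) (auto intro!: summable_mult)
  finally have "(\<integral>\<^sup>+x. (\<Sum>k. ennreal (norm (f (Suc k) x - f k x))) \<partial>omega_measure) \<noteq> \<infinity>"
    by (auto simp: top_unique)
  then have "AE x in omega_measure. (\<Sum>k. ennreal (norm (f (Suc k) x - f k x))) \<noteq> \<infinity>"
    by (intro nn_integral_PInf_AE) measurable
  then have "AE x in omega_measure. convergent (\<lambda>k. f k x)"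
  proof (rule eventually_mono)
    fix x assume "(\<Sum>k. ennreal (norm (f (Suc k) x - f k x))) \<noteq> \<infinity>"
    then have "summable (\<lambda>k. norm (f (Suc k) x - f k x))"
      by (intro summable_suminf_not_top) auto
    then have "summable (\<lambda>k. f (Suc k) x - f k x)" by (rule summable_norm_cancel)
    then have "convergent (\<lambda>n. \<Sum>k<n. f (Suc k) x - f k x)" by (simp add: summable_iff_convergent)
    then have "convergent (\<lambda>n. f n x - f 0 x)" by (simp only: sum_lessThan_telescope[where f = "\<lambda>k. f k x"])
    then have "convergent (\<lambda>n. (f n x - f 0 x) + f 0 x)" by (intro convergent_add convergent_const)
    then show "convergent (\<lambda>k. f k x)" by simp
  qed
  then have lim: "AE x in omega_measure. (\<lambda>k. rep_hsp (X (r k)) x) \<longlonglongrightarrow> lim (\<lambda>k. f k x)"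
    by (simp add: f_def convergent_LIMSEQ_iff)
  have meas: "(\<lambda>x. lim (\<lambda>k. f k x)) \<in> borel_measurable omega_measure"
    by (rule borel_measurable_lim_metric) measurable
  define Y where "Y = abs_hsp (\<lambda>x. lim (\<lambda>k. f k x))"
  have "X \<longlonglongrightarrow> Y"
  proof (rule metric_LIMSEQ_I)
    fix e :: real assume "e > 0"
    then obtain k where k: "(1/2) ^ k < e" using real_arch_pow_inv[of e "1/2"] by auto
    have "norm (Y - X n) \<le> (1/2) ^ k" if n: "n \<ge> K k" for n
      unfolding Y_def
    proof (rule hsp_fatou(2)[OF lim meas, where K = k])
      show "norm (X (r m) - X n) \<le> (1/2) ^ k" if "m \<ge> k" for m
        using K[OF rK[OF that] n] by simp
    qed simp
    then have "\<forall>n\<ge>K k. dist (X n) Y < e" using k by (metis dist_commute dist_norm le_less_trans)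
    then show "\<exists>no. \<forall>n\<ge>no. dist (X n) Y < e" by blast
  qed
  then show "convergent X" by (auto simp: convergent_def)
qed

section \<open>Traces\<close>

lemma sin_ge_half:
  assumes "0 \<le> x" "x \<le> pi / 2"
  shows "x / 2 \<le> sin x"
proof -
  have "0 \<le> sin (x/2) - (x/2) * cos (x/2)"
  proof -
    define g :: "real \<Rightarrow> real" where "g = (\<lambda>y. sin y - y * cos y)"
    have "g 0 \<le> g (x/2)"
    proof (rule DERIV_nonneg_imp_nondecreasing[where f = g])
      fix y assume y: "0 \<le> y" "y \<le> x/2"
      have "(g has_real_derivative y * sin y) (at y)"
        unfolding g_def by (auto intro!: derivative_eq_intros)
      moreover have "0 \<le> y * sin y" using y assms by (intro mult_nonneg_nonneg sin_ge_zero) auto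
      ultimately show "\<exists>z. (g has_real_derivative z) (at y) \<and> 0 \<le> z" by blast
    qed (use assms in auto)
    then show ?thesis by (simp add: g_def)
  qed
  then have "(x/2) * cos (x/2) * (2 * cos (x/2)) \<le> sin (x/2) * (2 * cos (x/2))"
    by (intro mult_right_mono) (use assms in \<open>auto intro!: cos_ge_zero\<close>)
  also have "\<dots> = sin x" using sin_double[of "x/2"] by simp
  also have "(x/2) * cos (x/2) * (2 * cos (x/2)) = (x/2) * (1 + cos x)"
    using cos_double_cos[of "x/2"] by (simp add: power2_eq_square algebra_simps)
  finally have "(x/2) * (1 + cos x) \<le> sin x" .
  moreover have "(x/2) * 1 \<le> (x/2) * (1 + cos x)"
    by (intro mult_left_mono) (use assms in \<open>auto intro!: cos_ge_zero\<close>)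
  ultimately show ?thesis by linarith
qed

text \<open>The sine is at least half the distance to the nearer endpoint, so \<open>1 / \<omega>\<close> has two inverse square root
  singularities at most.\<close>

lemma inverse_omega_integrable: "integrable (lebesgue_on {0<..<pi}) (\<lambda>x. 1 / omega x)"
proof -
  let ?F = "\<lambda>x. 2 * sqrt x - 2 * sqrt (pi - x)"
  let ?f = "\<lambda>x. 1 / sqrt x + 1 / sqrt (pi - x)"
  have "(?f has_integral (?F pi - ?F 0)) {0..pi}"
  proof (rule fundamental_theorem_of_calculus_interior)
    show "(?F has_vector_derivative ?f x) (at x)" if "x \<in> {0<..<pi}" for x
      using that unfolding has_real_derivative_iff_has_vector_derivative[symmetric]
      by (auto intro!: derivative_eq_intros simp: divide_simps)
  qed (auto intro!: continuous_intros)
  then have "?f integrable_on {0..pi}" by blast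
  then have "?f absolutely_integrable_on {0..pi}"
    by (rule nonnegative_absolutely_integrable_1) auto
  then have "?f absolutely_integrable_on {0<..<pi}"
    by (simp add: absolutely_integrable_on_def integrable_on_open_interval_real)
  then have f: "integrable (lebesgue_on {0<..<pi}) ?f"
    by (simp add: set_integrable_def integrable_restrict_space)
  have le: "1 / omega x \<le> sqrt 2 * ?f x" if x: "0 < x" "x < pi" for x
  proof -
    have aux: "1 / omega x \<le> sqrt 2 / sqrt y" if "0 < y" "y / 2 \<le> sin x" for y
    proof -
      have "sqrt (y / 2) \<le> omega x" unfolding omega_def using that by simp
      then have "1 / omega x \<le> 1 / sqrt (y / 2)" using that by (intro divide_left_mono) (auto intro!: mult_pos_pos simp: omega_pos x)
      then show ?thesis by (simp add: real_sqrt_divide)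
    qed
    show ?thesis
    proof (cases "x \<le> pi / 2")
      case True
      have "1 / omega x \<le> sqrt 2 / sqrt x" by (rule aux) (use x True sin_ge_half[of x] in auto)
      also have "\<dots> \<le> sqrt 2 * ?f x" using x by (simp add: distrib_left)
      finally show ?thesis .
    next
      case False
      have "1 / omega x \<le> sqrt 2 / sqrt (pi - x)"
        by (rule aux) (use x False sin_ge_half[of "pi - x"] in auto)
      also have "\<dots> \<le> sqrt 2 * ?f x" using x by (simp add: distrib_left)
      finally show ?thesis .
    qed
  qed
  show ?thesis
  proof (rule Bochner_Integration.integrable_bound[OF integrable_mult_right[OF f, of "sqrt 2"]])
    show "AE x in lebesgue_on {0<..<pi}. norm (1 / omega x) \<le> norm (sqrt 2 * ?f x)"
    proof (rule AE_I2)
      fix x assume "x \<in> space (lebesgue_on {0<..<pi})"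
      then have x: "0 < x" "x < pi" by auto
      then have "0 \<le> ?f x" by simp
      then show "norm (1 / omega x) \<le> norm (sqrt 2 * ?f x)"
        using le[OF x] omega_pos[of x] x by (simp add: abs_mult)
    qed
  qed measurable
qed

lemma rep_hsp_measurable [measurable]: "rep_hsp f \<in> borel_measurable (lebesgue_on {0<..<pi})"
  using square_integrable_rep[of f] by (simp add: square_integrable_def borel_measurable_omega_eq)

lemma rep_hsp_integrable: "integrable (lebesgue_on {0<..<pi}) (rep_hsp f)"
proof -
  have "integrable (lebesgue_on {0<..<pi}) (\<lambda>x. omega x *\<^sub>R (norm (rep_hsp f x))\<^sup>2)"
    using square_integrable_rep[of f] unfolding square_integrable_def
    by (subst (asm) integrable_omega) auto
  from Bochner_Integration.integrable_add[OF this inverse_omega_integrable]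
  show ?thesis
  proof (rule Bochner_Integration.integrable_bound)
    show "AE x in lebesgue_on {0<..<pi}. norm (rep_hsp f x) \<le> norm (omega x *\<^sub>R (norm (rep_hsp f x))\<^sup>2 + 1 / omega x)"
    proof (rule AE_I2)
      fix x assume "x \<in> space (lebesgue_on {0<..<pi})"
      then have w: "omega x > 0" by (simp add: omega_pos)
      let ?a = "norm (rep_hsp f x)"
      have "2 * (omega x * ?a) * 1 \<le> (omega x * ?a)\<^sup>2 + 1\<^sup>2" by (rule sum_squares_bound)
      moreover have "0 \<le> omega x * ?a" using w by simp
      ultimately have "omega x * ?a \<le> (omega x * ?a)\<^sup>2 + 1" by simp
      also have "\<dots> = omega x * (omega x * ?a\<^sup>2 + 1 / omega x)"
        using w by (simp add: power2_eq_square distrib_left mult_ac)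
      finally have "omega x * ?a \<le> omega x * (omega x * ?a\<^sup>2 + 1 / omega x)" .
      then show "norm (rep_hsp f x) \<le> norm (omega x *\<^sub>R ?a\<^sup>2 + 1 / omega x)"
        using w by (auto simp: mult_le_cancel_left_pos intro: order_trans)
    qed
  qed measurable
qed

lemma AE_interval_dense:
  fixes x :: real
  assumes P: "AE t in lebesgue_on {a<..<b}. P t" and ab: "a < b" and x: "x \<in> {a..b}"
  shows "\<exists>X. (\<forall>n. X n \<in> {a<..<b} \<and> P (X n)) \<and> X \<longlonglongrightarrow> x"
proof -
  have "\<exists>y. y \<in> {a<..<b} \<and> P y \<and> \<bar>y - x\<bar> < r" if r: "r > 0" for r
  proof (rule ccontr)
    assume no: "\<not> ?thesis"
    define l u where "l = max a (x - r)" and "u = min b (x + r)"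
    have lu: "l < u" using r x ab by (auto simp: l_def u_def)
    have "AE t in lebesgue. t \<in> {a<..<b} \<longrightarrow> P t" using P by (simp add: AE_restrict_space_iff)
    then have "AE t in lebesgue. t \<notin> {l<..<u}"
    proof (rule eventually_mono)
      fix t assume Pt: "t \<in> {a<..<b} \<longrightarrow> P t"
      show "t \<notin> {l<..<u}"
      proof
        assume "t \<in> {l<..<u}"
        then have "t \<in> {a<..<b}" "\<bar>t - x\<bar> < r" by (auto simp: l_def u_def)
        then show False using Pt no by blast
      qed
    qed
    then have "{l<..<u} \<in> null_sets lebesgue" by (rule iffD2[OF AE_iff_null_sets, rotated]) simp
    then have "emeasure lebesgue {l<..<u} = 0" by blast
    then show False using lu by simp
  qed
  then have "\<exists>y. y \<in> {a<..<b} \<and> P y \<and> \<bar>y - x\<bar> < inverse (Suc n)" for n by simp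
  then obtain X where X: "\<And>n. X n \<in> {a<..<b} \<and> P (X n) \<and> \<bar>X n - x\<bar> < inverse (Suc n)" by metis
  have "(\<lambda>n. X n - x) \<longlonglongrightarrow> 0"
    by (rule tendsto_rabs_zero_cancel, rule tendsto_sandwich[OF _ _ tendsto_const LIMSEQ_inverse_real_of_nat])
       (use X in \<open>auto intro!: always_eventually simp: less_imp_le\<close>)
  then have "X \<longlonglongrightarrow> x" by (simp add: LIM_zero_iff)
  then show ?thesis using X by blast
qed

lemma continuous_AE_eq_imp_eq:
  fixes f g :: "real \<Rightarrow> 'a::t2_space"
  assumes "AE t in lebesgue_on {a<..<b}. f t = g t" "a < b" "continuous_on {a..b} f" "continuous_on {a..b} g"
    and x: "x \<in> {a..b}"
  shows "f x = g x"
proof -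
  obtain X where X: "\<And>n. X n \<in> {a<..<b} \<and> f (X n) = g (X n)" "X \<longlonglongrightarrow> x"
    using AE_interval_dense[OF assms(1,2) x] by blast
  have eig_v: "\<forall>\<^sub>F n in sequentially. X n \<in> {a..b}" using X(1) by (auto intro!: always_eventually less_imp_le)
  have "(\<lambda>n. f (X n)) \<longlonglongrightarrow> f x"
    by (rule continuous_on_tendsto_compose[OF assms(3) X(2) x eig_v])
  moreover have "(\<lambda>n. g (X n)) \<longlonglongrightarrow> g x"
    by (rule continuous_on_tendsto_compose[OF assms(4) X(2) x eig_v])
  moreover have "(\<lambda>n. f (X n)) = (\<lambda>n. g (X n))" using X(1) by auto
  ultimately show ?thesis using LIMSEQ_unique by metis
qed

lemma vsp_indefinite_integral:
  "\<exists>c. AE x in lebesgue_on {0<..<pi}. rep_hsp (vincl v) x = c + integral {0..x} (rep_hsp (vderiv v))"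
  by (rule weak_derivative_imp_indefinite_integral[OF pi_gt_zero rep_hsp_integrable rep_hsp_integrable])
     (use weak_deriv_vderiv[of v] in \<open>simp add: weak_deriv_def\<close>)

text \<open>The primitive of the weak derivative is a continuous representative, so the choice in \<open>vrepr\<close> is
  not void.\<close>

lemma vrepr_props:
  "continuous_on {0..pi} (vrepr v)" "AE x in lebesgue_on {0<..<pi}. rep_hsp (vincl v) x = vrepr v x"
proof -
  obtain c where "AE x in lebesgue_on {0<..<pi}. rep_hsp (vincl v) x = c + integral {0..x} (rep_hsp (vderiv v))"
    using vsp_indefinite_integral by blast
  moreover have "continuous_on {0..pi} (\<lambda>x. c + integral {0..x} (rep_hsp (vderiv v)))"
    by (intro continuous_intros indefinite_integral_continuous rep_hsp_integrable)
  ultimately have "\<exists>h. continuous_on {0..pi} h \<and> (AE x in omega_measure. rep_hsp (vincl v) x = h x)"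
    unfolding AE_omega_measure by blast
  then have "continuous_on {0..pi} (vrepr v) \<and> (AE x in omega_measure. rep_hsp (vincl v) x = vrepr v x)"
    unfolding vrepr_def by (rule someI_ex)
  then show "continuous_on {0..pi} (vrepr v)"
    "AE x in lebesgue_on {0<..<pi}. rep_hsp (vincl v) x = vrepr v x"
    by (simp_all add: AE_omega_measure)
qed

lemma vrepr_unique:
  assumes "continuous_on {0..pi} h" "AE x in lebesgue_on {0<..<pi}. rep_hsp (vincl v) x = h x" "x \<in> {0..pi}"
  shows "vrepr v x = h x"
  by (rule continuous_AE_eq_imp_eq[OF _ pi_gt_zero vrepr_props(1) assms(1,3)])
     (use vrepr_props(2)[of v] assms(2) in eventually_elim, simp)

lemma vrepr_eq:
  assumes "x \<in> {0..pi}"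
  shows "vrepr v x = vrepr v 0 + integral {0..x} (rep_hsp (vderiv v))"
proof -
  obtain c where c: "AE x in lebesgue_on {0<..<pi}. rep_hsp (vincl v) x = c + integral {0..x} (rep_hsp (vderiv v))"
    using vsp_indefinite_integral by blast
  have "continuous_on {0..pi} (\<lambda>x. c + integral {0..x} (rep_hsp (vderiv v)))"
    by (intro continuous_intros indefinite_integral_continuous rep_hsp_integrable)
  from vrepr_unique[OF this c] have "vrepr v x = c + integral {0..x} (rep_hsp (vderiv v))" if "x \<in> {0..pi}" for x
    using that by blast
  from this[of 0] this[OF assms] show ?thesis by simp
qed

lemma vincl_simps [simp]:
  "vincl (f + g) = vincl f + vincl g" "vderiv (f + g) = vderiv f + vderiv g"
  "vincl (vscaleC z f) = hscaleC z (vincl f)" "vderiv (vscaleC z f) = hscaleC z (vderiv f)"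
  "vincl 0 = 0" "vderiv 0 = 0"
  unfolding plus_vsp_def zero_vsp_def vscaleC_def
  by (simp_all add: Abs_vsp_simps weak_deriv_add weak_deriv_scaleC weak_deriv_0 weak_deriv_vderiv)

lemma vincl_simps' [simp]:
  "vincl (r *\<^sub>R f) = r *\<^sub>R vincl f" "vderiv (r *\<^sub>R f) = r *\<^sub>R vderiv f"
  "vincl (- f) = - vincl f" "vderiv (- f) = - vderiv f"
  "vincl (f - g) = vincl f - vincl g" "vderiv (f - g) = vderiv f - vderiv g"
  by (simp_all add: scaleR_vsp_def scaleR_hsp_def uminus_vsp_def uminus_hsp_def minus_vsp_def minus_hsp_def)

lemma norm_vsp: "(norm v)\<^sup>2 = 4 * (norm (vderiv v))\<^sup>2 + (norm (vincl v))\<^sup>2"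
  unfolding power2_norm_eq_inner by (simp add: inner_vsp_def a0_def inner_hsp_def)

lemma norm_vincl_le: "norm (vincl v) \<le> norm v"
  by (rule power2_le_imp_le) (simp_all add: norm_vsp)

lemma norm_vderiv_le: "norm (vderiv v) \<le> norm v"
  by (rule power2_le_imp_le) (simp_all add: norm_vsp)

lemma vrepr_add: "x \<in> {0..pi} \<Longrightarrow> vrepr (u + v) x = vrepr u x + vrepr v x"
  by (rule vrepr_unique)
     (use AE_rep_plus[of "vincl u" "vincl v"] vrepr_props(2)[of u] vrepr_props(2)[of v] in
       \<open>auto intro!: continuous_intros vrepr_props(1)\<close>)

lemma vrepr_scaleC: "x \<in> {0..pi} \<Longrightarrow> vrepr (vscaleC z v) x = z * vrepr v x"
  by (rule vrepr_unique)
     (use AE_rep_scaleC[of z "vincl v"] vrepr_props(2)[of v] in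
       \<open>auto intro!: continuous_intros vrepr_props(1)\<close>)

lemma vrepr_diff: "x \<in> {0..pi} \<Longrightarrow> vrepr (u - v) x = vrepr u x - vrepr v x"
  by (simp add: minus_vsp_def uminus_vsp_def vrepr_add vrepr_scaleC)

text \<open>For a continuous \<open>k\<close> the class of \<open>k / \<omega>\<close> lies in the weighted space, and pairing with it is
  unweighted integration against \<open>k\<close>.\<close>

definition over_omega :: "(real \<Rightarrow> real) \<Rightarrow> hsp" where
  "over_omega k = abs_hsp (\<lambda>x. of_real (k x / omega x))"

lemma
  assumes k: "continuous_on {0..pi} k"
  shows square_integrable_over_omega: "square_integrable (\<lambda>x. of_real (k x / omega x))"
    and integrable_over_omega: "integrable (lebesgue_on {0<..<pi}) (\<lambda>x. (k x)\<^sup>2 / omega x)"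
proof -
  have [measurable]: "k \<in> borel_measurable (lebesgue_on {0<..<pi})"
    by (rule continuous_measurable_lebesgue_on_interval[OF k])
  obtain B where B: "\<And>x. x \<in> {0..pi} \<Longrightarrow> norm (k x) \<le> B"
    using continuous_on_interval_bounded[OF k] by blast
  show i: "integrable (lebesgue_on {0<..<pi}) (\<lambda>x. (k x)\<^sup>2 / omega x)"
  proof (rule Bochner_Integration.integrable_bound[OF integrable_mult_right[OF inverse_omega_integrable, of "B\<^sup>2"]])
    show "AE x in lebesgue_on {0<..<pi}. norm ((k x)\<^sup>2 / omega x) \<le> norm (B\<^sup>2 * (1 / omega x))"
    proof (rule AE_I2)
      fix x assume "x \<in> space (lebesgue_on {0<..<pi})"
      then have x: "x \<in> {0..pi}" "omega x > 0" by (auto simp: omega_pos)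
      have "\<bar>k x\<bar>\<^sup>2 \<le> B\<^sup>2" using B[OF x(1)] by (intro power_mono) auto
      then show "norm ((k x)\<^sup>2 / omega x) \<le> norm (B\<^sup>2 * (1 / omega x))" using x by (simp add: divide_right_mono)
    qed
  qed measurable
  have "integrable (lebesgue_on {0<..<pi}) (\<lambda>x. omega x *\<^sub>R (norm (complex_of_real (k x / omega x)))\<^sup>2)"
    using i
    by (rule iffD1[OF Bochner_Integration.integrable_cong[OF refl], rotated])
       (auto simp: norm_divide power_divide power2_eq_square omega_pos)
  then show "square_integrable (\<lambda>x. of_real (k x / omega x))"
    unfolding square_integrable_def borel_measurable_omega_eq
    by (subst integrable_omega) auto
qed

lemma hinner_over_omega:
  assumes k: "continuous_on {0..pi} k"
  shows "hinner f (over_omega k) = (LINT x|lebesgue_on {0<..<pi}. rep_hsp f x * of_real (k x))"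
proof -
  have [measurable]: "k \<in> borel_measurable (lebesgue_on {0<..<pi})"
    by (rule continuous_measurable_lebesgue_on_interval[OF k])
  have "hinner f (over_omega k) = hinner (abs_hsp (rep_hsp f)) (over_omega k)" by simp
  also have "\<dots> = (LINT x|omega_measure. rep_hsp f x * cnj (of_real (k x / omega x)))"
    unfolding over_omega_def
    by (rule hinner_abs[OF square_integrable_rep square_integrable_over_omega[OF k]])
  also have "\<dots> = (LINT x|lebesgue_on {0<..<pi}. omega x *\<^sub>R (rep_hsp f x * cnj (of_real (k x / omega x))))"
    by (rule integral_omega) measurable
  also have "\<dots> = (LINT x|lebesgue_on {0<..<pi}. rep_hsp f x * of_real (k x))"
  proof (rule Bochner_Integration.integral_cong[OF refl])
    fix x assume "x \<in> space (lebesgue_on {0<..<pi})"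
    then have "omega x \<noteq> 0" using omega_pos[of x] by auto
    then show "omega x *\<^sub>R (rep_hsp f x * cnj (of_real (k x / omega x))) = rep_hsp f x * of_real (k x)"
      by (simp add: scaleR_conv_of_real)
  qed
  finally show ?thesis .
qed

lemma norm_over_omega:
  assumes k: "continuous_on {0..pi} k"
  shows "(norm (over_omega k))\<^sup>2 = (LINT x|lebesgue_on {0<..<pi}. (k x)\<^sup>2 / omega x)"
proof -
  have [measurable]: "k \<in> borel_measurable (lebesgue_on {0<..<pi})"
    by (rule continuous_measurable_lebesgue_on_interval[OF k])
  have "(norm (over_omega k))\<^sup>2 = (LINT x|omega_measure. (norm (complex_of_real (k x / omega x)))\<^sup>2)"
    unfolding over_omega_def by (rule norm_abs_hsp[OF square_integrable_over_omega[OF k]])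
  also have "\<dots> = (LINT x|lebesgue_on {0<..<pi}. omega x *\<^sub>R (norm (complex_of_real (k x / omega x)))\<^sup>2)"
    by (rule integral_omega) measurable
  also have "\<dots> = (LINT x|lebesgue_on {0<..<pi}. (k x)\<^sup>2 / omega x)"
    by (rule Bochner_Integration.integral_cong[OF refl])
       (auto simp: norm_divide power_divide power2_eq_square omega_pos)
  finally show ?thesis .
qed

lemma vrepr_by_parts:
  assumes k: "continuous_on {0..pi} k" and k': "continuous_on {0..pi} k'"
    and d: "\<And>x. x \<in> {0<..<pi} \<Longrightarrow> (k has_vector_derivative k' x) (at x)"
  shows "(LINT x|lebesgue_on {0<..<pi}. rep_hsp (vincl v) x * k' x) =
     vrepr v pi * k pi - vrepr v 0 * k 0 - (LINT x|lebesgue_on {0<..<pi}. rep_hsp (vderiv v) x * k x)"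
proof -
  let ?M = "lebesgue_on {0<..<pi}"
  let ?g = "rep_hsp (vderiv v)"
  let ?c = "vrepr v 0"
  interpret M: finite_measure ?M by (rule finite_measure_lebesgue_on) simp
  have one: "integrable ?M (\<lambda>_. 1::complex)" by simp
  have ik': "integrable ?M k'" using continuous_times_integrable[OF one k'] by simp
  have ik: "integrable ?M (\<lambda>x. ?g x * k x)" by (rule continuous_times_integrable[OF rep_hsp_integrable k])
  have iG: "integrable ?M (\<lambda>x. integral {0..x} ?g * k' x)"
    using continuous_times_integrable[OF one continuous_on_mult[OF indefinite_integral_continuous[OF rep_hsp_integrable] k']] by simp
  have "(LINT x|?M. rep_hsp (vincl v) x * k' x) = (LINT x|?M. ?c * k' x + integral {0..x} ?g * k' x)"
  proof (rule integral_cong_AE)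
    show "AE x in ?M. rep_hsp (vincl v) x * k' x = ?c * k' x + integral {0..x} ?g * k' x"
      using vrepr_props(2)[of v] AE_space
    proof eventually_elim
      case (elim x)
      then have "vrepr v x = ?c + integral {0..x} ?g" by (intro vrepr_eq) simp
      then show ?case using elim by (simp only: distrib_right)
    qed
    show "(\<lambda>x. rep_hsp (vincl v) x * k' x) \<in> borel_measurable ?M"
      by (rule borel_measurable_integrable[OF continuous_times_integrable[OF rep_hsp_integrable k']])
    show "(\<lambda>x. ?c * k' x + integral {0..x} ?g * k' x) \<in> borel_measurable ?M"
      using ik' iG by (intro borel_measurable_integrable) auto
  qed
  also have "\<dots> = ?c * integral {0..pi} k' + (LINT s|?M. ?g s * (k pi - k s))"
    using ik' iG integral_by_parts_indefinite[OF rep_hsp_integrable k d k']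
    by (simp add: integrable_lebesgue_on_open_interval(2))
  also have "(k' has_integral (k pi - k 0)) {0..pi}"
    by (rule fundamental_theorem_of_calculus_interior) (use k d in auto)
  then have "integral {0..pi} k' = k pi - k 0" by (rule integral_unique)
  also have "(LINT s|?M. ?g s * (k pi - k s)) = integral {0..pi} ?g * k pi - (LINT s|?M. ?g s * k s)"
    using ik rep_hsp_integrable[of "vderiv v"]
    by (simp add: right_diff_distrib integrable_lebesgue_on_open_interval(2))
  finally show ?thesis using vrepr_eq[of pi v] by (simp add: algebra_simps)
qed

text \<open>Testing against a power \<open>k\<close> that is \<open>1\<close> at one endpoint and \<open>0\<close> at the other writes the endpoint value
  as a pairing of the function with \<open>k' / \<omega>\<close> and of its derivative with \<open>k / \<omega>\<close>. The latter
  tends to \<open>0\<close> with growing exponent, as \<open>1 / \<omega>\<close> is integrable; so the trace is small relative to the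
  derivative.\<close>

lemma trace_bound_aux:
  fixes q :: "real \<Rightarrow> real"
  assumes q: "q = (\<lambda>x. x / pi) \<or> q = (\<lambda>x. 1 - x / pi)" and e: "e = (if q 0 = 0 then pi else 0)" and eps: "\<epsilon> > 0"
  shows "\<exists>C\<ge>0. \<forall>v. norm (vrepr v e) \<le> C * norm (vincl v) + \<epsilon> * norm (vderiv v)"
proof -
  let ?M = "lebesgue_on {0<..<pi}"
  define q' where "q' = (if q 0 = 0 then 1 / pi else - (1 / pi))"
  have qd: "(q has_real_derivative q') (at x)" for x
    using q by (auto simp: q'_def intro!: derivative_eq_intros)
  have qc: "continuous_on A q" for A using q by (auto intro!: continuous_intros)
  have q01: "0 < q x" "q x < 1" if "x \<in> {0<..<pi}" for x using q that by (auto simp: field_simps)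
  have lim: "(\<lambda>n. LINT x|?M. (q x ^ n)\<^sup>2 / omega x) \<longlonglongrightarrow> (LINT x|?M. 0)"
  proof (rule integral_dominated_convergence[OF _ _ inverse_omega_integrable])
    show "AE x in ?M. (\<lambda>n. (q x ^ n)\<^sup>2 / omega x) \<longlonglongrightarrow> 0"
    proof (rule AE_I2)
      fix x assume "x \<in> space ?M"
      then have "(\<lambda>n. q x ^ n) \<longlonglongrightarrow> 0" using q01[of x] by (intro LIMSEQ_realpow_zero) auto
      from tendsto_mult[OF this this] have "(\<lambda>n. (q x ^ n)\<^sup>2) \<longlonglongrightarrow> 0" by (simp add: power2_eq_square)
      from tendsto_mult[OF this tendsto_const[of "inverse (omega x)"]]
      show "(\<lambda>n. (q x ^ n)\<^sup>2 / omega x) \<longlonglongrightarrow> 0" by (simp add: divide_inverse)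
    qed
    show "AE x in ?M. norm ((q x ^ n)\<^sup>2 / omega x) \<le> 1 / omega x" for n
    proof (rule AE_I2)
      fix x assume x: "x \<in> space ?M"
      then have "q x ^ n \<le> 1" using q01[of x] by (intro power_le_one) auto
      then have "(q x ^ n)\<^sup>2 \<le> 1" using q01[of x] x by (intro power_le_one) auto
      then show "norm ((q x ^ n)\<^sup>2 / omega x) \<le> 1 / omega x"
        using omega_pos[of x] x by (simp add: divide_right_mono)
    qed
    show "(\<lambda>x. (q x ^ n)\<^sup>2 / omega x) \<in> borel_measurable ?M" for n
      by (intro borel_measurable_integrable integrable_over_omega continuous_intros qc)
  qed simp_all
  then obtain n0 where "\<And>n. n \<ge> n0 \<Longrightarrow> norm (LINT x|?M. (q x ^ n)\<^sup>2 / omega x) < \<epsilon>\<^sup>2"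
    using LIMSEQ_D[of _ 0 "\<epsilon>\<^sup>2"] eps by fastforce
  from this[of "Suc n0"] have small: "(LINT x|?M. (q x ^ Suc n0)\<^sup>2 / omega x) < \<epsilon>\<^sup>2" by simp
  define k where "k x = q x ^ Suc n0" for x
  define k' where "k' x = real (Suc n0) * q x ^ n0 * q'" for x
  have kc: "continuous_on A k" "continuous_on A k'" for A
    unfolding k_def k'_def by (intro continuous_intros qc)+
  have dk: "(k has_real_derivative k' x) (at x)" for x
    unfolding k_def k'_def using DERIV_power_Suc[OF qd, of n0 x] by (simp only: of_nat_Suc mult_ac add_ac)
  have "(norm (over_omega k))\<^sup>2 < \<epsilon>\<^sup>2" using small norm_over_omega[OF kc(1)] by (simp add: k_def)
  then have nk: "norm (over_omega k) \<le> \<epsilon>" using eps by (meson less_imp_le power2_le_imp_le)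
  show ?thesis
  proof (intro exI[of _ "norm (over_omega k')"] conjI allI norm_ge_zero)
    fix v
    have "(LINT x|?M. rep_hsp (vincl v) x * of_real (k' x)) =
       vrepr v pi * of_real (k pi) - vrepr v 0 * of_real (k 0) - (LINT x|?M. rep_hsp (vderiv v) x * of_real (k x))"
    proof (rule vrepr_by_parts)
      show "((\<lambda>x. complex_of_real (k x)) has_vector_derivative of_real (k' x)) (at x)" for x
        by (intro has_vector_derivative_of_real) (simp add: dk flip: has_real_derivative_iff_has_vector_derivative)
    qed (intro continuous_intros kc)+
    then have "hinner (vincl v) (over_omega k') + hinner (vderiv v) (over_omega k) =
        vrepr v pi * of_real (k pi) - vrepr v 0 * of_real (k 0)"
      by (simp add: hinner_over_omega kc)
    moreover have "norm (vrepr v pi * of_real (k pi) - vrepr v 0 * of_real (k 0)) = norm (vrepr v e)"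
      using q by (auto simp: k_def e)
    ultimately have "norm (vrepr v e) \<le> norm (hinner (vincl v) (over_omega k')) + norm (hinner (vderiv v) (over_omega k))"
      by (metis norm_triangle_ineq)
    also have "\<dots> \<le> norm (vincl v) * norm (over_omega k') + norm (vderiv v) * norm (over_omega k)"
      by (intro add_mono norm_hinner_le)
    also have "\<dots> \<le> norm (vincl v) * norm (over_omega k') + norm (vderiv v) * \<epsilon>"
      by (intro add_left_mono mult_left_mono nk) auto
    finally show "norm (vrepr v e) \<le> norm (over_omega k') * norm (vincl v) + \<epsilon> * norm (vderiv v)"
      by (simp add: mult.commute)
  qed
qed

lemma trace_bound:
  assumes "e = 0 \<or> e = pi" "\<epsilon> > 0"
  shows "\<exists>C\<ge>0. \<forall>v. norm (vrepr v e) \<le> C * norm (vincl v) + \<epsilon> * norm (vderiv v)"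
  using trace_bound_aux[OF disjI1[OF refl], of pi \<epsilon>] trace_bound_aux[OF disjI2[OF refl], of 0 \<epsilon>] assms by auto

section \<open>Gegenbayer polynomials\<close>

definition sfun :: "real \<Rightarrow> real" where "sfun x = (1 - cos x) / 2"

definition polyfun :: "complex poly \<Rightarrow> real \<Rightarrow> complex" where "polyfun P x = poly P (of_real (sfun x))"

definition hpoly :: "complex poly \<Rightarrow> hsp" where "hpoly P = abs_hsp (polyfun P)"

definition dpoly :: "complex poly \<Rightarrow> hsp" where
  "dpoly P = abs_hsp (\<lambda>x. polyfun (pderiv P) x * of_real (sin x / 2))"

definition vpoly :: "complex poly \<Rightarrow> vsp" where "vpoly P = Abs_vsp (hpoly P, dpoly P)"

lemma sfun_simps [simp]: "sfun 0 = 0" "sfun pi = 1"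
  by (simp_all add: sfun_def)

lemma sfun_bounds: "0 \<le> sfun x" "sfun x \<le> 1"
  using cos_le_one[of x] cos_ge_minus_one[of x] by (auto simp: sfun_def)

lemma continuous_polyfun [continuous_intros]: "continuous_on A (polyfun P)"
  unfolding polyfun_def sfun_def by (intro continuous_intros) simp_all

lemma polyfun_deriv: "(polyfun P has_vector_derivative polyfun (pderiv P) x * of_real (sin x / 2)) (at x)"
proof -
  have "((\<lambda>x. complex_of_real (sfun x)) has_vector_derivative of_real (sin x / 2)) (at x)"
    unfolding sfun_def
    by (intro has_vector_derivative_of_real)
       (auto intro!: derivative_eq_intros simp flip: has_real_derivative_iff_has_vector_derivative)
  from field_vector_diff_chain_at[OF this poly_DERIV[of P]]
  show ?thesis by (simp add: polyfun_def[abs_def] o_def mult.commute)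
qed

lemma square_integrable_continuous:
  assumes "continuous_on {0..pi} f"
  shows "square_integrable f"
proof -
  have [measurable]: "f \<in> borel_measurable omega_measure"
    unfolding borel_measurable_omega_eq by (rule continuous_measurable_lebesgue_on_interval[OF assms])
  obtain B where B: "\<And>x. x \<in> {0..pi} \<Longrightarrow> norm (f x) \<le> B"
    using continuous_on_interval_bounded[OF assms] by blast
  have "integrable omega_measure (\<lambda>x. (norm (f x))\<^sup>2)"
    by (rule omega.integrable_const_bound[of _ "B\<^sup>2"]) (auto intro!: AE_I2 power_mono B)
  then show ?thesis by (simp add: square_integrable_def)
qed

lemma square_integrable_polyfun: "square_integrable (polyfun P)"
  by (intro square_integrable_continuous continuous_intros)

lemma square_integrable_dpoly: "square_integrable (\<lambda>x. polyfun P x * of_real (sin x / 2))"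
  by (intro square_integrable_continuous continuous_intros) simp

lemma hpoly_add: "hpoly (P + Q) = hpoly P + hpoly Q"
  unfolding hpoly_def abs_hsp_add[OF square_integrable_polyfun square_integrable_polyfun]
  by (simp add: polyfun_def[abs_def])

lemma hpoly_smult: "hpoly (smult z P) = hscaleC z (hpoly P)"
  unfolding hpoly_def abs_hsp_scaleC[OF square_integrable_polyfun]
  by (simp add: polyfun_def[abs_def])

lemma AE_rep_hpoly: "AE x in lebesgue_on {0<..<pi}. rep_hsp (hpoly P) x = polyfun P x"
  unfolding hpoly_def by (rule AE_rep_abs[OF square_integrable_polyfun])

lemma weak_deriv_poly: "weak_deriv (hpoly P) (dpoly P)"
  unfolding weak_deriv_def
proof (intro allI impI)
  fix \<eta> :: "real \<Rightarrow> real" assume \<eta>: "\<eta> \<in> Cc_smooth {0<..<pi}"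
  let ?M = "lebesgue_on {0<..<pi}"
  let ?D = "\<lambda>x. polyfun (pderiv P) x * of_real (sin x / 2)"
  interpret M: finite_measure ?M by (rule finite_measure_lebesgue_on) simp
  have one: "integrable ?M (\<lambda>_. 1::complex)" by simp
  have c: "continuous_on {0..pi} (\<lambda>x. polyfun P x * of_real (deriv \<eta> x))" "continuous_on {0..pi} (\<lambda>x. ?D x * of_real (\<eta> x))"
    by (intro continuous_intros Cc_smooth_continuous[OF \<eta>] Cc_smooth_continuous[OF Cc_smooth_deriv[OF \<eta>]]; simp)+
  have i: "integrable ?M (\<lambda>x. polyfun P x * of_real (deriv \<eta> x))" "integrable ?M (\<lambda>x. ?D x * of_real (\<eta> x))"
    using continuous_times_integrable[OF one c(1)] continuous_times_integrable[OF one c(2)] by simp_all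
  have "((\<lambda>x. polyfun P x * of_real (\<eta> x)) has_vector_derivative
      (polyfun P x * of_real (deriv \<eta> x) + ?D x * of_real (\<eta> x))) (at x)" for x
  proof -
    have "((\<lambda>x. complex_of_real (\<eta> x)) has_vector_derivative of_real (deriv \<eta> x)) (at x)"
      by (intro has_vector_derivative_of_real)
         (simp add: Cc_smooth_DERIV[OF \<eta>] flip: has_real_derivative_iff_has_vector_derivative)
    from has_vector_derivative_mult[OF polyfun_deriv this] show ?thesis .
  qed
  then have "((\<lambda>x. polyfun P x * of_real (deriv \<eta> x) + ?D x * of_real (\<eta> x)) has_integral
      (polyfun P pi * of_real (\<eta> pi) - polyfun P 0 * of_real (\<eta> 0))) {0..pi}"
    by (intro fundamental_theorem_of_calculus) (auto intro: has_vector_derivative_at_within)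
  moreover have "\<eta> 0 = 0" "\<eta> pi = 0" using \<eta> by (auto simp: Cc_smooth_def)
  ultimately have "integral {0..pi} (\<lambda>x. polyfun P x * of_real (deriv \<eta> x) + ?D x * of_real (\<eta> x)) = 0"
    by (simp add: integral_unique)
  then have "(LINT x|?M. polyfun P x * of_real (deriv \<eta> x) + ?D x * of_real (\<eta> x)) = 0"
    using i by (subst integrable_lebesgue_on_open_interval(2)) auto
  then have "(LINT x|?M. polyfun P x * of_real (deriv \<eta> x)) = - (LINT x|?M. ?D x * of_real (\<eta> x))"
    using i by (simp add: eq_neg_iff_add_eq_0)
  moreover have "(LINT x|?M. rep_hsp (hpoly P) x * of_real (deriv \<eta> x)) = (LINT x|?M. polyfun P x * of_real (deriv \<eta> x))"
    using i AE_rep_hpoly[of P] Cc_smooth_continuous[OF Cc_smooth_deriv[OF \<eta>], of "{0..pi}"]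
    by (intro integral_cong_AE) (auto intro!: borel_measurable_integrable[OF continuous_times_integrable[OF rep_hsp_integrable]] continuous_intros)
  moreover have "(LINT x|?M. rep_hsp (dpoly P) x * of_real (\<eta> x)) = (LINT x|?M. ?D x * of_real (\<eta> x))"
    using i AE_rep_abs[OF square_integrable_dpoly[of "pderiv P"]] Cc_smooth_continuous[OF \<eta>, of "{0..pi}"]
    unfolding dpoly_def
    by (intro integral_cong_AE) (auto intro!: borel_measurable_integrable[OF continuous_times_integrable[OF rep_hsp_integrable]] continuous_intros)
  ultimately show "(LINT x|?M. rep_hsp (hpoly P) x * of_real (deriv \<eta> x)) = - (LINT x|?M. rep_hsp (dpoly P) x * of_real (\<eta> x))"
    by simp
qed

lemma vincl_vpoly [simp]: "vincl (vpoly P) = hpoly P" and vderiv_vpoly [simp]: "vderiv (vpoly P) = dpoly P"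
  unfolding vpoly_def by (simp_all add: Abs_vsp_simps weak_deriv_poly)

lemma vrepr_vpoly: "x \<in> {0..pi} \<Longrightarrow> vrepr (vpoly P) x = polyfun P x"
  by (rule vrepr_unique) (auto intro: continuous_intros AE_rep_hpoly)

text \<open>On polynomials in \<open>s = (1 - cos \<phi>) / 2\<close> the operator of the form is the hypergeometric operator
  below; the weight \<open>\<omega>\<close> vanishes at the endpoints, hence no boundary terms.\<close>

definition gegenbayer_op :: "complex poly \<Rightarrow> complex poly" where
  "gegenbayer_op P = - (smult 3 ([:1, -2:] * pderiv P) + smult 4 ([:0, 1, -1:] * pderiv (pderiv P)))"

lemma a0_vpoly: "a0 v (vpoly P) = hinner (vincl v) (hpoly (gegenbayer_op P))"
proof -
  let ?M = "lebesgue_on {0<..<pi}"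
  define k where "k x = cnj (of_real (omega x) * (polyfun (pderiv P) x * of_real (sin x / 2)))" for x
  define k' where "k' x = - cnj (of_real (omega x) * polyfun (gegenbayer_op P) x) / 4" for x
  have co: "continuous_on A omega" for A unfolding omega_def by (intro continuous_intros)
  have kc: "continuous_on {0..pi} k" "continuous_on {0..pi} k'"
    unfolding k_def k'_def by (intro continuous_intros co; simp)+
  have d: "(k has_vector_derivative k' x) (at x)" if x: "x \<in> {0<..<pi}" for x
  proof -
    have s: "sin x > 0" using x by (auto intro: sin_gt_zero)
    have w: "omega x * omega x = sin x" "omega x > 0" using s by (auto simp: omega_def)
    have "(omega has_real_derivative cos x / (2 * omega x)) (at x)"
      using s unfolding omega_def by (auto intro!: derivative_eq_intros simp: field_simps)
    then have d1: "((\<lambda>x. complex_of_real (omega x)) has_vector_derivative of_real (cos x / (2 * omega x))) (at x)"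
      by (intro has_vector_derivative_of_real) (simp flip: has_real_derivative_iff_has_vector_derivative)
    have d2: "((\<lambda>x. complex_of_real (sin x / 2)) has_vector_derivative of_real (cos x / 2)) (at x)"
      by (intro has_vector_derivative_of_real)
         (auto intro!: derivative_eq_intros simp flip: has_real_derivative_iff_has_vector_derivative)
    let ?p1 = "polyfun (pderiv P) x" and ?p2 = "polyfun (pderiv (pderiv P)) x"
    let ?s = "complex_of_real (sin x)" and ?c = "complex_of_real (cos x)" and ?w = "complex_of_real (omega x)"
    have "((\<lambda>x. of_real (omega x) * (polyfun (pderiv P) x * of_real (sin x / 2))) has_vector_derivative
       ?w * (?p1 * of_real (cos x / 2) + ?p2 * of_real (sin x / 2) * of_real (sin x / 2)) +
       of_real (cos x / (2 * omega x)) * (?p1 * of_real (sin x / 2))) (at x)" (is "(_ has_vector_derivative ?R) _")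
      by (rule has_vector_derivative_mult[OF d1 has_vector_derivative_mult[OF polyfun_deriv d2]])
    moreover have "?R = - (?w * polyfun (gegenbayer_op P) x) / 4"
    proof -
      have "?w * ?w = ?s" using w by (simp flip: of_real_mult)
      then have r1: "of_real (cos x / (2 * omega x)) * (?p1 * of_real (sin x / 2)) = ?w * (?p1 * ?c) / 4"
        using w by (simp add: field_simps)
      have sc: "?s * ?s = 1 - ?c * ?c"
      proof -
        have "sin x * sin x = 1 - cos x * cos x" by (metis sin_squared_eq power2_eq_square)
        then show ?thesis by (metis of_real_1 of_real_diff of_real_mult)
      qed
      have "?w * ?p2 * (?s / 2) * (?s / 2) = ?w * ?p2 * (?s * ?s) / 4" by simp
      then have r2: "?w * (?p2 * of_real (sin x / 2) * of_real (sin x / 2)) = ?w * ?p2 * (1 - ?c * ?c) / 4"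
        unfolding sc by simp
      have r3: "polyfun (gegenbayer_op P) x = - (3 * ?c * ?p1 + (1 - ?c * ?c) * ?p2)"
        unfolding gegenbayer_op_def polyfun_def sfun_def
        by (simp add: field_simps)
      show ?thesis unfolding distrib_left[of ?w] r1 r2 r3 by (simp add: field_simps)
    qed
    ultimately show ?thesis
      unfolding k_def k'_def using has_vector_derivative_cnj by fastforce
  qed
  have "a0 v (vpoly P) = 4 * hinner (abs_hsp (rep_hsp (vderiv v))) (dpoly P)" by (simp add: a0_def)
  also have "hinner (abs_hsp (rep_hsp (vderiv v))) (dpoly P) =
      (LINT x|omega_measure. rep_hsp (vderiv v) x * cnj (polyfun (pderiv P) x * of_real (sin x / 2)))"
    unfolding dpoly_def by (rule hinner_abs[OF square_integrable_rep square_integrable_dpoly])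
  also have "\<dots> = (LINT x|?M. omega x *\<^sub>R (rep_hsp (vderiv v) x * cnj (polyfun (pderiv P) x * of_real (sin x / 2))))"
  proof (rule integral_omega)
    have "(\<lambda>x. cnj (polyfun (pderiv P) x * of_real (sin x / 2))) \<in> borel_measurable ?M"
      by (rule continuous_measurable_lebesgue_on_interval) (intro continuous_intros, simp)
    then show "(\<lambda>x. rep_hsp (vderiv v) x * cnj (polyfun (pderiv P) x * of_real (sin x / 2))) \<in> borel_measurable ?M"
      by (intro borel_measurable_times rep_hsp_measurable)
  qed
  also have "\<dots> = (LINT x|?M. rep_hsp (vderiv v) x * k x)"
    by (rule Bochner_Integration.integral_cong) (auto simp: k_def scaleR_conv_of_real)
  also have "\<dots> = - (LINT x|?M. rep_hsp (vincl v) x * k' x)"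
    using vrepr_by_parts[OF kc d, of v] by (simp add: k_def)
  also have "(LINT x|?M. rep_hsp (vincl v) x * k' x) =
      (LINT x|?M. (-1/4) * (omega x *\<^sub>R (rep_hsp (vincl v) x * cnj (polyfun (gegenbayer_op P) x))))"
    by (rule Bochner_Integration.integral_cong) (auto simp: k'_def scaleR_conv_of_real)
  also have "\<dots> = (-1/4) * (LINT x|?M. (omega x *\<^sub>R (rep_hsp (vincl v) x * cnj (polyfun (gegenbayer_op P) x))))"
    by (rule integral_mult_right_zero)
  also have "(LINT x|?M. (omega x *\<^sub>R (rep_hsp (vincl v) x * cnj (polyfun (gegenbayer_op P) x)))) =
      (LINT x|omega_measure. rep_hsp (vincl v) x * cnj (polyfun (gegenbayer_op P) x))"
  proof (rule integral_omega[symmetric])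
    have "(\<lambda>x. cnj (polyfun (gegenbayer_op P) x)) \<in> borel_measurable ?M"
      by (rule continuous_measurable_lebesgue_on_interval) (intro continuous_intros)
    then show "(\<lambda>x. rep_hsp (vincl v) x * cnj (polyfun (gegenbayer_op P) x)) \<in> borel_measurable ?M"
      by (intro borel_measurable_times rep_hsp_measurable)
  qed
  also have "\<dots> = hinner (abs_hsp (rep_hsp (vincl v))) (hpoly (gegenbayer_op P))"
    unfolding hpoly_def by (rule hinner_abs[OF square_integrable_rep square_integrable_polyfun, symmetric])
  finally show ?thesis by simp
qed

fun gegen_coeff :: "nat \<Rightarrow> nat \<Rightarrow> real" where
  "gegen_coeff n 0 = 1"
| "gegen_coeff n (Suc k) = gegen_coeff n k * ((real k - real n) * (real k + real n + 1/2)) / ((real k + 1) * (real k + 3/4))"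

text \<open>The polynomial solution \<open>F(-n, n + 1/2; 3/4; s)\<close>, that is, the Gegenbayer polynomial of degree \<open>n\<close> and
  parameter \<open>1/4\<close> in \<open>cos \<phi> = 1 - 2 s\<close>, normalised to be \<open>1\<close> at \<open>\<phi> = 0\<close>.\<close>

definition gegen :: "nat \<Rightarrow> complex poly" where
  "gegen n = (\<Sum>k\<le>n. monom (of_real (gegen_coeff n k)) k)"

definition eigval :: "nat \<Rightarrow> real" where "eigval n = 2 * real n * (2 * real n + 1)"

lemma gegen_coeff_eq_0: "k > n \<Longrightarrow> gegen_coeff n k = 0"
proof (induction k)
  case (Suc k)
  then show ?case by (cases "k = n") auto
qed simp

lemma gegen_coeff_neq_0: "k \<le> n \<Longrightarrow> gegen_coeff n k \<noteq> 0"
proof (induction k)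
  case (Suc k)
  have "real k + real n + 1/2 \<noteq> 0" "real k + 3/4 \<noteq> 0" by linarith+
  then show ?case using Suc by simp
qed simp

lemma coeff_gegen: "coeff (gegen n) k = of_real (gegen_coeff n k)"
  using gegen_coeff_eq_0[of n k] by (auto simp: gegen_def coeff_sum if_distrib cong: if_cong)

lemma degree_gegen: "degree (gegen n) = n"
  by (rule antisym) (auto intro!: degree_le le_degree simp: coeff_gegen gegen_coeff_eq_0 gegen_coeff_neq_0)

lemma poly_gegen_0 [simp]: "poly (gegen n) 0 = 1"
  using coeff_gegen[of n 0] by (simp add: poly_0_coeff_0)

lemma gegenbayer_op_gegen: "gegenbayer_op (gegen n) = smult (of_real (eigval n)) (gegen n)"
proof (rule poly_eqI)
  fix k
  let ?d = "gegen_coeff n"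
  have "(real k + 1) * (real k + 3/4) \<noteq> 0" by (simp add: add_nonneg_eq_0_iff)
  then have "?d (Suc k) * ((real k + 1) * (real k + 3/4)) = ?d k * ((real k - real n) * (real k + real n + 1/2))"
    unfolding gegen_coeff.simps by (rule nonzero_eq_divide_eq[THEN iffD1, OF _ refl])
  moreover have "(real k + 1) * (4 * real k + 3) * ?d (Suc k) = 4 * (?d (Suc k) * ((real k + 1) * (real k + 3/4)))"
    by (simp add: algebra_simps del: gegen_coeff.simps)
  ultimately have "(real k + 1) * (4 * real k + 3) * ?d (Suc k) = 4 * (real k - real n) * (real k + real n + 1/2) * ?d k"
    by (simp only: mult_ac)
  moreover have "- (3 * ((real k + 1) * S - 2 * (real k * D)) + 4 * (real k * ((real k + 1) * S) - (real k - 1) * (real k * D)))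
      = - ((real k + 1) * (4 * real k + 3) * S) + (4 * real k ^ 2 + 2 * real k) * D" for S D
    by (simp add: algebra_simps power2_eq_square)
  ultimately have r: "- (3 * ((real k + 1) * ?d (Suc k) - 2 * (real k * ?d k)) +
     4 * (real k * ((real k + 1) * ?d (Suc k)) - (real k - 1) * (real k * ?d k))) = eigval n * ?d k"
    by (simp add: eigval_def algebra_simps power2_eq_square del: gegen_coeff.simps)
  have "coeff (gegenbayer_op (gegen n)) k = of_real (- (3 * ((real k + 1) * ?d (Suc k) - 2 * (real k * ?d k)) +
     4 * (real k * ((real k + 1) * ?d (Suc k)) - (real k - 1) * (real k * ?d k))))"
  proof (cases k)
    case 0
    then show ?thesis by (simp add: gegenbayer_op_def coeff_pderiv coeff_gegen coeff_pCons)
  next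
    case (Suc j)
    then show ?thesis
      by (cases j) (simp_all add: gegenbayer_op_def coeff_pderiv coeff_gegen coeff_pCons algebra_simps
          del: gegen_coeff.simps)
  qed
  also have "\<dots> = coeff (smult (of_real (eigval n)) (gegen n)) k" unfolding r by (simp add: coeff_gegen)
  finally show "coeff (gegenbayer_op (gegen n)) k = coeff (smult (of_real (eigval n)) (gegen n)) k" .
qed

text \<open>The bound is crude: as the low modes are recovered with an exponential loss anyway, any exponential
  growth in \<open>n\<close> is good enough.\<close>

lemma gegen_coeff_bound: "\<bar>gegen_coeff n k\<bar> \<le> 2 ^ k * real (n choose k) * real ((n + k) choose k)"
proof (cases "k \<le> n")
  case True
  then show ?thesis
  proof (induction k)
    case (Suc k)
    then have kn: "k < n" by simp
    have b1: "real (n choose Suc k) = real (n choose k) * (real n - real k) / (real k + 1)"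
    proof -
      have "Suc k * (n choose Suc k) = (n choose k) * (n - k)"
        using binomial_absorb_comp[of n k] binomial_absorption[of k n] by (simp add: mult.commute)
      then have *: "Suc k * (n choose Suc k) = (n choose k) * (n - k)" .
      have "(real k + 1) * real (n choose Suc k) = real (n choose k) * (real n - real k)"
      proof -
        have "real (Suc k * (n choose Suc k)) = real ((n choose k) * (n - k))"
          by (simp only: *)
        then show ?thesis unfolding of_nat_mult using kn by (simp add: of_nat_diff algebra_simps del: binomial_Suc_Suc)
      qed
      then show ?thesis by (simp add: field_simps)
    qed
    have b2: "real ((n + Suc k) choose Suc k) = real ((n + k) choose k) * (real n + real k + 1) / (real k + 1)"
    proof -
      have "Suc k * (Suc (n + k) choose Suc k) = Suc (n + k) * ((n + k) choose k)"
        using Suc_times_binomial[of k "n + k"] by simp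
      then have *: "Suc k * (Suc (n + k) choose Suc k) = Suc (n + k) * ((n + k) choose k)" .
      have "(real k + 1) * real ((n + Suc k) choose Suc k) = (real n + real k + 1) * real ((n + k) choose k)"
      proof -
        have "real (Suc k * (Suc (n + k) choose Suc k)) = real (Suc (n + k) * ((n + k) choose k))"
          by (simp only: *)
        then show ?thesis unfolding of_nat_mult by (simp add: algebra_simps del: binomial_Suc_Suc)
      qed
      then show ?thesis by (simp add: field_simps)
    qed
    have f: "(real k + real n + 1/2) / (real k + 3/4) \<le> 2 * (real n + real k + 1) / (real k + 1)"
      by (simp add: field_simps)
    have "\<bar>gegen_coeff n (Suc k)\<bar> = \<bar>gegen_coeff n k\<bar> * ((real n - real k) / (real k + 1)) * ((real k + real n + 1/2) / (real k + 3/4))"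
      using kn by (simp add: abs_mult)
    also have "\<dots> \<le> (2 ^ k * real (n choose k) * real ((n + k) choose k)) * ((real n - real k) / (real k + 1)) * (2 * (real n + real k + 1) / (real k + 1))"
      by (intro mult_mono f Suc.IH) (use kn in auto)
    also have "\<dots> = 2 ^ Suc k * real (n choose Suc k) * real ((n + Suc k) choose Suc k)"
      unfolding b1 b2 by (simp add: field_simps)
    finally show ?case .
  qed simp
qed (simp add: gegen_coeff_eq_0)

lemma polyfun_gegen_bound: "norm (polyfun (gegen n) x) \<le> 32 ^ n"
proof -
  have b: "\<bar>gegen_coeff n k\<bar> \<le> 16 ^ n" if "k \<le> n" for k
  proof -
    have "\<bar>gegen_coeff n k\<bar> \<le> 2 ^ k * real (n choose k) * real ((n + k) choose k)" by (rule gegen_coeff_bound)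
    also have "\<dots> \<le> 2 ^ n * 2 ^ n * 2 ^ (2 * n)"
    proof (intro mult_mono)
      show "real (n choose k) \<le> 2 ^ n" using binomial_le_pow2[of n k] by (metis of_nat_le_iff of_nat_numeral of_nat_power)
      have "(n + k choose k) \<le> 2 ^ (n + k)" by (rule binomial_le_pow2)
      also have "\<dots> \<le> 2 ^ (2 * n)" using that by (intro power_increasing) auto
      finally show "real (n + k choose k) \<le> 2 ^ (2 * n)" by (metis of_nat_le_iff of_nat_numeral of_nat_power)
    qed (use that in auto)
    also have "\<dots> = 16 ^ n" by (simp add: power_mult power_mult_distrib[symmetric])
    finally show ?thesis .
  qed
  have "norm (polyfun (gegen n) x) \<le> (\<Sum>k\<le>n. norm (of_real (gegen_coeff n k) * complex_of_real (sfun x) ^ k))"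
    unfolding polyfun_def gegen_def poly_sum poly_monom by (rule norm_sum)
  also have "\<dots> \<le> (\<Sum>k\<le>n. 16 ^ n)"
  proof (rule sum_mono)
    fix k assume "k \<in> {..n}"
    then have "\<bar>gegen_coeff n k\<bar> * \<bar>sfun x\<bar> ^ k \<le> 16 ^ n * 1"
      by (intro mult_mono b power_le_one) (use sfun_bounds[of x] in auto)
    then show "norm (of_real (gegen_coeff n k) * complex_of_real (sfun x) ^ k) \<le> 16 ^ n"
      by (simp add: norm_mult norm_power)
  qed
  also have "\<dots> = real (n + 1) * 16 ^ n" by simp
  also have "\<dots> \<le> 2 ^ n * 16 ^ n"
  proof (intro mult_right_mono)
    have "n + 1 \<le> 2 ^ n" by (induction n) auto
    then show "real (n + 1) \<le> 2 ^ n" by (metis of_nat_le_iff of_nat_numeral of_nat_power)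
  qed simp
  also have "\<dots> = 32 ^ n" by (simp flip: power_mult_distrib)
  finally show ?thesis .
qed

lemma norm_hpoly_gegen_le: "norm (hpoly (gegen n)) \<le> 2 * 32 ^ n"
proof -
  have "(norm (hpoly (gegen n)))\<^sup>2 = (LINT x|omega_measure. (norm (polyfun (gegen n) x))\<^sup>2)"
    unfolding hpoly_def by (rule norm_abs_hsp[OF square_integrable_polyfun])
  also have "\<dots> \<le> (LINT x|omega_measure. (32 ^ n)\<^sup>2)"
  proof (rule integral_mono)
    show "integrable omega_measure (\<lambda>x. (norm (polyfun (gegen n) x))\<^sup>2)"
      using square_integrable_polyfun[of "gegen n"] by (simp add: square_integrable_def)
  qed (auto intro!: power_mono polyfun_gegen_bound)
  also have "\<dots> \<le> pi * (32 ^ n)\<^sup>2"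
    using measure_omega_le by (simp add: mult_right_mono)
  also have "\<dots> \<le> 4 * (32 ^ n)\<^sup>2" using pi_less_4 by (intro mult_right_mono) auto
  also have "\<dots> = (2 * 32 ^ n)\<^sup>2" by (simp add: power_mult_distrib)
  finally show ?thesis by (rule power2_le_imp_le) simp
qed

lemma norm_hpoly_gegen_pos: "norm (hpoly (gegen n)) > 0"
proof (rule ccontr)
  assume "\<not> ?thesis"
  then have "hpoly (gegen n) = 0" by simp
  then have "AE x in lebesgue_on {0<..<pi}. rep_hsp (vincl (vpoly (gegen n))) x = 0"
    using AE_rep_0 by simp
  then have "vrepr (vpoly (gegen n)) 0 = 0" by (intro vrepr_unique[where h = "\<lambda>_. 0"]) auto
  then show False using vrepr_vpoly[of 0 "gegen n"] by (simp add: polyfun_def)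
qed

section \<open>The orthonormal basis\<close>

text \<open>Bessel's identity for an orthogonal family, some members of which may vanish. It is used for the
  eigenfunctions and for their derivatives, which are orthogonal as well, with the same
  coefficients.\<close>

lemma hinner_orthogonal_sum:
  assumes g: "\<And>i j. i \<in> A \<Longrightarrow> j \<in> A \<Longrightarrow> hinner (g i) (g j) = (if i = j then of_real (\<kappa> i) else 0)" and A: "finite A"
  shows "hinner (\<Sum>i\<in>A. hscaleC (c i) (g i)) (\<Sum>i\<in>A. hscaleC (d i) (g i)) = (\<Sum>i\<in>A. of_real (\<kappa> i) * (c i * cnj (d i)))"
proof -
  have "hinner (\<Sum>i\<in>A. hscaleC (c i) (g i)) (\<Sum>i\<in>A. hscaleC (d i) (g i)) =
      (\<Sum>i\<in>A. \<Sum>j\<in>A. c i * (cnj (d j) * hinner (g i) (g j)))"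
    unfolding hinner_sum_left hinner_sum_right hinner_scaleC_left hinner_scaleC_right
    by (subst sum.swap[of _ A A]) (simp add: sum_distrib_left mult.left_commute)
  also have "\<dots> = (\<Sum>i\<in>A. \<Sum>j\<in>A. if i = j then of_real (\<kappa> i) * (c i * cnj (d i)) else 0)"
    by (intro sum.cong refl) (auto simp: g)
  also have "\<dots> = (\<Sum>i\<in>A. of_real (\<kappa> i) * (c i * cnj (d i)))"
    using A by simp
  finally show ?thesis .
qed

lemma norm_orthogonal_sum:
  assumes g: "\<And>i j. i \<in> A \<Longrightarrow> j \<in> A \<Longrightarrow> hinner (g i) (g j) = (if i = j then of_real (\<kappa> i) else 0)" and A: "finite A"
  shows "(norm (\<Sum>i\<in>A. hscaleC (c i) (g i)))\<^sup>2 = (\<Sum>i\<in>A. \<kappa> i * (norm (c i))\<^sup>2)"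
proof -
  have "complex_of_real ((norm (\<Sum>i\<in>A. hscaleC (c i) (g i)))\<^sup>2) = of_real (\<Sum>i\<in>A. \<kappa> i * (norm (c i))\<^sup>2)"
  proof -
    have "hinner (\<Sum>i\<in>A. hscaleC (c i) (g i)) (\<Sum>i\<in>A. hscaleC (c i) (g i)) = (\<Sum>i\<in>A. of_real (\<kappa> i) * (c i * cnj (c i)))"
      by (rule hinner_orthogonal_sum[OF _ A]) (rule g)
    then show ?thesis unfolding hinner_self[symmetric] by (simp add: complex_norm_square del: of_real_power)
  qed
  then show ?thesis using of_real_eq_iff by blast
qed

lemma bessel_identity:
  assumes g: "\<And>i j. i \<in> A \<Longrightarrow> j \<in> A \<Longrightarrow> hinner (g i) (g j) = (if i = j then of_real (\<kappa> i) else 0)" and A: "finite A"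
    and x: "\<And>i. i \<in> A \<Longrightarrow> hinner x (g i) = of_real (\<kappa> i) * c i"
  shows "(norm (x - (\<Sum>i\<in>A. hscaleC (c i) (g i))))\<^sup>2 = (norm x)\<^sup>2 - (\<Sum>i\<in>A. \<kappa> i * (norm (c i))\<^sup>2)"
proof -
  let ?y = "\<Sum>i\<in>A. hscaleC (c i) (g i)"
  let ?T = "complex_of_real (\<Sum>i\<in>A. \<kappa> i * (norm (c i))\<^sup>2)"
  have xy: "hinner x ?y = ?T"
    unfolding hinner_sum_right hinner_scaleC_right of_real_sum
    by (intro sum.cong refl) (simp add: x complex_norm_square mult_ac del: of_real_power)
  have yx: "hinner ?y x = ?T" using hinner_commute[of ?y x] xy by simp
  have yy: "hinner ?y ?y = ?T" 
  proof -
    have "(norm ?y)\<^sup>2 = (\<Sum>i\<in>A. \<kappa> i * (norm (c i))\<^sup>2)"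
      by (rule norm_orthogonal_sum[OF _ A]) (rule g)
    then show ?thesis unfolding hinner_self by (rule arg_cong)
  qed
  have "complex_of_real ((norm (x - ?y))\<^sup>2) = of_real ((norm x)\<^sup>2 - (\<Sum>i\<in>A. \<kappa> i * (norm (c i))\<^sup>2))"
    unfolding hinner_self[symmetric] hinner_diff_left hinner_diff_right xy yx yy
    by (simp add: hinner_self)
  then show ?thesis using of_real_eq_iff by blast
qed

lemma eigval_neq:
  assumes "m \<noteq> n"
  shows "eigval m \<noteq> eigval n"
proof
  assume "eigval m = eigval n"
  then have "(real m - real n) * (4 * (real m + real n) + 2) = 0" by (simp add: eigval_def algebra_simps)
  moreover have "4 * (real m + real n) + 2 > 0" by (simp add: add_nonneg_pos)
  ultimately show False using assms by auto
qed

lemma eigval_nonneg: "eigval n \<ge> 0" by (simp add: eigval_def)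

text \<open>Since \<open>gegen n\<close> is \<open>1\<close> at \<open>\<phi> = 0\<close>, this is the value there of the normalised eigenfunction.\<close>

definition eig_trace :: "nat \<Rightarrow> real" where "eig_trace n = 1 / norm (hpoly (gegen n))"

definition eig_h :: "nat \<Rightarrow> hsp" where "eig_h n = hpoly (smult (of_real (eig_trace n)) (gegen n))"

definition eig_v :: "nat \<Rightarrow> vsp" where "eig_v n = vpoly (smult (of_real (eig_trace n)) (gegen n))"

definition coef :: "hsp \<Rightarrow> nat \<Rightarrow> complex" where "coef f n = hinner f (eig_h n)"

lemma eig_trace_pos: "eig_trace n > 0" using norm_hpoly_gegen_pos[of n] by (simp add: eig_trace_def)

lemma eig_trace_lower: "1 \<le> 2 * 32 ^ n * eig_trace n"
  using norm_hpoly_gegen_le[of n] norm_hpoly_gegen_pos[of n] by (simp add: eig_trace_def)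

lemma vincl_eig_v [simp]: "vincl (eig_v n) = eig_h n" by (simp add: eig_v_def eig_h_def)

lemma gegenbayer_op_smult: "gegenbayer_op (smult z P) = smult z (gegenbayer_op P)"
  by (rule poly_eqI) (simp add: gegenbayer_op_def pderiv_smult coeff_pCons algebra_simps split: nat.splits)

lemma a0_eig_v: "a0 v (eig_v n) = of_real (eigval n) * coef (vincl v) n"
  unfolding eig_v_def a0_vpoly gegenbayer_op_smult gegenbayer_op_gegen coef_def eig_h_def
  by (simp add: hpoly_smult hinner_scaleC_right mult_ac)

lemma a0_commute: "a0 u v = cnj (a0 v u)"
  unfolding a0_def using hinner_commute[of "vderiv u" "vderiv v"] by simp

lemma norm_eig_h: "norm (eig_h n) = 1"
  using norm_hpoly_gegen_pos[of n] by (simp add: eig_h_def hpoly_smult norm_hscaleC eig_trace_def norm_divide)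

text \<open>The form is hermitian and the eigenvalues are distinct.\<close>

lemma hinner_eig_h: "hinner (eig_h i) (eig_h j) = (if i = j then of_real 1 else 0)"
proof (cases "i = j")
  case True
  then show ?thesis by (simp add: hinner_self norm_eig_h)
next
  case False
  have "of_real (eigval j) * hinner (eig_h i) (eig_h j) = a0 (eig_v i) (eig_v j)" by (simp add: a0_eig_v coef_def)
  also have "\<dots> = cnj (a0 (eig_v j) (eig_v i))" by (rule a0_commute)
  also have "\<dots> = of_real (eigval i) * hinner (eig_h i) (eig_h j)"
    using hinner_commute[of "eig_h i" "eig_h j"] by (simp add: a0_eig_v coef_def)
  finally show ?thesis using eigval_neq[OF False] False by simp
qed

lemma hinner_vderiv_eig: "hinner (vderiv v) (vderiv (eig_v n)) = of_real (eigval n / 4) * coef (vincl v) n"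
  using a0_eig_v[of v n] by (simp add: a0_def mult.commute)

lemma hinner_vderiv_eig_eig: "hinner (vderiv (eig_v i)) (vderiv (eig_v j)) = (if i = j then of_real (eigval i / 4) else 0)"
  unfolding hinner_vderiv_eig vincl_eig_v coef_def hinner_eig_h by simp

lemma vrepr_eig_v: "vrepr (eig_v n) 0 = of_real (eig_trace n)"
  by (simp add: eig_v_def vrepr_vpoly polyfun_def)

definition partial_h :: "nat \<Rightarrow> hsp \<Rightarrow> hsp" where
  "partial_h m f = (\<Sum>n\<le>m. hscaleC (coef f n) (eig_h n))"

definition partial_v :: "nat \<Rightarrow> vsp \<Rightarrow> vsp" where
  "partial_v m v = (\<Sum>n\<le>m. vscaleC (coef (vincl v) n) (eig_v n))"

lemma vincl_sum: "vincl (\<Sum>i\<in>A. f i) = (\<Sum>i\<in>A. vincl (f i))"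
  and vderiv_sum: "vderiv (\<Sum>i\<in>A. f i) = (\<Sum>i\<in>A. vderiv (f i))"
  by (induction A rule: infinite_finite_induct) simp_all

lemma vincl_partial_v: "vincl (partial_v m v) = partial_h m (vincl v)"
  by (simp add: partial_v_def partial_h_def vincl_sum)

lemma norm_diff_partial_h: "(norm (f - partial_h m f))\<^sup>2 = (norm f)\<^sup>2 - (\<Sum>n\<le>m. (norm (coef f n))\<^sup>2)"
  using bessel_identity[of "{..m}" eig_h "\<lambda>_. 1" f "coef f"] by (simp add: partial_h_def hinner_eig_h coef_def)

lemma bessel_inequality: "(\<Sum>n\<le>m. (norm (coef f n))\<^sup>2) \<le> (norm f)\<^sup>2"
  using norm_diff_partial_h[of f m] zero_le_power2[of "norm (f - partial_h m f)"] by linarith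

lemma norm_vderiv_diff_partial_v: "norm (vderiv (v - partial_v m v)) \<le> norm (vderiv v)"
proof (rule power2_le_imp_le)
  have "(norm (vderiv v - (\<Sum>n\<le>m. hscaleC (coef (vincl v) n) (vderiv (eig_v n)))))\<^sup>2 =
      (norm (vderiv v))\<^sup>2 - (\<Sum>n\<le>m. eigval n / 4 * (norm (coef (vincl v) n))\<^sup>2)"
    by (rule bessel_identity[OF _ _ hinner_vderiv_eig])
       (simp_all only: hinner_vderiv_eig_eig finite_atMost)
  moreover have "0 \<le> (\<Sum>n\<le>m. eigval n / 4 * (norm (coef (vincl v) n))\<^sup>2)"
    by (intro sum_nonneg mult_nonneg_nonneg) (auto simp: eigval_nonneg)
  ultimately show "(norm (vderiv (v - partial_v m v)))\<^sup>2 \<le> (norm (vderiv v))\<^sup>2"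
    by (simp add: partial_v_def vderiv_sum)
qed simp

text \<open>The eigenfunctions have the degrees \<open>0, 1, 2, \<dots>\<close> in \<open>s\<close>, so leading terms can be removed one by one.\<close>

lemma hpoly_in_span:
  "degree P \<le> m \<Longrightarrow> \<exists>c. hpoly P = (\<Sum>n\<le>m. hscaleC (c n) (eig_h n))"
proof (induction m arbitrary: P)
  case 0
  then have "P = smult (coeff P 0 / of_real (eig_trace 0)) (smult (of_real (eig_trace 0)) (gegen 0))"
    using eig_trace_pos[of 0] degree_gegen[of 0]
    by (intro poly_eqI) (auto simp: coeff_eq_0 coeff_gegen elim!: degree_eq_zeroE split: nat.splits simp: coeff_pCons gegen_coeff_eq_0)
  then have "hpoly P = (\<Sum>n\<le>0. hscaleC (coeff P 0 / of_real (eig_trace 0)) (eig_h n))"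
    by (metis (no_types, lifting) atMost_0 eig_h_def finite.emptyI hpoly_smult sum.empty sum.insert empty_iff add.right_neutral)
  then show ?case by (intro exI[of _ "\<lambda>_. coeff P 0 / of_real (eig_trace 0)"])
next
  case (Suc m)
  let ?G = "smult (of_real (eig_trace (Suc m))) (gegen (Suc m))"
  define z where "z = coeff P (Suc m) / coeff ?G (Suc m)"
  have G: "coeff ?G (Suc m) \<noteq> 0" using eig_trace_pos[of "Suc m"] by (simp add: coeff_gegen gegen_coeff_neq_0 del: gegen_coeff.simps)
  have "degree (P - smult z ?G) \<le> m"
  proof (rule degree_le, intro allI impI)
    fix i assume "m < i"
    then consider "i = Suc m" | "i > Suc m" by linarith
    then show "coeff (P - smult z ?G) i = 0"
    proof cases
      case 1
      then show ?thesis using G by (simp add: z_def)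
    next
      case 2
      then show ?thesis using Suc.prems by (simp add: coeff_eq_0 degree_gegen)
    qed
  qed
  from Suc.IH[OF this] obtain c where c: "hpoly (P - smult z ?G) = (\<Sum>n\<le>m. hscaleC (c n) (eig_h n))" by blast
  have "hpoly P = hpoly ((P - smult z ?G) + smult z ?G)" by simp
  also have "\<dots> = (\<Sum>n\<le>m. hscaleC (c n) (eig_h n)) + hscaleC z (eig_h (Suc m))"
    unfolding hpoly_add c by (simp only: hpoly_smult[of z] eig_h_def)
  also have "\<dots> = (\<Sum>n\<le>Suc m. hscaleC ((c(Suc m := z)) n) (eig_h n))"
    by (simp add: sum.atMost_Suc)
  finally show ?case by blast
qed

text \<open>Subtracting a combination \<open>y\<close> of the first \<open>m + 1\<close> eigenfunctions from \<open>f\<close> leaves the remainder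
  \<open>f - partial_h m f\<close> unchanged, and by Bessel's identity that is no longer than \<open>f - y\<close>.\<close>

lemma norm_diff_partial_h_le:
  "norm (f - partial_h m f) \<le> norm (f - (\<Sum>n\<le>m. hscaleC (c n) (eig_h n)))"
proof (rule power2_le_imp_le)
  define y where "y = (\<Sum>n\<le>m. hscaleC (c n) (eig_h n))"
  have cy: "coef y n = c n" if "n \<le> m" for n
    using that unfolding coef_def y_def hinner_sum_left hinner_scaleC_left hinner_eig_h by (simp add: if_distrib cong: if_cong)
  have hadd: "hscaleC (a + b) x = hscaleC a x + hscaleC b x" for a b x
    by transfer (auto simp: hrel_def square_integrable_add square_integrable_scale distrib_right)
  have "partial_h m (f - y) + y = partial_h m f"
  proof -
    have "partial_h m (f - y) + y = (\<Sum>n\<le>m. hscaleC (coef (f - y) n) (eig_h n) + hscaleC (c n) (eig_h n))"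
      by (simp add: partial_h_def y_def sum.distrib)
    also have "\<dots> = partial_h m f"
      unfolding partial_h_def by (intro sum.cong refl) (simp add: hadd[symmetric] cy coef_def hinner_diff_left cy[unfolded coef_def])
    finally show ?thesis .
  qed
  then have eq: "f - partial_h m f = (f - y) - partial_h m (f - y)" by (metis add.commute diff_diff_eq)
  have "(norm (f - partial_h m f))\<^sup>2 = (norm (f - y))\<^sup>2 - (\<Sum>n\<le>m. (norm (coef (f - y) n))\<^sup>2)"
    unfolding eq by (rule norm_diff_partial_h)
  moreover have "0 \<le> (\<Sum>n\<le>m. (norm (coef (f - y) n))\<^sup>2)" by (intro sum_nonneg) simp
  ultimately show "(norm (f - partial_h m f))\<^sup>2 \<le> (norm (f - (\<Sum>n\<le>m. hscaleC (c n) (eig_h n))))\<^sup>2"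
    by (simp add: y_def)
qed simp

lemma norm_diff_hsp: "square_integrable u \<Longrightarrow> square_integrable v \<Longrightarrow>
    (norm (abs_hsp u - abs_hsp v))\<^sup>2 = (LINT x|omega_measure. (norm (u x - v x))\<^sup>2)"
  by (simp add: abs_hsp_diff norm_abs_hsp square_integrable_diff)

lemma hsp_approx_DCT:
  assumes u: "square_integrable u" and f: "\<And>n::nat. square_integrable (f n)"
    and lim: "AE x in omega_measure. (\<lambda>n. f n x) \<longlonglongrightarrow> u x"
    and b: "integrable omega_measure B" "\<And>n. AE x in omega_measure. (norm (f n x - u x))\<^sup>2 \<le> B x" and e: "\<epsilon> > 0"
  shows "\<exists>n. norm (abs_hsp (f n) - abs_hsp u) < \<epsilon>"
proof -
  have "(\<lambda>n. LINT x|omega_measure. (norm (f n x - u x))\<^sup>2) \<longlonglongrightarrow> (LINT x|omega_measure. 0)"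
  proof (rule integral_dominated_convergence[OF _ _ b(1)])
    show "AE x in omega_measure. (\<lambda>n. (norm (f n x - u x))\<^sup>2) \<longlonglongrightarrow> 0"
      using lim
    proof (rule eventually_mono)
      fix x assume "(\<lambda>n. f n x) \<longlonglongrightarrow> u x"
      then have "(\<lambda>n. (norm (f n x - u x))\<^sup>2) \<longlonglongrightarrow> (norm (u x - u x))\<^sup>2" by (intro tendsto_intros)
      then show "(\<lambda>n. (norm (f n x - u x))\<^sup>2) \<longlonglongrightarrow> 0" by simp
    qed
    show "AE x in omega_measure. norm ((norm (f n x - u x))\<^sup>2) \<le> B x" for n using b(2)[of n] by simp
    show "(\<lambda>x. (norm (f n x - u x))\<^sup>2) \<in> borel_measurable omega_measure" for n
      using square_integrable_diff[OF f[of n] u] by (auto simp: square_integrable_def)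
  qed simp
  then have "(\<lambda>n. (norm (abs_hsp (f n) - abs_hsp u))\<^sup>2) \<longlonglongrightarrow> 0"
    by (simp add: norm_diff_hsp[OF f u])
  then obtain n where "(norm (abs_hsp (f n) - abs_hsp u))\<^sup>2 < \<epsilon>\<^sup>2"
    using LIMSEQ_D[of _ 0 "\<epsilon>\<^sup>2"] e by fastforce
  then show ?thesis using e by (meson less_imp_le power2_less_imp_less)
qed

text \<open>Density of the polynomials: truncation, approximation of bounded measurable functions by
  continuous ones, and the Weierstrass theorem in the variable \<open>s\<close>.\<close>

lemma hpoly_dense:
  assumes e: "\<epsilon> > 0"
  shows "\<exists>P. norm (f - hpoly P) < \<epsilon>"
proof -
  define e3 where "e3 = \<epsilon> / 3"
  have e3: "e3 > 0" using e by (simp add: e3_def)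
  let ?r = "rep_hsp f"
  have [measurable]: "?r \<in> borel_measurable omega_measure"
    using square_integrable_rep[of f] by (simp add: square_integrable_def)
  define t where "t n x = (if norm (?r x) \<le> real n then ?r x else 0)" for n x
  have tm [measurable]: "t n \<in> borel_measurable omega_measure" for n unfolding t_def by measurable
  have tb: "norm (t n x) \<le> real n" for n x by (simp add: t_def)
  have bsq: "square_integrable g" if "g \<in> borel_measurable omega_measure" "\<And>x. norm (g x) \<le> B" for g :: "real \<Rightarrow> complex" and B
  proof -
    note [measurable] = that(1)
    have "integrable omega_measure (\<lambda>x. (norm (g x))\<^sup>2)"
      by (rule omega.integrable_const_bound[of _ "B\<^sup>2"]) (auto intro!: AE_I2 power_mono that(2))
    then show ?thesis by (simp add: square_integrable_def)
  qed
  have "\<exists>n. norm (abs_hsp (t n) - abs_hsp ?r) < e3"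
  proof (rule hsp_approx_DCT[OF square_integrable_rep bsq[OF tm tb] _ _ _ e3])
    show "AE x in omega_measure. (\<lambda>n. t n x) \<longlonglongrightarrow> ?r x"
    proof (rule AE_I2)
      fix x
      obtain N where "norm (?r x) \<le> real N" using real_arch_simple by blast
      then have "\<forall>n\<ge>N. t n x = ?r x" by (auto simp: t_def)
      then show "(\<lambda>n. t n x) \<longlonglongrightarrow> ?r x"
        by (intro tendsto_eventually) (auto simp: eventually_sequentially)
    qed
    show "integrable omega_measure (\<lambda>x. (norm (?r x))\<^sup>2)" using square_integrable_rep[of f] by (simp add: square_integrable_def)
    show "AE x in omega_measure. (norm (t n x - ?r x))\<^sup>2 \<le> (norm (?r x))\<^sup>2" for n
      by (intro AE_I2) (simp add: t_def)
  qed
  then obtain n where n: "norm (abs_hsp (t n) - f) < e3" by auto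
  have "t n measurable_on {0<..<pi}"
    using tm[of n] by (subst measurable_on_iff_borel_measurable) (auto simp: borel_measurable_omega_eq)
  then obtain N g where N: "negligible N" "\<And>k. continuous_on UNIV (g k)"
    "\<And>x. x \<notin> N \<Longrightarrow> (\<lambda>k. g k x) \<longlonglongrightarrow> (if x \<in> {0<..<pi} then t n x else 0)"
    unfolding measurable_on_def by metis
  define cl where "cl = closest_point (cball 0 (real n) :: complex set)"
  have clc: "continuous_on UNIV cl" unfolding cl_def by (rule continuous_on_closest_point) auto
  have clb: "norm (cl z) \<le> real n" for z
    using closest_point_in_set[of "cball 0 (real n) :: complex set" z] by (simp add: cl_def)
  have cli: "cl z = z" if "norm z \<le> real n" for z using that by (simp add: cl_def closest_point_self)
  define h where "h k x = cl (g k x)" for k x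
  have hc: "continuous_on UNIV (h k)" for k
    unfolding h_def by (rule continuous_on_compose2[OF clc N(2)]) auto
  have "\<exists>k. norm (abs_hsp (h k) - abs_hsp (t n)) < e3"
  proof (rule hsp_approx_DCT[OF bsq[OF tm tb] _ _ _ _ e3])
    show "square_integrable (h k)" for k
      by (rule square_integrable_continuous) (rule continuous_on_subset[OF hc], simp)
    have "AE x in lebesgue. x \<notin> N" using N(1) by (simp add: negligible_iff_null_sets AE_not_in)
    then have "AE x in lebesgue_on {0<..<pi}. x \<notin> N"

    proof (subst AE_restrict_space_iff)
      show "AE x in lebesgue. x \<in> {0<..<pi} \<longrightarrow> x \<notin> N" using \<open>AE x in lebesgue. x \<notin> N\<close> by (rule eventually_mono) simp
    qed simp
    then show "AE x in omega_measure. (\<lambda>k. h k x) \<longlonglongrightarrow> t n x"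
      unfolding AE_omega_measure using AE_space
    proof eventually_elim
      case (elim x)
      then have "(\<lambda>k. g k x) \<longlonglongrightarrow> t n x" using N(3)[of x] by simp
      then have "(\<lambda>k. cl (g k x)) \<longlonglongrightarrow> cl (t n x)"
        by (rule continuous_on_tendsto_compose[OF clc]) auto
      then show ?case by (simp add: h_def cli tb)
    qed
    show "integrable omega_measure (\<lambda>x. (2 * real n)\<^sup>2)" by simp
    show "AE x in omega_measure. (norm (h k x - t n x))\<^sup>2 \<le> (2 * real n)\<^sup>2" for k
    proof (intro AE_I2 power_mono)
      fix x
      show "norm (h k x - t n x) \<le> 2 * real n"
        using norm_triangle_ineq4[of "h k x" "t n x"] clb[of "g k x"] tb[of n x] by (simp add: h_def)
    qed simp
  qed
  then obtain k where k: "norm (abs_hsp (h k) - abs_hsp (t n)) < e3" by blast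
  define q where "q s = h k (arccos (1 - 2 * s))" for s
  have qc: "continuous_on {0..1} q"
    unfolding q_def by (rule continuous_on_compose2[OF hc]) (auto intro!: continuous_intros)
  have "\<exists>P. \<forall>s\<in>{0..1}. norm (q s - poly P (of_real s)) < e3 / 2"
  proof -
    have approx: "\<exists>P. \<forall>s\<in>{0..1}. norm (complex_of_real (r s) - poly P (of_real s)) < e3 / 4"
      if r: "continuous_on {0..1} r" for r :: "real \<Rightarrow> real"
    proof -
      obtain p where p: "real_polynomial_function p" "\<And>s. s \<in> {0..1} \<Longrightarrow> \<bar>r s - p s\<bar> < e3 / 4"
        using Stone_Weierstrass_real_polynomial_function[OF compact_Icc r, of "e3 / 4"] e3 by auto
      obtain a M where a: "p = (\<lambda>x. \<Sum>i\<le>M. a i * x ^ i)"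
        using p(1) by (auto simp: real_polynomial_function_iff_sum)
      define P where "P = (\<Sum>i\<le>M. monom (complex_of_real (a i)) i)"
      have "poly P (of_real s) = of_real (p s)" for s
        by (simp add: P_def a poly_sum poly_monom)
      then have "norm (complex_of_real (r s) - poly P (of_real s)) < e3 / 4" if "s \<in> {0..1}" for s
        using p(2)[OF that] by (metis norm_of_real of_real_diff)
      then show ?thesis by blast
    qed
    obtain P1 where P1: "\<forall>s\<in>{0..1}. norm (complex_of_real (Re (q s)) - poly P1 (of_real s)) < e3 / 4"
      using approx[of "\<lambda>s. Re (q s)"] continuous_on_Re[OF qc] by blast
    obtain P2 where P2: "\<forall>s\<in>{0..1}. norm (complex_of_real (Im (q s)) - poly P2 (of_real s)) < e3 / 4"
      using approx[of "\<lambda>s. Im (q s)"] continuous_on_Im[OF qc] by blast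
    have "norm (q s - poly (P1 + smult \<i> P2) (of_real s)) < e3 / 2" if s: "s \<in> {0..1}" for s
    proof -
      have "q s - poly (P1 + smult \<i> P2) (of_real s) =
          (of_real (Re (q s)) - poly P1 (of_real s)) + \<i> * (of_real (Im (q s)) - poly P2 (of_real s))"
        using complex_eq[of "q s"] by (simp add: algebra_simps)
      also have "norm \<dots> \<le> norm (of_real (Re (q s)) - poly P1 (of_real s)) + norm (of_real (Im (q s)) - poly P2 (of_real s))"
        by (rule order_trans[OF norm_triangle_ineq]) (simp add: norm_mult)
      also have "\<dots> < e3 / 4 + e3 / 4" using P1 P2 s by (intro add_strict_mono) auto
      finally show ?thesis by simp
    qed
    then show ?thesis by blast
  qed
  then obtain P where P: "\<And>s. s \<in> {0..1} \<Longrightarrow> norm (q s - poly P (of_real s)) < e3 / 2" by blast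
  have hP: "norm (h k x - polyfun P x) \<le> e3 / 2" if "x \<in> {0<..<pi}" for x
  proof -
    have "1 - 2 * sfun x = cos x" by (simp add: sfun_def field_simps)
    then have "arccos (1 - 2 * sfun x) = x" using that by (simp add: arccos_cos)
    then have "h k x = q (sfun x)" by (simp add: q_def)
    then show ?thesis using P[of "sfun x"] sfun_bounds[of x] by (simp add: polyfun_def)
  qed
  have hs: "square_integrable (h k)"
    by (rule square_integrable_continuous) (rule continuous_on_subset[OF hc], simp)
  have "(norm (abs_hsp (h k) - hpoly P))\<^sup>2 = (LINT x|omega_measure. (norm (h k x - polyfun P x))\<^sup>2)"
    unfolding hpoly_def by (rule norm_diff_hsp[OF hs square_integrable_polyfun])
  also have "\<dots> \<le> (LINT x|omega_measure. (e3 / 2)\<^sup>2)"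
  proof (rule integral_mono)
    show "integrable omega_measure (\<lambda>x. (norm (h k x - polyfun P x))\<^sup>2)"
      using square_integrable_diff[OF hs square_integrable_polyfun] by (simp add: square_integrable_def)
  qed (auto intro!: power_mono hP)
  also have "\<dots> \<le> 4 * (e3 / 2)\<^sup>2"
    using measure_omega_le pi_less_4 by (simp add: mult_right_mono)
  also have "\<dots> = e3\<^sup>2" by (simp add: power2_eq_square)
  finally have hk: "norm (abs_hsp (h k) - hpoly P) \<le> e3" using e3 by (rule power2_le_imp_le[OF _ less_imp_le])
  have "f - hpoly P = (abs_hsp (h k) - hpoly P) - ((abs_hsp (h k) - abs_hsp (t n)) + (abs_hsp (t n) - f))" by simp
  then have "norm (f - hpoly P) \<le> norm (abs_hsp (h k) - hpoly P) + (norm (abs_hsp (h k) - abs_hsp (t n)) + norm (abs_hsp (t n) - f))"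
    by (metis add_left_mono norm_triangle_ineq norm_triangle_ineq4 order_trans)
  also have "\<dots> < \<epsilon>" using hk n k by (simp add: e3_def)
  finally show ?thesis by blast
qed

lemma partial_h_tendsto: "(\<lambda>m. partial_h m f) \<longlonglongrightarrow> f"
proof (rule metric_LIMSEQ_I)
  fix e :: real assume "e > 0"
  then obtain P where P: "norm (f - hpoly P) < e" using hpoly_dense by blast
  have "dist (partial_h m f) f < e" if "m \<ge> degree P" for m
  proof -
    obtain c where "hpoly P = (\<Sum>n\<le>m. hscaleC (c n) (eig_h n))" using hpoly_in_span[OF \<open>m \<ge> degree P\<close>] by blast
    then have "norm (f - partial_h m f) \<le> norm (f - hpoly P)" using norm_diff_partial_h_le[of f m c] by simp
    then show ?thesis using P by (simp add: dist_norm norm_minus_commute)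
  qed
  then show "\<exists>no. \<forall>m\<ge>no. dist (partial_h m f) f < e" by blast
qed

lemma parseval: "(\<lambda>m. \<Sum>n\<le>m. (norm (coef f n))\<^sup>2) \<longlonglongrightarrow> (norm f)\<^sup>2"
proof -
  have "(\<lambda>m. (norm f)\<^sup>2 - (norm (f - partial_h m f))\<^sup>2) \<longlonglongrightarrow> (norm f)\<^sup>2 - (norm (f - f))\<^sup>2"
    by (intro tendsto_intros partial_h_tendsto)
  then show ?thesis by (simp add: norm_diff_partial_h)
qed

lemma vrepr_sum: "x \<in> {0..pi} \<Longrightarrow> vrepr (\<Sum>i\<in>A. f i) x = (\<Sum>i\<in>A. vrepr (f i) x)"
proof (induction A rule: infinite_finite_induct)
  case empty
  have "vrepr (0 + 0) x = vrepr 0 x + vrepr 0 x" using empty by (rule vrepr_add)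
  then show ?case by simp
next
  case (infinite A)
  have "vrepr (0 + 0) x = vrepr 0 x + vrepr 0 x" using infinite(2) by (rule vrepr_add)
  then show ?case using infinite by simp
qed (simp add: vrepr_add)

text \<open>The remainders of the expansion are bounded in the form domain and tend to \<open>0\<close> in the weighted space,
  which is enough for the traces because the trace is small relative to the derivative.\<close>

lemma trace_partial_v_tendsto: "(\<lambda>m. vrepr (v - partial_v m v) 0) \<longlonglongrightarrow> 0"
proof (rule LIMSEQ_I)
  fix e :: real assume e: "e > 0"
  define \<epsilon> where "\<epsilon> = e / (2 * (norm (vderiv v) + 1))"
  have eps: "\<epsilon> > 0" using e by (simp add: \<epsilon>_def add_nonneg_pos)
  obtain C where C: "C \<ge> 0" "\<And>v. norm (vrepr v 0) \<le> C * norm (vincl v) + \<epsilon> * norm (vderiv v)"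
    using trace_bound[of 0 \<epsilon>] eps by auto
  have "(\<lambda>m. C * norm (vincl v - partial_h m (vincl v))) \<longlonglongrightarrow> C * norm (vincl v - vincl v)"
    by (intro tendsto_intros partial_h_tendsto)
  then obtain no where no: "\<And>m. m \<ge> no \<Longrightarrow> C * norm (vincl v - partial_h m (vincl v)) < e / 2"
    using LIMSEQ_D[of "\<lambda>m. C * norm (vincl v - partial_h m (vincl v))" 0 "e / 2"] e C(1) by auto
  have "norm (vrepr (v - partial_v m v) 0 - 0) < e" if "m \<ge> no" for m
  proof -
    have "norm (vrepr (v - partial_v m v) 0) \<le> C * norm (vincl v - partial_h m (vincl v)) + \<epsilon> * norm (vderiv (v - partial_v m v))"
      using C(2)[of "v - partial_v m v"] by (simp add: vincl_partial_v)
    also have "\<dots> \<le> C * norm (vincl v - partial_h m (vincl v)) + \<epsilon> * norm (vderiv v)"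
      using eps by (intro add_left_mono mult_left_mono norm_vderiv_diff_partial_v) auto
    also have "\<epsilon> * norm (vderiv v) \<le> e / 2"
    proof -
      have "\<epsilon> * norm (vderiv v) \<le> \<epsilon> * (norm (vderiv v) + 1)" using eps by (intro mult_left_mono) auto
      also have "\<dots> = e / 2"
      proof -
        define q where "q = norm (vderiv v) + 1"
        have "q \<noteq> 0" using norm_ge_zero[of "vderiv v"] by (simp only: q_def)
        then show ?thesis unfolding \<epsilon>_def q_def[symmetric] by simp
      qed
      finally show ?thesis .
    qed
    finally show ?thesis using no[OF that] by simp
  qed
  then show "\<exists>no. \<forall>m\<ge>no. norm (vrepr (v - partial_v m v) 0 - 0) < e" by blast
qed

lemma trace_norm_bound:
  "\<exists>K>0. \<forall>v. norm (vrepr v 0) \<le> K * norm v \<and> norm (vrepr v pi) \<le> K * norm v"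
proof -
  obtain C0 where C0: "C0 \<ge> 0" "\<And>v. norm (vrepr v 0) \<le> C0 * norm (vincl v) + 1 * norm (vderiv v)"
    using trace_bound[of 0 1] by auto
  obtain C1 where C1: "C1 \<ge> 0" "\<And>v. norm (vrepr v pi) \<le> C1 * norm (vincl v) + 1 * norm (vderiv v)"
    using trace_bound[of pi 1] by auto
  have le: "C * norm (vincl v) + 1 * norm (vderiv v) \<le> (C0 + C1 + 1) * norm v" if "C = C0 \<or> C = C1" for C v
  proof -
    have "C * norm (vincl v) \<le> (C0 + C1) * norm v"
      using that C0(1) C1(1) by (intro mult_mono norm_vincl_le) auto
    then show ?thesis using norm_vderiv_le[of v] by (simp add: distrib_right)
  qed
  show ?thesis
  proof (intro exI[of _ "C0 + C1 + 1"] conjI allI)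
    fix v
    show "norm (vrepr v 0) \<le> (C0 + C1 + 1) * norm v" using C0(2)[of v] le[of C0 v] by simp
    show "norm (vrepr v pi) \<le> (C0 + C1 + 1) * norm v" using C1(2)[of v] le[of C1 v] by simp
  qed (use C0 C1 in auto)
qed

text \<open>Boundedness of the trace on the form domain is, by duality, square summability of the traces of the eigenfunctions
  against \<open>1 / (1 + eigval n)\<close>: test with the partial sum of the representer.\<close>

lemma trace_square_sum:
  assumes K: "\<And>v. norm (vrepr v e) \<le> K * norm v" and e: "e = 0 \<or> e = pi"
  shows "(\<Sum>n\<le>m. (norm (vrepr (eig_v n) e))\<^sup>2 / (1 + eigval n)) \<le> K\<^sup>2"
proof -
  define t where "t n = vrepr (eig_v n) e" for n
  define c where "c n = cnj (t n) / of_real (1 + eigval n)" for n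
  define T where "T = (\<Sum>n\<le>m. (norm (t n))\<^sup>2 / (1 + eigval n))"
  define v where "v = (\<Sum>n\<le>m. vscaleC (c n) (eig_v n))"
  have l: "1 + eigval n > 0" for n using eigval_nonneg[of n] by linarith
  have T0: "T \<ge> 0" unfolding T_def by (intro sum_nonneg divide_nonneg_pos l) auto
  have "vrepr v e = (\<Sum>n\<le>m. c n * t n)"
    using e unfolding v_def by (auto simp: vrepr_sum vrepr_scaleC t_def)
  also have "\<dots> = of_real T"
    unfolding T_def of_real_sum
    by (intro sum.cong refl) (simp add: c_def complex_norm_square mult.commute del: of_real_power)
  finally have tr: "norm (vrepr v e) = T" using T0 by simp
  have "(norm v)\<^sup>2 = 4 * (\<Sum>n\<le>m. eigval n / 4 * (norm (c n))\<^sup>2) + (\<Sum>n\<le>m. 1 * (norm (c n))\<^sup>2)"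
    unfolding norm_vsp v_def vincl_sum vderiv_sum vincl_simps vincl_eig_v
    by (intro arg_cong2[of _ _ _ _ "(+)"] arg_cong[of _ _ "\<lambda>x. 4 * x"] norm_orthogonal_sum)
       (simp_all add: hinner_eig_h hinner_vderiv_eig_eig)
  also have "\<dots> = (\<Sum>n\<le>m. (1 + eigval n) * (norm (c n))\<^sup>2)"
    by (simp add: sum_distrib_left algebra_simps sum.distrib)
  also have "\<dots> = T"
    unfolding T_def
  proof (intro sum.cong refl)
    fix n
    have "norm (c n) = norm (t n) / (1 + eigval n)" using l[of n] by (simp add: c_def norm_divide del: of_real_add)
    then show "(1 + eigval n) * (norm (c n))\<^sup>2 = (norm (t n))\<^sup>2 / (1 + eigval n)"
      using l[of n] by (simp add: power2_eq_square)
  qed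
  finally have nv: "(norm v)\<^sup>2 = T" .
  have "T\<^sup>2 \<le> (K * norm v)\<^sup>2" using K[of v] tr T0 by (intro power_mono) auto
  also have "\<dots> = K\<^sup>2 * T" by (simp add: power_mult_distrib nv)
  finally have "T * T \<le> K\<^sup>2 * T" by (simp add: power2_eq_square)
  then have "T \<le> K\<^sup>2" using T0 by (cases "T = 0") auto
  then show ?thesis by (simp add: T_def t_def)
qed

section \<open>Solutions in time\<close>

text \<open>Only scalar functions of a Bochner measurable function are ever integrated. They are almost
  everywhere limits of simple functions, hence measurable, as Lebesgue measure is complete.\<close>

lemma strongly_measurable_continuous_comp:
  fixes h :: "'a::real_normed_vector \<Rightarrow> 'b::euclidean_space" and a b :: real
  assumes f: "strongly_measurable (lebesgue_on {a<..<b}) f" and h: "continuous_on UNIV h"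
  shows "(\<lambda>t. h (f t)) \<in> borel_measurable (lebesgue_on {a<..<b})"
proof -
  let ?M = "lebesgue_on {a<..<b}"
  obtain s where s: "\<And>n::nat. simple_function ?M (s n)" and lim: "AE x in ?M. (\<lambda>n. s n x) \<longlonglongrightarrow> f x"
    using f by (auto simp: strongly_measurable_def)
  obtain N where N: "{x \<in> space ?M. \<not> (\<lambda>n. s n x) \<longlonglongrightarrow> f x} \<subseteq> N" "emeasure ?M N = 0" "N \<in> sets ?M"
    using AE_E[OF lim] by blast
  have [measurable]: "(\<lambda>x. h (s n x)) \<in> borel_measurable ?M" for n
    using simple_function_compose[OF s[of n], of h] by (intro borel_measurable_simple_function) (simp add: o_def)
  have [measurable]: "N \<in> sets ?M" by fact
  define g where "g x = (if x \<in> N then 0 else h (f x))" for x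
  have "g \<in> borel_measurable ?M"
  proof (rule borel_measurable_LIMSEQ_metric)
    show "(\<lambda>x. if x \<in> N then 0 else h (s n x)) \<in> borel_measurable ?M" for n by measurable
    show "(\<lambda>n. if x \<in> N then 0 else h (s n x)) \<longlonglongrightarrow> g x" if "x \<in> space ?M" for x
    proof (cases "x \<in> N")
      case False
      then have "(\<lambda>n. s n x) \<longlonglongrightarrow> f x" using N(1) that by blast
      then show ?thesis using False by (simp add: g_def continuous_on_tendsto_compose[OF h])
    qed (simp add: g_def)
  qed
  then have "g measurable_on {a<..<b}" by (subst measurable_on_iff_borel_measurable) auto
  moreover have "negligible N"
    using N(2,3) by (auto simp: negligible_iff_null_sets null_sets_def emeasure_restrict_space sets_restrict_space)
  ultimately have "(\<lambda>t. h (f t)) measurable_on {a<..<b}"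
    by (rule measurable_on_spike) (auto simp: g_def)
  then show ?thesis by (subst measurable_on_iff_borel_measurable[symmetric]) auto
qed

lemma L2_comp_integrable:
  fixes h :: "'a::real_normed_vector \<Rightarrow> 'b::euclidean_space" and a b :: real
  assumes f: "f \<in> L2 {a<..<b}" and h: "continuous_on UNIV h" and K: "\<And>v. norm (h v) \<le> K * norm v"
  shows "integrable (lebesgue_on {a<..<b}) (\<lambda>t. (norm (h (f t)))\<^sup>2)" "integrable (lebesgue_on {a<..<b}) (\<lambda>t. h (f t))"
proof -
  let ?M = "lebesgue_on {a<..<b}"
  interpret M: finite_measure ?M by (rule finite_measure_lebesgue_on) simp
  have [measurable]: "(\<lambda>t. h (f t)) \<in> borel_measurable ?M"
    using f by (intro strongly_measurable_continuous_comp[OF _ h]) (simp add: L2_def)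
  have i: "integrable ?M (\<lambda>t. (norm (f t))\<^sup>2)" using f by (simp add: L2_def)
  show sq: "integrable ?M (\<lambda>t. (norm (h (f t)))\<^sup>2)"
  proof (rule Bochner_Integration.integrable_bound[OF integrable_mult_right[OF i, of "K\<^sup>2"]])
    show "AE t in ?M. norm ((norm (h (f t)))\<^sup>2) \<le> norm (K\<^sup>2 * (norm (f t))\<^sup>2)"
    proof (rule AE_I2)
      fix t
      have "(norm (h (f t)))\<^sup>2 \<le> (K * norm (f t))\<^sup>2" by (intro power_mono K) simp
      then show "norm ((norm (h (f t)))\<^sup>2) \<le> norm (K\<^sup>2 * (norm (f t))\<^sup>2)" by (simp add: power_mult_distrib)
    qed
  qed measurable
  have "integrable ?M (\<lambda>t. 1 + (norm (h (f t)))\<^sup>2)" using sq by simp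
  then show "integrable ?M (\<lambda>t. h (f t))"
  proof (rule Bochner_Integration.integrable_bound)
    show "AE t in ?M. norm (h (f t)) \<le> norm (1 + (norm (h (f t)))\<^sup>2)"
    proof (rule AE_I2)
      fix t
      have "2 * norm (h (f t)) \<le> (norm (h (f t)))\<^sup>2 + 1"
        using sum_squares_bound[of "norm (h (f t))" 1] by simp
      then have "norm (h (f t)) \<le> 1 + (norm (h (f t)))\<^sup>2"
        using norm_ge_zero[of "h (f t)"] by linarith
      then show "norm (h (f t)) \<le> norm (1 + (norm (h (f t)))\<^sup>2)" by simp
    qed
  qed measurable
qed

lemma bounded_linear_coef_vincl: "bounded_linear (\<lambda>v. coef (vincl v) n)"
  unfolding coef_def
  by (rule bounded_linear_compose[OF bounded_linear_hinner])
     (rule bounded_linear_intro[where K = 1], auto simp: norm_vincl_le)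

lemma norm_coef_le: "norm (coef f n) \<le> norm f"
  using norm_hinner_le[of f "eig_h n"] by (simp add: coef_def norm_eig_h)

lemma coef_vincl_integrable:
  assumes "w \<in> L2 {a<..<b}"
  shows "integrable (lebesgue_on {a<..<b}) (\<lambda>t. coef (vincl (w t)) n)"
  by (rule L2_comp_integrable(2)[OF assms, where K = 1])
     (auto intro!: linear_continuous_on bounded_linear_coef_vincl order_trans[OF norm_coef_le norm_vincl_le])

lemma bounded_linear_coef: "bounded_linear (\<lambda>f. coef f n)"
  unfolding coef_def by (rule bounded_linear_hinner)

lemma trace_op_nth: "trace_op v $ 1 = vrepr v 0" "trace_op v $ 2 = vrepr v pi"
  by (simp_all add: trace_op_def)

lemma vrepr_scaleR: "x \<in> {0..pi} \<Longrightarrow> vrepr (r *\<^sub>R v) x = of_real r * vrepr v x"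
  by (simp add: scaleR_vsp_def vrepr_scaleC)

lemma bounded_linear_trace_op: "bounded_linear trace_op"
proof -
  obtain K where K: "K > 0" "\<And>v. norm (vrepr v 0) \<le> K * norm v" "\<And>v. norm (vrepr v pi) \<le> K * norm v"
    using trace_norm_bound by blast
  show ?thesis
  proof (rule bounded_linear_intro[where K = "2 * K"])
    show "trace_op (u + v) = trace_op u + trace_op v" for u v
      by (simp add: vec_eq_iff forall_2 trace_op_nth vrepr_add)
    show "trace_op (r *\<^sub>R v) = r *\<^sub>R trace_op v" for r v
      by (simp add: vec_eq_iff forall_2 trace_op_nth vrepr_scaleR scaleR_conv_of_real[of r "vrepr v _"])
    show "norm (trace_op v) \<le> norm v * (2 * K)" for v
    proof -
      have "norm (trace_op v) \<le> (\<Sum>i\<in>UNIV. norm (trace_op v $ i))"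
        unfolding norm_vec_def by (rule L2_set_le_sum) simp
      also have "\<dots> \<le> 2 * (K * norm v)"
        using K(2)[of v] K(3)[of v] by (simp add: sum_2 trace_op_nth)
      finally show ?thesis by (simp add: mult_ac)
    qed
  qed
qed

lemma norm_cinner2_le: "norm (cinner2 x y) \<le> norm x * norm y"
proof -
  have "norm (cinner2 x y) \<le> (\<Sum>i\<in>UNIV. \<bar>norm (x $ i)\<bar> * \<bar>norm (y $ i)\<bar>)"
    unfolding cinner2_def by (rule order_trans[OF norm_sum]) (simp add: norm_mult)
  also have "\<dots> \<le> norm x * norm y"
    unfolding norm_vec_def by (rule L2_set_mult_ineq)
  finally show ?thesis .
qed

definition forcing :: "(real \<Rightarrow> complex^2^2) \<Rightarrow> (real \<Rightarrow> vsp) \<Rightarrow> nat \<Rightarrow> real \<Rightarrow> complex" where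
  "forcing \<Gamma> w n t = cinner2 (\<Gamma> t *v trace_op (w t)) (trace_op (eig_v n))"

lemma norm_forcing_le:
  assumes "onorm ((*v) (\<Gamma> t)) \<le> \<mu>"
  shows "norm (forcing \<Gamma> w n t) \<le> \<mu> * norm (trace_op (w t)) * norm (trace_op (eig_v n))"
proof -
  have bl: "bounded_linear ((*v) (\<Gamma> t))"
    by (rule linear_conv_bounded_linear[THEN iffD1])
       (auto intro!: linearI simp: matrix_vector_right_distrib vec_eq_iff matrix_vector_mult_def scaleR_conv_of_real sum_distrib_left mult_ac)
  have "norm (\<Gamma> t *v trace_op (w t)) \<le> onorm ((*v) (\<Gamma> t)) * norm (trace_op (w t))" by (rule onorm[OF bl])
  also have "\<dots> \<le> \<mu> * norm (trace_op (w t))" using assms by (intro mult_right_mono) auto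
  finally have "norm (\<Gamma> t *v trace_op (w t)) * norm (trace_op (eig_v n)) \<le> \<mu> * norm (trace_op (w t)) * norm (trace_op (eig_v n))"
    by (rule mult_right_mono) simp
  then show ?thesis unfolding forcing_def using norm_cinner2_le order_trans by blast
qed

lemma trace_op_integrable:
  assumes "w \<in> L2 {a<..<b}"
  shows "integrable (lebesgue_on {a<..<b}) (\<lambda>t. (norm (trace_op (w t)))\<^sup>2)"
    "integrable (lebesgue_on {a<..<b}) (\<lambda>t. trace_op (w t))"
proof -
  obtain K where K: "\<And>v. norm (trace_op v) \<le> norm v * K" using bounded_linear.bounded[OF bounded_linear_trace_op] by blast
  have c: "continuous_on UNIV trace_op" by (rule linear_continuous_on[OF bounded_linear_trace_op])
  show "integrable (lebesgue_on {a<..<b}) (\<lambda>t. (norm (trace_op (w t)))\<^sup>2)"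
    "integrable (lebesgue_on {a<..<b}) (\<lambda>t. trace_op (w t))"
    by (rule L2_comp_integrable[OF assms c, where K = K], use K in \<open>simp add: mult.commute\<close>)+
qed

lemma forcing_integrable:
  assumes w: "w \<in> L2 {a<..<b}" and \<Gamma>: "\<Gamma> \<in> borel_measurable (lebesgue_on {a<..<b})"
    and \<mu>: "AE t in lebesgue_on {a<..<b}. onorm ((*v) (\<Gamma> t)) \<le> \<mu>"
  shows "integrable (lebesgue_on {a<..<b}) (forcing \<Gamma> w n)"
proof -
  let ?M = "lebesgue_on {a<..<b}"
  have tr [measurable]: "(\<lambda>t. trace_op (w t)) \<in> borel_measurable ?M"
    using trace_op_integrable(2)[OF w] by simp
  have nth: "(\<lambda>x::'b::euclidean_space^2. x $ i) \<in> borel_measurable borel" for i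
    by (intro borel_measurable_continuous_onI continuous_intros)
  have [measurable]: "(\<lambda>t. trace_op (w t) $ i) \<in> borel_measurable ?M" for i
    by (rule measurable_compose[OF tr nth])
  have [measurable]: "(\<lambda>t. \<Gamma> t $ i $ j) \<in> borel_measurable ?M" for i j
    by (rule measurable_compose[OF measurable_compose[OF \<Gamma> nth] nth])
  have "forcing \<Gamma> w n = (\<lambda>t. \<Sum>i\<in>UNIV. (\<Sum>j\<in>UNIV. \<Gamma> t $ i $ j * trace_op (w t) $ j) * cnj (trace_op (eig_v n) $ i))"
    by (simp add: forcing_def cinner2_def matrix_vector_mult_def fun_eq_iff)
  then have [measurable]: "forcing \<Gamma> w n \<in> borel_measurable ?M" by simp
  show ?thesis
  proof (rule Bochner_Integration.integrable_bound)
    show "integrable ?M (\<lambda>t. \<mu> * norm (trace_op (w t)) * norm (trace_op (eig_v n)))"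
      using trace_op_integrable(2)[OF w] by simp
    show "AE t in ?M. norm (forcing \<Gamma> w n t) \<le> norm (\<mu> * norm (trace_op (w t)) * norm (trace_op (eig_v n)))"
      using \<mu>
    proof (rule eventually_mono)
      fix t assume "onorm ((*v) (\<Gamma> t)) \<le> \<mu>"
      from norm_forcing_le[where \<Gamma> = \<Gamma> and t = t and \<mu> = \<mu>, OF this, of w n]
      show "norm (forcing \<Gamma> w n t) \<le> norm (\<mu> * norm (trace_op (w t)) * norm (trace_op (eig_v n)))" by simp
    qed
  qed measurable
qed

text \<open>The integrating factor of a first-order equation, moved onto the test function.\<close>

lemma weak_derivative_exp:
  fixes u g :: "real \<Rightarrow> complex"
  assumes u: "integrable (lebesgue_on {a<..<b}) u" and g: "integrable (lebesgue_on {a<..<b}) g"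
    and w: "\<And>\<eta>::real \<Rightarrow> real. \<eta> \<in> Cc_smooth {a<..<b} \<Longrightarrow>
      (LINT x|lebesgue_on {a<..<b}. u x * of_real (deriv \<eta> x)) = - (LINT x|lebesgue_on {a<..<b}. g x * of_real (\<eta> x))"
    and \<eta>: "\<eta> \<in> Cc_smooth {a<..<b}"
  shows "(LINT x|lebesgue_on {a<..<b}. (u x * of_real (exp (k * x))) * of_real (deriv \<eta> x)) =
     - (LINT x|lebesgue_on {a<..<b}. ((g x + of_real k * u x) * of_real (exp (k * x))) * of_real (\<eta> x))"
proof -
  let ?M = "lebesgue_on {a<..<b}"
  define \<xi> where "\<xi> x = exp (k * x) * \<eta> x" for x
  have \<xi>: "\<xi> \<in> Cc_smooth {a<..<b}" unfolding \<xi>_def using Cc_smooth_exp_mult[OF \<eta>] .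
  have d: "deriv \<xi> x = k * \<xi> x + exp (k * x) * deriv \<eta> x" for x
    unfolding \<xi>_def by (rule DERIV_imp_deriv) (auto intro!: derivative_eq_intros Cc_smooth_DERIV[OF \<eta>])
  have cx: "continuous_on {a..b} (\<lambda>x. complex_of_real (\<xi> x))" by (intro continuous_intros Cc_smooth_continuous[OF \<xi>])
  have cd: "continuous_on {a..b} (\<lambda>x. complex_of_real (exp (k * x) * deriv \<eta> x))"
    by (intro continuous_intros Cc_smooth_continuous[OF Cc_smooth_deriv[OF \<eta>]])
  note i = continuous_times_integrable[OF u cx] continuous_times_integrable[OF g cx] continuous_times_integrable[OF u cd]
  have "(LINT x|?M. (u x * of_real (exp (k * x))) * of_real (deriv \<eta> x)) = (LINT x|?M. u x * of_real (exp (k * x) * deriv \<eta> x))"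
    by (intro Bochner_Integration.integral_cong) auto
  also have "\<dots> = (LINT x|?M. u x * of_real (deriv \<xi> x) - of_real k * (u x * of_real (\<xi> x)))"
    by (intro Bochner_Integration.integral_cong) (auto simp: d algebra_simps)
  also have "\<dots> = (LINT x|?M. u x * of_real (deriv \<xi> x)) - of_real k * (LINT x|?M. u x * of_real (\<xi> x))"
  proof -
    have "integrable ?M (\<lambda>x. u x * of_real (deriv \<xi> x))"
      by (rule continuous_times_integrable[OF u]) (intro continuous_intros Cc_smooth_continuous[OF Cc_smooth_deriv[OF \<xi>]])
    then show ?thesis using i(1) by simp
  qed
  also have "\<dots> = - ((LINT x|?M. g x * of_real (\<xi> x)) + of_real k * (LINT x|?M. u x * of_real (\<xi> x)))"
    using w[OF \<xi>] by simp
  also have "(LINT x|?M. g x * of_real (\<xi> x)) + of_real k * (LINT x|?M. u x * of_real (\<xi> x)) =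
     (LINT x|?M. g x * of_real (\<xi> x) + of_real k * (u x * of_real (\<xi> x)))"
    using i(1,2) by simp
  also have "\<dots> = (LINT x|?M. ((g x + of_real k * u x) * of_real (exp (k * x))) * of_real (\<eta> x))"
    by (intro Bochner_Integration.integral_cong) (auto simp: \<xi>_def algebra_simps)
  finally show ?thesis .
qed

text \<open>The variance of \<open>y\<close> is nonnegative.\<close>

lemma integral_power2_le:
  fixes y :: "real \<Rightarrow> real"
  assumes "y integrable_on {s..t}" "(\<lambda>x. (y x)\<^sup>2) integrable_on {s..t}" "s < t"
  shows "(integral {s..t} y)\<^sup>2 \<le> (t - s) * integral {s..t} (\<lambda>x. (y x)\<^sup>2)"
proof -
  define c where "c = integral {s..t} y / (t - s)"
  have c: "integral {s..t} y = c * (t - s)" using assms(3) by (simp add: c_def)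
  have "((\<lambda>x. (y x)\<^sup>2 - 2 * c * y x + c\<^sup>2) has_integral
      (integral {s..t} (\<lambda>x. (y x)\<^sup>2) - 2 * c * integral {s..t} y + (t - s) *\<^sub>R c\<^sup>2)) {s..t}"
    using assms has_integral_const_real[of "c\<^sup>2" s t]
    by (auto intro!: has_integral_add has_integral_diff has_integral_mult_right simp: integrable_integral)
  moreover have "0 \<le> (y x)\<^sup>2 - 2 * c * y x + c\<^sup>2" for x
    using zero_le_power2[of "y x - c"] by (simp add: power2_eq_square algebra_simps)
  ultimately have "0 \<le> integral {s..t} (\<lambda>x. (y x)\<^sup>2) - 2 * c * integral {s..t} y + (t - s) *\<^sub>R c\<^sup>2"
    by (rule has_integral_nonneg)
  then have "(t - s) * c\<^sup>2 \<le> integral {s..t} (\<lambda>x. (y x)\<^sup>2)"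
    unfolding c by (simp add: power2_eq_square algebra_simps)
  then have "(t - s) * ((t - s) * c\<^sup>2) \<le> (t - s) * integral {s..t} (\<lambda>x. (y x)\<^sup>2)"
    using assms(3) by (intro mult_left_mono) auto
  then show ?thesis unfolding c by (simp add: power2_eq_square algebra_simps)
qed

lemma h_weak_deriv_coef:
  assumes "h_weak_deriv J w w1" "\<eta> \<in> Cc_smooth J"
  shows "(LINT t|lebesgue_on J. coef (w t) n * of_real (deriv \<eta> t)) = - (LINT t|lebesgue_on J. coef (w1 t) n * of_real (\<eta> t))"
  using assms unfolding h_weak_deriv_def coef_def by (metis (no_types, lifting) Bochner_Integration.integral_cong mult.commute)

text \<open>The continuous representative: by Parseval, the coefficients inherit from their weak derivatives that
  \<open>w\<close> is Hoelder continuous of order \<open>1/2\<close> on a set of full measure; extend by uniform continuity.\<close>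

lemma continuous_representative:
  fixes w :: "real \<Rightarrow> vsp"
  assumes ab: "a < b" and w: "w \<in> L2 {a<..<b}" and w1: "w1 \<in> L2 {a<..<b}"
    and d: "h_weak_deriv {a<..<b} (\<lambda>t. vincl (w t)) w1"
  shows "\<exists>u. continuous_on {a..b} u \<and> (AE t in lebesgue_on {a<..<b}. vincl (w t) = u t)"
proof -
  let ?M = "lebesgue_on {a<..<b}"
  have iu: "integrable ?M (\<lambda>t. coef (vincl (w t)) n)" for n
    by (rule coef_vincl_integrable[OF w])
  have cc: "continuous_on UNIV (\<lambda>f. coef f n)" for n by (rule linear_continuous_on[OF bounded_linear_coef])
  have iv: "integrable ?M (\<lambda>t. coef (w1 t) n)" for n
    by (rule L2_comp_integrable(2)[OF w1 cc, where K = 1]) (simp add: norm_coef_le)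
  have iv2: "integrable ?M (\<lambda>t. (norm (coef (w1 t) n))\<^sup>2)" for n
    by (rule L2_comp_integrable(1)[OF w1 cc, where K = 1]) (simp add: norm_coef_le)
  have "\<exists>c. AE t in ?M. coef (vincl (w t)) n = c + integral {a..t} (\<lambda>t. coef (w1 t) n)" for n
    by (rule weak_derivative_imp_indefinite_integral[OF ab iu iv h_weak_deriv_coef[OF d]])
  then obtain c where c: "\<And>n. AE t in ?M. coef (vincl (w t)) n = c n + integral {a..t} (\<lambda>t. coef (w1 t) n)" by metis
  define E where "E = {t\<in>{a<..<b}. \<forall>n. coef (vincl (w t)) n = c n + integral {a..t} (\<lambda>t. coef (w1 t) n)}"
  have aeE: "AE t in ?M. t \<in> E"
  proof -
    have "AE t in ?M. \<forall>n. coef (vincl (w t)) n = c n + integral {a..t} (\<lambda>t. coef (w1 t) n)"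
      using c by (simp add: AE_all_countable)
    then show ?thesis using AE_space by eventually_elim (simp add: E_def)
  qed
  define K where "K = (LINT t|?M. (norm (w1 t))\<^sup>2)"
  have i1: "integrable ?M (\<lambda>t. (norm (w1 t))\<^sup>2)" using w1 by (simp add: L2_def)
  have K0: "K \<ge> 0" unfolding K_def by (intro integral_nonneg_AE) simp
  have real_hk: "y integrable_on {s..t}" "integral {s..t} y \<le> integral\<^sup>L ?M y"
    if "integrable ?M y" "\<And>x. y x \<ge> 0" "a \<le> s" "t \<le> b" for y :: "real \<Rightarrow> real" and s t
  proof -
    have i: "integrable ?M (\<lambda>x. complex_of_real (y x))" using that(1) by simp
    have "Re \<circ> (\<lambda>x. complex_of_real (y x)) integrable_on {a..b}"
      by (rule integrable_linear[OF integrable_lebesgue_on_open_interval(3)[OF i]]) (rule bounded_linear_Re)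
    then have yab: "y integrable_on {a..b}" by (simp add: o_def)
    then show yst: "y integrable_on {s..t}" by (rule integrable_on_subinterval_real') (use that in auto)
    have "integral {s..t} y \<le> integral {a..b} y"
      by (rule integral_subset_le) (use that yab yst in auto)
    also have "\<dots> = integral {a<..<b} y" by (simp add: integral_open_interval_real)
    also have "\<dots> = integral\<^sup>L ?M y" by (rule lebesgue_integral_eq_integral[OF that(1), symmetric]) simp
    finally show "integral {s..t} y \<le> integral\<^sup>L ?M y" .
  qed
  have hoelder: "(norm (vincl (w t) - vincl (w s)))\<^sup>2 \<le> K * (t - s)" if st: "s \<in> E" "t \<in> E" "s < t" for s t
  proof (rule LIMSEQ_le_const2[OF parseval])
    have ast: "a < s" "t < b" using st by (auto simp: E_def)
    have cbound: "(norm (coef (vincl (w t) - vincl (w s)) n))\<^sup>2 \<le> (t - s) * integral {s..t} (\<lambda>x. (norm (coef (w1 x) n))\<^sup>2)" for n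
    proof -
      let ?v = "\<lambda>x. coef (w1 x) n"
      have vab: "?v integrable_on {a..b}" by (rule integrable_lebesgue_on_open_interval(3)[OF iv])
      have "integral {a..s} ?v + integral {s..t} ?v = integral {a..t} ?v"
        by (rule Henstock_Kurzweil_Integration.integral_combine)
           (use ast st(3) in \<open>auto intro: integrable_on_subinterval_real'[OF vab]\<close>)
      then have "coef (vincl (w t) - vincl (w s)) n = integral {s..t} ?v"
        using st(1,2) by (simp add: coef_def hinner_diff_left E_def) (simp add: algebra_simps)
      also have "norm \<dots> \<le> integral {s..t} (\<lambda>x. norm (?v x))"
        by (rule integral_norm_bound_integral)
           (use ast integrable_on_subinterval_real'[OF vab, of s t] real_hk(1)[OF integrable_norm[OF iv]] in auto)
      finally have "(norm (coef (vincl (w t) - vincl (w s)) n))\<^sup>2 \<le> (integral {s..t} (\<lambda>x. norm (?v x)))\<^sup>2"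
        by (intro power_mono) auto
      also have "\<dots> \<le> (t - s) * integral {s..t} (\<lambda>x. (norm (?v x))\<^sup>2)"
        by (rule integral_power2_le) (use ast st(3) real_hk(1)[OF integrable_norm[OF iv]] real_hk(1)[OF iv2] in auto)
      finally show ?thesis .
    qed
    show "\<exists>N. \<forall>m\<ge>N. (\<Sum>n\<le>m. (norm (coef (vincl (w t) - vincl (w s)) n))\<^sup>2) \<le> K * (t - s)"
    proof (intro exI allI impI)
      fix m
      have "(\<Sum>n\<le>m. (norm (coef (vincl (w t) - vincl (w s)) n))\<^sup>2) \<le>
          (\<Sum>n\<le>m. (t - s) * (LINT x|?M. (norm (coef (w1 x) n))\<^sup>2))"
      proof (rule sum_mono)
        fix n
        have "(t - s) * integral {s..t} (\<lambda>x. (norm (coef (w1 x) n))\<^sup>2) \<le> (t - s) * (LINT x|?M. (norm (coef (w1 x) n))\<^sup>2)"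
          using st(3) ast real_hk(2)[OF iv2] by (intro mult_left_mono) auto
        then show "(norm (coef (vincl (w t) - vincl (w s)) n))\<^sup>2 \<le> (t - s) * (LINT x|?M. (norm (coef (w1 x) n))\<^sup>2)"
          using cbound[of n] by linarith
      qed
      also have "\<dots> = (t - s) * (LINT x|?M. (\<Sum>n\<le>m. (norm (coef (w1 x) n))\<^sup>2))"
        using iv2 by (simp add: sum_distrib_left)
      also have "\<dots> \<le> (t - s) * K"
        unfolding K_def using st(3) iv2 i1
        by (intro mult_left_mono integral_mono) (auto intro: bessel_inequality)
      finally show "(\<Sum>n\<le>m. (norm (coef (vincl (w t) - vincl (w s)) n))\<^sup>2) \<le> K * (t - s)" by (simp add: mult.commute)
    qed
  qed
  have "uniformly_continuous_on E (\<lambda>t. vincl (w t))"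
    unfolding uniformly_continuous_on_def
  proof (intro allI impI)
    fix e :: real assume e: "e > 0"
    define r where "r = e\<^sup>2 / (K + 1)"
    have r: "r > 0" using e K0 by (simp add: r_def add_nonneg_pos)
    have main: "norm (vincl (w t) - vincl (w s)) < e" if "s \<in> E" "t \<in> E" "s < t" "t - s < r" for s t
    proof -
      have "(norm (vincl (w t) - vincl (w s)))\<^sup>2 \<le> K * (t - s)" by (rule hoelder) (use that in auto)
      also have "\<dots> < (K + 1) * r" using that K0 by (intro mult_strict_mono') auto
      also have "\<dots> = e\<^sup>2" using K0 by (simp add: r_def)
      finally show ?thesis using e by (meson less_imp_le power2_less_imp_less)
    qed
    show "\<exists>d>0. \<forall>x\<in>E. \<forall>x'\<in>E. dist x' x < d \<longrightarrow> dist (vincl (w x')) (vincl (w x)) < e"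
    proof (intro exI[of _ r] conjI ballI impI r)
      fix x x' assume x: "x \<in> E" "x' \<in> E" "dist x' x < r"
      consider "x < x'" | "x' < x" | "x = x'" by linarith
      then show "dist (vincl (w x')) (vincl (w x)) < e"
        by cases (use x main[of x x'] main[of x' x] e in \<open>auto simp: dist_norm norm_minus_commute\<close>)
    qed
  qed
  then obtain g where g: "uniformly_continuous_on (closure E) g" "\<And>x. x \<in> E \<Longrightarrow> vincl (w x) = g x"
    by (rule uniformly_continuous_on_extension_on_closure) blast
  have "{a..b} \<subseteq> closure E"
  proof
    fix x assume "x \<in> {a..b}"
    from AE_interval_dense[OF aeE ab this] show "x \<in> closure E" by (auto simp: closure_sequential)
  qed
  then have "continuous_on {a..b} g"
    using uniformly_continuous_imp_continuous[OF g(1)] continuous_on_subset by blast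
  moreover have "AE t in ?M. vincl (w t) = g t" using aeE by (rule eventually_mono) (rule g(2))
  ultimately show ?thesis by blast
qed

lemma h_crep_props:
  assumes ab: "a < b" and ws: "weak_solution {a<..<b} \<Gamma> w"
  shows "continuous_on {a..b} (h_crep {a<..<b} w)" "AE t in lebesgue_on {a<..<b}. vincl (w t) = h_crep {a<..<b} w t"
proof -
  have cl: "closure {a<..<b} = {a..b}" using ab by (rule closure_greaterThanLessThan)
  obtain w1 where "w \<in> L2 {a<..<b}" "w1 \<in> L2 {a<..<b}" "h_weak_deriv {a<..<b} (\<lambda>t. vincl (w t)) w1"
    using ws by (auto simp: weak_solution_def)
  from continuous_representative[OF ab this]
  have "continuous_on (closure {a<..<b}) (h_crep {a<..<b} w) \<and> (AE t in lebesgue_on {a<..<b}. vincl (w t) = h_crep {a<..<b} w t)"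
    unfolding h_crep_def cl by (rule someI_ex)
  then show "continuous_on {a..b} (h_crep {a<..<b} w)" "AE t in lebesgue_on {a<..<b}. vincl (w t) = h_crep {a<..<b} w t"
    by (auto simp: cl)
qed

text \<open>The weak form, tested with a scalar test function times an eigenfunction. Here \<open>v\<close> is the coefficient of
  the time derivative.\<close>

lemma weak_solution_coef:
  assumes ab: "a < b" and ws: "weak_solution {a<..<b} \<Gamma> w"
    and \<Gamma>: "\<Gamma> \<in> borel_measurable (lebesgue_on {a<..<b})"
    and \<mu>: "AE t in lebesgue_on {a<..<b}. onorm ((*v) (\<Gamma> t)) \<le> \<mu>"
  shows "\<exists>v. integrable (lebesgue_on {a<..<b}) v \<and>
    (\<forall>\<eta>::real \<Rightarrow> real. \<eta> \<in> Cc_smooth {a<..<b} \<longrightarrow>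
      (LINT t|lebesgue_on {a<..<b}. coef (vincl (w t)) n * of_real (deriv \<eta> t)) =
        - (LINT t|lebesgue_on {a<..<b}. v t * of_real (\<eta> t)) \<and>
      (LINT t|lebesgue_on {a<..<b}. v t * of_real (deriv \<eta> t)) =
        - (LINT t|lebesgue_on {a<..<b}. (of_real (eigval n) * coef (vincl (w t)) n + forcing \<Gamma> w n t - v t) * of_real (\<eta> t)))"
proof -
  let ?M = "lebesgue_on {a<..<b}"
  from ws obtain w1 w2 where w: "w \<in> L2 {a<..<b}" and w1: "w1 \<in> L2 {a<..<b}"
    and d1: "h_weak_deriv {a<..<b} (\<lambda>t. vincl (w t)) w1" and w2: "w2 \<in> L2 {a<..<b}"
    and d2: "vdual_weak_deriv {a<..<b} w1 w2"
    and eq: "\<And>\<psi>::real \<Rightarrow> vsp. \<psi> \<in> Cc_smooth {a<..<b} \<Longrightarrow>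
          (LINT t|?M. blinfun_apply (w2 t) (\<psi> t) + hinner (w1 t) (vincl (\<psi> t)) - a0 (w t) (\<psi> t)
             - cinner2 (\<Gamma> t *v trace_op (w t)) (trace_op (\<psi> t))) = 0"
    unfolding weak_solution_def by blast
  let ?u = "\<lambda>t. coef (vincl (w t)) n" and ?v = "\<lambda>t. coef (w1 t) n" and ?z = "\<lambda>t. blinfun_apply (w2 t) (eig_v n)"
  have iu: "integrable ?M ?u"
    by (rule coef_vincl_integrable[OF w])
  have iv: "integrable ?M ?v"
    by (rule L2_comp_integrable(2)[OF w1 linear_continuous_on[OF bounded_linear_coef], where K = 1]) (simp add: norm_coef_le)
  have iz: "integrable ?M ?z"
    by (rule L2_comp_integrable(2)[OF w2, where K = "norm (eig_v n)"])
       (auto intro!: linear_continuous_on blinfun.bounded_linear_left simp: mult.commute[of "norm (eig_v n)"] norm_blinfun)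
  have frc: "integrable ?M (forcing \<Gamma> w n)" by (rule forcing_integrable[OF w \<Gamma> \<mu>])
  show ?thesis
  proof (intro exI[of _ ?v] conjI iv allI impI)
    fix \<eta> :: "real \<Rightarrow> real" assume \<eta>: "\<eta> \<in> Cc_smooth {a<..<b}"
    show "(LINT t|?M. ?u t * of_real (deriv \<eta> t)) = - (LINT t|?M. ?v t * of_real (\<eta> t))"
      by (rule h_weak_deriv_coef[OF d1 \<eta>])
    have c: "continuous_on {a..b} (\<lambda>t. complex_of_real (\<eta> t))" by (intro continuous_intros Cc_smooth_continuous[OF \<eta>])
    note i = continuous_times_integrable[OF iu c] continuous_times_integrable[OF iv c] continuous_times_integrable[OF iz c]
      continuous_times_integrable[OF frc c]
    have "0 = (LINT t|?M. blinfun_apply (w2 t) (\<eta> t *\<^sub>R eig_v n) + hinner (w1 t) (vincl (\<eta> t *\<^sub>R eig_v n)) - a0 (w t) (\<eta> t *\<^sub>R eig_v n)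
             - cinner2 (\<Gamma> t *v trace_op (w t)) (trace_op (\<eta> t *\<^sub>R eig_v n)))"
      by (rule eq[OF Cc_smooth_scaleR[OF \<eta>], symmetric])
    also have "\<dots> = (LINT t|?M. ?z t * of_real (\<eta> t) + ?v t * of_real (\<eta> t) - of_real (eigval n) * (?u t * of_real (\<eta> t))
             - forcing \<Gamma> w n t * of_real (\<eta> t))"
    proof (intro Bochner_Integration.integral_cong refl arg_cong2[of _ _ _ _ "(-)"] arg_cong2[of _ _ _ _ "(+)"])
      fix t
      show "blinfun_apply (w2 t) (\<eta> t *\<^sub>R eig_v n) = ?z t * of_real (\<eta> t)"
        by (simp add: blinfun.scaleR_right scaleR_conv_of_real mult.commute)
      show "hinner (w1 t) (vincl (\<eta> t *\<^sub>R eig_v n)) = ?v t * of_real (\<eta> t)"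
        by (simp add: hinner_scaleR_right coef_def mult.commute)
      have "a0 (w t) (\<eta> t *\<^sub>R eig_v n) = of_real (\<eta> t) * a0 (w t) (eig_v n)"
        by (simp add: a0_def hinner_scaleR_right)
      then show "a0 (w t) (\<eta> t *\<^sub>R eig_v n) = of_real (eigval n) * (?u t * of_real (\<eta> t))"
        by (simp add: a0_eig_v)
      have "trace_op (\<eta> t *\<^sub>R eig_v n) = \<eta> t *\<^sub>R trace_op (eig_v n)"
        using bounded_linear_trace_op by (simp add: bounded_linear.linear linear_scale)
      then show "cinner2 (\<Gamma> t *v trace_op (w t)) (trace_op (\<eta> t *\<^sub>R eig_v n)) = forcing \<Gamma> w n t * of_real (\<eta> t)"
        by (simp add: forcing_def cinner2_def sum_2 scaleR_conv_of_real[of "\<eta> t" "trace_op (eig_v n) $ _"] algebra_simps)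
    qed
    also have "\<dots> = (LINT t|?M. ?z t * of_real (\<eta> t)) -
        (LINT t|?M. (of_real (eigval n) * ?u t + forcing \<Gamma> w n t - ?v t) * of_real (\<eta> t))"
    proof -
      have e: "(\<lambda>t. (of_real (eigval n) * ?u t + forcing \<Gamma> w n t - ?v t) * of_real (\<eta> t)) =
          (\<lambda>t. of_real (eigval n) * (?u t * of_real (\<eta> t)) + forcing \<Gamma> w n t * of_real (\<eta> t) - ?v t * of_real (\<eta> t))"
        by (simp add: algebra_simps)
      show ?thesis unfolding e using i by simp
    qed
    finally have "(LINT t|?M. ?z t * of_real (\<eta> t)) =
        (LINT t|?M. (of_real (eigval n) * ?u t + forcing \<Gamma> w n t - ?v t) * of_real (\<eta> t))" by simp
    moreover have "(LINT t|?M. ?v t * of_real (deriv \<eta> t)) = - (LINT t|?M. ?z t * of_real (\<eta> t))"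
    proof -
      have "(LINT t|?M. of_real (deriv \<eta> t) * hinner (w1 t) (vincl (eig_v n))) = - (LINT t|?M. of_real (\<eta> t) * ?z t)"
        using d2 \<eta> unfolding vdual_weak_deriv_def by blast
      then show ?thesis by (simp add: coef_def mult.commute)
    qed
    ultimately show "(LINT t|?M. ?v t * of_real (deriv \<eta> t)) =
        - (LINT t|?M. (of_real (eigval n) * ?u t + forcing \<Gamma> w n t - ?v t) * of_real (\<eta> t))" by simp
  qed
qed

text \<open>Each coefficient solves \<open>u'' + u' - eigval n u = f\<close>, whose characteristic roots are the integers \<open>2 n\<close> and
  \<open>- (2 n + 1)\<close>. The two first-order factors \<open>u' + (2 n + 1) u\<close> and \<open>u' - 2 n u\<close> are integrated
  separately.\<close>

lemma mode_formula:
  assumes ab: "a < b" and ws: "weak_solution {a<..<b} \<Gamma> w"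
    and \<Gamma>: "\<Gamma> \<in> borel_measurable (lebesgue_on {a<..<b})"
    and \<mu>: "AE t in lebesgue_on {a<..<b}. onorm ((*v) (\<Gamma> t)) \<le> \<mu>"
  shows "\<exists>c1 c2. \<forall>t\<in>{a..b}. of_real (4 * real n + 1) * coef (h_crep {a<..<b} w t) n =
    of_real (exp (2 * real n * t)) * (c1 + integral {a..t} (\<lambda>s. forcing \<Gamma> w n s * of_real (exp (- (2 * real n) * s))))
    - of_real (exp (- (2 * real n + 1) * t)) * (c2 + integral {a..t} (\<lambda>s. forcing \<Gamma> w n s * of_real (exp ((2 * real n + 1) * s))))"
proof -
  let ?M = "lebesgue_on {a<..<b}"
  have w: "w \<in> L2 {a<..<b}" using ws by (simp add: weak_solution_def)
  let ?u = "\<lambda>t. coef (vincl (w t)) n" and ?f = "forcing \<Gamma> w n"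
  let ?l = "complex_of_real (eigval n)" and ?N = "2 * real n"
  obtain v where iv: "integrable ?M v"
    and d1: "\<And>\<eta>::real \<Rightarrow> real. \<eta> \<in> Cc_smooth {a<..<b} \<Longrightarrow>
      (LINT t|?M. ?u t * of_real (deriv \<eta> t)) = - (LINT t|?M. v t * of_real (\<eta> t))"
    and d2: "\<And>\<eta>::real \<Rightarrow> real. \<eta> \<in> Cc_smooth {a<..<b} \<Longrightarrow>
      (LINT t|?M. v t * of_real (deriv \<eta> t)) = - (LINT t|?M. (?l * ?u t + ?f t - v t) * of_real (\<eta> t))"
    using weak_solution_coef[OF ab ws \<Gamma> \<mu>, of n] by blast
  have iu: "integrable ?M ?u"
    by (rule coef_vincl_integrable[OF w])
  have if': "integrable ?M ?f" by (rule forcing_integrable[OF w \<Gamma> \<mu>])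
  \<comment> \<open>The conditions say that \<open>- r\<close> and \<open>r - 1\<close> are the characteristic roots; then \<open>v + r u\<close> solves an equation of
    first order, with the integrating factor \<open>exp (k t)\<close>.\<close>
  have main: "\<exists>c. AE t in ?M. (v t + of_real r * ?u t) * of_real (exp (k * t)) =
        c + integral {a..t} (\<lambda>s. ?f s * of_real (exp (k * s)))"
    if rk: "r + k = 1" "r * k = - eigval n" for r k :: real
  proof (rule weak_derivative_imp_indefinite_integral[OF ab])
    let ?p = "\<lambda>t. v t + of_real r * ?u t"
    let ?g = "\<lambda>t. (?l * ?u t + ?f t - v t) + of_real r * v t"
    have ip: "integrable ?M ?p" and ig: "integrable ?M ?g" using iu iv if' by simp_all
    have ce: "continuous_on {a..b} (\<lambda>x. complex_of_real (exp (c * x)))" for c by (intro continuous_intros)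
    show "integrable ?M (\<lambda>t. ?p t * of_real (exp (k * t)))" "integrable ?M (\<lambda>s. ?f s * of_real (exp (k * s)))"
      by (rule continuous_times_integrable[OF ip ce] continuous_times_integrable[OF if' ce])+
    fix \<eta> :: "real \<Rightarrow> real" assume \<eta>: "\<eta> \<in> Cc_smooth {a<..<b}"
    have dp: "(LINT t|?M. ?p t * of_real (deriv \<xi> t)) = - (LINT t|?M. ?g t * of_real (\<xi> t))"
      if \<xi>: "\<xi> \<in> Cc_smooth {a<..<b}" for \<xi> :: "real \<Rightarrow> real"
    proof -
      have c: "continuous_on {a..b} (\<lambda>t. complex_of_real (\<xi> t))" "continuous_on {a..b} (\<lambda>t. complex_of_real (deriv \<xi> t))"
        by (intro continuous_intros Cc_smooth_continuous[OF \<xi>] Cc_smooth_continuous[OF Cc_smooth_deriv[OF \<xi>]])+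
      have ih: "integrable ?M (\<lambda>t. ?l * ?u t + ?f t - v t)" using iu iv if' by simp
      have e1: "(\<lambda>t. ?p t * of_real (deriv \<xi> t)) = (\<lambda>t. v t * of_real (deriv \<xi> t) + of_real r * (?u t * of_real (deriv \<xi> t)))"
        and e2: "(\<lambda>t. ?g t * of_real (\<xi> t)) = (\<lambda>t. (?l * ?u t + ?f t - v t) * of_real (\<xi> t) + of_real r * (v t * of_real (\<xi> t)))"
        by (simp_all add: algebra_simps)
      have "(LINT t|?M. ?p t * of_real (deriv \<xi> t)) = (LINT t|?M. v t * of_real (deriv \<xi> t)) + of_real r * (LINT t|?M. ?u t * of_real (deriv \<xi> t))"
        unfolding e1 using continuous_times_integrable[OF iv c(2)] continuous_times_integrable[OF iu c(2)] by simp
      moreover have "(LINT t|?M. ?g t * of_real (\<xi> t)) = (LINT t|?M. (?l * ?u t + ?f t - v t) * of_real (\<xi> t)) + of_real r * (LINT t|?M. v t * of_real (\<xi> t))"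
        unfolding e2 using continuous_times_integrable[OF ih c(1)] continuous_times_integrable[OF iv c(1)] by simp
      ultimately show ?thesis using d1[OF \<xi>] d2[OF \<xi>] by simp
    qed
    have cancel: "?g t + of_real k * ?p t = ?f t" for t
    proof -
      have "?g t + of_real k * ?p t = ?f t + (of_real (r + k) - 1) * v t + (?l + of_real (r * k)) * ?u t"
        by (simp add: algebra_simps)
      then show ?thesis using rk by simp
    qed
    show "(LINT t|?M. ?p t * of_real (exp (k * t)) * of_real (deriv \<eta> t)) = - (LINT t|?M. ?f t * of_real (exp (k * t)) * of_real (\<eta> t))"
      using weak_derivative_exp[OF ip ig dp \<eta>, of k] by (simp only: cancel)
  qed
  obtain c1 where c1: "AE t in ?M. (v t + of_real (?N + 1) * ?u t) * of_real (exp (- ?N * t)) =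
        c1 + integral {a..t} (\<lambda>s. ?f s * of_real (exp (- ?N * s)))"
    using main[of "?N + 1" "- ?N"] by (auto simp: eigval_def algebra_simps)
  obtain c2 where c2: "AE t in ?M. (v t + of_real (- ?N) * ?u t) * of_real (exp ((?N + 1) * t)) =
        c2 + integral {a..t} (\<lambda>s. ?f s * of_real (exp ((?N + 1) * s)))"
    using main[of "- ?N" "?N + 1"] by (auto simp: eigval_def algebra_simps)
  let ?R = "\<lambda>t. of_real (exp (?N * t)) * (c1 + integral {a..t} (\<lambda>s. ?f s * of_real (exp (- ?N * s))))
    - of_real (exp (- (?N + 1) * t)) * (c2 + integral {a..t} (\<lambda>s. ?f s * of_real (exp ((?N + 1) * s))))"
  have ae: "AE t in ?M. of_real (4 * real n + 1) * coef (h_crep {a<..<b} w t) n = ?R t"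
    using c1 c2 h_crep_props(2)[OF ab ws]
  proof eventually_elim
    case (elim t)
    have e1: "of_real (exp (?N * t)) * ((v t + of_real (?N + 1) * ?u t) * of_real (exp (- ?N * t))) = v t + of_real (?N + 1) * ?u t"
    proof -
      have "exp (?N * t) * exp (- ?N * t) = 1" by (simp flip: exp_add)
      then have "complex_of_real (exp (?N * t)) * of_real (exp (- ?N * t)) = 1" by (metis of_real_1 of_real_mult)
      then show ?thesis by (simp only: mult.left_commute[of _ "v t + _"] mult_1_right)
    qed
    have e2: "of_real (exp (- (?N + 1) * t)) * ((v t + of_real (- ?N) * ?u t) * of_real (exp ((?N + 1) * t))) = v t + of_real (- ?N) * ?u t"
    proof -
      have "exp (- (?N + 1) * t) * exp ((?N + 1) * t) = 1" by (simp add: algebra_simps flip: exp_add)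
      then have "complex_of_real (exp (- (?N + 1) * t)) * of_real (exp ((?N + 1) * t)) = 1" by (metis of_real_1 of_real_mult)
      then show ?thesis by (simp only: mult.left_commute[of _ "v t + _"] mult_1_right)
    qed
    have "?R t = (v t + of_real (?N + 1) * ?u t) - (v t + of_real (- ?N) * ?u t)"
      unfolding elim(1)[symmetric] elim(2)[symmetric] e1 e2 ..
    also have "\<dots> = of_real (4 * real n + 1) * ?u t" by (simp add: algebra_simps)
    finally show ?case using elim(3) by simp
  qed
  have ce: "continuous_on {a..b} (\<lambda>x. complex_of_real (exp (c * x)))" for c by (intro continuous_intros)
  have cR: "continuous_on {a..b} ?R"
    by (intro continuous_intros indefinite_integral_continuous continuous_times_integrable[OF if' ce])
  have cL: "continuous_on {a..b} (\<lambda>t. of_real (4 * real n + 1) * coef (h_crep {a<..<b} w t) n)"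
    by (intro continuous_intros continuous_on_compose2[OF linear_continuous_on[OF bounded_linear_coef, of UNIV] h_crep_props(1)[OF ab ws]]) auto
  show ?thesis
    using continuous_AE_eq_imp_eq[OF ae ab cL cR] by blast
qed

section \<open>Sums of exponentials\<close>

lemma exp_diff_ge: "0 \<le> y \<Longrightarrow> y \<le> x \<Longrightarrow> x - y \<le> exp x - exp (y::real)"
proof -
  assume y: "0 \<le> y" "y \<le> x"
  have "x - y \<le> exp (x - y) - 1" using exp_ge_add_one_self[of "x - y"] by linarith
  then have "1 * (x - y) \<le> exp y * (exp (x - y) - 1)"
    using y by (intro mult_mono) auto
  then show ?thesis by (simp add: exp_diff algebra_simps)
qed

lemma prod_distance_ge:
  assumes "j < m"
  shows "(\<Prod>s\<in>{..<m} - {j}. \<bar>real j - real s\<bar>) = fact j * fact (m - 1 - j)"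
proof -
  have "Suc j \<le> m" using assms by simp
  then show ?thesis
  proof (induction m rule: dec_induct)
    case base
    have "{..<Suc j} - {j} = {0..<j}" by auto
    then have "(\<Prod>s\<in>{..<Suc j} - {j}. \<bar>real j - real s\<bar>) = (\<Prod>s = 0..<j. real (j - s))"
      by (simp add: of_nat_diff)
    also have "\<dots> = fact j" by (simp add: fact_prod_rev)
    finally show ?case by simp
  next
    case (step n)
    then have "{..<Suc n} - {j} = insert n ({..<n} - {j})" by auto
    moreover have "Suc n - 1 - j = Suc (n - 1 - j)" using step by simp
    ultimately show ?case using step by (simp add: of_nat_diff)
  qed
qed

text \<open>The product is \<open>fact (m - 1)\<close> over a binomial coefficient and a power of \<open>m\<close>; the exponential series gives
  \<open>m ^ m \<le> exp m * fact m\<close>.\<close>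

lemma prod_distance_lower:
  assumes "j < m"
  shows "1 \<le> 2 ^ m * exp m * (\<Prod>s\<in>{..<m} - {j}. \<bar>real j - real s\<bar> / m)"
proof -
  have m: "m > 0" using assms by simp
  have c: "card ({..<m} - {j}) = m - 1" using assms by simp
  have b: "real ((m - 1) choose j) \<le> 2 ^ (m - 1)"
    using binomial_le_pow2[of "m - 1" j] by (metis of_nat_le_iff of_nat_numeral of_nat_power)
  have f: "fact (m - 1) = fact j * fact (m - 1 - j) * real ((m - 1) choose j)"
    using binomial_fact_lemma[of j "m - 1"] assms by (metis Suc_pred' less_Suc_eq_le of_nat_fact of_nat_mult m)
  have e: "real m ^ m \<le> exp m * fact m"
  proof -
    have "(\<Sum>k\<in>{m}. real m ^ k / fact k) \<le> (\<Sum>k. real m ^ k / fact k)"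
      by (rule sum_le_suminf) (auto intro: summable_exp[of "real m", simplified inverse_eq_divide, simplified] simp: exp_converges[THEN sums_summable] divide_inverse mult.commute summable_exp)
    also have "\<dots> = exp (real m)" by (simp add: exp_def divide_inverse mult.commute)
    finally show ?thesis by (simp add: field_simps)
  qed
  have e': "real m ^ (m - 1) \<le> exp m * fact (m - 1)"
  proof -
    have "real m * real m ^ (m - 1) \<le> real m * (exp m * fact (m - 1))"
      using e m by (simp add: power_eq_if fact_num_eq_if mult_ac)
    then show ?thesis using m by simp
  qed
  have "real m ^ (m - 1) \<le> exp m * (fact j * fact (m - 1 - j) * 2 ^ (m - 1))"
    using e' b unfolding f by (meson mult_left_mono exp_ge_zero fact_ge_zero mult_nonneg_nonneg order_trans)
  also have "\<dots> \<le> exp m * (fact j * fact (m - 1 - j) * 2 ^ m)"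
    by (intro mult_left_mono power_increasing) auto
  finally have "1 \<le> 2 ^ m * exp m * ((fact j * fact (m - 1 - j)) / real m ^ (m - 1))"
    using m by (simp add: field_simps)
  also have "(fact j * fact (m - 1 - j)) / real m ^ (m - 1) = (\<Prod>s\<in>{..<m} - {j}. \<bar>real j - real s\<bar> / m)"
    using prod_distance_ge[OF assms] c by (simp add: prod_dividef)
  finally show ?thesis .
qed

text \<open>Every coefficient of a sum of exponentials with frequencies among \<open>0, \<dots>, m - 1\<close> is recovered with a loss
  exponential in \<open>m\<close>: the shift operator \<open>E - exp (s h)\<close> kills the frequency \<open>s\<close>, and applying it for
  all the other frequencies, with step \<open>h = 1 / m\<close>, isolates one coefficient.\<close>

lemma exp_sum_coeff_bound:
  fixes c :: "'i \<Rightarrow> complex" and \<epsilon> :: "'i \<Rightarrow> nat"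
  assumes I: "finite I" "inj_on \<epsilon> I" "\<epsilon> ` I \<subseteq> {..<m}" and i: "i \<in> I"
  shows "norm (c i) \<le> 48 ^ m * integral {0..1} (\<lambda>t. norm (\<Sum>i\<in>I. c i * of_real (exp (real (\<epsilon> i) * t))))"
proof -
  define j where "j = \<epsilon> i"
  have j: "j < m" using I(3) i by (auto simp: j_def)
  then have m: "m > 0" by simp
  define h where "h = 1 / real m"
  have h: "h > 0" "real m * h = 1" using m by (auto simp: h_def)
  \<comment> \<open>\<open>T S\<close> is the image of the sum under the operators that belong to the frequencies in \<open>S\<close>. Each of them shortens
    the interval by \<open>h\<close>, so an interval of length \<open>h\<close> is left after \<open>m - 1\<close> of them.\<close>
  define T where "T S t = (\<Sum>k\<in>I. c k * of_real ((\<Prod>s\<in>S. exp (real (\<epsilon> k) * h) - exp (real s * h)) * exp (real (\<epsilon> k) * t)))" for S :: "nat set" and t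
  have Tc: "continuous_on A (T S)" for A S unfolding T_def by (intro continuous_intros)
  have Ti: "(\<lambda>t. norm (T S t)) integrable_on {p..q}" for S p q
    by (intro integrable_continuous_interval continuous_intros Tc)
  define X where "X = integral {0..1} (\<lambda>t. norm (T {} t))"
  have X0: "X \<ge> 0" unfolding X_def by (rule integral_nonneg) (auto intro: Ti)
  have step: "integral {0..1 - real (card S) * h} (\<lambda>t. norm (T S t)) \<le> (\<Prod>s\<in>S. 1 + exp (real s * h)) * X"
    if "finite S" "card S \<le> m" for S
    using that
  proof (induction S rule: finite_induct)
    case empty
    then show ?case by (simp add: X_def)
  next
    case (insert s S)
    have T': "T (insert s S) t = T S (t + h) - of_real (exp (real s * h)) * T S t" for t
      unfolding T_def sum_distrib_left sum_subtractf[symmetric] using insert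
      by (intro sum.cong refl) (simp add: algebra_simps exp_add)
    define r where "r = 1 - real (card (insert s S)) * h"
    have r: "1 - real (card S) * h = r + h" using insert by (simp add: r_def algebra_simps)
    have r0: "r \<ge> 0"
    proof -
      have "real (card (insert s S)) * h \<le> real m * h" using insert.prems h by (intro mult_right_mono) auto
      then show ?thesis using h by (simp add: r_def)
    qed
    have "integral {0..r} (\<lambda>t. norm (T (insert s S) t)) \<le> integral {0..r} (\<lambda>t. norm (T S (t + h)) + exp (real s * h) * norm (T S t))"
    proof (rule integral_le)
      show "(\<lambda>t. norm (T S (t + h)) + exp (real s * h) * norm (T S t)) integrable_on {0..r}"
        by (intro integrable_continuous_interval continuous_intros Tc continuous_on_compose2[OF Tc[of UNIV S]]) auto
      show "norm (T (insert s S) t) \<le> norm (T S (t + h)) + exp (real s * h) * norm (T S t)" for t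
        unfolding T' by (rule order_trans[OF norm_triangle_ineq4]) (simp add: norm_mult)
    qed (rule Ti)
    also have "\<dots> = integral {0..r} (\<lambda>t. norm (T S (t + h))) + exp (real s * h) * integral {0..r} (\<lambda>t. norm (T S t))"
    proof -
      have "(\<lambda>t. norm (T S (t + h))) integrable_on {0..r}"
        by (intro integrable_continuous_interval continuous_intros continuous_on_compose2[OF Tc[of UNIV S]]) auto
      then show ?thesis using Ti[of S 0 r] by (subst Henstock_Kurzweil_Integration.integral_add) (auto intro: integrable_on_mult_right)
    qed
    also have "integral {0..r} (\<lambda>t. norm (T S (t + h))) = integral {0 + h..r + h} (\<lambda>t. norm (T S t))"
      using integral_shift[of 0 h r "\<lambda>t. norm (T S t)"] by (simp add: o_def continuous_on_norm[OF Tc])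
    also have "\<dots> \<le> integral {0..r + h} (\<lambda>t. norm (T S t))"
      by (rule integral_subset_le) (use h Ti in auto)
    also have "integral {0..r} (\<lambda>t. norm (T S t)) \<le> integral {0..r + h} (\<lambda>t. norm (T S t))"
      by (rule integral_subset_le) (use h Ti in auto)
    finally have "integral {0..r} (\<lambda>t. norm (T (insert s S) t)) \<le> (1 + exp (real s * h)) * integral {0..r + h} (\<lambda>t. norm (T S t))"
      by (simp add: distrib_right)
    also have "\<dots> \<le> (1 + exp (real s * h)) * ((\<Prod>s\<in>S. 1 + exp (real s * h)) * X)"
      using insert by (intro mult_left_mono) (auto simp: r[symmetric] add_nonneg_nonneg)
    finally show ?case using insert by (simp add: r_def mult.assoc)
  qed
  define S where "S = {..<m} - {j}"
  have S: "finite S" "card S = m - 1" using j by (auto simp: S_def)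
  define D where "D = (\<Prod>s\<in>S. exp (real j * h) - exp (real s * h))"
  have TS: "T S t = c i * of_real (D * exp (real j * t))" for t
  proof -
    have z: "(\<Prod>s\<in>S. exp (real (\<epsilon> k) * h) - exp (real s * h)) = 0" if "k \<in> I" "k \<noteq> i" for k
    proof (rule prod_zero[OF S(1)])
      have "\<epsilon> k \<noteq> j" using that i I(2) by (auto simp: j_def inj_on_def)
      then have "\<epsilon> k \<in> S" using that I(3) by (auto simp: S_def)
      then show "\<exists>s\<in>S. exp (real (\<epsilon> k) * h) - exp (real s * h) = 0" by (intro bexI[of _ "\<epsilon> k"]) auto
    qed
    have "T S t = (\<Sum>k\<in>I. if k = i then c i * of_real (D * exp (real j * t)) else 0)"
      unfolding T_def
    proof (intro sum.cong refl)
      fix k assume k: "k \<in> I"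
      show "c k * of_real ((\<Prod>s\<in>S. exp (real (\<epsilon> k) * h) - exp (real s * h)) * exp (real (\<epsilon> k) * t)) =
          (if k = i then c i * of_real (D * exp (real j * t)) else 0)"
      proof (cases "k = i")
        case False
        from z[OF k False] show ?thesis using False by (simp only: if_False mult_zero_left mult_zero_right of_real_0)
      qed (simp add: D_def j_def)
    qed
    then show ?thesis using I(1) i by simp
  qed
  have "h * (norm (c i) * \<bar>D\<bar>) \<le> integral {0..h} (\<lambda>t. norm (T S t))"
  proof -
    have "integral {0..h} (\<lambda>t. norm (c i) * \<bar>D\<bar>) \<le> integral {0..h} (\<lambda>t. norm (T S t))"
    proof (rule integral_le)
      fix t assume "t \<in> {0..h}"
      then have "1 \<le> exp (real j * t)" by simp
      then have "norm (c i) * \<bar>D\<bar> * 1 \<le> norm (c i) * \<bar>D\<bar> * exp (real j * t)" by (intro mult_left_mono) auto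
      then show "norm (c i) * \<bar>D\<bar> \<le> norm (T S t)" by (simp add: TS norm_mult abs_mult mult.assoc)
    qed (auto intro: Ti)
    moreover have const: "integral {0..h} (\<lambda>t. K) = h * K" for K :: real using h by simp
    ultimately show ?thesis unfolding const by blast
  qed
  also have "\<dots> \<le> (\<Prod>s\<in>S. 1 + exp (real s * h)) * X"
    using step[OF S(1)] S(2) m h by (simp add: of_nat_diff algebra_simps)
  also have "\<dots> \<le> 4 ^ m * X"
  proof (rule mult_right_mono[OF _ X0])
    have "(\<Prod>s\<in>S. 1 + exp (real s * h)) \<le> (\<Prod>s\<in>S. 4)"
    proof (rule prod_mono)
      fix s assume "s \<in> S"
      then have "real s * h \<le> real m * h" using h by (intro mult_right_mono) (auto simp: S_def)
      then have "exp (real s * h) \<le> exp 1" using h by simp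
      then have "exp (real s * h) \<le> 3" using exp_le by (rule order_trans)
      then show "0 \<le> 1 + exp (real s * h) \<and> 1 + exp (real s * h) \<le> 4"
        by (auto intro: add_nonneg_nonneg)
    qed
    also have "\<dots> \<le> 4 ^ m" using S by (simp add: power_increasing)
    finally show "(\<Prod>s\<in>S. 1 + exp (real s * h)) \<le> 4 ^ m" .
  qed
  finally have 1: "h * (norm (c i) * \<bar>D\<bar>) \<le> 4 ^ m * X" .
  have D: "(\<Prod>s\<in>S. \<bar>real j - real s\<bar> / m) \<le> \<bar>D\<bar>"
    unfolding D_def abs_prod
  proof (rule prod_mono)
    fix s
    have "\<bar>real j * h - real s * h\<bar> \<le> \<bar>exp (real j * h) - exp (real s * h)\<bar>"
    proof (cases "s \<le> j")
      case True
      then have le: "real s * h \<le> real j * h" using h by (intro mult_right_mono) auto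
      then show ?thesis using exp_diff_ge[OF _ le] h by simp
    next
      case False
      then have le: "real j * h \<le> real s * h" using h by (intro mult_right_mono) auto
      then show ?thesis using exp_diff_ge[OF _ le] h by simp
    qed
    also have "\<bar>real j * h - real s * h\<bar> = \<bar>real j - real s\<bar> / m"
      using m by (simp add: h_def abs_divide flip: diff_divide_distrib)
    finally show "0 \<le> \<bar>real j - real s\<bar> / m \<and> \<bar>real j - real s\<bar> / m \<le> \<bar>exp (real j * h) - exp (real s * h)\<bar>" by simp
  qed
  have "norm (c i) * 1 \<le> norm (c i) * (2 ^ m * exp m * \<bar>D\<bar>)"
  proof (rule mult_left_mono)
    have "1 \<le> 2 ^ m * exp m * (\<Prod>s\<in>S. \<bar>real j - real s\<bar> / m)" unfolding S_def by (rule prod_distance_lower[OF j])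
    also have "\<dots> \<le> 2 ^ m * exp m * \<bar>D\<bar>" using D by (intro mult_left_mono) auto
    finally show "1 \<le> 2 ^ m * exp m * \<bar>D\<bar>" .
  qed simp
  also have "\<dots> = 2 ^ m * exp m * (real m * (h * (norm (c i) * \<bar>D\<bar>)))"
    using h by (simp add: mult_ac)
  also have "\<dots> \<le> 2 ^ m * exp m * (real m * (4 ^ m * X))"
    using 1 by (intro mult_left_mono) auto
  also have "\<dots> \<le> 2 ^ m * 3 ^ m * (2 ^ m * (4 ^ m * X))"
  proof (intro mult_mono)
    have "exp (real m) = exp 1 ^ m" by (simp flip: exp_of_nat_mult)
    also have "\<dots> \<le> 3 ^ m" using exp_le by (intro power_mono) auto
    finally show "exp (real m) \<le> 3 ^ m" .
    show "real m \<le> 2 ^ m" using less_exp[of m] by (metis less_imp_le of_nat_le_iff of_nat_numeral of_nat_power)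
  qed (use X0 in auto)
  also have "\<dots> = 48 ^ m * X"
    by (simp flip: power_mult_distrib mult.assoc)
  finally show ?thesis by (simp add: X_def T_def)
qed

section \<open>Bounds for one coefficient\<close>

lemma real_lebesgue_on_interval:
  fixes y :: "real \<Rightarrow> real"
  assumes y: "integrable (lebesgue_on {a<..<b}) y"
  shows "a \<le> s \<Longrightarrow> t \<le> b \<Longrightarrow> y integrable_on {s..t}"
    "integral\<^sup>L (lebesgue_on {a<..<b}) y = integral {a..b} y"
proof -
  have i: "integrable (lebesgue_on {a<..<b}) (\<lambda>x. complex_of_real (y x))" using y by simp
  have "Re \<circ> (\<lambda>x. complex_of_real (y x)) integrable_on {a..b}"
    by (rule integrable_linear[OF integrable_lebesgue_on_open_interval(3)[OF i]]) (rule bounded_linear_Re)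
  then have yab: "y integrable_on {a..b}" by (simp add: o_def)
  then show "y integrable_on {s..t}" if "a \<le> s" "t \<le> b" by (rule integrable_on_subinterval_real') (use that in auto)
  have "integral\<^sup>L (lebesgue_on {a<..<b}) y = integral {a<..<b} y"
    by (rule lebesgue_integral_eq_integral[OF y]) simp
  then show "integral\<^sup>L (lebesgue_on {a<..<b}) y = integral {a..b} y" by (simp add: integral_open_interval_real)
qed

lemma real_continuous_times_integrable:
  fixes y k :: "real \<Rightarrow> real"
  assumes y: "integrable (lebesgue_on {a<..<b}) y" and k: "continuous_on {a..b} k"
  shows "integrable (lebesgue_on {a<..<b}) (\<lambda>x. y x * k x)"
proof -
  have "integrable (lebesgue_on {a<..<b}) (\<lambda>x. complex_of_real (y x) * of_real (k x))"
    by (rule continuous_times_integrable) (use y in \<open>auto intro!: continuous_intros k\<close>)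
  from integrable_Re[OF this] show ?thesis by simp
qed

lemma exp_times_integrable_on:
  fixes y :: "real \<Rightarrow> real"
  assumes y: "integrable (lebesgue_on {a<..<b}) y" and "a \<le> s" "t \<le> b"
  shows "(\<lambda>x. y x * exp (c * x)) integrable_on {s..t}"
  by (rule real_lebesgue_on_interval(1)[OF real_continuous_times_integrable[OF y]])
     (use assms in \<open>auto intro!: continuous_intros\<close>)

lemma AE_norm_bound_integral:
  fixes F :: "real \<Rightarrow> complex" and G :: "real \<Rightarrow> real"
  assumes F: "integrable (lebesgue_on {a<..<b}) F" and G: "integrable (lebesgue_on {a<..<b}) G"
    and le: "AE t in lebesgue_on {a<..<b}. norm (F t) \<le> G t" and st: "a \<le> s" "t \<le> b"
  shows "norm (integral {s..t} F) \<le> integral {s..t} G"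
proof -
  have "AE t in lebesgue. t \<in> {a<..<b} \<longrightarrow> norm (F t) \<le> G t" using le by (simp add: AE_restrict_space_iff)
  then obtain N where N: "{x \<in> space lebesgue. \<not> (x \<in> {a<..<b} \<longrightarrow> norm (F x) \<le> G x)} \<subseteq> N" "emeasure lebesgue N = 0" "N \<in> sets lebesgue"
    by (rule AE_E)
  have neg: "negligible (N \<union> {a, b})"
  proof (rule negligible_Un)
    show "negligible N" using N(2,3) by (auto simp: negligible_iff_null_sets null_sets_def)
    show "negligible {a, b}" by (rule negligible_finite) simp
  qed
  have le': "norm (F x) \<le> G x" if "x \<in> {s..t} - (N \<union> {a, b})" for x using that N(1) st by force
  have iF: "F integrable_on {s..t}"
    by (rule integrable_on_subinterval_real'[OF integrable_lebesgue_on_open_interval(3)[OF F]]) (use st in auto)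
  have iG: "G integrable_on {s..t}" by (rule real_lebesgue_on_interval(1)[OF G st])
  let ?F = "\<lambda>x. if x \<in> N \<union> {a, b} then 0 else F x" and ?G = "\<lambda>x. if x \<in> N \<union> {a, b} then 0 else G x"
  have "integral {s..t} F = integral {s..t} ?F" "integral {s..t} G = integral {s..t} ?G"
    by (rule integral_spike[OF neg]; simp)+
  moreover have "norm (integral {s..t} ?F) \<le> integral {s..t} ?G"
  proof (rule integral_norm_bound_integral)
    show "?F integrable_on {s..t}" by (rule integrable_spike[OF iF neg]) auto
    show "?G integrable_on {s..t}" by (rule integrable_spike[OF iG neg]) auto
    show "norm (?F x) \<le> ?G x" if "x \<in> {s..t}" for x using le' that by auto
  qed
  ultimately show ?thesis by simp
qed

text \<open>The component of a solution that grows in time is small in the middle of the interval, as it is bounded at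
  the right end: the values at \<open>b - 1\<close> and \<open>b\<close> determine it, without derivatives.\<close>

lemma growing_component_bound:
  fixes u P Q :: "real \<Rightarrow> complex" and g :: "real \<Rightarrow> real"
  assumes \<alpha>: "\<alpha> \<ge> 0" and \<beta>: "\<beta> \<ge> 0" and \<kappa>: "\<kappa> = \<alpha> + \<beta>" "\<kappa> \<ge> 1" and ab: "a \<le> b - 1"
    and gi: "\<And>c x y. a \<le> x \<Longrightarrow> y \<le> b \<Longrightarrow> (\<lambda>s. g s * exp (c * s)) integrable_on {x..y}" and g0: "\<And>s. g s \<ge> 0"
    and eq: "\<And>t. t \<in> {a..b} \<Longrightarrow> of_real \<kappa> * u t = of_real (exp (\<alpha> * t)) * P t - of_real (exp (- \<beta> * t)) * Q t"
    and dP: "\<And>x y. a \<le> x \<Longrightarrow> x \<le> y \<Longrightarrow> y \<le> b \<Longrightarrow> norm (P y - P x) \<le> integral {x..y} (\<lambda>s. g s * exp (- \<alpha> * s))"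
    and dQ: "\<And>x y. a \<le> x \<Longrightarrow> x \<le> y \<Longrightarrow> y \<le> b \<Longrightarrow> norm (Q y - Q x) \<le> integral {x..y} (\<lambda>s. g s * exp (\<beta> * s))"
    and M: "\<And>t. t \<in> {a..b} \<Longrightarrow> norm (u t) \<le> M" and t: "t \<in> {a..b - 1}"
  shows "exp (\<alpha> * t) * norm (P t) \<le> 4 * \<kappa> * exp (- \<alpha> * (b - t)) * M
     + 4 * (exp (\<alpha> * t) * integral {t..b} (\<lambda>s. g s * exp (- \<alpha> * s)))"
proof -
  define T where "T = b - 1"
  define I where "I x y = integral {x..y} (\<lambda>s. g s * exp (- \<alpha> * s))" for x y
  have M0: "M \<ge> 0" using order_trans[OF norm_ge_zero M[of b]] ab by simp
  have E: "of_real (exp (\<beta> * t)) * (of_real \<kappa> * u t) = of_real (exp (\<kappa> * t)) * P t - Q t" if "t \<in> {a..b}" for t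
  proof -
    have "exp (\<beta> * t) * exp (\<alpha> * t) = exp (\<kappa> * t)" "exp (\<beta> * t) * exp (- \<beta> * t) = 1"
      by (simp_all add: \<kappa>(1) algebra_simps flip: exp_add)
    then have "complex_of_real (exp (\<beta> * t)) * of_real (exp (\<alpha> * t)) = of_real (exp (\<kappa> * t))"
      "complex_of_real (exp (\<beta> * t)) * of_real (exp (- \<beta> * t)) = 1"
      by (metis of_real_mult, metis of_real_1 of_real_mult)
    then show ?thesis unfolding eq[OF that] right_diff_distrib mult.assoc[symmetric] by simp
  qed
  \<comment> \<open>After multiplication with \<open>exp (\<beta> t)\<close> the component \<open>Q\<close> is constant up to the forcing, so it cancels in the
    difference of the values at \<open>b\<close> and \<open>b - 1\<close>.\<close>
  have id: "of_real (exp (\<kappa> * b) - exp (\<kappa> * T)) * P T = of_real (exp (\<beta> * b)) * (of_real \<kappa> * u b)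
      - of_real (exp (\<beta> * T)) * (of_real \<kappa> * u T) - of_real (exp (\<kappa> * b)) * (P b - P T) + (Q b - Q T)"
  proof -
    have "b \<in> {a..b}" "T \<in> {a..b}" using ab by (auto simp: T_def)
    then show ?thesis unfolding E[OF \<open>b \<in> {a..b}\<close>] E[OF \<open>T \<in> {a..b}\<close>] of_real_diff by (simp add: algebra_simps)
  qed
  have eT: "exp (\<kappa> * T) \<le> exp (\<kappa> * b) / 2"
  proof -
    have "2 \<le> exp (1::real)" using exp_ge_add_one_self[of 1] by simp
    also have "\<dots> \<le> exp \<kappa>" using \<kappa> by simp
    finally have "2 * exp (\<kappa> * T) \<le> exp \<kappa> * exp (\<kappa> * T)" by simp
    also have "\<dots> = exp (\<kappa> * b)" by (simp add: T_def algebra_simps flip: exp_add)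
    finally show ?thesis by simp
  qed
  have "exp (\<kappa> * b) / 2 * norm (P T) \<le> norm (of_real (exp (\<kappa> * b) - exp (\<kappa> * T)) * P T)"
  proof -
    have "exp (\<kappa> * b) / 2 \<le> \<bar>exp (\<kappa> * b) - exp (\<kappa> * T)\<bar>" using eT by linarith
    then show ?thesis unfolding norm_mult norm_of_real by (rule mult_right_mono) simp
  qed
  also have "\<dots> \<le> norm (of_real (exp (\<beta> * b)) * (of_real \<kappa> * u b)) + norm (of_real (exp (\<beta> * T)) * (of_real \<kappa> * u T))
      + norm (of_real (exp (\<kappa> * b)) * (P b - P T)) + norm (Q b - Q T)"
    unfolding id by (intro order_trans[OF norm_triangle_ineq] add_right_mono order_trans[OF norm_triangle_ineq4] order_refl)
  also have "\<dots> \<le> exp (\<beta> * b) * (\<kappa> * M) + exp (\<beta> * b) * (\<kappa> * M) + exp (\<kappa> * b) * I T b + exp (\<kappa> * b) * I T b"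
  proof (intro add_mono)
    show "norm (of_real (exp (\<beta> * b)) * (of_real \<kappa> * u b)) \<le> exp (\<beta> * b) * (\<kappa> * M)"
      using M[of b] \<kappa>(2) ab by (simp add: norm_mult)
    have "exp (\<beta> * T) * (\<kappa> * norm (u T)) \<le> exp (\<beta> * b) * (\<kappa> * M)"
      using M[of T] \<kappa>(2) ab \<beta> M0 by (intro mult_mono) (auto simp: T_def intro: mult_left_mono)
    then show "norm (of_real (exp (\<beta> * T)) * (of_real \<kappa> * u T)) \<le> exp (\<beta> * b) * (\<kappa> * M)"
      using \<kappa>(2) by (simp add: norm_mult)
    show "norm (of_real (exp (\<kappa> * b)) * (P b - P T)) \<le> exp (\<kappa> * b) * I T b"
      using dP[of T b] ab by (simp add: norm_mult T_def I_def)
    have "norm (Q b - Q T) \<le> integral {T..b} (\<lambda>s. g s * exp (\<beta> * s))"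
      by (rule dQ) (use ab in \<open>auto simp: T_def\<close>)
    also have "\<dots> \<le> integral {T..b} (\<lambda>s. exp (\<kappa> * b) * (g s * exp (- \<alpha> * s)))"
    proof (rule integral_le)
      show "(\<lambda>s. g s * exp (\<beta> * s)) integrable_on {T..b}" by (rule gi) (use ab in \<open>auto simp: T_def\<close>)
      show "(\<lambda>s. exp (\<kappa> * b) * (g s * exp (- \<alpha> * s))) integrable_on {T..b}"
        by (intro integrable_on_mult_right gi) (use ab in \<open>auto simp: T_def\<close>)
      fix s assume "s \<in> {T..b}"
      then have "exp (\<kappa> * s) \<le> exp (\<kappa> * b)" using \<kappa> by simp
      then have "g s * exp (- \<alpha> * s) * exp (\<kappa> * s) \<le> g s * exp (- \<alpha> * s) * exp (\<kappa> * b)"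
        using g0 by (intro mult_left_mono) auto
      moreover have "exp (- \<alpha> * s) * exp (\<kappa> * s) = exp (\<beta> * s)" by (simp add: \<kappa>(1) algebra_simps flip: exp_add)
      ultimately show "g s * exp (\<beta> * s) \<le> exp (\<kappa> * b) * (g s * exp (- \<alpha> * s))" by (simp add: mult_ac)
    qed
    finally show "norm (Q b - Q T) \<le> exp (\<kappa> * b) * I T b" by (simp add: I_def)
  qed
  finally have "exp (\<kappa> * b) * norm (P T) \<le> exp (\<kappa> * b) * (4 * \<kappa> * exp (- \<alpha> * b) * M + 4 * I T b)"
  proof -
    assume a: "exp (\<kappa> * b) / 2 * norm (P T) \<le> exp (\<beta> * b) * (\<kappa> * M) + exp (\<beta> * b) * (\<kappa> * M) + exp (\<kappa> * b) * I T b + exp (\<kappa> * b) * I T b"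
    have "exp (\<beta> * b) = exp (\<kappa> * b) * exp (- \<alpha> * b)" by (simp add: \<kappa>(1) algebra_simps flip: exp_add)
    then show ?thesis using a by (simp add: algebra_simps)
  qed
  then have PT: "norm (P T) \<le> 4 * \<kappa> * exp (- \<alpha> * b) * M + 4 * I T b" by simp
  have I0: "I x y \<ge> 0" if "a \<le> x" "y \<le> b" for x y
    unfolding I_def by (rule integral_nonneg) (use gi[of x y "- \<alpha>"] that g0 in auto)
  have "norm (P t) \<le> norm (P T) + norm (P T - P t)" by (metis norm_triangle_sub norm_minus_commute)
  also have "\<dots> \<le> (4 * \<kappa> * exp (- \<alpha> * b) * M + 4 * I T b) + I t T"
    using PT dP[of t T] t by (intro add_mono) (auto simp: T_def I_def)
  also have "\<dots> \<le> 4 * \<kappa> * exp (- \<alpha> * b) * M + 4 * I t b"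
  proof -
    have "I t T + I T b = I t b" unfolding I_def
      by (rule Henstock_Kurzweil_Integration.integral_combine) (use t gi[of t b "- \<alpha>"] in \<open>auto simp: T_def\<close>)
    then show ?thesis using I0[of t T] t by (simp add: T_def)
  qed
  finally have "exp (\<alpha> * t) * norm (P t) \<le> exp (\<alpha> * t) * (4 * \<kappa> * exp (- \<alpha> * b) * M + 4 * I t b)" by simp
  also have "\<dots> = 4 * \<kappa> * (exp (\<alpha> * t) * exp (- \<alpha> * b)) * M + 4 * (exp (\<alpha> * t) * I t b)" by (simp add: algebra_simps)
  also have "exp (\<alpha> * t) * exp (- \<alpha> * b) = exp (- \<alpha> * (b - t))" by (simp add: algebra_simps flip: exp_add)
  finally show ?thesis by (simp add: I_def)
qed

text \<open>Time reversal exchanges the growing and the decaying component.\<close>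

lemma decaying_component_bound:
  fixes u P Q :: "real \<Rightarrow> complex" and g :: "real \<Rightarrow> real"
  assumes \<alpha>: "\<alpha> \<ge> 0" and \<beta>: "\<beta> \<ge> 0" and \<kappa>: "\<kappa> = \<alpha> + \<beta>" "\<kappa> \<ge> 1" and ab: "a \<le> b - 1"
    and gi: "\<And>c x y. a \<le> x \<Longrightarrow> y \<le> b \<Longrightarrow> (\<lambda>s. g s * exp (c * s)) integrable_on {x..y}" and g0: "\<And>s. g s \<ge> 0"
    and eq: "\<And>t. t \<in> {a..b} \<Longrightarrow> of_real \<kappa> * u t = of_real (exp (\<alpha> * t)) * P t - of_real (exp (- \<beta> * t)) * Q t"
    and dP: "\<And>x y. a \<le> x \<Longrightarrow> x \<le> y \<Longrightarrow> y \<le> b \<Longrightarrow> norm (P y - P x) \<le> integral {x..y} (\<lambda>s. g s * exp (- \<alpha> * s))"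
    and dQ: "\<And>x y. a \<le> x \<Longrightarrow> x \<le> y \<Longrightarrow> y \<le> b \<Longrightarrow> norm (Q y - Q x) \<le> integral {x..y} (\<lambda>s. g s * exp (\<beta> * s))"
    and M: "\<And>t. t \<in> {a..b} \<Longrightarrow> norm (u t) \<le> M" and t: "t \<in> {a + 1..b}"
  shows "exp (- \<beta> * t) * norm (Q t) \<le> 4 * \<kappa> * exp (- \<beta> * (t - a)) * M
     + 4 * (exp (- \<beta> * t) * integral {a..t} (\<lambda>s. g s * exp (\<beta> * s)))"
proof -
  have r: "integral {x..y} (\<lambda>s. g (- s) * exp (c * s)) = integral {- y..- x} (\<lambda>s. g s * exp (- c * s))" for c x y
    using Henstock_Kurzweil_Integration.integral_reflect_real[of "- x" "- y" "\<lambda>s. g s * exp (- c * s)"] by simp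
  have "exp (\<beta> * (- t)) * norm ((\<lambda>s. Q (- s)) (- t)) \<le> 4 * \<kappa> * exp (- \<beta> * (- a - (- t))) * M
     + 4 * (exp (\<beta> * (- t)) * integral {- t..- a} (\<lambda>s. g (- s) * exp (- \<beta> * s)))"
  proof (rule growing_component_bound[OF \<beta> \<alpha>, where a = "- b" and u = "\<lambda>s. - u (- s)" and Q = "\<lambda>s. P (- s)"])
    show "(\<lambda>s. g (- s) * exp (c * s)) integrable_on {x..y}" if "- b \<le> x" "y \<le> - a" for c x y
      using Henstock_Kurzweil_Integration.integrable_reflect_real[of "\<lambda>s. g s * exp (- c * s)" "- x" "- y"] gi[of "- y" "- x" "- c"] that by simp
    show "of_real \<kappa> * - u (- s) = of_real (exp (\<beta> * s)) * Q (- s) - of_real (exp (- \<alpha> * s)) * P (- s)" if "s \<in> {- b..- a}" for s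
      using eq[of "- s"] that by simp
    show "norm (Q (- y) - Q (- x)) \<le> integral {x..y} (\<lambda>s. g (- s) * exp (- \<beta> * s))" if "- b \<le> x" "x \<le> y" "y \<le> - a" for x y
      unfolding r using dQ[of "- y" "- x"] that by (simp add: norm_minus_commute)
    show "norm (P (- y) - P (- x)) \<le> integral {x..y} (\<lambda>s. g (- s) * exp (\<alpha> * s))" if "- b \<le> x" "x \<le> y" "y \<le> - a" for x y
      unfolding r using dP[of "- y" "- x"] that by (simp add: norm_minus_commute)
    show "norm (- u (- s)) \<le> M" if "s \<in> {- b..- a}" for s using M[of "- s"] that by simp
  qed (use \<kappa> ab g0 t in auto)
  then show ?thesis unfolding r by simp
qed

lemma integral_of_real_complex:
  fixes y :: "real \<Rightarrow> real"
  assumes "y integrable_on S"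
  shows "integral S (\<lambda>x. complex_of_real (y x)) = of_real (integral S y)"
  using integral_linear[OF assms bounded_linear_of_real] by (simp add: o_def)

lemma real_integral_by_parts_indefinite:
  fixes y k k' :: "real \<Rightarrow> real"
  assumes y: "integrable (lebesgue_on {a<..<b}) y" and ab: "a < b"
    and k: "\<And>x. (k has_real_derivative k' x) (at x)" and k': "continuous_on {a..b} k'"
  shows "integral {a..b} (\<lambda>x. integral {a..x} y * k' x) = integral {a..b} (\<lambda>s. y s * (k b - k s))"
    "(\<lambda>x. integral {a..x} y * k' x) integrable_on {a..b}"
proof -
  let ?M = "lebesgue_on {a<..<b}"
  have kc: "continuous_on {a..b} k" using k by (meson DERIV_continuous continuous_at_imp_continuous_on)
  have yc: "integrable ?M (\<lambda>x. complex_of_real (y x))" using y by simp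
  have yab: "y integrable_on {a..b}" by (rule real_lebesgue_on_interval(1)[OF y]) auto
  have c: "continuous_on {a..b} (\<lambda>x. integral {a..x} y * k' x)"
    by (intro continuous_intros indefinite_integral_continuous_1 yab k')
  then show i: "(\<lambda>x. integral {a..x} y * k' x) integrable_on {a..b}" by (rule integrable_continuous_interval)
  have i2: "(\<lambda>s. y s * (k b - k s)) integrable_on {a..b}"
    by (rule real_lebesgue_on_interval(1)[OF real_continuous_times_integrable[OF y]]) (auto intro!: continuous_intros kc)
  have yx: "integral {a..x} (\<lambda>x. complex_of_real (y x)) = of_real (integral {a..x} y)" if "x \<in> {a..b}" for x
    by (rule integral_of_real_complex[OF integrable_on_subinterval_real'[OF yab]]) (use that in auto)
  have "(LINT x|?M. integral {a..x} (\<lambda>x. complex_of_real (y x)) * of_real (k' x)) =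
      (LINT s|?M. of_real (y s) * (of_real (k b) - of_real (k s)))"
    by (rule integral_by_parts_indefinite[OF yc])
       (auto intro!: continuous_intros kc k' has_vector_derivative_of_real k simp flip: has_real_derivative_iff_has_vector_derivative)
  moreover have "integrable ?M (\<lambda>x. integral {a..x} (\<lambda>x. complex_of_real (y x)) * of_real (k' x))"
  proof -
    interpret M: finite_measure ?M by (rule finite_measure_lebesgue_on) simp
    have one: "integrable ?M (\<lambda>_. 1::complex)" by simp
    have "continuous_on {a..b} (\<lambda>x. integral {a..x} (\<lambda>x. complex_of_real (y x)) * of_real (k' x))"
      by (intro continuous_intros indefinite_integral_continuous yc k')
    from continuous_times_integrable[OF one this] show ?thesis by simp
  qed
  moreover have "integrable ?M (\<lambda>s. complex_of_real (y s) * (of_real (k b) - of_real (k s)))"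
    by (rule continuous_times_integrable[OF yc]) (intro continuous_intros kc)
  ultimately have "integral {a..b} (\<lambda>x. integral {a..x} (\<lambda>x. complex_of_real (y x)) * of_real (k' x)) =
      integral {a..b} (\<lambda>s. complex_of_real (y s) * (of_real (k b) - of_real (k s)))"
    by (simp only: integrable_lebesgue_on_open_interval(2))
  also have "integral {a..b} (\<lambda>x. integral {a..x} (\<lambda>x. complex_of_real (y x)) * of_real (k' x)) =
      integral {a..b} (\<lambda>x. complex_of_real (integral {a..x} y * k' x))"
    by (rule integral_cong) (simp add: yx)
  also have "integral {a..b} (\<lambda>s. complex_of_real (y s) * (of_real (k b) - of_real (k s))) = integral {a..b} (\<lambda>s. complex_of_real (y s * (k b - k s)))"
    by (rule integral_cong) simp
  finally show "integral {a..b} (\<lambda>x. integral {a..x} y * k' x) = integral {a..b} (\<lambda>s. y s * (k b - k s))"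
    unfolding integral_of_real_complex[OF i] integral_of_real_complex[OF i2] by simp
qed

text \<open>A one-sided exponential of rate \<open>\<beta>\<close> has mass at most \<open>1 / \<beta>\<close>; integration by parts replaces the
  exchange of the integrals. This gain in the mean, which pointwise bounds do not give, makes the sum over the
  high modes converge.\<close>

lemma exp_convolution_backward:
  fixes y :: "real \<Rightarrow> real"
  assumes y: "integrable (lebesgue_on {a<..<b}) y" and y0: "\<And>x. y x \<ge> 0" and ab: "a < b" and \<beta>: "\<beta> > 0"
  shows "(\<lambda>t. exp (- \<beta> * t) * integral {a..t} (\<lambda>s. y s * exp (\<beta> * s))) integrable_on {a..b}"
    "integral {a..b} (\<lambda>t. exp (- \<beta> * t) * integral {a..t} (\<lambda>s. y s * exp (\<beta> * s))) \<le> 1 / \<beta> * integral {a..b} y"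
proof -
  define k where "k t = - (1 / \<beta>) * exp (- \<beta> * t)" for t
  have k: "(k has_real_derivative exp (- \<beta> * t)) (at t)" for t
    unfolding k_def using \<beta> by (auto intro!: derivative_eq_intros)
  have ye: "integrable (lebesgue_on {a<..<b}) (\<lambda>s. y s * exp (\<beta> * s))"
    by (rule real_continuous_times_integrable[OF y]) (intro continuous_intros)
  have kc: "continuous_on {a..b} k" unfolding k_def by (intro continuous_intros)
  note p = real_integral_by_parts_indefinite[OF ye ab k]
  show "(\<lambda>t. exp (- \<beta> * t) * integral {a..t} (\<lambda>s. y s * exp (\<beta> * s))) integrable_on {a..b}"
    using p(2) by (simp add: mult.commute continuous_on_exp continuous_on_minus continuous_on_mult continuous_on_const continuous_on_id)
  have "integral {a..b} (\<lambda>t. exp (- \<beta> * t) * integral {a..t} (\<lambda>s. y s * exp (\<beta> * s))) =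
      integral {a..b} (\<lambda>s. y s * exp (\<beta> * s) * (k b - k s))"
    using p(1) by (simp add: mult.commute continuous_on_exp continuous_on_minus continuous_on_mult continuous_on_const continuous_on_id)
  also have "\<dots> \<le> integral {a..b} (\<lambda>s. 1 / \<beta> * y s)"
  proof (rule integral_le)
    show "(\<lambda>s. y s * exp (\<beta> * s) * (k b - k s)) integrable_on {a..b}"
      by (rule real_lebesgue_on_interval(1)[OF real_continuous_times_integrable[OF ye]]) (auto intro!: continuous_intros kc)
    show "(\<lambda>s. 1 / \<beta> * y s) integrable_on {a..b}"
      by (rule integrable_on_mult_right) (rule real_lebesgue_on_interval(1)[OF y], auto)
    fix s
    have "y s * exp (\<beta> * s) * (k b - k s) \<le> y s * exp (\<beta> * s) * (1 / \<beta> * exp (- \<beta> * s))"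
      using y0 \<beta> by (intro mult_left_mono) (auto simp: k_def)
    also have "\<dots> = 1 / \<beta> * y s * (exp (\<beta> * s) * exp (- \<beta> * s))" by simp
    also have "exp (\<beta> * s) * exp (- \<beta> * s) = 1" by (simp flip: exp_add)
    finally show "y s * exp (\<beta> * s) * (k b - k s) \<le> 1 / \<beta> * y s" by simp
  qed
  finally show "integral {a..b} (\<lambda>t. exp (- \<beta> * t) * integral {a..t} (\<lambda>s. y s * exp (\<beta> * s))) \<le> 1 / \<beta> * integral {a..b} y"
    by simp
qed

lemma exp_convolution_forward:
  fixes y :: "real \<Rightarrow> real"
  assumes y: "integrable (lebesgue_on {a<..<b}) y" and y0: "\<And>x. y x \<ge> 0" and ab: "a < b" and \<alpha>: "\<alpha> > 0"
  shows "(\<lambda>t. exp (\<alpha> * t) * integral {t..b} (\<lambda>s. y s * exp (- \<alpha> * s))) integrable_on {a..b}"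
    "integral {a..b} (\<lambda>t. exp (\<alpha> * t) * integral {t..b} (\<lambda>s. y s * exp (- \<alpha> * s))) \<le> 1 / \<alpha> * integral {a..b} y"
proof -
  define k where "k t = 1 / \<alpha> * exp (\<alpha> * t)" for t
  define z where "z s = y s * exp (- \<alpha> * s)" for s
  define Z where "Z = integral {a..b} z"
  have k: "(k has_real_derivative exp (\<alpha> * t)) (at t)" for t
    unfolding k_def using \<alpha> by (auto intro!: derivative_eq_intros)
  have z: "integrable (lebesgue_on {a<..<b}) z"
    unfolding z_def by (rule real_continuous_times_integrable[OF y]) (intro continuous_intros)
  have zi: "z integrable_on {p..q}" if "a \<le> p" "q \<le> b" for p q by (rule real_lebesgue_on_interval(1)[OF z that])
  have kc: "continuous_on {a..b} k" unfolding k_def by (intro continuous_intros)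
  have ec: "continuous_on {a..b} (\<lambda>t. exp (\<alpha> * t))" by (intro continuous_intros)
  note p = real_integral_by_parts_indefinite[OF z ab k ec]
  have kI: "((\<lambda>t. exp (\<alpha> * t)) has_integral (k b - k a)) {a..b}"
    by (rule fundamental_theorem_of_calculus)
       (use ab k in \<open>auto intro: has_field_derivative_at_within simp flip: has_real_derivative_iff_has_vector_derivative\<close>)
  have e: "exp (\<alpha> * t) * integral {t..b} z = Z * exp (\<alpha> * t) - integral {a..t} z * exp (\<alpha> * t)" if "t \<in> {a..b}" for t
  proof -
    have "integral {a..t} z + integral {t..b} z = Z" unfolding Z_def
      by (rule Henstock_Kurzweil_Integration.integral_combine) (use that zi in auto)
    then have "integral {t..b} z = Z - integral {a..t} z" by simp
    then show ?thesis by (simp only: right_diff_distrib) (simp only: mult.commute)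
  qed
  have hi: "((\<lambda>t. Z * exp (\<alpha> * t) - integral {a..t} z * exp (\<alpha> * t)) has_integral (Z * (k b - k a) - integral {a..b} (\<lambda>s. z s * (k b - k s)))) {a..b}"
    by (intro has_integral_diff has_integral_mult_right kI) (use p in \<open>auto simp: has_integral_iff\<close>)
  then have hi': "((\<lambda>t. exp (\<alpha> * t) * integral {t..b} z) has_integral (Z * (k b - k a) - integral {a..b} (\<lambda>s. z s * (k b - k s)))) {a..b}"
    by (rule has_integral_eq[rotated]) (simp add: e)
  then show "(\<lambda>t. exp (\<alpha> * t) * integral {t..b} (\<lambda>s. y s * exp (- \<alpha> * s))) integrable_on {a..b}"
    unfolding z_def by blast
  have zk: "(\<lambda>s. z s * k s) integrable_on {a..b}"
    by (rule real_lebesgue_on_interval(1)[OF real_continuous_times_integrable[OF z kc]]) auto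
  have "integral {a..b} (\<lambda>t. exp (\<alpha> * t) * integral {t..b} z) = Z * (k b - k a) - integral {a..b} (\<lambda>s. z s * (k b - k s))"
    using hi' by (rule integral_unique)
  also have "integral {a..b} (\<lambda>s. z s * (k b - k s)) = k b * Z - integral {a..b} (\<lambda>s. z s * k s)"
  proof -
    have "(\<lambda>s. z s * (k b - k s)) = (\<lambda>s. k b * z s - z s * k s)" by (simp add: algebra_simps)
    then show ?thesis
      unfolding Z_def using zi[of a b] zk
      by (simp add: Henstock_Kurzweil_Integration.integral_diff integrable_on_mult_right)
  qed
  also have "(\<lambda>s. z s * k s) = (\<lambda>s. 1 / \<alpha> * y s)"
  proof
    fix s
    have "exp (- \<alpha> * s) * exp (\<alpha> * s) = 1" by (simp flip: exp_add)
    then show "z s * k s = 1 / \<alpha> * y s" unfolding z_def k_def by (simp add: field_simps)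
  qed
  also have "Z * (k b - k a) - (k b * Z - integral {a..b} (\<lambda>s. 1 / \<alpha> * y s)) \<le> 1 / \<alpha> * integral {a..b} y"
  proof -
    have "Z \<ge> 0" unfolding Z_def by (rule integral_nonneg) (use zi y0 in \<open>auto simp: z_def\<close>)
    moreover have "k a \<ge> 0" using \<alpha> by (simp add: k_def)
    ultimately have "Z * k a \<ge> 0" by simp
    then show ?thesis by (simp add: algebra_simps)
  qed
  finally show "integral {a..b} (\<lambda>t. exp (\<alpha> * t) * integral {t..b} (\<lambda>s. y s * exp (- \<alpha> * s))) \<le> 1 / \<alpha> * integral {a..b} y"
    by (simp add: z_def[abs_def])
qed

text \<open>The exponential bound comes from a single term of the sum.\<close>

lemma trace_op_eig_bounds:
  "\<exists>G\<ge>1. (\<forall>m. (\<Sum>n\<le>m. (norm (trace_op (eig_v n)))\<^sup>2 / (1 + eigval n)) \<le> G\<^sup>2) \<and>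
     (\<forall>n. norm (trace_op (eig_v n)) \<le> G * exp (2 * real n))"
proof -
  obtain K where K: "K > 0" "\<And>v. norm (vrepr v 0) \<le> K * norm v" "\<And>v. norm (vrepr v pi) \<le> K * norm v"
    using trace_norm_bound by blast
  define G where "G = 2 * K + 1"
  have l: "1 + eigval n > 0" for n using eigval_nonneg[of n] by linarith
  have sq: "(norm (trace_op v))\<^sup>2 = (norm (vrepr v 0))\<^sup>2 + (norm (vrepr v pi))\<^sup>2" for v
    unfolding norm_vec_def L2_set_def by (simp add: sum_2 trace_op_nth)
  have s: "(\<Sum>n\<le>m. (norm (trace_op (eig_v n)))\<^sup>2 / (1 + eigval n)) \<le> G\<^sup>2" for m
  proof -
    have "(\<Sum>n\<le>m. (norm (trace_op (eig_v n)))\<^sup>2 / (1 + eigval n)) \<le> K\<^sup>2 + K\<^sup>2"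
      unfolding sq add_divide_distrib sum.distrib
      by (intro add_mono trace_square_sum K) auto
    also have "\<dots> \<le> G\<^sup>2" using K(1) by (simp add: G_def power2_eq_square algebra_simps)
    finally show ?thesis .
  qed
  have "norm (trace_op (eig_v n)) \<le> G * exp (2 * real n)" for n
  proof (rule power2_le_imp_le)
    have "(norm (trace_op (eig_v n)))\<^sup>2 / (1 + eigval n) \<le> (\<Sum>n\<le>n. (norm (trace_op (eig_v n)))\<^sup>2 / (1 + eigval n))"
      by (rule member_le_sum) (auto intro!: divide_nonneg_pos l)
    also have "\<dots> \<le> G\<^sup>2" by (rule s)
    finally have "(norm (trace_op (eig_v n)))\<^sup>2 \<le> G\<^sup>2 * (1 + eigval n)" using l[of n] by (simp add: pos_divide_le_eq)
    also have "1 + eigval n \<le> (1 + 2 * real n)\<^sup>2" by (simp add: eigval_def power2_eq_square algebra_simps)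
    also have "(1 + 2 * real n)\<^sup>2 \<le> (exp (2 * real n))\<^sup>2"
      using exp_ge_add_one_self[of "2 * real n"] by (intro power_mono) auto
    finally show "(norm (trace_op (eig_v n)))\<^sup>2 \<le> (G * exp (2 * real n))\<^sup>2"
      by (simp add: power_mult_distrib mult_left_mono)
  qed (use K(1) in \<open>simp add: G_def\<close>)
  then show ?thesis using s K(1) by (intro exI[of _ G]) (auto simp: G_def)
qed

lemma eig_trace_le_trace_op: "eig_trace n \<le> norm (trace_op (eig_v n))"
proof -
  have "norm (trace_op (eig_v n) $ 1) \<le> norm (trace_op (eig_v n))"
    unfolding norm_vec_def by (rule member_le_L2_set) auto
  then show ?thesis using eig_trace_pos[of n] by (simp add: trace_op_nth vrepr_eig_v)
qed

lemma geometric_tail: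
  fixes r :: real
  assumes "0 \<le> r" "r \<le> 1/2" "N \<le> m"
  shows "(\<Sum>n\<in>{N<..m}. r ^ n) \<le> 2 * r ^ (N + 1)"
proof -
  have "(\<Sum>n\<in>{N<..m}. r ^ n) \<le> 2 * r ^ (N + 1) - 2 * r ^ (m + 1)"
    using assms(3)
  proof (induction m rule: dec_induct)
    case (step m)
    have "{N<..Suc m} = insert (Suc m) {N<..m}" using step by auto
    then have "(\<Sum>n\<in>{N<..Suc m}. r ^ n) = r ^ Suc m + (\<Sum>n\<in>{N<..m}. r ^ n)" by simp
    moreover have "r * r ^ Suc m \<le> 1/2 * r ^ Suc m" using assms by (intro mult_right_mono) auto
    ultimately show ?case using step.IH by simp
  qed simp
  moreover have "0 \<le> r ^ (m + 1)" using assms by simp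
  ultimately show ?thesis by linarith
qed

text \<open>The first two bounds are for the high modes: at time \<open>0\<close>, where the solution is estimated, and in the mean over
  \<open>[0, 1]\<close>, where it is observed. In the second one the factor \<open>1 / (4 n + 1)\<close> of the formula and the gain
  \<open>1 / (2 n)\<close> of the convolution combine to \<open>1 / (1 + eigval n)\<close>. The third one is for the low modes: the amplitudes are frozen
  at time \<open>0\<close>.\<close>

lemma mode_bounds:
  fixes d \<mu> M :: real and n :: nat and w :: "real \<Rightarrow> vsp" and \<Gamma> :: "real \<Rightarrow> complex^2^2"
  defines "U \<equiv> h_crep {-d<..<1 + d} w"
    and "Y \<equiv> LINT t|lebesgue_on {-d<..<1 + d}. norm (trace_op (w t))"
    and "\<theta> \<equiv> \<mu> * norm (trace_op (eig_v n))"
  assumes d: "d \<ge> 1" and ws: "weak_solution {-d<..<1 + d} \<Gamma> w"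
    and \<Gamma>: "\<Gamma> \<in> borel_measurable (lebesgue_on {-d<..<1 + d})" and \<mu>0: "\<mu> \<ge> 0"
    and \<mu>: "AE t in lebesgue_on {-d<..<1 + d}. onorm ((*v) (\<Gamma> t)) \<le> \<mu>"
    and M: "\<And>t. t \<in> {-d..1 + d} \<Longrightarrow> norm (U t) \<le> M"
  shows "norm (coef (U 0) n) \<le> 8 * exp (- (2 * real n * d)) * M + 8 * \<theta> * Y / (4 * real n + 1)"
    and "n \<ge> 1 \<Longrightarrow> integral {0..1} (\<lambda>t. norm (coef (U t) n)) \<le> 8 * exp (- (2 * real n * d)) * M + 8 * \<theta> * Y / (1 + eigval n)"
    and "\<exists>p q. coef (U 0) n = p - q \<and> (\<forall>t\<in>{0..1}.
      norm (coef (U t) n - (p * of_real (exp (2 * real n * t)) - q * of_real (exp (- (2 * real n + 1) * t)))) \<le> 2 * exp (2 * real n) * \<theta> * Y)"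
proof -
  define a b where "a = - d" and "b = 1 + d"
  let ?M = "lebesgue_on {a<..<b}"
  define \<alpha> \<beta> \<kappa> where "\<alpha> = 2 * real n" and "\<beta> = 2 * real n + 1" and "\<kappa> = 4 * real n + 1"
  have ab: "a < b" "a \<le> b - 1" "a \<le> 0" "1 \<le> b" using d by (auto simp: a_def b_def)
  have \<kappa>: "\<kappa> = \<alpha> + \<beta>" "\<kappa> \<ge> 1" "\<alpha> \<ge> 0" "\<beta> \<ge> 0" "\<beta> > 0" by (auto simp: \<alpha>_def \<beta>_def \<kappa>_def)
  note ws = ws[folded a_def b_def] and \<Gamma> = \<Gamma>[folded a_def b_def] and \<mu> = \<mu>[folded a_def b_def]
  have w: "w \<in> L2 {a<..<b}" using ws by (simp add: weak_solution_def)
  have U: "U = h_crep {a<..<b} w" by (simp add: U_def a_def b_def)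
  have M': "norm (U t) \<le> M" if "t \<in> {a..b}" for t using M that by (simp add: a_def b_def)
  define u where "u t = coef (U t) n" for t
  have uM: "norm (u t) \<le> M" if "t \<in> {a..b}" for t
    using M'[OF that] norm_coef_le[of "U t" n] by (simp add: u_def)
  have M0: "M \<ge> 0" using order_trans[OF norm_ge_zero uM[of 0]] ab by simp
  define y where "y t = norm (trace_op (w t))" for t
  have yi: "integrable ?M y" unfolding y_def using trace_op_integrable(2)[OF w] by simp
  have Y: "Y = integral {a..b} y"
    using real_lebesgue_on_interval(2)[OF yi] by (simp add: Y_def y_def[abs_def] a_def b_def)
  have \<theta>0: "\<theta> \<ge> 0" using \<mu>0 by (simp add: \<theta>_def)
  define g where "g t = \<theta> * y t" for t
  have g0: "g t \<ge> 0" for t using \<theta>0 by (simp add: g_def y_def)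
  have gint: "integrable ?M g" unfolding g_def using yi by simp
  have Gt: "integral {a..b} g = \<theta> * Y" unfolding g_def Y by simp
  have gi: "(\<lambda>s. g s * exp (c * s)) integrable_on {p..q}" if "a \<le> p" "q \<le> b" for c p q
    by (rule exp_times_integrable_on[OF gint that])
  have gi1: "g integrable_on {p..q}" if "a \<le> p" "q \<le> b" for p q
    by (rule real_lebesgue_on_interval(1)[OF gint that])
  have Y0: "Y \<ge> 0" unfolding Y by (rule integral_nonneg) (use real_lebesgue_on_interval(1)[OF yi] in \<open>auto simp: y_def\<close>)
  have weight: "integral {p..q} (\<lambda>s. g s * exp (c * s)) \<le> W * (\<theta> * Y)"
    if pq: "a \<le> p" "q \<le> b" and W: "\<And>s. s \<in> {p..q} \<Longrightarrow> exp (c * s) \<le> W" "W \<ge> 0" for c p q W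
  proof -
    have "integral {p..q} (\<lambda>s. g s * exp (c * s)) \<le> integral {p..q} (\<lambda>s. W * g s)"
    proof (rule integral_le[OF gi[OF pq]])
      show "(\<lambda>s. W * g s) integrable_on {p..q}" by (rule integrable_on_mult_right[OF gi1[OF pq]])
      show "g s * exp (c * s) \<le> W * g s" if "s \<in> {p..q}" for s
        using mult_left_mono[OF W(1)[OF that] g0[of s]] by (simp only: mult.commute)
    qed
    also have "\<dots> = W * integral {p..q} g" by simp
    also have "integral {p..q} g \<le> integral {a..b} g"
      by (rule integral_subset_le) (use pq gi1 g0 in auto)
    finally show ?thesis using W(2) by (simp add: Gt mult_left_mono)
  qed
  let ?f = "forcing \<Gamma> w n"
  have fi: "integrable ?M (\<lambda>s. ?f s * of_real (exp (c * s)))" for c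
    by (rule continuous_times_integrable[OF forcing_integrable[OF w \<Gamma> \<mu>]]) (intro continuous_intros)
  have fg: "norm (integral {p..q} (\<lambda>s. ?f s * of_real (exp (c * s)))) \<le> integral {p..q} (\<lambda>s. g s * exp (c * s))"
    if "a \<le> p" "q \<le> b" for p q c
  proof (rule AE_norm_bound_integral[OF fi _ _ that])
    show "integrable ?M (\<lambda>s. g s * exp (c * s))"
      by (rule real_continuous_times_integrable[OF gint]) (intro continuous_intros)
    show "AE s in ?M. norm (?f s * of_real (exp (c * s))) \<le> g s * exp (c * s)"
      using \<mu>
    proof (rule eventually_mono)
      fix s assume "onorm ((*v) (\<Gamma> s)) \<le> \<mu>"
      from norm_forcing_le[where \<Gamma> = \<Gamma> and t = s and \<mu> = \<mu>, OF this, of w n]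
      have "norm (?f s) \<le> g s" by (simp add: g_def \<theta>_def y_def mult_ac)
      then show "norm (?f s * of_real (exp (c * s))) \<le> g s * exp (c * s)" by (simp add: norm_mult)
    qed
  qed
  obtain c1 c2 where formula: "\<And>t. t \<in> {a..b} \<Longrightarrow> of_real (4 * real n + 1) * coef (h_crep {a<..<b} w t) n =
    of_real (exp (2 * real n * t)) * (c1 + integral {a..t} (\<lambda>s. ?f s * of_real (exp (- (2 * real n) * s))))
    - of_real (exp (- (2 * real n + 1) * t)) * (c2 + integral {a..t} (\<lambda>s. ?f s * of_real (exp ((2 * real n + 1) * s))))"
    using mode_formula[OF ab(1) ws \<Gamma> \<mu>, of n] by blast
  define P where "P t = c1 + integral {a..t} (\<lambda>s. ?f s * of_real (exp (- \<alpha> * s)))" for t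
  define Q where "Q t = c2 + integral {a..t} (\<lambda>s. ?f s * of_real (exp (\<beta> * s)))" for t
  have eq: "of_real \<kappa> * u t = of_real (exp (\<alpha> * t)) * P t - of_real (exp (- \<beta> * t)) * Q t" if "t \<in> {a..b}" for t
    using formula[OF that] by (simp only: u_def U P_def Q_def \<alpha>_def \<beta>_def \<kappa>_def)
  have diff: "integral {a..q} (\<lambda>s. ?f s * of_real (exp (c * s))) - integral {a..p} (\<lambda>s. ?f s * of_real (exp (c * s)))
      = integral {p..q} (\<lambda>s. ?f s * of_real (exp (c * s)))" if "a \<le> p" "p \<le> q" "q \<le> b" for p q c
  proof -
    have "(\<lambda>s. ?f s * of_real (exp (c * s))) integrable_on {a..q}"
      by (rule integrable_on_subinterval_real'[OF integrable_lebesgue_on_open_interval(3)[OF fi]]) (use that in auto)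
    from Henstock_Kurzweil_Integration.integral_combine[OF that(1,2) this] show ?thesis by (simp add: algebra_simps)
  qed
  have dP: "norm (P q - P p) \<le> integral {p..q} (\<lambda>s. g s * exp (- \<alpha> * s))" if "a \<le> p" "p \<le> q" "q \<le> b" for p q
    using fg[of p q "- \<alpha>"] diff[OF that, of "- \<alpha>"] that by (simp add: P_def)
  have dQ: "norm (Q q - Q p) \<le> integral {p..q} (\<lambda>s. g s * exp (\<beta> * s))" if "a \<le> p" "p \<le> q" "q \<le> b" for p q
    using fg[of p q \<beta>] diff[OF that, of \<beta>] that by (simp add: Q_def)
  define A B where "A t = exp (\<alpha> * t) * integral {t..b} (\<lambda>s. g s * exp (- \<alpha> * s))"
    and "B t = exp (- \<beta> * t) * integral {a..t} (\<lambda>s. g s * exp (\<beta> * s))" for t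
  define E where "E = exp (- (2 * real n * d))"
  have pointwise: "norm (u t) \<le> 8 * E * M + 4 / \<kappa> * (A t + B t)" if t: "t \<in> {0..1}" for t
  proof -
    have tab: "t \<in> {a..b}" "t \<in> {a..b - 1}" "t \<in> {a + 1..b}" using t d by (auto simp: a_def b_def)
    have "exp (\<alpha> * t) * norm (P t) \<le> 4 * \<kappa> * exp (- \<alpha> * (b - t)) * M + 4 * A t"
      unfolding A_def
      by (rule growing_component_bound[OF \<kappa>(3,4,1,2) ab(2) gi g0 eq dP dQ uM tab(2)]) auto
    also have "\<dots> \<le> 4 * \<kappa> * E * M + 4 * A t"
    proof -
      have "\<alpha> * d \<le> \<alpha> * (b - t)" using t \<kappa> by (intro mult_left_mono) (auto simp: b_def)
      then have "exp (- \<alpha> * (b - t)) \<le> E" by (simp add: E_def \<alpha>_def)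
      then show ?thesis using \<kappa> M0 by (intro add_right_mono mult_right_mono mult_left_mono) auto
    qed
    finally have PP: "exp (\<alpha> * t) * norm (P t) \<le> 4 * \<kappa> * E * M + 4 * A t" .
    have "exp (- \<beta> * t) * norm (Q t) \<le> 4 * \<kappa> * exp (- \<beta> * (t - a)) * M + 4 * B t"
      unfolding B_def
      by (rule decaying_component_bound[OF \<kappa>(3,4,1,2) ab(2) gi g0 eq dP dQ uM tab(3)]) auto
    also have "\<dots> \<le> 4 * \<kappa> * E * M + 4 * B t"
    proof -
      have "\<alpha> * d \<le> \<beta> * (t - a)" using t d by (intro mult_mono) (auto simp: a_def \<alpha>_def \<beta>_def)
      then have "exp (- \<beta> * (t - a)) \<le> E" by (simp add: E_def \<alpha>_def algebra_simps)
      then show ?thesis using \<kappa> M0 by (intro add_right_mono mult_right_mono mult_left_mono) auto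
    qed
    finally have QQ: "exp (- \<beta> * t) * norm (Q t) \<le> 4 * \<kappa> * E * M + 4 * B t" .
    have "\<kappa> * norm (u t) = norm (of_real \<kappa> * u t)" using \<kappa>(2) by (simp add: norm_mult)
    also have "\<dots> \<le> exp (\<alpha> * t) * norm (P t) + exp (- \<beta> * t) * norm (Q t)"
      unfolding eq[OF tab(1)] by (rule order_trans[OF norm_triangle_ineq4]) (simp add: norm_mult)
    also have "\<dots> \<le> (4 * \<kappa> * E * M + 4 * A t) + (4 * \<kappa> * E * M + 4 * B t)"
      by (rule add_mono[OF PP QQ])
    also have "\<dots> = \<kappa> * (8 * E * M + 4 / \<kappa> * (A t + B t))"
      using \<kappa>(2) by (simp add: field_simps)
    finally show ?thesis using \<kappa>(2) by simp
  qed
  have AY: "A t \<le> \<theta> * Y" if "t \<in> {0..1}" for t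
  proof -
    have "integral {t..b} (\<lambda>s. g s * exp (- \<alpha> * s)) \<le> exp (- \<alpha> * t) * (\<theta> * Y)"
      by (rule weight) (use that ab \<kappa> in \<open>auto intro: mult_left_mono\<close>)
    then have "A t \<le> exp (\<alpha> * t) * (exp (- \<alpha> * t) * (\<theta> * Y))" unfolding A_def by (intro mult_left_mono) auto
    also have "\<dots> = \<theta> * Y" by (simp add: mult.assoc[symmetric] flip: exp_add)
    finally show ?thesis .
  qed
  have BY: "B t \<le> \<theta> * Y" if "t \<in> {0..1}" for t
  proof -
    have "integral {a..t} (\<lambda>s. g s * exp (\<beta> * s)) \<le> exp (\<beta> * t) * (\<theta> * Y)"
      by (rule weight) (use that ab \<kappa> in \<open>auto intro: mult_left_mono\<close>)
    then have "B t \<le> exp (- \<beta> * t) * (exp (\<beta> * t) * (\<theta> * Y))" unfolding B_def by (intro mult_left_mono) auto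
    also have "\<dots> = \<theta> * Y" by (simp add: mult.assoc[symmetric] flip: exp_add)
    finally show ?thesis .
  qed
  have "4 / \<kappa> * (A 0 + B 0) \<le> 4 / \<kappa> * (2 * (\<theta> * Y))"
    using AY[of 0] BY[of 0] \<kappa>(2) by (intro mult_left_mono) auto
  then show "norm (coef (U 0) n) \<le> 8 * exp (- (2 * real n * d)) * M + 8 * \<theta> * Y / (4 * real n + 1)"
    using pointwise[of 0] by (simp add: u_def E_def \<kappa>_def)
  show "integral {0..1} (\<lambda>t. norm (coef (U t) n)) \<le> 8 * exp (- (2 * real n * d)) * M + 8 * \<theta> * Y / (1 + eigval n)"
    if n: "n \<ge> 1"
  proof -
    have \<alpha>: "\<alpha> > 0" using n by (simp add: \<alpha>_def)
    note fw = exp_convolution_forward[OF gint g0 ab(1) \<alpha>, folded A_def]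
    note bw = exp_convolution_backward[OF gint g0 ab(1) \<kappa>(5), folded B_def]
    have sub: "h integrable_on {0..1}" if "h integrable_on {a..b}" for h :: "real \<Rightarrow> real"
      by (rule integrable_on_subinterval_real'[OF that]) (use ab in auto)
    have A0: "A t \<ge> 0" if "t \<in> {a..b}" for t
      unfolding A_def by (intro mult_nonneg_nonneg integral_nonneg gi) (use that g0 in auto)
    have B0: "B t \<ge> 0" if "t \<in> {a..b}" for t
      unfolding B_def by (intro mult_nonneg_nonneg integral_nonneg gi) (use that g0 in auto)
    have "integral {0..1} A \<le> integral {a..b} A"
      by (rule integral_subset_le) (use ab fw(1) sub A0 in auto)
    also have "\<dots> \<le> 1 / \<alpha> * (\<theta> * Y)" using fw(2) by (simp add: Gt)
    finally have iA: "integral {0..1} A \<le> 1 / \<alpha> * (\<theta> * Y)" .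
    have "integral {0..1} B \<le> integral {a..b} B"
      by (rule integral_subset_le) (use ab bw(1) sub B0 in auto)
    also have "\<dots> \<le> 1 / \<beta> * (\<theta> * Y)" using bw(2) by (simp add: Gt)
    finally have iB: "integral {0..1} B \<le> 1 / \<beta> * (\<theta> * Y)" .
    have Uc: "continuous_on {a..b} U" unfolding U by (rule h_crep_props(1)[OF ab(1) ws])
    have "continuous_on {a..b} (\<lambda>t. norm (coef (U t) n))"
      by (intro continuous_intros continuous_on_compose2[OF linear_continuous_on[OF bounded_linear_coef, of UNIV] Uc]) auto
    then have ui: "(\<lambda>t. norm (u t)) integrable_on {0..1}"
      unfolding u_def by (intro sub integrable_continuous_interval)
    have A1: "A integrable_on {0..1}" "B integrable_on {0..1}" using sub[OF fw(1)] sub[OF bw(1)] by auto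
    have hi: "((\<lambda>t. 8 * E * M + 4 / \<kappa> * (A t + B t)) has_integral (8 * E * M + 4 / \<kappa> * (integral {0..1} A + integral {0..1} B))) {0..1}"
    proof -
      have c: "((\<lambda>t. 8 * E * M) has_integral 8 * E * M) {0..1::real}"
        using has_integral_const_real[of "8 * E * M" 0 1] by simp
      have AB: "((\<lambda>t. A t + B t) has_integral (integral {0..1} A + integral {0..1} B)) {0..1}"
        by (intro has_integral_add integrable_integral A1)
      show ?thesis by (rule has_integral_add[OF c has_integral_mult_right[OF AB]])
    qed
    have "integral {0..1} (\<lambda>t. norm (u t)) \<le> 8 * E * M + 4 / \<kappa> * (integral {0..1} A + integral {0..1} B)"
      by (rule integral_le[OF ui has_integral_integrable[OF hi], unfolded integral_unique[OF hi]]) (rule pointwise)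
    also have "\<dots> \<le> 8 * E * M + 4 / \<kappa> * ((1 / \<alpha> + 1 / \<beta>) * (\<theta> * Y))"
      using iA iB \<kappa>(2) by (intro add_left_mono mult_left_mono) (auto simp: distrib_right)
    also have "4 / \<kappa> * ((1 / \<alpha> + 1 / \<beta>) * (\<theta> * Y)) \<le> 8 / (1 + eigval n) * (\<theta> * Y)"
    proof -
      have "1 / \<beta> \<le> 1 / \<alpha>" using \<alpha> by (intro divide_left_mono) (auto simp: \<alpha>_def \<beta>_def)
      then have "4 / \<kappa> * (1 / \<alpha> + 1 / \<beta>) \<le> 4 / \<kappa> * (2 / \<alpha>)" using \<kappa>(2) by (intro mult_left_mono) auto
      also have "\<dots> = 8 / (\<kappa> * \<alpha>)" by simp
      also have "\<dots> \<le> 8 / (1 + eigval n)"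
      proof (rule divide_left_mono)
        have "1 + eigval n \<le> 4 * real n * real n + 4 * real n * real n + 2 * real n"
        proof -
          have "1 * 1 \<le> real n * real n" using n by (intro mult_mono) auto
          then show ?thesis by (simp add: eigval_def algebra_simps)
        qed
        then show "1 + eigval n \<le> \<kappa> * \<alpha>" by (simp add: \<kappa>_def \<alpha>_def algebra_simps)
        show "0 < \<kappa> * \<alpha> * (1 + eigval n)" using \<kappa>(2) \<alpha> eigval_nonneg[of n] by (intro mult_pos_pos) auto
      qed simp
      finally have "4 / \<kappa> * (1 / \<alpha> + 1 / \<beta>) * (\<theta> * Y) \<le> 8 / (1 + eigval n) * (\<theta> * Y)"
        using \<theta>0 Y0 by (intro mult_right_mono) auto
      then show ?thesis by (simp only: mult.assoc)
    qed
    finally show ?thesis by (simp add: u_def E_def mult.assoc)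
  qed
  show "\<exists>p q. coef (U 0) n = p - q \<and> (\<forall>t\<in>{0..1}.
      norm (coef (U t) n - (p * of_real (exp (2 * real n * t)) - q * of_real (exp (- (2 * real n + 1) * t)))) \<le> 2 * exp (2 * real n) * \<theta> * Y)"
  proof (intro exI conjI ballI)
    let ?p = "P 0 / of_real \<kappa>" and ?q = "Q 0 / of_real \<kappa>"
    have k0: "complex_of_real \<kappa> \<noteq> 0" using \<kappa>(2) by simp
    have "of_real \<kappa> * u 0 = P 0 - Q 0" using eq[of 0] ab by simp
    then have "u 0 = (P 0 - Q 0) / of_real \<kappa>" using k0 by (simp add: nonzero_eq_divide_eq mult.commute)
    then show "coef (U 0) n = ?p - ?q" by (simp add: u_def diff_divide_distrib)
    fix t :: real assume t: "t \<in> {0..1}"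
    have tab: "t \<in> {a..b}" using t ab by auto
    let ?z = "u t - (?p * of_real (exp (\<alpha> * t)) - ?q * of_real (exp (- \<beta> * t)))"
    have "of_real \<kappa> * ?z = of_real (exp (\<alpha> * t)) * (P t - P 0) - of_real (exp (- \<beta> * t)) * (Q t - Q 0)"
      using k0 by (simp only: right_diff_distrib eq[OF tab]) (simp add: field_simps)
    moreover have "norm (of_real \<kappa> * ?z) = \<kappa> * norm ?z"
      unfolding norm_mult norm_of_real using \<kappa>(2) by simp
    ultimately have "\<kappa> * norm ?z = norm (of_real (exp (\<alpha> * t)) * (P t - P 0) - of_real (exp (- \<beta> * t)) * (Q t - Q 0))"
      by simp
    also have "\<dots> \<le> exp (\<alpha> * t) * norm (P t - P 0) + exp (- \<beta> * t) * norm (Q t - Q 0)"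
      by (rule order_trans[OF norm_triangle_ineq4]) (simp add: norm_mult)
    also have "\<dots> \<le> exp \<alpha> * (\<theta> * Y) + exp \<alpha> * (\<theta> * Y)"
    proof (rule add_mono)
      have "norm (P t - P 0) \<le> integral {0..t} (\<lambda>s. g s * exp (- \<alpha> * s))" by (rule dP) (use t ab in auto)
      also have "\<dots> \<le> 1 * (\<theta> * Y)" by (rule weight) (use t ab \<kappa> in \<open>auto\<close>)
      finally show "exp (\<alpha> * t) * norm (P t - P 0) \<le> exp \<alpha> * (\<theta> * Y)"
        using t \<kappa> by (intro mult_mono) (auto intro: mult_left_le)
      have "norm (Q t - Q 0) \<le> integral {0..t} (\<lambda>s. g s * exp (\<beta> * s))" by (rule dQ) (use t ab in auto)
      also have "\<dots> \<le> exp (\<beta> * t) * (\<theta> * Y)" by (rule weight) (use t ab \<kappa> in \<open>auto intro: mult_left_mono\<close>)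
      finally have "exp (- \<beta> * t) * norm (Q t - Q 0) \<le> exp (- \<beta> * t) * (exp (\<beta> * t) * (\<theta> * Y))"
        by (intro mult_left_mono) auto
      also have "\<dots> = 1 * (\<theta> * Y)" by (simp add: mult.assoc[symmetric] flip: exp_add)
      also have "\<dots> \<le> exp \<alpha> * (\<theta> * Y)" using \<kappa> \<theta>0 Y0 by (intro mult_right_mono) auto
      finally show "exp (- \<beta> * t) * norm (Q t - Q 0) \<le> exp \<alpha> * (\<theta> * Y)" .
    qed
    finally have "\<kappa> * norm ?z \<le> 2 * exp \<alpha> * (\<theta> * Y)" by (simp only: mult_2 distrib_right)
    moreover have "1 * norm ?z \<le> \<kappa> * norm ?z" using \<kappa>(2) by (intro mult_right_mono) auto
    ultimately have "norm ?z \<le> 2 * exp \<alpha> * (\<theta> * Y)" by linarith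
    then show "norm (coef (U t) n - (?p * of_real (exp (2 * real n * t)) - ?q * of_real (exp (- (2 * real n + 1) * t)))) \<le> 2 * exp (2 * real n) * \<theta> * Y"
      by (simp only: u_def \<alpha>_def \<beta>_def mult.assoc)
  qed
qed

section \<open>Observation through the trace\<close>

lemma integrable_lebesgue_on_subset:
  fixes f :: "real \<Rightarrow> 'a::{banach, second_countable_topology}"
  assumes "integrable (lebesgue_on A) f" "B \<subseteq> A" "A \<in> sets lebesgue" "B \<in> sets lebesgue"
  shows "integrable (lebesgue_on B) f"
proof -
  have "set_integrable lebesgue A f" using assms by (simp add: set_integrable_def integrable_restrict_space)
  then have "set_integrable lebesgue B f" by (rule set_integrable_subset) (use assms in auto)
  then show ?thesis using assms by (simp add: set_integrable_def integrable_restrict_space)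
qed

lemma AE_lebesgue_on_subset:
  assumes "AE x in lebesgue_on A. P x" "B \<subseteq> A" "A \<in> sets lebesgue" "B \<in> sets lebesgue"
  shows "AE x in lebesgue_on B. P x"
proof -
  have "AE x in lebesgue. x \<in> A \<longrightarrow> P x" using assms by (simp add: AE_restrict_space_iff)
  then have "AE x in lebesgue. x \<in> B \<longrightarrow> P x" by (rule eventually_mono) (use assms(2) in auto)
  then show ?thesis using assms by (simp add: AE_restrict_space_iff)
qed

lemma bounded_linear_vrepr_0: "bounded_linear (\<lambda>v. vrepr v 0)"
proof -
  obtain K where K: "\<And>v. norm (vrepr v 0) \<le> K * norm v" using trace_norm_bound by blast
  show ?thesis
    by (rule bounded_linear_intro[where K = K])
       (use K in \<open>auto simp: vrepr_add vrepr_scaleR scaleR_conv_of_real mult.commute\<close>)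
qed

lemma norm_diff_partial_v_le: "norm (v - partial_v m v) \<le> norm v"
proof (rule power2_le_imp_le)
  have "(norm (vderiv (v - partial_v m v)))\<^sup>2 \<le> (norm (vderiv v))\<^sup>2"
    by (intro power_mono norm_vderiv_diff_partial_v) simp
  moreover have "(norm (vincl (v - partial_v m v)))\<^sup>2 \<le> (norm (vincl v))\<^sup>2"
  proof -
    have "0 \<le> (\<Sum>n\<le>m. (norm (coef (vincl v) n))\<^sup>2)" by (intro sum_nonneg) simp
    then show ?thesis using norm_diff_partial_h[of "vincl v" m] by (simp add: vincl_partial_v)
  qed
  ultimately show "(norm (v - partial_v m v))\<^sup>2 \<le> (norm v)\<^sup>2" unfolding norm_vsp by linarith
qed simp

lemma trace_remainder_eq:
  "vrepr (v - partial_v m v) 0 = vrepr v 0 - (\<Sum>n\<le>m. coef (vincl v) n * of_real (eig_trace n))"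
  by (simp add: vrepr_diff partial_v_def vrepr_sum vrepr_scaleC vrepr_eig_v)

text \<open>The trace of the high modes, integrated over \<open>(0, 1)\<close>: the expansion of the trace converges almost
  everywhere, dominated by the form norm, so its tail is bounded term by term.\<close>

lemma trace_remainder_integral:
  fixes w :: "real \<Rightarrow> vsp" and U :: "real \<Rightarrow> hsp" and a b :: real
  assumes w: "w \<in> L2 {a<..<b}" and ab: "a \<le> 0" "1 \<le> b"
    and U: "AE t in lebesgue_on {a<..<b}. vincl (w t) = U t" "continuous_on {a..b} U"
    and B: "\<And>m. m \<ge> N \<Longrightarrow> (\<Sum>n\<in>{N<..m}. eig_trace n * integral {0..1} (\<lambda>t. norm (coef (U t) n))) \<le> B"
  shows "integrable (lebesgue_on {0<..<1}) (\<lambda>t. vrepr (w t - partial_v m (w t)) 0)"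
    and "(LINT t|lebesgue_on {0<..<1}. norm (vrepr (w t - partial_v N (w t)) 0)) \<le> B"
proof -
  let ?M = "lebesgue_on {0<..<1::real}"
  define R where "R m t = vrepr (w t - partial_v m (w t)) 0" for m t
  have sub: "integrable ?M f" if "integrable (lebesgue_on {a<..<b}) f" for f :: "real \<Rightarrow> 'z::{banach, second_countable_topology}"
    by (rule integrable_lebesgue_on_subset[OF that]) (use ab in auto)
  obtain K where K: "K > 0" "\<And>v. norm (vrepr v 0) \<le> K * norm v" using trace_norm_bound by blast
  have i0: "integrable ?M (\<lambda>t. vrepr (w t) 0)"
    by (rule sub, rule L2_comp_integrable(2)[OF w linear_continuous_on[OF bounded_linear_vrepr_0] K(2)])
  have ic: "integrable ?M (\<lambda>t. coef (vincl (w t)) n)" for n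
    by (rule sub[OF coef_vincl_integrable[OF w]])
  have iR: "integrable ?M (R m)" for m
    unfolding R_def[abs_def] trace_remainder_eq using i0 ic by simp
  then show "integrable ?M (\<lambda>t. vrepr (w t - partial_v m (w t)) 0)" by (simp add: R_def[abs_def])
  have nw: "integrable ?M (\<lambda>t. K * norm (w t))"
  proof -
    have "integrable (lebesgue_on {a<..<b}) (\<lambda>t. norm (w t))"
      by (rule L2_comp_integrable(2)[OF w, where K = 1]) (auto intro!: continuous_intros)
    then show ?thesis using sub by auto
  qed
  have Rw: "norm (R m t) \<le> K * norm (w t)" for m t
  proof -
    have "norm (R m t) \<le> K * norm (w t - partial_v m (w t))" unfolding R_def by (rule K(2))
    also have "\<dots> \<le> K * norm (w t)" using K(1) by (intro mult_left_mono norm_diff_partial_v_le) auto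
    finally show ?thesis .
  qed
  have "(\<lambda>m. LINT t|?M. norm (R m t)) \<longlonglongrightarrow> (LINT t|?M. norm (0::complex))"
  proof (rule integral_dominated_convergence[where w = "\<lambda>t. K * norm (w t)"])
    show "AE t in ?M. (\<lambda>m. norm (R m t)) \<longlonglongrightarrow> norm (0::complex)"
      unfolding R_def by (intro AE_I2 tendsto_norm trace_partial_v_tendsto)
    show "AE t in ?M. norm (norm (R m t)) \<le> K * norm (w t)" for m using Rw by simp
    show "(\<lambda>t. norm (R m t)) \<in> borel_measurable ?M" for m using iR[of m] by simp
  qed (use nw in auto)
  then have lim: "(\<lambda>m. LINT t|?M. norm (R m t)) \<longlonglongrightarrow> 0" by simp
  have UU: "AE t in ?M. vincl (w t) = U t"
    by (rule AE_lebesgue_on_subset[OF U(1)]) (use ab in auto)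
  have coefU: "(LINT t|?M. norm (coef (vincl (w t)) n)) = integral {0..1} (\<lambda>t. norm (coef (U t) n))" for n
  proof -
    have "continuous_on {a..b} (\<lambda>t. norm (coef (U t) n))"
      by (intro continuous_intros continuous_on_compose2[OF linear_continuous_on[OF bounded_linear_coef, of UNIV] U(2)]) auto
    then have c: "continuous_on {0..1} (\<lambda>t. norm (coef (U t) n))" by (rule continuous_on_subset) (use ab in auto)
    have m: "(\<lambda>t. norm (coef (U t) n)) \<in> borel_measurable ?M" by (rule continuous_measurable_lebesgue_on_interval[OF c])
    have e: "AE t in ?M. norm (coef (vincl (w t)) n) = norm (coef (U t) n)" using UU by (rule eventually_mono) simp
    have i: "integrable ?M (\<lambda>t. norm (coef (U t) n))"
      using integrable_cong_AE[OF _ m e] ic[of n] by auto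
    have "(LINT t|?M. norm (coef (vincl (w t)) n)) = (LINT t|?M. norm (coef (U t) n))"
      using ic[of n] by (intro integral_cong_AE m e) auto
    also have "\<dots> = integral {0..1} (\<lambda>t. norm (coef (U t) n))" by (rule real_lebesgue_on_interval(2)[OF i])
    finally show ?thesis .
  qed
  have le: "(LINT t|?M. norm (R N t)) \<le> B + (LINT t|?M. norm (R m t))" if m: "m \<ge> N" for m
  proof -
    have RN: "R N t = R m t + (\<Sum>n\<in>{N<..m}. coef (vincl (w t)) n * of_real (eig_trace n))" for t
    proof -
      have "{..m} = {..N} \<union> {N<..m}" using m by auto
      then have "(\<Sum>n\<le>m. coef (vincl (w t)) n * of_real (eig_trace n)) = (\<Sum>n\<le>N. coef (vincl (w t)) n * of_real (eig_trace n)) +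
          (\<Sum>n\<in>{N<..m}. coef (vincl (w t)) n * of_real (eig_trace n))"
        by (simp add: sum.union_disjoint ivl_disj_int)
      then show ?thesis unfolding R_def trace_remainder_eq by simp
    qed
    have "(LINT t|?M. norm (R N t)) \<le> (LINT t|?M. norm (R m t) + (\<Sum>n\<in>{N<..m}. eig_trace n * norm (coef (vincl (w t)) n)))"
    proof (rule integral_mono)
      show "integrable ?M (\<lambda>t. norm (R N t))" using iR by simp
      show "integrable ?M (\<lambda>t. norm (R m t) + (\<Sum>n\<in>{N<..m}. eig_trace n * norm (coef (vincl (w t)) n)))" using iR ic by simp
      fix t
      have "norm (R N t) \<le> norm (R m t) + (\<Sum>n\<in>{N<..m}. norm (coef (vincl (w t)) n * of_real (eig_trace n)))"
        unfolding RN by (intro order_trans[OF norm_triangle_ineq] add_left_mono norm_sum)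
      also have "(\<Sum>n\<in>{N<..m}. norm (coef (vincl (w t)) n * of_real (eig_trace n))) = (\<Sum>n\<in>{N<..m}. eig_trace n * norm (coef (vincl (w t)) n))"
        using eig_trace_pos by (intro sum.cong refl) (simp add: norm_mult less_imp_le mult.commute)
      finally show "norm (R N t) \<le> norm (R m t) + (\<Sum>n\<in>{N<..m}. eig_trace n * norm (coef (vincl (w t)) n))" .
    qed
    also have "\<dots> = (LINT t|?M. norm (R m t)) + (\<Sum>n\<in>{N<..m}. eig_trace n * integral {0..1} (\<lambda>t. norm (coef (U t) n)))"
      using iR ic by (simp add: coefU)
    also have "\<dots> \<le> (LINT t|?M. norm (R m t)) + B" using B[OF m] by simp
    finally show ?thesis by simp
  qed
  have "(\<lambda>m. B + (LINT t|?M. norm (R m t))) \<longlonglongrightarrow> B + 0" by (intro tendsto_intros lim)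
  then have "(LINT t|?M. norm (R N t)) \<le> B + 0"
    by (rule LIMSEQ_le_const) (use le in blast)
  then show "(LINT t|?M. norm (vrepr (w t - partial_v N (w t)) 0)) \<le> B" by (simp add: R_def)
qed

text \<open>The low modes form a sum of exponentials with the \<open>2 N + 2\<close> pairwise distinct integer frequencies
  \<open>2 n\<close> and \<open>- (2 n + 1)\<close>; multiplying by \<open>exp ((2 N + 1) t)\<close> makes them nonnegative.\<close>

lemma low_mode_coeff_bound:
  fixes p q :: "nat \<Rightarrow> complex" and N :: nat
  defines "L \<equiv> \<lambda>t. \<Sum>n\<le>N. p n * of_real (exp (2 * real n * t)) - q n * of_real (exp (- (2 * real n + 1) * t))"
  assumes n: "n \<le> N"
  shows "norm (p n) \<le> exp (26 * (real N + 1)) * integral {0..1} (\<lambda>t. norm (L t))"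
    "norm (q n) \<le> exp (26 * (real N + 1)) * integral {0..1} (\<lambda>t. norm (L t))"
proof -
  define I :: "(nat + nat) set" where "I = {..N} <+> {..N}"
  define c where "c i = (case i of Inl n \<Rightarrow> p n | Inr n \<Rightarrow> - q n)" for i
  define \<epsilon> where "\<epsilon> i = (case i of Inl n \<Rightarrow> 2 * n + 2 * N + 1 | Inr n \<Rightarrow> 2 * N - 2 * n)" for i
  have fin: "finite I" by (simp add: I_def)
  have inj: "inj_on \<epsilon> I" by (auto simp: inj_on_def I_def \<epsilon>_def)
  have rng: "\<epsilon> ` I \<subseteq> {..<4 * N + 2}" by (auto simp: I_def \<epsilon>_def)
  have S: "(\<Sum>i\<in>I. c i * of_real (exp (real (\<epsilon> i) * t))) = of_real (exp ((2 * real N + 1) * t)) * L t" for t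
  proof -
    have "(\<Sum>i\<in>I. c i * of_real (exp (real (\<epsilon> i) * t))) =
      (\<Sum>n\<le>N. p n * of_real (exp (real (2 * n + 2 * N + 1) * t))) + (\<Sum>n\<le>N. - q n * of_real (exp (real (2 * N - 2 * n) * t)))"
      unfolding I_def by (subst sum.Plus) (simp_all add: c_def \<epsilon>_def)
    also have "\<dots> = (\<Sum>n\<le>N. of_real (exp ((2 * real N + 1) * t)) *
        (p n * of_real (exp (2 * real n * t)) - q n * of_real (exp (- (2 * real n + 1) * t))))"
      unfolding sum.distrib[symmetric]
    proof (intro sum.cong refl)
      fix n assume "n \<in> {..N}"
      then have "real (2 * N - 2 * n) = 2 * real N - 2 * real n" by (simp add: of_nat_diff)
      then have e: "exp (real (2 * n + 2 * N + 1) * t) = exp ((2 * real N + 1) * t) * exp (2 * real n * t)"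
        "exp (real (2 * N - 2 * n) * t) = exp ((2 * real N + 1) * t) * exp (- (2 * real n + 1) * t)"
        by (simp_all add: algebra_simps flip: exp_add)
      show "p n * of_real (exp (real (2 * n + 2 * N + 1) * t)) + - q n * of_real (exp (real (2 * N - 2 * n) * t)) =
        of_real (exp ((2 * real N + 1) * t)) * (p n * of_real (exp (2 * real n * t)) - q n * of_real (exp (- (2 * real n + 1) * t)))"
        unfolding e of_real_mult by (simp add: algebra_simps del: of_real_exp)
    qed
    finally show ?thesis by (simp add: L_def sum_distrib_left)
  qed
  have Lc: "continuous_on {0..1} (\<lambda>t. norm (L t))" unfolding L_def by (intro continuous_intros)
  have Li: "(\<lambda>t. norm (L t)) integrable_on {0..1}" by (rule integrable_continuous_interval[OF Lc])
  have X0: "0 \<le> integral {0..1} (\<lambda>t. norm (L t))" by (rule integral_nonneg[OF Li]) simp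
  have "integral {0..1} (\<lambda>t. norm (\<Sum>i\<in>I. c i * of_real (exp (real (\<epsilon> i) * t)))) \<le>
      integral {0..1} (\<lambda>t. exp (2 * (real N + 1)) * norm (L t))"
  proof (rule integral_le)
    show "(\<lambda>t. norm (\<Sum>i\<in>I. c i * of_real (exp (real (\<epsilon> i) * t)))) integrable_on {0..1}"
      by (intro integrable_continuous_interval continuous_intros)
    show "(\<lambda>t. exp (2 * (real N + 1)) * norm (L t)) integrable_on {0..1}" by (rule integrable_on_mult_right[OF Li])
    fix t :: real assume "t \<in> {0..1}"
    then have "(2 * real N + 1) * t \<le> (2 * real N + 1) * 1" by (intro mult_left_mono) auto
    also have "\<dots> \<le> 2 * (real N + 1)" by simp
    finally have "exp ((2 * real N + 1) * t) \<le> exp (2 * (real N + 1))" by (rule iffD2[OF exp_le_cancel_iff])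
    then show "norm (\<Sum>i\<in>I. c i * of_real (exp (real (\<epsilon> i) * t))) \<le> exp (2 * (real N + 1)) * norm (L t)"
      unfolding S norm_mult norm_of_real by (intro mult_right_mono) auto
  qed
  then have le: "integral {0..1} (\<lambda>t. norm (\<Sum>i\<in>I. c i * of_real (exp (real (\<epsilon> i) * t)))) \<le> exp (2 * (real N + 1)) * integral {0..1} (\<lambda>t. norm (L t))"
    by simp
  \<comment> \<open>\<open>48 \<le> 2 ^ 6 \<le> exp 6\<close>\<close>
  have K: "(48::real) ^ (4 * N + 2) \<le> exp (24 * (real N + 1))"
  proof -
    have "(48::real) ^ (4 * N + 2) \<le> 64 ^ (4 * N + 2)" by (intro power_mono) auto
    also have "\<dots> = (2 ^ 6) ^ (4 * N + 2)" by simp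
    also have "\<dots> \<le> (exp 1 ^ 6) ^ (4 * N + 2)"
      using exp_ge_add_one_self[of 1] by (intro power_mono) auto
    also have "\<dots> = exp (real (6 * (4 * N + 2)))"
      using exp_of_nat_mult[of "6 * (4 * N + 2)" "1::real"] by (simp only: power_mult mult_1_right)
    also have "\<dots> \<le> exp (24 * (real N + 1))" by simp
    finally show ?thesis .
  qed
  have main: "norm (c i) \<le> exp (26 * (real N + 1)) * integral {0..1} (\<lambda>t. norm (L t))" if "i \<in> I" for i
  proof -
    have "norm (c i) \<le> 48 ^ (4 * N + 2) * integral {0..1} (\<lambda>t. norm (\<Sum>i\<in>I. c i * of_real (exp (real (\<epsilon> i) * t))))"
      by (rule exp_sum_coeff_bound[OF fin inj rng that])
    also have "\<dots> \<le> exp (24 * (real N + 1)) * (exp (2 * (real N + 1)) * integral {0..1} (\<lambda>t. norm (L t)))"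
    proof (intro mult_mono K le)
      show "0 \<le> integral {0..1} (\<lambda>t. norm (\<Sum>i\<in>I. c i * of_real (exp (real (\<epsilon> i) * t))))"
        by (intro integral_nonneg integrable_continuous_interval continuous_intros) simp
    qed simp
    also have "\<dots> = exp (26 * (real N + 1)) * integral {0..1} (\<lambda>t. norm (L t))"
    proof -
      have "26 * (real N + 1) = 24 * (real N + 1) + 2 * (real N + 1)" by simp
      then show ?thesis by (simp only: exp_add mult.assoc)
    qed
    finally show ?thesis .
  qed
  show "norm (p n) \<le> exp (26 * (real N + 1)) * integral {0..1} (\<lambda>t. norm (L t))"
    using main[of "Inl n"] n by (auto simp: I_def c_def)
  show "norm (q n) \<le> exp (26 * (real N + 1)) * integral {0..1} (\<lambda>t. norm (L t))"
    using main[of "Inr n"] n by (auto simp: I_def c_def)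
qed

section \<open>The estimate\<close>

text \<open>The value \<open>d = 20\<close> comes from the squared low modes. Their recovery costs \<open>exp (63 (N + 1))\<close>, whereas the
  high modes enter the observed trace squared with the factor \<open>exp (- 4 (d - 1) (N + 1))\<close>, that is
  \<open>exp (- 76 (N + 1))\<close>.\<close>

lemma solution_estimate:
  fixes G d \<mu> M :: real and w :: "real \<Rightarrow> vsp" and \<Gamma> :: "real \<Rightarrow> complex^2^2" and N :: nat
  defines "U \<equiv> h_crep {-d<..<1 + d} w"
    and "Y \<equiv> LINT t|lebesgue_on {-d<..<1 + d}. norm (trace_op (w t))"
  assumes G: "G \<ge> 1" "\<And>m. (\<Sum>n\<le>m. (norm (trace_op (eig_v n)))\<^sup>2 / (1 + eigval n)) \<le> G\<^sup>2"
      "\<And>n. norm (trace_op (eig_v n)) \<le> G * exp (2 * real n)"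
    and d: "d = 20" and ws: "weak_solution {-d<..<1 + d} \<Gamma> w"
    and \<Gamma>: "\<Gamma> \<in> borel_measurable (lebesgue_on {-d<..<1 + d})" and \<mu>0: "\<mu> \<ge> 0"
    and \<mu>: "AE t in lebesgue_on {-d<..<1 + d}. onorm ((*v) (\<Gamma> t)) \<le> \<mu>"
    and M: "\<And>t. t \<in> {-d..1 + d} \<Longrightarrow> norm (U t) \<le> M"
    and N: "1 + \<mu>\<^sup>2 \<le> real N + 1"
  shows "(norm (U 0))\<^sup>2 \<le> 4000 * G ^ 4 * exp (79 * (real N + 1)) * Y\<^sup>2 + 8448 * G\<^sup>2 * exp (- real N) * M\<^sup>2"
proof -
  let ?J = "{-d<..<1 + d}"
  let ?M = "lebesgue_on {0<..<1::real}"
  have d1: "d \<ge> 1" "- d < 1 + d" "- d \<le> 0" "1 \<le> 1 + d" using d by auto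
  define T where "T n = norm (trace_op (eig_v n))" for n
  define E where "E = exp (real N + 1)"
  \<comment> \<open>\<open>exp (- 2 n d)\<close> from the ends of the interval, times \<open>exp (2 n)\<close> for the size of the trace of an eigenfunction\<close>
  define r where "r = exp (- (2 * (d - 1)))"
  have Ek: "E ^ k = exp (real k * (real N + 1))" for k by (simp add: E_def exp_of_nat_mult)
  have E1: "E \<ge> 1" "real N + 1 \<le> E" using exp_ge_add_one_self[of "real N + 1"] by (auto simp: E_def)
  have \<mu>E: "\<mu> \<le> E" "\<mu>\<^sup>2 \<le> E"
  proof -
    have "2 * \<mu> * 1 \<le> \<mu>\<^sup>2 + 1\<^sup>2" by (rule sum_squares_bound)
    then show "\<mu> \<le> E" "\<mu>\<^sup>2 \<le> E" using N E1 \<mu>0 by auto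
  qed
  have w: "w \<in> L2 ?J" using ws by (simp add: weak_solution_def)
  have M0: "M \<ge> 0" using order_trans[OF norm_ge_zero M[of 0]] d by simp
  define y where "y t = norm (trace_op (w t))" for t
  have yi: "integrable (lebesgue_on ?J) y" unfolding y_def using trace_op_integrable(2)[OF w] by simp
  have Yi: "Y = integral {-d..1 + d} y"
    unfolding Y_def using real_lebesgue_on_interval(2)[OF yi] by (simp add: y_def[abs_def])
  have y_hk: "y integrable_on {s..t}" if "-d \<le> s" "t \<le> 1 + d" for s t by (rule real_lebesgue_on_interval(1)[OF yi that])
  have Y0: "Y \<ge> 0" unfolding Yi by (rule integral_nonneg) (use y_hk in \<open>auto simp: y_def\<close>)
  have T0: "T n \<ge> 0" for n by (simp add: T_def)
  have TG: "T n \<le> G * exp (2 * real n)" for n using G(3) by (simp add: T_def)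
  have tT: "eig_trace n \<le> T n" for n using eig_trace_le_trace_op by (simp add: T_def)
  have t0: "eig_trace n \<ge> 0" for n using eig_trace_pos[of n] by simp
  have lam1: "1 + eigval n > 0" for n using eigval_nonneg[of n] by linarith
  have sumT: "(\<Sum>n\<in>{N<..m}. (T n)\<^sup>2 / (1 + eigval n)) \<le> G\<^sup>2" for m
  proof -
    have "(\<Sum>n\<in>{N<..m}. (T n)\<^sup>2 / (1 + eigval n)) \<le> (\<Sum>n\<le>m. (T n)\<^sup>2 / (1 + eigval n))"
      by (rule sum_mono2) (auto intro!: divide_nonneg_pos lam1)
    also have "\<dots> \<le> G\<^sup>2" using G(2)[of m] by (simp add: T_def)
    finally show ?thesis .
  qed
  have mb1: "norm (coef (U 0) n) \<le> 8 * exp (- (2 * real n * d)) * M + 8 * (\<mu> * T n) * Y / (4 * real n + 1)" for n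
    unfolding U_def Y_def T_def by (rule mode_bounds(1)[OF d1(1) ws \<Gamma> \<mu>0 \<mu>]) (rule M[unfolded U_def])
  have mb2: "integral {0..1} (\<lambda>t. norm (coef (U t) n)) \<le> 8 * exp (- (2 * real n * d)) * M + 8 * (\<mu> * T n) * Y / (1 + eigval n)"
    if "n \<ge> 1" for n
    unfolding U_def Y_def T_def by (rule mode_bounds(2)[OF d1(1) ws \<Gamma> \<mu>0 \<mu> _ that]) (rule M[unfolded U_def])
  have mb3: "\<exists>p q. coef (U 0) n = p - q \<and> (\<forall>t\<in>{0..1}.
      norm (coef (U t) n - (p * of_real (exp (2 * real n * t)) - q * of_real (exp (- (2 * real n + 1) * t)))) \<le> 2 * exp (2 * real n) * (\<mu> * T n) * Y)" for n
    unfolding U_def Y_def T_def by (rule mode_bounds(3)[OF d1(1) ws \<Gamma> \<mu>0 \<mu>]) (rule M[unfolded U_def])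
  have r: "0 \<le> r" "r \<le> 1/2" and s: "0 \<le> exp (- (4 * d))" "exp (- (4 * d)) \<le> 1/2"
  proof -
    have h: "exp (- x) \<le> 1/2" if "x \<ge> 1" for x :: real
    proof -
      have "2 \<le> exp x" using exp_ge_add_one_self[of x] that by linarith
      then show ?thesis by (simp add: exp_minus field_simps)
    qed
    show "0 \<le> r" "r \<le> 1/2" "0 \<le> exp (- (4 * d))" "exp (- (4 * d)) \<le> 1/2"
      unfolding r_def using h[of "2 * (d - 1)"] h[of "4 * d"] d by auto
  qed
  \<comment> \<open>a bound of the trace of the high modes in the mean over \<open>[0, 1]\<close>\<close>
  define B where "B = 16 * G * M * r ^ (N + 1) + 8 * \<mu> * Y * G\<^sup>2"
  have Bsum: "(\<Sum>n\<in>{N<..m}. eig_trace n * integral {0..1} (\<lambda>t. norm (coef (U t) n))) \<le> B" if m: "m \<ge> N" for m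
  proof -
    have "(\<Sum>n\<in>{N<..m}. eig_trace n * integral {0..1} (\<lambda>t. norm (coef (U t) n))) \<le>
        (\<Sum>n\<in>{N<..m}. 8 * G * M * r ^ n + 8 * \<mu> * Y * ((T n)\<^sup>2 / (1 + eigval n)))"
    proof (rule sum_mono)
      fix n assume "n \<in> {N<..m}"
      then have n: "n \<ge> 1" by auto
      have "eig_trace n * integral {0..1} (\<lambda>t. norm (coef (U t) n)) \<le>
          eig_trace n * (8 * exp (- (2 * real n * d)) * M + 8 * (\<mu> * T n) * Y / (1 + eigval n))"
        by (rule mult_left_mono[OF mb2[OF n] t0])
      also have "\<dots> = 8 * M * (eig_trace n * exp (- (2 * real n * d))) + 8 * \<mu> * Y * (eig_trace n * T n / (1 + eigval n))"
        by (simp add: algebra_simps)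
      also have "\<dots> \<le> 8 * M * (G * r ^ n) + 8 * \<mu> * Y * (T n * T n / (1 + eigval n))"
      proof (intro add_mono mult_left_mono divide_right_mono mult_right_mono)
        have "eig_trace n * exp (- (2 * real n * d)) \<le> (G * exp (2 * real n)) * exp (- (2 * real n * d))"
          using order_trans[OF tT TG] by (intro mult_right_mono) auto
        also have "\<dots> = G * (exp (2 * real n) * exp (- (2 * real n * d)))" by simp
        also have "exp (2 * real n) * exp (- (2 * real n * d)) = r ^ n"
          unfolding r_def exp_of_nat_mult[symmetric] by (simp add: algebra_simps flip: exp_add)
        finally show "eig_trace n * exp (- (2 * real n * d)) \<le> G * r ^ n" .
      qed (use M0 \<mu>0 Y0 tT T0 lam1[of n] in \<open>auto\<close>)
      finally show "eig_trace n * integral {0..1} (\<lambda>t. norm (coef (U t) n)) \<le> 8 * G * M * r ^ n + 8 * \<mu> * Y * ((T n)\<^sup>2 / (1 + eigval n))"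
        by (simp add: power2_eq_square mult_ac)
    qed
    also have "\<dots> = 8 * G * M * (\<Sum>n\<in>{N<..m}. r ^ n) + 8 * \<mu> * Y * (\<Sum>n\<in>{N<..m}. (T n)\<^sup>2 / (1 + eigval n))"
      by (simp add: sum.distrib sum_distrib_left)
    also have "\<dots> \<le> 8 * G * M * (2 * r ^ (N + 1)) + 8 * \<mu> * Y * G\<^sup>2"
      using G(1) M0 \<mu>0 Y0 by (intro add_mono mult_left_mono geometric_tail[OF r m] sumT) auto
    finally show ?thesis by (simp add: B_def)
  qed
  note Uprops = h_crep_props(2)[OF d1(2) ws, folded U_def] h_crep_props(1)[OF d1(2) ws, folded U_def]
  have rem: "integrable ?M (\<lambda>t. vrepr (w t - partial_v N (w t)) 0)"
    "(LINT t|?M. norm (vrepr (w t - partial_v N (w t)) 0)) \<le> B"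
    by (rule trace_remainder_integral[OF w d1(3,4) Uprops Bsum], assumption)+
  obtain p q where pq: "\<And>n. coef (U 0) n = p n - q n"
    "\<And>n t. t \<in> {0..1} \<Longrightarrow> norm (coef (U t) n - (p n * of_real (exp (2 * real n * t)) - q n * of_real (exp (- (2 * real n + 1) * t))))
       \<le> 2 * exp (2 * real n) * (\<mu> * T n) * Y"
    using mb3 by metis
  \<comment> \<open>the trace of the low modes without their response to the forcing\<close>
  define L where "L t = (\<Sum>n\<le>N. (of_real (eig_trace n) * p n) * of_real (exp (2 * real n * t)) - (of_real (eig_trace n) * q n) * of_real (exp (- (2 * real n + 1) * t)))" for t
  define X where "X = integral {0..1} (\<lambda>t. norm (L t))"
  have Lc: "continuous_on {0..1} (\<lambda>t. norm (L t))" unfolding L_def by (intro continuous_intros)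
  have X0: "X \<ge> 0" unfolding X_def by (rule integral_nonneg[OF integrable_continuous_interval[OF Lc]]) simp
  have S1: "(\<Sum>n\<le>N. eig_trace n * (2 * exp (2 * real n) * (\<mu> * T n) * Y)) \<le> 2 * G\<^sup>2 * E ^ 8 * Y"
  proof -
    have "(\<Sum>n\<le>N. eig_trace n * (2 * exp (2 * real n) * (\<mu> * T n) * Y)) \<le> (\<Sum>n\<le>N. 2 * G\<^sup>2 * E ^ 7 * Y)"
    proof (rule sum_mono)
      fix n assume n: "n \<in> {..N}"
      have eN: "exp (2 * real n) \<le> E ^ 2" unfolding Ek using n by simp
      have tE: "T n \<le> G * E ^ 2"
        using order_trans[OF TG[of n] mult_left_mono[OF eN]] G(1) by simp
      have "eig_trace n * (2 * exp (2 * real n) * (\<mu> * T n) * Y) \<le> (G * E ^ 2) * (2 * E ^ 2 * (E * (G * E ^ 2)) * Y)"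
        by (intro mult_mono order_trans[OF tT tE] eN tE \<mu>E(1) mult_nonneg_nonneg)
           (use G(1) E1 \<mu>0 T0 Y0 t0 in auto)
      also have "\<dots> = 2 * G\<^sup>2 * E ^ 7 * Y" by (simp add: power2_eq_square eval_nat_numeral mult_ac)
      finally show "eig_trace n * (2 * exp (2 * real n) * (\<mu> * T n) * Y) \<le> 2 * G\<^sup>2 * E ^ 7 * Y" .
    qed
    also have "\<dots> = (real N + 1) * (2 * G\<^sup>2 * E ^ 7 * Y)" by simp
    also have "\<dots> \<le> E * (2 * G\<^sup>2 * E ^ 7 * Y)" using E1 Y0 by (intro mult_right_mono) auto
    also have "\<dots> = 2 * G\<^sup>2 * E ^ 8 * Y" by (simp add: eval_nat_numeral mult_ac)
    finally show ?thesis .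
  qed
  have XB: "X \<le> Y + B + 2 * G\<^sup>2 * E ^ 8 * Y"
  proof -
    interpret fm: finite_measure ?M by (rule finite_measure_lebesgue_on) simp
    let ?S = "\<Sum>n\<le>N. eig_trace n * (2 * exp (2 * real n) * (\<mu> * T n) * Y)"
    let ?R = "\<lambda>t. vrepr (w t - partial_v N (w t)) 0"
    have y01: "integrable ?M y" by (rule integrable_lebesgue_on_subset[OF yi]) (use d in auto)
    have Li: "integrable ?M (\<lambda>t. norm (L t))"
    proof -
      have "integrable ?M (\<lambda>t. 1 * norm (L t))" by (rule real_continuous_times_integrable[OF _ Lc]) simp
      then show ?thesis by simp
    qed
    have UU: "AE t in ?M. vincl (w t) = U t"
      by (rule AE_lebesgue_on_subset[OF h_crep_props(2)[OF d1(2) ws, folded U_def]]) (use d in auto)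
    have "X = (LINT t|?M. norm (L t))" unfolding X_def by (rule real_lebesgue_on_interval(2)[OF Li, symmetric])
    also have "\<dots> \<le> (LINT t|?M. y t + norm (?R t) + ?S)"
    proof (rule integral_mono_AE[OF Li])
      show "integrable ?M (\<lambda>t. y t + norm (?R t) + ?S)" using y01 rem(1) by simp
      show "AE t in ?M. norm (L t) \<le> y t + norm (?R t) + ?S"
        using UU AE_space
      proof eventually_elim
        case (elim t)
        then have t: "t \<in> {0..1}" by auto
        let ?e = "\<lambda>n. coef (U t) n - (p n * of_real (exp (2 * real n * t)) - q n * of_real (exp (- (2 * real n + 1) * t)))"
        have "L t = (\<Sum>n\<le>N. coef (U t) n * of_real (eig_trace n)) - (\<Sum>n\<le>N. of_real (eig_trace n) * ?e n)"
          unfolding L_def sum_subtractf[symmetric] by (intro sum.cong refl) (simp add: algebra_simps)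
        also have "(\<Sum>n\<le>N. coef (U t) n * of_real (eig_trace n)) = vrepr (w t) 0 - ?R t"
          unfolding trace_remainder_eq using elim(1) by simp
        finally have Lt: "L t = vrepr (w t) 0 - ?R t - (\<Sum>n\<le>N. of_real (eig_trace n) * ?e n)" .
        have tri: "norm (x - y - z) \<le> norm x + norm y + norm z" for x y z :: complex
          using norm_triangle_ineq4[of "x - y" z] norm_triangle_ineq4[of x y] by linarith
        have "norm (L t) \<le> norm (vrepr (w t) 0) + norm (?R t) + norm (\<Sum>n\<le>N. of_real (eig_trace n) * ?e n)"
          unfolding Lt by (rule tri)
        also have "norm (vrepr (w t) 0) \<le> y t"
        proof -
          have "norm (trace_op (w t) $ 1) \<le> norm (trace_op (w t))"
            unfolding norm_vec_def by (rule member_le_L2_set) auto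
          then show ?thesis by (simp add: trace_op_nth y_def)
        qed
        also have "norm (\<Sum>n\<le>N. of_real (eig_trace n) * ?e n) \<le> ?S"
        proof (rule order_trans[OF norm_sum sum_mono])
          fix n
          show "norm (of_real (eig_trace n) * ?e n) \<le> eig_trace n * (2 * exp (2 * real n) * (\<mu> * T n) * Y)"
            unfolding norm_mult norm_of_real using mult_left_mono[OF pq(2)[OF t, of n] t0[of n]] t0[of n] by simp
        qed
        finally show ?case by simp
      qed
    qed
    also have "\<dots> = (LINT t|?M. y t) + (LINT t|?M. norm (?R t)) + ?S"
      using y01 rem(1) by (simp add: measure_restrict_space)
    also have "(LINT t|?M. y t) \<le> Y"
    proof -
      have "(LINT t|?M. y t) = integral {0..1} y" by (rule real_lebesgue_on_interval(2)[OF y01])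
      also have "\<dots> \<le> integral {-d..1 + d} y"
        by (rule integral_subset_le) (use d y_hk in \<open>auto simp: y_def\<close>)
      finally show ?thesis by (simp add: Yi)
    qed
    finally show ?thesis using rem(2) S1 by linarith
  qed
  have X: "X \<le> 11 * G\<^sup>2 * E ^ 8 * Y + 16 * G * M * r ^ (N + 1)"
  proof -
    have "E * 1 \<le> E * E ^ 7" using E1 by (intro mult_left_mono one_le_power) auto
    then have E8: "E \<le> E ^ 8" by (simp add: eval_nat_numeral)
    have G2: "1 \<le> G\<^sup>2" using G(1) by (intro one_le_power) auto
    have a: "1 * Y \<le> (G\<^sup>2 * E ^ 8) * Y"
      using mult_mono[of 1 "G\<^sup>2" 1 "E ^ 8"] G2 one_le_power[OF E1(1), of 8] Y0 by (intro mult_right_mono) auto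
    have b: "8 * \<mu> * Y * G\<^sup>2 \<le> 8 * E ^ 8 * Y * G\<^sup>2"
      using order_trans[OF \<mu>E(1) E8] Y0 by (intro mult_right_mono mult_left_mono) auto
    show ?thesis using XB a b unfolding B_def by (simp add: mult_ac)
  qed
  have low: "norm (coef (U 0) n) \<le> 4 * E ^ 31 * X" if n: "n \<le> N" for n
  proof -
    have "(32::real) ^ n \<le> E ^ 5"
    proof -
      have "(32::real) ^ n = (2 ^ 5) ^ n" by simp
      also have "\<dots> \<le> (exp 1 ^ 5) ^ n" using exp_ge_add_one_self[of 1] by (intro power_mono) auto
      also have "\<dots> = exp (real (5 * n))" 
        using exp_of_nat_mult[of "5 * n" "1::real"] by (simp only: power_mult mult_1_right)
      also have "\<dots> \<le> E ^ 5" unfolding Ek using n by simp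
      finally show ?thesis .
    qed
    then have inv: "1 \<le> 2 * E ^ 5 * eig_trace n"
      using eig_trace_lower[of n] t0[of n] by (meson mult_left_mono mult_right_mono order_trans zero_le_numeral)
    have part: "norm z \<le> 2 * E ^ 31 * X" if "norm (of_real (eig_trace n) * z) \<le> E ^ 26 * X" for z :: complex
    proof -
      have "1 * norm z \<le> 2 * E ^ 5 * eig_trace n * norm z" by (rule mult_right_mono[OF inv]) simp
      also have "\<dots> = 2 * E ^ 5 * norm (of_real (eig_trace n) * z)" using t0[of n] by (simp add: norm_mult)
      also have "\<dots> \<le> 2 * E ^ 5 * (E ^ 26 * X)" using that E1 by (intro mult_left_mono) auto
      also have "\<dots> = 2 * E ^ 31 * X" by (simp add: mult.assoc[symmetric] flip: power_add)
      finally show ?thesis by simp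
    qed
    have "norm (p n) \<le> 2 * E ^ 31 * X" "norm (q n) \<le> 2 * E ^ 31 * X"
    proof -
      have E26: "E ^ 26 = exp (26 * (real N + 1))" by (simp add: Ek)
      note lc = low_mode_coeff_bound[where p = "\<lambda>n. of_real (eig_trace n) * p n" and q = "\<lambda>n. of_real (eig_trace n) * q n", OF n]
      show "norm (p n) \<le> 2 * E ^ 31 * X" by (rule part) (unfold E26 X_def L_def, rule lc(1))
      show "norm (q n) \<le> 2 * E ^ 31 * X" by (rule part) (unfold E26 X_def L_def, rule lc(2))
    qed
    then show ?thesis unfolding pq(1) using norm_triangle_ineq4[of "p n" "q n"] by linarith
  qed
  have lowsum: "(\<Sum>n\<le>N. (norm (coef (U 0) n))\<^sup>2) \<le> 3872 * G ^ 4 * E ^ 79 * Y\<^sup>2 + 8192 * G\<^sup>2 * exp (- real N) * M\<^sup>2"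
  proof -
    have "(\<Sum>n\<le>N. (norm (coef (U 0) n))\<^sup>2) \<le> (\<Sum>n\<le>N. (4 * E ^ 31 * X)\<^sup>2)"
      by (intro sum_mono power_mono low) auto
    also have "\<dots> = (real N + 1) * (4 * E ^ 31 * X)\<^sup>2" by simp
    also have "\<dots> \<le> E * (4 * E ^ 31 * X)\<^sup>2" using E1 by (intro mult_right_mono) auto
    also have "\<dots> = 16 * E ^ 63 * X\<^sup>2" by (simp add: power_mult_distrib power_Suc[symmetric] flip: power_mult)
    finally have 1: "(\<Sum>n\<le>N. (norm (coef (U 0) n))\<^sup>2) \<le> 16 * E ^ 63 * X\<^sup>2" .
    have 2: "X\<^sup>2 \<le> 2 * (11 * G\<^sup>2 * E ^ 8 * Y)\<^sup>2 + 2 * (16 * G * M * r ^ (N + 1))\<^sup>2"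
    proof -
      have "X\<^sup>2 \<le> (11 * G\<^sup>2 * E ^ 8 * Y + 16 * G * M * r ^ (N + 1))\<^sup>2" using X X0 by (intro power_mono) auto
      also have "\<dots> \<le> 2 * (11 * G\<^sup>2 * E ^ 8 * Y)\<^sup>2 + 2 * (16 * G * M * r ^ (N + 1))\<^sup>2"
        using sum_squares_bound[of "11 * G\<^sup>2 * E ^ 8 * Y" "16 * G * M * r ^ (N + 1)"] unfolding power2_sum by linarith
      finally show ?thesis .
    qed
    have 3: "16 * E ^ 63 * (2 * (11 * G\<^sup>2 * E ^ 8 * Y)\<^sup>2 + 2 * (16 * G * M * r ^ (N + 1))\<^sup>2) =
        3872 * G ^ 4 * E ^ 79 * Y\<^sup>2 + 8192 * G\<^sup>2 * (E ^ 63 * (r ^ (N + 1))\<^sup>2) * M\<^sup>2"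
    proof -
      have "E ^ 63 * (E ^ 8)\<^sup>2 = E ^ 79" by (simp flip: power_mult power_add)
      moreover have "(G\<^sup>2)\<^sup>2 = G ^ 4" by (simp flip: power_mult)
      ultimately show ?thesis by (simp only: power_mult_distrib distrib_left) (simp add: mult_ac)
    qed
    have 4: "E ^ 63 * (r ^ (N + 1))\<^sup>2 \<le> exp (- real N)"
    proof -
      have "(r ^ (N + 1))\<^sup>2 = exp (- (76 * (real N + 1)))"
        unfolding r_def d exp_of_nat_mult[symmetric] power_mult[symmetric] by simp
      then have "E ^ 63 * (r ^ (N + 1))\<^sup>2 = exp (- (13 * (real N + 1)))"
        unfolding Ek by (simp flip: exp_add)
      then show ?thesis by simp
    qed
    have "16 * E ^ 63 * X\<^sup>2 \<le> 16 * E ^ 63 * (2 * (11 * G\<^sup>2 * E ^ 8 * Y)\<^sup>2 + 2 * (16 * G * M * r ^ (N + 1))\<^sup>2)"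
      using 2 E1 by (intro mult_left_mono) auto
    also have "\<dots> \<le> 3872 * G ^ 4 * E ^ 79 * Y\<^sup>2 + 8192 * G\<^sup>2 * exp (- real N) * M\<^sup>2"
      unfolding 3 using 4 by (intro add_left_mono mult_right_mono mult_left_mono) auto
    finally show ?thesis using 1 by linarith
  qed
  have highsum: "(\<Sum>n\<in>{N<..m}. (norm (coef (U 0) n))\<^sup>2) \<le> 256 * exp (- real N) * M\<^sup>2 + 128 * E * Y\<^sup>2 * G\<^sup>2" if m: "m \<ge> N" for m
  proof -
    have "(\<Sum>n\<in>{N<..m}. (norm (coef (U 0) n))\<^sup>2) \<le>
        (\<Sum>n\<in>{N<..m}. 128 * M\<^sup>2 * exp (- (4 * d)) ^ n + 128 * E * Y\<^sup>2 * ((T n)\<^sup>2 / (1 + eigval n)))"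
    proof (rule sum_mono)
      fix n
      let ?x = "8 * exp (- (2 * real n * d)) * M" and ?z = "8 * (\<mu> * T n) * Y / (4 * real n + 1)"
      have "(norm (coef (U 0) n))\<^sup>2 \<le> (?x + ?z)\<^sup>2" by (intro power_mono mb1) simp
      also have "\<dots> \<le> 2 * ?x\<^sup>2 + 2 * ?z\<^sup>2" using sum_squares_bound[of ?x ?z] unfolding power2_sum by linarith
      also have "2 * ?x\<^sup>2 = 128 * M\<^sup>2 * exp (- (4 * d)) ^ n"
        unfolding power_mult_distrib exp_of_nat_mult[symmetric]
        by (simp add: power2_eq_square algebra_simps flip: exp_add)
      also have "2 * ?z\<^sup>2 \<le> 128 * E * Y\<^sup>2 * ((T n)\<^sup>2 / (1 + eigval n))"
      proof -
        have "2 * ?z\<^sup>2 = 128 * \<mu>\<^sup>2 * Y\<^sup>2 * ((T n)\<^sup>2 / (4 * real n + 1)\<^sup>2)"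
          by (simp add: power_mult_distrib power_divide)
        also have "\<dots> \<le> 128 * E * Y\<^sup>2 * ((T n)\<^sup>2 / (1 + eigval n))"
        proof (intro mult_mono mult_right_mono mult_left_mono \<mu>E(2) divide_left_mono)
          show "1 + eigval n \<le> (4 * real n + 1)\<^sup>2" by (simp add: eigval_def power2_eq_square algebra_simps)
          show "0 < (4 * real n + 1)\<^sup>2 * (1 + eigval n)" using lam1[of n] by (intro mult_pos_pos) (auto simp: add_nonneg_pos)
        qed (use E1 in auto)
        finally show ?thesis .
      qed
      finally show "(norm (coef (U 0) n))\<^sup>2 \<le> 128 * M\<^sup>2 * exp (- (4 * d)) ^ n + 128 * E * Y\<^sup>2 * ((T n)\<^sup>2 / (1 + eigval n))" by simp
    qed
    also have "\<dots> = 128 * M\<^sup>2 * (\<Sum>n\<in>{N<..m}. exp (- (4 * d)) ^ n) + 128 * E * Y\<^sup>2 * (\<Sum>n\<in>{N<..m}. (T n)\<^sup>2 / (1 + eigval n))"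
      by (simp add: sum.distrib sum_distrib_left)
    also have "\<dots> \<le> 128 * M\<^sup>2 * (2 * exp (- (4 * d)) ^ (N + 1)) + 128 * E * Y\<^sup>2 * G\<^sup>2"
      using E1 by (intro add_mono mult_left_mono geometric_tail[OF s m] sumT) auto
    also have "\<dots> \<le> 128 * M\<^sup>2 * (2 * exp (- real N)) + 128 * E * Y\<^sup>2 * G\<^sup>2"
    proof -
      have "exp (- (4 * d)) ^ (N + 1) \<le> exp (- real N)" unfolding exp_of_nat_mult[symmetric] d by simp
      then show ?thesis by (intro add_right_mono mult_left_mono) auto
    qed
    finally show ?thesis by (simp add: mult_ac)
  qed
  have total: "(\<Sum>n\<le>m. (norm (coef (U 0) n))\<^sup>2) \<le> 4000 * G ^ 4 * E ^ 79 * Y\<^sup>2 + 8448 * G\<^sup>2 * exp (- real N) * M\<^sup>2" if m: "m \<ge> N" for m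
  proof -
    have "{..m} = {..N} \<union> {N<..m}" using m by auto
    then have "(\<Sum>n\<le>m. (norm (coef (U 0) n))\<^sup>2) = (\<Sum>n\<le>N. (norm (coef (U 0) n))\<^sup>2) + (\<Sum>n\<in>{N<..m}. (norm (coef (U 0) n))\<^sup>2)"
      by (simp add: sum.union_disjoint ivl_disj_int)
    moreover have "128 * E * Y\<^sup>2 * G\<^sup>2 \<le> 128 * G ^ 4 * E ^ 79 * Y\<^sup>2"
    proof -
      have "E * G\<^sup>2 \<le> E ^ 79 * G ^ 4"
        using power_increasing[of 1 79 E] power_increasing[of 2 4 G] E1 G(1) by (intro mult_mono) auto
      then have "128 * Y\<^sup>2 * (E * G\<^sup>2) \<le> 128 * Y\<^sup>2 * (E ^ 79 * G ^ 4)" by (intro mult_left_mono) auto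
      then show ?thesis by (simp only: mult_ac)
    qed
    moreover have "256 * exp (- real N) * M\<^sup>2 \<le> 256 * G\<^sup>2 * exp (- real N) * M\<^sup>2"
    proof -
      have "1 * (256 * exp (- real N) * M\<^sup>2) \<le> G\<^sup>2 * (256 * exp (- real N) * M\<^sup>2)"
        using G(1) by (intro mult_right_mono one_le_power) auto
      then show ?thesis by (simp only: mult_ac mult_1_left)
    qed
    ultimately show ?thesis using lowsum highsum[OF m] by linarith
  qed
  have "(norm (U 0))\<^sup>2 \<le> 4000 * G ^ 4 * E ^ 79 * Y\<^sup>2 + 8448 * G\<^sup>2 * exp (- real N) * M\<^sup>2"
    by (rule LIMSEQ_le_const2[OF parseval]) (use total in blast)
  then show ?thesis by (simp add: Ek)
qed

theorem theorem11p3: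
  shows "\<exists>d C0 C c :: real. d > 1 \<and> C0 > 0 \<and> C > 0 \<and> c > 0 \<and>
    (\<forall>(\<mu>::real) (\<Gamma>::real \<Rightarrow> complex^2^2) (w::real \<Rightarrow> vsp).
       \<mu> \<ge> 0 \<longrightarrow>
       \<Gamma> \<in> borel_measurable (lebesgue_on (J_int d)) \<longrightarrow>
       Linf_norm (J_int d) \<Gamma> \<le> ereal \<mu> \<longrightarrow>
       weak_solution (J_int d) \<Gamma> w \<longrightarrow>
       (\<forall>N::int. real_of_int N + 1 \<ge> C0 * (1 + \<mu>\<^sup>2) \<longrightarrow>
          (norm (h_crep (J_int d) w 0))\<^sup>2
            \<le> exp (C * (real_of_int N + 1)) * (L2_norm (J_int d) (\<lambda>t. trace_op (w t)))\<^sup>2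
               + C * exp (- c * real_of_int N) * (M_sup d w)\<^sup>2))"
proof -
  obtain G where G: "G \<ge> 1" "\<And>m. (\<Sum>n\<le>m. (norm (trace_op (eig_v n)))\<^sup>2 / (1 + eigval n)) \<le> G\<^sup>2"
      "\<And>n. norm (trace_op (eig_v n)) \<le> G * exp (2 * real n)"
    using trace_op_eig_bounds by blast
  define d :: real where "d = 20"
  \<comment> \<open>The factor \<open>41\<close> is the length of the interval, from \<open>L\<^sup>1\<close> to \<open>L\<^sup>2\<close>; the constants in front of the exponential are
    absorbed into the exponent by \<open>x \<le> exp x\<close>.\<close>
  define C where "C = 79 + 41 * (4000 * G ^ 4) + 8448 * G\<^sup>2"
  have G0: "0 \<le> G ^ 4" "0 \<le> G\<^sup>2" by simp_all
  have C: "C > 0" "8448 * G\<^sup>2 \<le> C" using G0 unfolding C_def by linarith+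
  have ab: "- d < 1 + d" by (simp add: d_def)
  show ?thesis
  proof (intro exI conjI allI impI)
    show "d > 1" by (simp add: d_def)
    show "(1::real) > 0" by simp
    show "C > 0" by (rule C(1))
    show "(1::real) > 0" by simp
    fix \<mu> :: real and \<Gamma> w and N' :: int
    assume \<mu>0: "\<mu> \<ge> 0" and \<Gamma>: "\<Gamma> \<in> borel_measurable (lebesgue_on (J_int d))"
      and lin: "Linf_norm (J_int d) \<Gamma> \<le> ereal \<mu>" and ws: "weak_solution (J_int d) \<Gamma> w"
      and N': "1 * (1 + \<mu>\<^sup>2) \<le> real_of_int N' + 1"
    define N where "N = nat N'"
    have N1: "1 + \<mu>\<^sup>2 \<le> real_of_int N' + 1" using N' by simp
    have "0 \<le> \<mu>\<^sup>2" by simp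
    then have "0 \<le> real_of_int N'" using N1 by linarith
    then have N: "real N = real_of_int N'" by (simp add: N_def)
    have J: "J_int d = {-d<..<1 + d}" by (simp add: J_int_def)
    let ?U = "h_crep {-d<..<1 + d} w"
    let ?M = "lebesgue_on {-d<..<1 + d}"
    have ae: "AE t in ?M. onorm ((*v) (\<Gamma> t)) \<le> \<mu>"
    proof -
      have "AE t in ?M. ereal (onorm ((*v) (\<Gamma> t))) \<le> Linf_norm (J_int d) \<Gamma>"
        unfolding Linf_norm_def J by (rule esssup_AE)
      then show ?thesis
      proof (rule eventually_mono)
        fix t assume "ereal (onorm ((*v) (\<Gamma> t))) \<le> Linf_norm (J_int d) \<Gamma>"
        then have "ereal (onorm ((*v) (\<Gamma> t))) \<le> ereal \<mu>" using lin by (rule order_trans)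
        then show "onorm ((*v) (\<Gamma> t)) \<le> \<mu>" by simp
      qed
    qed
    have Uc: "continuous_on {-d..1 + d} (\<lambda>t. norm (?U t))"
      by (intro continuous_intros h_crep_props(1)[OF ab ws[unfolded J]])
    have M: "norm (?U t) \<le> M_sup d w" if t: "t \<in> {-d..1 + d}" for t
    proof (rule continuous_le_on_closure[where S = "{-d<..<1 + d}" and f = "\<lambda>t. norm (?U t)"])
      show "continuous_on (closure {-d<..<1 + d}) (\<lambda>t. norm (?U t))" using Uc ab by simp
      show "t \<in> closure {-d<..<1 + d}" using t ab by simp
      fix x assume x: "x \<in> {-d<..<1 + d}"
      have "bdd_above ((\<lambda>t. norm (?U t)) ` {-d..1 + d})"
        by (intro bounded_imp_bdd_above compact_imp_bounded compact_continuous_image Uc compact_Icc)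
      then have "bdd_above ((\<lambda>t. norm (?U t)) ` {-d<..<1 + d})" by (rule bdd_above_mono) auto
      then show "norm (?U x) \<le> M_sup d w" unfolding M_sup_def J by (rule cSUP_upper[OF x])
    qed
    have w: "w \<in> L2 {-d<..<1 + d}" using ws by (simp add: weak_solution_def J)
    define y where "y t = norm (trace_op (w t))" for t
    have yi: "integrable ?M y" "integrable ?M (\<lambda>t. (y t)\<^sup>2)"
      using trace_op_integrable[OF w] by (simp_all add: y_def[abs_def])
    let ?L = "(L2_norm (J_int d) (\<lambda>t. trace_op (w t)))\<^sup>2"
    have L2: "?L = integral {-d..1 + d} (\<lambda>t. (y t)\<^sup>2)"
    proof -
      have "?L = (LINT t|?M. (y t)\<^sup>2)"
        unfolding L2_norm_def J y_def by (rule real_sqrt_pow2) (intro integral_nonneg_AE AE_I2, simp)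
      then show ?thesis using real_lebesgue_on_interval(2)[OF yi(2)] by simp
    qed
    have L0: "0 \<le> ?L" by simp
    have Y: "(LINT t|?M. y t)\<^sup>2 \<le> 41 * ?L"
      unfolding real_lebesgue_on_interval(2)[OF yi(1)] L2
      using integral_power2_le[OF real_lebesgue_on_interval(1)[OF yi(1) order_refl order_refl]
          real_lebesgue_on_interval(1)[OF yi(2) order_refl order_refl] ab]
      by (simp add: d_def)
    have "(norm (?U 0))\<^sup>2 \<le> 4000 * G ^ 4 * exp (79 * (real N + 1)) * (LINT t|?M. y t)\<^sup>2 + 8448 * G\<^sup>2 * exp (- real N) * (M_sup d w)\<^sup>2"
      unfolding y_def
      by (rule solution_estimate[OF G d_def ws[unfolded J] \<Gamma>[unfolded J] \<mu>0 ae M]) (use N N' in auto)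
    also have "\<dots> \<le> exp (C * (real N + 1)) * ?L + C * exp (- real N) * (M_sup d w)\<^sup>2"
    proof (rule add_mono)
      have "41 * (4000 * G ^ 4) \<le> exp (41 * (4000 * G ^ 4))"
        using exp_ge_add_one_self[of "41 * (4000 * G ^ 4)"] by linarith
      also have "\<dots> \<le> exp ((C - 79) * (real N + 1))"
      proof -
        have "41 * (4000 * G ^ 4) * 1 \<le> (C - 79) * (real N + 1)"
          by (rule mult_mono) (use G0 in \<open>auto simp: C_def\<close>)
        then show ?thesis by simp
      qed
      finally have g: "41 * (4000 * G ^ 4) \<le> exp ((C - 79) * (real N + 1))" .
      have "4000 * G ^ 4 * exp (79 * (real N + 1)) * (LINT t|?M. y t)\<^sup>2 \<le> 4000 * G ^ 4 * exp (79 * (real N + 1)) * (41 * ?L)"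
        using Y by (intro mult_left_mono) auto
      also have "\<dots> = 41 * (4000 * G ^ 4) * (exp (79 * (real N + 1)) * ?L)" by (simp only: mult_ac)
      also have "\<dots> \<le> exp ((C - 79) * (real N + 1)) * (exp (79 * (real N + 1)) * ?L)"
        using g L0 by (intro mult_right_mono) auto
      also have "\<dots> = exp (C * (real N + 1)) * ?L"
      proof -
        have "C * (real N + 1) = (C - 79) * (real N + 1) + 79 * (real N + 1)" by (simp add: algebra_simps)
        then show ?thesis by (simp only: exp_add mult.assoc)
      qed
      finally show "4000 * G ^ 4 * exp (79 * (real N + 1)) * (LINT t|?M. y t)\<^sup>2 \<le> exp (C * (real N + 1)) * ?L" .
      show "8448 * G\<^sup>2 * exp (- real N) * (M_sup d w)\<^sup>2 \<le> C * exp (- real N) * (M_sup d w)\<^sup>2"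
        using C(2) by (intro mult_right_mono) auto
    qed
    finally show "(norm (h_crep (J_int d) w 0))\<^sup>2
            \<le> exp (C * (real_of_int N' + 1)) * ?L + C * exp (- 1 * real_of_int N') * (M_sup d w)\<^sup>2"
      by (simp add: J N)
  qed
qed

end
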